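(* Let $\mathfrak D=(X,U,\mathbb K,\mathsf T)$ be a cdt-MP and let $S,G\in\mathcal B(X)$ be disjoint. Then $\mathsf M^*(\cdot;S\,\mathsf U^0G)=\mathsf M_*(\cdot;S\,\mathsf U^0G)=1_G(\cdot)$, and for any $n\in\bar{\mathbb N}_0=\mathbb N_0\cup\{\infty\}$ (with $\infty+1=\infty$) $$\mathsf M^*(\cdot;S\,\mathsf U^{n+1}G)=\mathsf R^*[\mathsf M^*(\cdot;S\,\mathsf U^nG)],\qquad \mathsf M_*(\cdot;S\,\mathsf U^{n+1}G)=\mathsf R_*[\mathsf M_*(\cdot;S\,\mathsf U^nG)].$$ Moreover, $\mathsf M^*(\cdot;S\,\mathsf U\,G)$ and $\mathsf M_*(\cdot;S\,\mathsf U\,G)$ are the least non-negative fixpoints of $\mathsf R^*$ and $\mathsf R_*$ respectively, in the following sense: if a non-negative $f\in\mathrm b\mathcal A^*(X)$ satisfies $f\ge\mathsf R^*f$, then $f\ge\mathsf M^*(\cdot;S\,\mathsf U\,G)$; and if a non-negative $f\in\mathrm b\mathcal A_*(X)$ satisfies $f\ge\mathsf R_*f$, then $f\ge\mathsf M_*(\cdot;S\,\mathsf U\,G)$.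
   Context: A Borel space is a topological space homeomorphic to a Borel subset of a complete separable metric space; $\mathcal B(Y)$ is its Borel $\sigma$-algebra. A cdt-MP is a tuple $\mathfrak D=(X,U,\mathbb K,\mathsf T)$ with $X,U$ non-empty Borel spaces, $\mathbb K\subseteq X\times U$ an analytic set such that $\mathbb K_x:=\{u\in U:(x,u)\in\mathbb K\}\neq\emptyset$ for all $x\in X$, and $\mathsf T(\cdot|x,u)$ a Borel measurable stochastic kernel on $X$ given $X\times U$. The path space is $H=(X\times U)^{\mathbb N_0}$ and $H_n=(X\times U)^n\times X$ is the space of histories $h_n=(x_0,u_0,\dots,u_{n-1},x_n)$. A policy is a sequence $\pi=(\pi_n)_{n\ge0}$ of universally measurable stochastic kernels $\pi_n$ on $U$ given $H_n$ with $\pi_n(\mathbb K_{x_n}|h_n)=1$ for all $h_n$; $\Pi$ is the set of all policies. $\mathsf P^\pi_x$ is the unique probability measure on $H$ under which $x_0=x$, the conditional law of $u_n$ given $h_n$ is $\pi_n(\cdot|h_n)$, and the conditional law of $x_{n+1}$ given $(h_n,u_n)$ is $\mathsf T(\cdot|x_n,u_n)$. For an event $A$: $\mathsf M^\pi(x;A)=\mathsf P^\pi_x(A)$, $\mathsf M^*(x;A)=\sup_{\pi\in\Pi}\mathsf M^\pi(x;A)$, $\mathsf M_*(x;A)=\inf_{\pi\in\Pi}\mathsf M^\pi(x;A)$. $S\,\mathsf U^nG$ is the event that there is a finite $i\in\mathbb N_0$, $i\le n$, with $x_i\in G$ and $x_j\in S$ for all $0\le j<i$; $S\,\mathsf U\,G:=S\,\mathsf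 U^\infty G$. $\mathrm b\mathcal A_*(X)$ is the set of bounded lower semi-analytic functions $f:X\to\mathbb R$ ($\{f<c\}$ is analytic for every $c\in\mathbb R$), and $\mathrm b\mathcal A^*(X)=\{f:-f\in\mathrm b\mathcal A_*(X)\}$. Put $\mathsf T^uf(x)=\int_Xf(x')\mathsf T(dx'|x,u)$, $\mathsf T^*f(x)=\sup_{u\in\mathbb K_x}\mathsf T^uf(x)$, $\mathsf T_*f(x)=\inf_{u\in\mathbb K_x}\mathsf T^uf(x)$, and $\mathsf R^*f=1_G+1_S\cdot\mathsf T^*f$ for $f\in\mathrm b\mathcal A^*(X)$, $\mathsf R_*f=1_G+1_S\cdot\mathsf T_*f$ for $f\in\mathrm b\mathcal A_*(X)$. *)

theory Defs
  imports "HOL-Probability.Probability"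
begin

section \<open>Borel spaces, analytic sets, universal measurability\<close>

text \<open>
  A Borel space is a topological space homeomorphic to a Borel subset \<open>B\<close> of a complete separable
  metric space \<open>Y\<close>. Taking the points of \<open>Y\<close> from the type of reals is no restriction: a separable
  metric space has at most the cardinality of the continuum, and its points can be renamed. The
  topology of \<open>Y\<close> is unrelated to the usual topology of the reals. The term \<open>topology open\<close> is
  \<open>euclidean\<close>, which cannot be used inside the class specification.
\<close>

class borel_space = topological_space +
  assumes ex_homeomorphic_borel_subset:
    "\<exists>(Y :: real topology) B.
       completely_metrizable_space Y \<and> separable_space Y \<and>
       B \<in> sigma_sets (topspace Y) {V. openin Y V} \<and>
       topology open homeomorphic_space subtopology Y B"

text \<open>Analytic sets: the empty set and the continuous images of the Baire space.\<close>

definition analytic :: "'a::topological_space set \<Rightarrow> bool" where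
  "analytic A \<longleftrightarrow>
     A = {} \<or> (\<exists>f :: (nat \<Rightarrow> nat) \<Rightarrow> 'a. continuous_on UNIV f \<and> range f = A)"

text \<open>
  The \<open>\<sigma>\<close>-algebra of universally measurable sets: those measurable for the completion of every
  probability measure. Only this \<open>\<sigma>\<close>-algebra matters; the measure of \<open>univ_completion M\<close> is zero.
\<close>

definition univ_completion :: "'a measure \<Rightarrow> 'a measure" where
  "univ_completion M = sigma (space M)
     {A. A \<subseteq> space M \<and> (\<forall>p. prob_space p \<and> sets p = sets M \<longrightarrow> A \<in> sets (completion p))}"

definition lower_semianalytic :: "('a::topological_space \<Rightarrow> real) \<Rightarrow> bool" where
  "lower_semianalytic f \<longleftrightarrow> (\<forall>c. analytic {x. f x < c})"

definition bA_lower :: "('a::topological_space \<Rightarrow> real) set" where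
  "bA_lower = {f. bounded (range f) \<and> lower_semianalytic f}"

definition bA_upper :: "('a::topological_space \<Rightarrow> real) set" where
  "bA_upper = {f. (\<lambda>x. - f x) \<in> bA_lower}"

section \<open>Controlled discrete-time Markov processes\<close>

text \<open>The spaces \<open>X\<close> and \<open>U\<close> are the (non-empty) types \<open>'x\<close> and \<open>'u\<close>.\<close>

definition cdt_MP ::
  "('x::borel_space \<times> 'u::borel_space) set \<Rightarrow> ('x \<times> 'u \<Rightarrow> 'x measure) \<Rightarrow> bool" where
  "cdt_MP K T \<longleftrightarrow>
     analytic K \<and> (\<forall>x. K `` {x} \<noteq> {}) \<and> T \<in> borel \<rightarrow>\<^sub>M prob_algebra borel"

text \<open>
  A path is a sequence of pairs \<open>(x\<^sub>k, u\<^sub>k)\<close>; a history \<open>h\<^sub>n\<close> consists of the first \<open>n\<close> pairs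
  and the state \<open>x\<^sub>n\<close>.
\<close>

type_synonym ('x, 'u) path = "nat \<Rightarrow> 'x \<times> 'u"
type_synonym ('x, 'u) hist = "(nat \<Rightarrow> 'x \<times> 'u) \<times> 'x"
type_synonym ('x, 'u) policy = "nat \<Rightarrow> ('x, 'u) hist \<Rightarrow> 'u measure"

definition path_space :: "('x::borel_space, 'u::borel_space) path measure" where
  "path_space = (\<Pi>\<^sub>M k\<in>UNIV. borel)"

definition hist_space :: "nat \<Rightarrow> ('x::borel_space, 'u::borel_space) hist measure" where
  "hist_space n = (\<Pi>\<^sub>M k\<in>{..<n}. borel) \<Otimes>\<^sub>M borel"

definition hist_of :: "nat \<Rightarrow> ('x, 'u) path \<Rightarrow> ('x, 'u) hist" where
  "hist_of n \<omega> = (restrict \<omega> {..<n}, fst (\<omega> n))"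

text \<open>
  The sections of \<open>K\<close> are analytic but in general not Borel, so the constraint is expressed through
  the completion of the Borel measure \<open>\<pi> n h\<close>. The same applies to the integrals below, whose
  integrands are universally measurable.
\<close>

definition policies ::
  "('x::borel_space \<times> 'u::borel_space) set \<Rightarrow> ('x, 'u) policy set" where
  "policies K = {\<pi>. \<forall>n.
     \<pi> n \<in> univ_completion (hist_space n) \<rightarrow>\<^sub>M prob_algebra borel \<and>
     (\<forall>h\<in>space (hist_space n). emeasure (completion (\<pi> n h)) (K `` {snd h}) = 1)}"

text \<open>
  The last two conjuncts say that \<open>\<pi> n\<close> is the conditional law of \<open>u\<^sub>n\<close> given \<open>h\<^sub>n\<close>, and \<open>T\<close> that of
  \<open>x\<^sub>n\<^sub>+\<^sub>1\<close> given \<open>(h\<^sub>n, u\<^sub>n)\<close>.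
\<close>

definition is_path_measure ::
  "('x::borel_space \<times> 'u::borel_space \<Rightarrow> 'x measure) \<Rightarrow> ('x, 'u) policy \<Rightarrow> 'x \<Rightarrow>
     ('x, 'u) path measure \<Rightarrow> bool" where
  "is_path_measure T \<pi> x P \<longleftrightarrow>
     prob_space P \<and> sets P = sets path_space \<and>
     (AE \<omega> in P. fst (\<omega> 0) = x) \<and>
     (\<forall>n. \<forall>A\<in>sets (hist_space n). \<forall>B\<in>sets borel.
        emeasure P {\<omega>. hist_of n \<omega> \<in> A \<and> snd (\<omega> n) \<in> B} =
        (\<integral>\<^sup>+\<omega>\<in>{\<omega>. hist_of n \<omega> \<in> A}. emeasure (\<pi> n (hist_of n \<omega>)) B \<partial>completion P)) \<and>
     (\<forall>n. \<forall>A\<in>sets (hist_space n \<Otimes>\<^sub>M borel). \<forall>B\<in>sets borel.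
        emeasure P {\<omega>. (hist_of n \<omega>, snd (\<omega> n)) \<in> A \<and> fst (\<omega> (Suc n)) \<in> B} =
        (\<integral>\<^sup>+\<omega>\<in>{\<omega>. (hist_of n \<omega>, snd (\<omega> n)) \<in> A}. emeasure (T (\<omega> n)) B \<partial>completion P))"

definition path_measure ::
  "('x::borel_space \<times> 'u::borel_space \<Rightarrow> 'x measure) \<Rightarrow> ('x, 'u) policy \<Rightarrow> 'x \<Rightarrow>
     ('x, 'u) path measure" where
  "path_measure T \<pi> x = (THE P. is_path_measure T \<pi> x P)"

definition M_sup ::
  "('x::borel_space \<times> 'u::borel_space) set \<Rightarrow> ('x \<times> 'u \<Rightarrow> 'x measure) \<Rightarrow>
     ('x, 'u) path set \<Rightarrow> 'x \<Rightarrow> real" where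
  "M_sup K T A x = (SUP \<pi>\<in>policies K. measure (path_measure T \<pi> x) A)"

definition M_inf ::
  "('x::borel_space \<times> 'u::borel_space) set \<Rightarrow> ('x \<times> 'u \<Rightarrow> 'x measure) \<Rightarrow>
     ('x, 'u) path set \<Rightarrow> 'x \<Rightarrow> real" where
  "M_inf K T A x = (INF \<pi>\<in>policies K. measure (path_measure T \<pi> x) A)"

definition reach_event :: "'x set \<Rightarrow> enat \<Rightarrow> 'x set \<Rightarrow> ('x, 'u) path set" where
  "reach_event S n G = {\<omega>. \<exists>i. enat i \<le> n \<and> fst (\<omega> i) \<in> G \<and> (\<forall>j<i. fst (\<omega> j) \<in> S)}"

definition T_ctrl :: "('x \<times> 'u \<Rightarrow> 'x measure) \<Rightarrow> 'u \<Rightarrow> ('x \<Rightarrow> real) \<Rightarrow> 'x \<Rightarrow> real" where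
  "T_ctrl T u f x = (LINT y|completion (T (x, u)). f y)"

definition T_sup ::
  "('x \<times> 'u) set \<Rightarrow> ('x \<times> 'u \<Rightarrow> 'x measure) \<Rightarrow> ('x \<Rightarrow> real) \<Rightarrow> 'x \<Rightarrow> real" where
  "T_sup K T f x = (SUP u\<in>K `` {x}. T_ctrl T u f x)"

definition T_inf ::
  "('x \<times> 'u) set \<Rightarrow> ('x \<times> 'u \<Rightarrow> 'x measure) \<Rightarrow> ('x \<Rightarrow> real) \<Rightarrow> 'x \<Rightarrow> real" where
  "T_inf K T f x = (INF u\<in>K `` {x}. T_ctrl T u f x)"

definition R_sup ::
  "('x \<times> 'u) set \<Rightarrow> ('x \<times> 'u \<Rightarrow> 'x measure) \<Rightarrow> 'x set \<Rightarrow> 'x set \<Rightarrow> ('x \<Rightarrow> real) \<Rightarrow> 'x \<Rightarrow> real" where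
  "R_sup K T S G f x = indicator G x + indicator S x * T_sup K T f x"

definition R_inf ::
  "('x \<times> 'u) set \<Rightarrow> ('x \<times> 'u \<Rightarrow> 'x measure) \<Rightarrow> 'x set \<Rightarrow> 'x set \<Rightarrow> ('x \<Rightarrow> real) \<Rightarrow> 'x \<Rightarrow> real" where
  "R_inf K T S G f x = indicator G x + indicator S x * T_inf K T f x"

end

theory Submission
  imports Defs
begin

text \<open>
  The laws of the path under the policies from \<open>x\<close> are exactly the strategic measures started at
  \<open>x\<close>: those under which almost surely \<open>(x\<^sub>n, u\<^sub>n) \<in> K\<close> and \<open>x\<^sub>n\<^sub>+\<^sub>1\<close> has conditional law \<open>T\<close>.
  Coded by points of the Baire space they form an analytic set, because the probability of an
  analytic set is, by capacitability, an upper semi-analytic function of the law. Hence the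
  optimal values are semi-analytic, and almost optimal measures can be chosen measurably by
  Jankov--von Neumann selection. Disintegrating at \<open>x\<^sub>1\<close>, and conversely pasting such a choice
  after one step, yields the recursion. Finite horizons make \<open>f \<ge> M_sup\<close> a plain induction; for \<open>f
  \<ge> M_inf\<close> the policy which is \<open>\<epsilon>/2\<^sup>n\<^sup>+\<^sup>1\<close>-optimal for \<open>f\<close> at time \<open>n\<close> turns \<open>f\<close> into a
  supermartingale up to a total error \<open>\<epsilon>\<close>.
\<close>

section \<open>Souslin spaces\<close>

text \<open>There is no evident Borel structure on the set of universally measurable policies,
  whereas a law on the path space is determined by countably many numbers. Optimization therefore
  runs over laws, and a policy is rebuilt from a law by disintegration. Neither \<open>K\<close> nor
  the optimal values are Borel in general, so an integral or an almost sure statement about them is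
  first moved to a Borel version modulo a null set of the law at hand; the kernels obtained by
  selection are Borel only after such a correction. Infimum values are reduced to supremum values of
  the complementary event, so that only one recursion is proved directly. This duality does not
  reach the last claim: infima over policies need not commute with the limit of the horizons, hence
  a single policy has to be controlled at all times at once. The spaces are treated as second
  countable Hausdorff continuous images of the Baire space. This class is closed under countable
  products, so it contains the path space.\<close>

lemma open_agree_prefix: "open {z :: nat \<Rightarrow> 'a::discrete_topology. \<forall>i<n. z i = y i}"
proof -
  have "{z :: nat \<Rightarrow> 'a. \<forall>i<n. z i = y i} = (\<Inter>i\<in>{..<n}. (\<lambda>z. z i) -` {y i})"
    by auto
  moreover have "open ((\<lambda>z :: nat \<Rightarrow> 'a. z i) -` {y i})" for i
    by (intro open_vimage continuous_on_product_coordinates) (rule discrete_topology_class.open_discrete)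
  ultimately show ?thesis
    by auto
qed

text \<open>A basic open set of the product restricts only finitely many coordinates, so a bound on
  their indices gives the length of the prefix.\<close>

lemma ex_agree_prefix_subset:
  fixes y :: "nat \<Rightarrow> 'a::discrete_topology"
  assumes "open V" "y \<in> V"
  obtains n where "{z. \<forall>i<n. z i = y i} \<subseteq> V"
proof -
  have "openin (product_topology (\<lambda>_. euclidean) UNIV) V"
    using assms(1) by (simp add: open_fun_def)
  from product_topology_open_contains_basis[OF this assms(2)]
  obtain X where X: "y \<in> Pi\<^sub>E UNIV X" "finite {i. X i \<noteq> UNIV}" "Pi\<^sub>E UNIV X \<subseteq> V"
    by (elim exE conjE) simp
  then obtain n where n: "\<And>i. X i \<noteq> UNIV \<Longrightarrow> i < n"
    by (auto simp: finite_nat_set_iff_bounded)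
  have "{z. \<forall>i<n. z i = y i} \<subseteq> Pi\<^sub>E UNIV X"
  proof safe
    fix z i assume z: "\<forall>i<n. z i = y i"
    show "z i \<in> X i"
      using n[of i] z X(1) by (cases "X i = UNIV") (auto simp: PiE_iff)
  qed auto
  with X(3) show ?thesis
    by (intro that) auto
qed

section \<open>Complete separable metric spaces as continuous images of the Baire space\<close>

lemma (in Metric_space) separable_imp_second_countable_mtopology:
  assumes "separable_space mtopology"
  shows "second_countable mtopology"
proof -
  obtain C where C: "countable C" "C \<subseteq> M" "mtopology closure_of C = M"
    using assms by (auto simp: separable_space_def)
  let ?B = "(\<lambda>(c, n). mball c (1 / real (Suc n))) ` (C \<times> UNIV)"
  have cover: "\<exists>V\<in>?B. x \<in> V \<and> V \<subseteq> U" if U: "openin mtopology U" "x \<in> U" for U x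
  proof -
    obtain r where r: "r > 0" "mball x r \<subseteq> U" "x \<in> M"
      using U unfolding openin_mtopology by (metis subsetD)
    obtain n where n: "1 / real (Suc n) < r / 2"
      using r(1) nat_approx_posE[of "r / 2"] by auto
    have "x \<in> mtopology closure_of C"
      using C r by simp
    then obtain c where c: "c \<in> C" "c \<in> mball x (1 / real (Suc n))"
      unfolding metric_closure_of by (auto simp del: of_nat_Suc dest!: spec[of _ "1 / real (Suc n)"])
    have "mball c (1 / real (Suc n)) \<subseteq> mball x r"
    proof
      fix z assume z: "z \<in> mball c (1 / real (Suc n))"
      have "d x c < r / 2" "d c z < r / 2" "c \<in> M" "z \<in> M"
        using c(2) z n by (auto simp del: of_nat_Suc)
      then show "z \<in> mball x r"
        using triangle[of x c z] r(3) by auto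
    qed
    moreover have "x \<in> mball c (1 / real (Suc n))"
      using c(2) commute[of x c] by (simp del: of_nat_Suc)
    ultimately show ?thesis
      using c(1) r(2) by blast
  qed
  have base: "countable ?B" "\<forall>V\<in>?B. openin mtopology V"
    using C(1) by auto
  show ?thesis
    unfolding second_countable_def
    by (intro exI[of _ ?B] conjI allI impI base) (elim conjE, rule cover)
qed

text \<open>
  A point \<open>y\<close> of the Baire space is read as a sequence of indices into a dense sequence \<open>D\<close>; an
  index is skipped whenever it would move the approximation by \<open>2\<^sup>-\<^sup>n\<close> or more, so that every \<open>y\<close>
  yields a Cauchy sequence.
\<close>

context Metric_space
begin

primrec baire_approx :: "(nat \<Rightarrow> 'a) \<Rightarrow> (nat \<Rightarrow> nat) \<Rightarrow> nat \<Rightarrow> 'a" where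
  "baire_approx D y 0 = D (y 0)"
| "baire_approx D y (Suc n) =
     (if d (baire_approx D y n) (D (y (Suc n))) < (1/2)^n then D (y (Suc n)) else baire_approx D y n)"

lemma baire_approx_in: "range D \<subseteq> M \<Longrightarrow> baire_approx D y n \<in> M"
  by (induction n) auto

text \<open>Step \<open>n\<close> moves the approximation by at most \<open>(1/2)^n\<close>, and
  these bounds add up to \<open>2 * (1/2)^n\<close> from \<open>n\<close> on. Keeping the subtracted
  remainder of the geometric series makes the induction close.\<close>

lemma baire_approx_dist:
  assumes D: "range D \<subseteq> M"
  shows "d (baire_approx D y n) (baire_approx D y (n + k)) \<le> 2 * (1/2)^n - 2 * (1/2)^(n + k)"
proof (induction k)
  case (Suc k)
  have "d (baire_approx D y (n + k)) (baire_approx D y (n + Suc k)) \<le> (1/2)^(n + k)"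
    using baire_approx_in[OF D] by auto
  then have "d (baire_approx D y n) (baire_approx D y (n + Suc k))
      \<le> (2 * (1/2)^n - 2 * (1/2)^(n + k)) + (1/2)^(n + k)"
    using Suc triangle[of "baire_approx D y n" "baire_approx D y (n + k)" "baire_approx D y (n + Suc k)"]
      baire_approx_in[OF D] by (smt (verit))
  then show ?case
    by simp
qed (use baire_approx_in[OF D] in auto)

lemma baire_approx_cong:
  "(\<And>i. i \<le> n \<Longrightarrow> y i = z i) \<Longrightarrow> baire_approx D y n = baire_approx D z n"
  by (induction n) auto

lemma complete_separable_imp_baire_image:
  assumes "mcomplete" "separable_space mtopology" "M \<noteq> {}"
  shows "\<exists>f :: (nat \<Rightarrow> nat) \<Rightarrow> 'a. continuous_map euclidean mtopology f \<and> range f = M"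
proof -
  obtain C where C: "countable C" "C \<subseteq> M" "mtopology closure_of C = M"
    using assms(2) by (auto simp: separable_space_def)
  have "C \<noteq> {}"
    using C(3) assms(3) by auto
  define D where "D = from_nat_into C"
  have D: "range D \<subseteq> M" "range D = C"
    using C \<open>C \<noteq> {}\<close> by (auto simp: D_def from_nat_into range_from_nat_into)
  let ?a = "baire_approx D"
  have pow: "\<exists>n. 2 * (1/2)^n < (e::real)" if "e > 0" for e
    using real_arch_pow_inv[of "e / 2" "1/2"] that by (auto simp: mult.commute)
  have le: "d (?a y n) (?a y m) \<le> 2 * (1/2)^n" if "n \<le> m" for y n m
    using baire_approx_dist[OF D(1), of y n "m - n"] that
    by (smt (verit) le_add_diff_inverse zero_le_power divide_nonneg_nonneg)
  have "\<exists>l. limitin mtopology (?a y) l sequentially" for y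
  proof -
    have "MCauchy (?a y)"
      unfolding MCauchy_def
    proof (intro conjI allI impI)
      fix e :: real assume "e > 0"
      then obtain n where n: "2 * (1/2)^n < e / 2"
        using pow[of "e / 2"] by auto
      have "d (?a y i) (?a y j) < e" if "n \<le> i" "n \<le> j" for i j
        using le[OF that(1), of y] le[OF that(2), of y] n triangle[of "?a y i" "?a y n" "?a y j"]
          baire_approx_in[OF D(1)] by (smt (verit) commute field_sum_of_halves)
      then show "\<exists>N. \<forall>n n'. N \<le> n \<longrightarrow> N \<le> n' \<longrightarrow> d (?a y n) (?a y n') < e"
        by blast
    qed (use baire_approx_in[OF D(1)] in auto)
    then show ?thesis
      using assms(1) by (auto simp: mcomplete_def)
  qed
  then obtain l where l: "\<And>y. limitin mtopology (?a y) (l y) sequentially"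
    by metis
  have lM: "l y \<in> M" for y
    using l[of y] limitin_mspace by blast
  have dl: "d (?a y n) (l y) \<le> 2 * (1/2)^n" for y n
  proof (rule ccontr)
    assume "\<not> ?thesis"
    then have "d (?a y n) (l y) - 2 * (1/2)^n > 0"
      by simp
    then obtain N where N: "\<And>m. m \<ge> N \<Longrightarrow> d (?a y m) (l y) < d (?a y n) (l y) - 2 * (1/2)^n"
      using l[of y] unfolding limit_metric_sequentially by blast
    show False
      using N[of "max N n"] le[of n "max N n" y] triangle[of "?a y n" "?a y (max N n)" "l y"]
        baire_approx_in[OF D(1)] lM by (smt (verit) max.cobounded1 max.cobounded2)
  qed
  have "continuous_map euclidean mtopology l"
    unfolding continuous_map_to_metric
  proof (intro ballI allI impI)
    fix y and e :: real assume "e > 0"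
    then obtain n where n: "2 * (1/2)^n < e / 2"
      using pow[of "e / 2"] by auto
    \<comment> \<open>The approximation at \<open>n\<close> reads only the first
      \<open>Suc n\<close> entries, so both limits lie within \<open>2 * (1/2)^n\<close> of one
      common point.\<close>
    have "l z \<in> mball (l y) e" if "\<forall>i<Suc n. z i = y i" for z
    proof -
      have "?a z n = ?a y n"
        using that by (intro baire_approx_cong) auto
      then show ?thesis
        using dl[of z n] dl[of y n] triangle[of "l y" "?a y n" "l z"] n lM baire_approx_in[OF D(1)]
        by (auto simp: commute)
    qed
    then show "\<exists>U. openin euclidean U \<and> y \<in> U \<and> (\<forall>z\<in>U. l z \<in> mball (l y) e)"
      by (intro exI[of _ "{z. \<forall>i<Suc n. z i = y i}"])
        (simp add: open_openin[symmetric] open_agree_prefix)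
  qed
  moreover have "x \<in> range l" if x: "x \<in> M" for x
  proof -
    \<comment> \<open>The margin \<open>(1/2)^(n + 2)\<close> makes consecutive chosen points less
      than \<open>(1/2)^n\<close> apart. No index is then skipped, and the approximations are
      exactly the points \<open>D (y n)\<close>.\<close>
    have "\<exists>k. d x (D k) < (1/2)^(n + 2)" for n
    proof -
      have "x \<in> mtopology closure_of (range D)"
        using x C D by simp
      then have "\<forall>r>0. \<exists>y\<in>range D. y \<in> mball x r"
        unfolding metric_closure_of by blast
      moreover have "(0::real) < (1/2)^(n + 2)"
        by simp
      ultimately obtain y where "y \<in> range D" "y \<in> mball x ((1/2)^(n + 2))"
        by blast
      then show ?thesis
        unfolding in_mball by blast
    qed
    then obtain y where y: "\<And>n. d x (D (y n)) < (1/2)^(n + 2)"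
      by metis
    have a: "?a y n = D (y n)" for n
    proof (cases n)
      case (Suc m)
      have *: "d x (?a y m) < (1/2)^(m + 2)"
      proof (induction m)
        case (Suc k)
        have "d (?a y k) (D (y (Suc k))) < (1/2)^(k + 2) + (1/2)^(k + 3)"
          using Suc y[of "Suc k"] triangle[of "?a y k" x "D (y (Suc k))"] x baire_approx_in[OF D(1), of y k]
            D(1) commute[of x "?a y k"] by (smt (verit) add_Suc numeral_2_eq_2 numeral_3_eq_3 rangeI subsetD add_Suc_right)
        also have "\<dots> \<le> (1/2)^k"
          by (simp add: power_add power3_eq_cube)
        finally show ?case
          using y[of "Suc k"] by simp
      qed (use y[of 0] in simp)
      have "d (?a y m) (D (y (Suc m))) < (1/2)^(m + 2) + (1/2)^(m + 3)"
        using * y[of "Suc m"] triangle[of "?a y m" x "D (y (Suc m))"] x baire_approx_in[OF D(1), of y m]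
          D(1) commute[of x "?a y m"] by (smt (verit) add_Suc numeral_2_eq_2 numeral_3_eq_3 rangeI subsetD add_Suc_right)
      also have "\<dots> \<le> (1/2)^m"
        by (simp add: power_add power3_eq_cube)
      finally show ?thesis
        using Suc by simp
    qed simp
    have "d x (l y) = 0"
    proof (rule ccontr)
      assume "d x (l y) \<noteq> 0"
      then have "d x (l y) / 2 > 0"
        using nonneg[of x "l y"] by linarith
      then obtain n where n: "2 * (1/2)^n < d x (l y) / 2"
        using pow by blast
      have "d x (D (y n)) < (1/2)^n"
        using y[of n] by (rule less_le_trans) (simp add: power_add)
      moreover have "D (y n) \<in> M"
        using D(1) by auto
      then have "d x (l y) \<le> d x (D (y n)) + d (D (y n)) (l y)"
        using x lM by (intro triangle)
      moreover have "(0::real) < (1/2)^n"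
        by simp
      ultimately show False
        using n dl[of y n, unfolded a] by linarith
    qed
    then show ?thesis
      using x lM by auto
  qed
  ultimately show ?thesis
    using lM by (intro exI[of _ l]) auto
qed

end

section \<open>Analytic sets of a fixed topology and their closure properties\<close>

text \<open>The metric space in \<open>borel_space\<close> is a value of type
  \<open>real topology\<close>, unrelated to the class instance on the reals.
  \<open>analytic\<close> speaks about class topologies only, hence this relative version.\<close>

definition analytic_in :: "'a topology \<Rightarrow> 'a set \<Rightarrow> bool" where
  "analytic_in Y A \<longleftrightarrow>
     A = {} \<or> (\<exists>f :: (nat \<Rightarrow> nat) \<Rightarrow> 'a. continuous_map euclidean Y f \<and> range f = A)"

lemma analytic_in_euclidean: "analytic_in euclidean A \<longleftrightarrow> analytic A"
  by (simp add: analytic_in_def analytic_def continuous_map_iff_continuous)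

lemma completely_metrizable_separable_analytic_in:
  assumes "completely_metrizable_space Y" "separable_space Y"
  shows "analytic_in Y (topspace Y)"
proof -
  obtain M d where Md: "Metric_space M d" "Metric_space.mcomplete M d" "Y = Metric_space.mtopology M d"
    using assms(1) by (auto simp: completely_metrizable_space_def)
  interpret Metric_space M d by fact
  show ?thesis
    using complete_separable_imp_baire_image Md assms(2) by (auto simp: analytic_in_def)
qed

lemma metrizable_separable_imp_second_countable:
  assumes "metrizable_space Y" "separable_space Y"
  shows "second_countable Y"
proof -
  obtain M d where Md: "Metric_space M d" "Y = Metric_space.mtopology M d"
    using assms(1) by (auto simp: metrizable_space_def)
  interpret Metric_space M d by fact
  show ?thesis
    using separable_imp_second_countable_mtopology Md(2) assms(2) by simp
qed

lemma analytic_in_closedin: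
  assumes Y: "completely_metrizable_space Y" "separable_space Y" and A: "closedin Y A"
  shows "analytic_in Y A"
proof -
  have "second_countable (subtopology Y A)"
    using Y by (intro second_countable_subtopology metrizable_separable_imp_second_countable
        completely_metrizable_imp_metrizable_space)
  then have "analytic_in (subtopology Y A) (topspace (subtopology Y A))"
    using Y A by (intro completely_metrizable_separable_analytic_in second_countable_imp_separable_space
        completely_metrizable_space_closedin) auto
  moreover have "topspace (subtopology Y A) = A"
    using closedin_subset[OF A] by auto
  ultimately show ?thesis
    by (auto simp: analytic_in_def continuous_map_in_subtopology)
qed

lemma continuous_shift: "continuous_on UNIV (\<lambda>y :: nat \<Rightarrow> 'a::topological_space. \<lambda>k. y (Suc k))"
  by (intro continuous_on_coordinatewise_then_product continuous_on_product_coordinates)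

lemma analytic_in_UN:
  fixes A :: "nat \<Rightarrow> 'a set"
  assumes "\<And>n. analytic_in Y (A n)"
  shows "analytic_in Y (\<Union>n. A n)"
proof (cases "(\<Union>n. A n) = {}")
  case False
  then obtain m where m: "A m \<noteq> {}"
    by auto
  \<comment> \<open>Empty members have no parametrization. Replacing them by the nonempty
    \<open>A m\<close> does not change the union.\<close>
  define B where "B n = (if A n = {} then A m else A n)" for n
  have "\<exists>f :: (nat \<Rightarrow> nat) \<Rightarrow> 'a. continuous_map euclidean Y f \<and> range f = B n" for n
    using assms[of n] assms[of m] m by (auto simp: B_def analytic_in_def)
  then obtain f :: "nat \<Rightarrow> (nat \<Rightarrow> nat) \<Rightarrow> 'a"
    where f: "\<And>n. continuous_map euclidean Y (f n)" "\<And>n. range (f n) = B n"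
    by metis
  \<comment> \<open>The first entry selects a member of the family, the remaining entries select a
    point of it.\<close>
  define F where "F y = f (y 0) (\<lambda>k. y (Suc k))" for y
  have "range F = (\<Union>n. B n)"
  proof safe
    fix n x assume "x \<in> B n"
    then obtain y where "x = f n y"
      using f(2) by blast
    then have "x = F (case_nat n y)"
      by (simp add: F_def)
    then show "x \<in> range F" by blast
  next
    fix y
    show "F y \<in> (\<Union>n. B n)"
      using f(2)[of "y 0"] unfolding F_def by blast
  qed
  moreover have "(\<Union>n. B n) = (\<Union>n. A n)"
    by (auto simp: B_def split: if_splits)
  moreover have "continuous_map euclidean Y F"
    unfolding continuous_map
  proof (intro conjI allI impI)
    show "F ` topspace euclidean \<subseteq> topspace Y"
      using f(1) by (auto simp: F_def continuous_map)
    fix V assume V: "openin Y V"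
    have "open (\<Union>k. (\<lambda>y. y 0) -` {k} \<inter> (\<lambda>y k. y (Suc k)) -` (f k -` V))"
    proof (intro open_UN ballI open_Int open_vimage continuous_shift continuous_on_product_coordinates)
      fix k
      show "open (f k -` V)"
        using f(1)[of k] V by (auto simp: continuous_map vimage_def)
    qed (rule discrete_topology_class.open_discrete)
    also have "(\<Union>k. (\<lambda>y. y 0) -` {k} \<inter> (\<lambda>y k. y (Suc k)) -` (f k -` V)) =
        {x \<in> topspace euclidean. F x \<in> V}"
      by (auto simp: F_def)
    finally show "openin euclidean {x \<in> topspace euclidean. F x \<in> V}"
      by simp
  qed
  ultimately show ?thesis
    by (auto simp: analytic_in_def)
qed (auto simp: analytic_in_def)

lemma completely_metrizable_space_fun:
  assumes "completely_metrizable_space (euclidean :: 'a::topological_space topology)"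
  shows "completely_metrizable_space (euclidean :: (nat \<Rightarrow> 'a) topology)"
  unfolding euclidean_product_topology[symmetric]
  using assms by (intro completely_metrizable_space_product_topology[THEN iffD2] disjI2 conjI) auto

lemma completely_metrizable_space_nat: "completely_metrizable_space (euclidean :: nat topology)"
proof -
  have "(euclidean :: nat topology) = discrete_topology UNIV"
    by (simp add: topology_eq discrete_topology_class.open_discrete)
  then show ?thesis
    by (simp add: completely_metrizable_space_discrete_topology)
qed

lemma separable_space_euclidean: "separable_space (euclidean :: 'a::second_countable_topology topology)"
  using countable_dense_exists[where 'a='a] unfolding separable_space_def
proof (elim exE conjE, intro exI conjI)
  fix D :: "'a set"
  assume D: "\<forall>X. open X \<longrightarrow> X \<noteq> {} \<longrightarrow> (\<exists>d\<in>D. d \<in> X)"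
  show "euclidean closure_of D = topspace euclidean"
    using D by (auto simp: closure_of_def)
qed auto

text \<open>A point of the intersection is the common value of a sequence of parameters, one for
  each \<open>A n\<close>. In a Hausdorff space the sequences with equal values form a closed subset
  of a Polish space, which is itself a continuous image of the Baire space.\<close>

lemma analytic_in_INT:
  fixes A :: "nat \<Rightarrow> 'a set"
  assumes Y: "Hausdorff_space Y" and A: "\<And>n. analytic_in Y (A n)"
  shows "analytic_in Y (\<Inter>n. A n)"
proof (cases "(\<Inter>n. A n) = {}")
  case False
  then have "\<exists>f :: (nat \<Rightarrow> nat) \<Rightarrow> 'a. continuous_map euclidean Y f \<and> range f = A n" for n
    using A[of n] by (auto simp: analytic_in_def)
  then obtain f :: "nat \<Rightarrow> (nat \<Rightarrow> nat) \<Rightarrow> 'a"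
    where f: "\<And>n. continuous_map euclidean Y (f n)" "\<And>n. range (f n) = A n"
    by metis
  define E :: "(nat \<Rightarrow> nat \<Rightarrow> nat) set" where "E = (\<Inter>n. {w. f n (w n) = f 0 (w 0)})"
  have cont: "continuous_map euclidean Y (\<lambda>w :: nat \<Rightarrow> nat \<Rightarrow> nat. f n (w n))" for n
  proof -
    have "continuous_map euclidean euclidean (\<lambda>w :: nat \<Rightarrow> nat \<Rightarrow> nat. w n)"
      by (simp add: continuous_map_iff_continuous continuous_on_product_coordinates)
    from continuous_map_compose[OF this f(1)[of n]] show ?thesis
      by (simp add: o_def)
  qed
  have "closedin euclidean E"
    unfolding E_def
    using closedin_continuous_maps_eq[OF Y cont cont]
    by (intro closedin_INT) auto
  then have "analytic_in euclidean E"
    by (intro analytic_in_closedin completely_metrizable_space_fun completely_metrizable_space_nat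
        separable_space_euclidean)
  moreover have "E \<noteq> {}"
  proof -
    obtain x where x: "\<And>n. x \<in> A n"
      using False by auto
    then have "\<exists>y. f n y = x" for n
      using f(2)[of n] by (metis imageE)
    then obtain w where "\<And>n. f n (w n) = x"
      by metis
    then have "w \<in> E"
      by (simp add: E_def)
    then show ?thesis
      by auto
  qed
  ultimately obtain g :: "(nat \<Rightarrow> nat) \<Rightarrow> (nat \<Rightarrow> nat \<Rightarrow> nat)"
    where g: "continuous_map euclidean euclidean g" "range g = E"
    by (auto simp: analytic_in_def)
  have "range (\<lambda>y. f 0 (g y 0)) = (\<Inter>n. A n)"
  proof safe
    fix y n
    have "g y \<in> E"
      using g(2) by auto
    then have "f n (g y n) = f 0 (g y 0)"
      unfolding E_def by blast
    then show "f 0 (g y 0) \<in> A n"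
      using f(2)[of n] by (metis rangeI)
  next
    fix x assume x: "x \<in> (\<Inter>n. A n)"
    then have "\<exists>y. f n y = x" for n
      using f(2)[of n] by (metis INT_E UNIV_I imageE)
    then obtain w where w: "\<And>n. f n (w n) = x"
      by metis
    then have "w \<in> E"
      by (simp add: E_def)
    then obtain y where "w = g y"
      using g(2) by blast
    then show "x \<in> range (\<lambda>y. f 0 (g y 0))"
      using w[of 0] by blast
  qed
  moreover have "continuous_map euclidean Y (\<lambda>y. f 0 (g y 0))"
    using continuous_map_compose[OF g(1) cont[of 0]] by (simp add: o_def)
  ultimately show ?thesis
    unfolding analytic_in_def by blast
qed (simp add: analytic_in_def)

lemma borel_imp_analytic_in:
  assumes Y: "completely_metrizable_space Y" "separable_space Y"
    and B: "B \<in> sigma_sets (topspace Y) {V. openin Y V}"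
  shows "analytic_in Y B"
proof -
  have H: "Hausdorff_space Y" and m: "metrizable_space Y"
    using Y(1) completely_metrizable_imp_metrizable_space metrizable_imp_Hausdorff_space by blast+
  \<comment> \<open>Analytic sets are not closed under complements, so the induction over the Borel
    sets carries both a set and its complement. Open sets enter as countable unions of closed
    sets.\<close>
  have "analytic_in Y B \<and> analytic_in Y (topspace Y - B)"
    using B
  proof (induction rule: sigma_sets.induct)
    case (Basic V)
    then have V: "openin Y V" by simp
    then have "fsigma_in Y V"
      using m by (rule open_imp_fsigma_in[rotated])
    then obtain C :: "nat \<Rightarrow> 'a set" where C: "\<And>n. closedin Y (C n)" "(\<Union>n. C n) = V"
      unfolding fsigma_in_ascending by auto
    have "analytic_in Y (\<Union>n. C n)"
      using C Y by (intro analytic_in_UN analytic_in_closedin) auto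
    moreover have "analytic_in Y (topspace Y - V)"
      using V Y by (intro analytic_in_closedin) auto
    ultimately show ?case
      using C by simp
  next
    case Empty
    show ?case
      using Y by (auto simp: completely_metrizable_separable_analytic_in) (simp add: analytic_in_def)
  next
    case (Compl A)
    then show ?case
      by (auto simp: double_diff dest: sigma_sets_into_sp[rotated] dest!: openin_subset)
  next
    case (Union A)
    have "topspace Y - (\<Union>i. A i) = (\<Inter>i. topspace Y - A i)"
      by auto
    with Union H show ?case
      using analytic_in_UN[of Y A] analytic_in_INT[of Y "\<lambda>i. topspace Y - A i"] by simp
  qed
  then show ?thesis ..
qed

text \<open>
  The class repeats the Hausdorff axiom instead of extending \<open>t2_space\<close>: the library makes function
  types an instance of \<open>t2_space\<close> only for metric codomains, which rules out a more general instance.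
\<close>

class souslin_space = second_countable_topology +
  assumes souslin_hausdorff: "x \<noteq> y \<Longrightarrow> \<exists>U V. open U \<and> open V \<and> x \<in> U \<and> y \<in> V \<and> U \<inter> V = {}"
    and ex_baire_surjection:
    "\<exists>f :: (nat \<Rightarrow> nat) \<Rightarrow> 'a. (\<forall>V. open V \<longrightarrow> open (f -` V)) \<and> range f = UNIV"

lemma analytic_UNIV: "analytic (UNIV :: 'a::souslin_space set)"
  using ex_baire_surjection[where 'a='a] by (auto simp: analytic_def continuous_on_open_vimage)

text \<open>A Borel subset of a Polish space is analytic there, and the homeomorphism transports its
  parametrization as well as the separation and countability properties.\<close>

instance borel_space \<subseteq> souslin_space
proof
  obtain Y :: "real topology" and B where Y: "completely_metrizable_space Y" "separable_space Y"
    and B: "B \<in> sigma_sets (topspace Y) {V. openin Y V}"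
    and "(euclidean :: 'a topology) homeomorphic_space subtopology Y B"
    using ex_homeomorphic_borel_subset[where 'a='a] by auto
  then obtain f and g :: "real \<Rightarrow> 'a" where f: "continuous_map euclidean (subtopology Y B) f"
    and g: "continuous_map (subtopology Y B) euclidean g"
    and gf: "\<And>x. g (f x) = x" and fg: "\<And>y. y \<in> topspace Y \<inter> B \<Longrightarrow> f (g y) = y"
    by (auto simp: homeomorphic_space_def homeomorphic_maps_def)
  have hom: "(euclidean :: 'a topology) homeomorphic_space subtopology Y B"
    by fact
  have m: "metrizable_space Y"
    using Y by (intro completely_metrizable_imp_metrizable_space)
  have "second_countable Y"
    using m Y by (intro metrizable_separable_imp_second_countable)
  then have "second_countable (euclidean :: 'a topology)"
    using homeomorphic_space_second_countability[OF hom] second_countable_subtopology by blast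
  then obtain \<B> :: "'a set set" where \<B>: "countable \<B>" "\<forall>V\<in>\<B>. open V"
    "\<forall>U x. open U \<and> x \<in> U \<longrightarrow> (\<exists>V\<in>\<B>. x \<in> V \<and> V \<subseteq> U)"
    unfolding second_countable_def by auto
  then have "topological_basis \<B>"
    by (auto simp: topological_basis_iff)
  then show "\<exists>B :: 'a set set. countable B \<and> open = generate_topology B"
    using \<B>(1) topological_basis_imp_subbasis by blast
  have "Hausdorff_space (euclidean :: 'a topology)"
    using homeomorphic_Hausdorff_space[OF hom] m metrizable_imp_Hausdorff_space Hausdorff_space_subtopology
    by blast
  then show "\<exists>U V. open U \<and> open V \<and> x \<in> U \<and> y \<in> V \<and> U \<inter> V = {}" if "x \<noteq> y" for x y :: 'a
    using that unfolding Hausdorff_space_def by (auto simp: disjnt_def)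
  have Bsub: "B \<subseteq> topspace Y"
    using B sigma_sets_into_sp[of "{V. openin Y V}" "topspace Y" B] openin_subset by blast
  have "analytic_in Y B"
    using Y B by (rule borel_imp_analytic_in)
  moreover have "B \<noteq> {}"
    using f by (auto simp: continuous_map_def)
  ultimately obtain h :: "(nat \<Rightarrow> nat) \<Rightarrow> real" where h: "continuous_map euclidean Y h" "range h = B"
    by (auto simp: analytic_in_def)
  have "continuous_map euclidean euclidean (g \<circ> h)"
    using h by (intro continuous_map_compose[OF _ g]) (auto simp: continuous_map_in_subtopology)
  moreover have "x \<in> range (g \<circ> h)" for x
  proof -
    have "f x \<in> B"
      using f by (auto simp: continuous_map_def)
    then show ?thesis
      using h(2) gf[of x] by (metis comp_apply image_iff rangeI)
  qed
  ultimately show "\<exists>f :: (nat \<Rightarrow> nat) \<Rightarrow> 'a. (\<forall>V. open V \<longrightarrow> open (f -` V)) \<and> range f = UNIV"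
    by (intro exI[of _ "g \<circ> h"]) (auto simp: continuous_map_iff_continuous continuous_on_open_vimage o_def)
qed

section \<open>Products of Souslin spaces\<close>

lemma souslin_spaceI_analytic:
  assumes "analytic (UNIV :: 'a::topological_space set)"
  shows "\<exists>f :: (nat \<Rightarrow> nat) \<Rightarrow> 'a. (\<forall>V. open V \<longrightarrow> open (f -` V)) \<and> range f = UNIV"
  using assms by (auto simp: analytic_def continuous_on_open_vimage)

lemma continuous_on_UNIV_fun:
  "(\<And>i. continuous_on UNIV (\<lambda>x. f x i)) \<Longrightarrow> continuous_on UNIV f"
  by (rule continuous_on_coordinatewise_then_product)

lemma continuous_reindex: "continuous_on UNIV (\<lambda>y :: 'i \<Rightarrow> 'a::topological_space. \<lambda>k. y (h k))"
  by (intro continuous_on_UNIV_fun continuous_on_product_coordinates)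

lemma continuous_compose_UNIV:
  "continuous_on UNIV f \<Longrightarrow> continuous_on UNIV g \<Longrightarrow> continuous_on UNIV (\<lambda>x. f (g x))"
  by (rule continuous_on_compose2[of UNIV f UNIV g]) auto

abbreviation evens :: "(nat \<Rightarrow> nat) \<Rightarrow> nat \<Rightarrow> nat" where
  "evens y \<equiv> \<lambda>n. y (2 * n)"

abbreviation odds :: "(nat \<Rightarrow> nat) \<Rightarrow> nat \<Rightarrow> nat" where
  "odds y \<equiv> \<lambda>n. y (Suc (2 * n))"

lemma ex_evens_odds: "\<exists>y. evens y = a \<and> odds y = b"
  by (intro exI[of _ "\<lambda>n. if even n then a (n div 2) else b (n div 2)"]) auto

lemma Hausdorff_space_souslin: "Hausdorff_space (euclidean :: 'a::souslin_space topology)"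
  using souslin_hausdorff by (auto simp: Hausdorff_space_def disjnt_def)

instance prod :: (souslin_space, souslin_space) souslin_space
proof
  fix x y :: "'a \<times> 'b" assume "x \<noteq> y"
  then consider "fst x \<noteq> fst y" | "snd x \<noteq> snd y"
    by (auto simp: prod_eq_iff)
  then show "\<exists>U V. open U \<and> open V \<and> x \<in> U \<and> y \<in> V \<and> U \<inter> V = {}"
  proof cases
    case 1
    then obtain U V where "open U" "open V" "fst x \<in> U" "fst y \<in> V" "U \<inter> V = {}"
      using souslin_hausdorff[of "fst x" "fst y"] by auto
    then show ?thesis
      by (intro exI[of _ "fst -` U"] exI[of _ "fst -` V"] conjI open_vimage_fst) auto
  next
    case 2
    then obtain U V where "open U" "open V" "snd x \<in> U" "snd y \<in> V" "U \<inter> V = {}"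
      using souslin_hausdorff[of "snd x" "snd y"] by auto
    then show ?thesis
      by (intro exI[of _ "snd -` U"] exI[of _ "snd -` V"] conjI open_vimage_snd) auto
  qed
next
  show "\<exists>f :: (nat \<Rightarrow> nat) \<Rightarrow> 'a \<times> 'b. (\<forall>V. open V \<longrightarrow> open (f -` V)) \<and> range f = UNIV"
  proof (rule souslin_spaceI_analytic)
  obtain f :: "(nat \<Rightarrow> nat) \<Rightarrow> 'a" and g :: "(nat \<Rightarrow> nat) \<Rightarrow> 'b"
    where f: "continuous_on UNIV f" "range f = UNIV" and g: "continuous_on UNIV g" "range g = UNIV"
    using analytic_UNIV[where 'a='a] analytic_UNIV[where 'a='b] by (auto simp: analytic_def)
  have "\<exists>y. (f (evens y), g (odds y)) = (a, b)" for a b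
  proof -
    obtain u v where "f u = a" "g v = b"
      using f(2) g(2) by (metis UNIV_I imageE)
    then show ?thesis
      using ex_evens_odds[of u v] by auto
  qed
  then have "range (\<lambda>y. (f (evens y), g (odds y))) = UNIV"
    by (auto simp: image_iff) metis
  moreover have "continuous_on UNIV (\<lambda>y. (f (evens y), g (odds y)))"
    by (intro continuous_on_Pair continuous_compose_UNIV[OF f(1)] continuous_compose_UNIV[OF g(1)]
        continuous_reindex)
  ultimately show "analytic (UNIV :: ('a \<times> 'b) set)"
    unfolding analytic_def by blast
  qed
qed

instance "fun" :: (countable, souslin_space) souslin_space
proof
  fix x y :: "'a \<Rightarrow> 'b" assume "x \<noteq> y"
  then obtain i where "x i \<noteq> y i" by auto
  then obtain U V where UV: "open U" "open V" "x i \<in> U" "y i \<in> V" "U \<inter> V = {}"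
    using souslin_hausdorff[of "x i" "y i"] by auto
  have "open ((\<lambda>x. x i) -` U)" "open ((\<lambda>x. x i) -` V)"
    by (intro open_vimage UV continuous_on_product_coordinates)+
  then show "\<exists>U V. open U \<and> open V \<and> x \<in> U \<and> y \<in> V \<and> U \<inter> V = {}"
    using UV(3-5) by (intro exI[of _ "(\<lambda>x. x i) -` U"] exI[of _ "(\<lambda>x. x i) -` V"] conjI) auto
next
  show "\<exists>f :: (nat \<Rightarrow> nat) \<Rightarrow> 'a \<Rightarrow> 'b. (\<forall>V. open V \<longrightarrow> open (f -` V)) \<and> range f = UNIV"
  proof (rule souslin_spaceI_analytic)
  obtain f :: "(nat \<Rightarrow> nat) \<Rightarrow> 'b" where f: "continuous_on UNIV f" "range f = UNIV"
    using analytic_UNIV[where 'a='b] by (auto simp: analytic_def)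
  \<comment> \<open>One point of the Baire space is split into countably many of them along a
    pairing function, one parameter for each coordinate.\<close>
  define F where "F y = (\<lambda>i :: 'a. f (\<lambda>n. y (prod_encode (to_nat i, n))))" for y
  have "w \<in> range F" for w
  proof -
    have "\<forall>i. \<exists>y. f y = w i"
      using f(2) by (metis UNIV_I imageE)
    then obtain y where y: "\<And>i. f (y i) = w i"
      by metis
    have "F (\<lambda>k. y (from_nat (fst (prod_decode k))) (snd (prod_decode k))) = w"
      by (simp add: F_def y)
    then show ?thesis by blast
  qed
  then have "range F = UNIV"
    by auto
  moreover have "continuous_on UNIV F"
    unfolding F_def by (intro continuous_on_UNIV_fun continuous_compose_UNIV[OF f(1)] continuous_reindex)
  ultimately show "analytic (UNIV :: ('a \<Rightarrow> 'b) set)"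
    unfolding analytic_def by blast
  qed
qed

instance nat :: souslin_space
proof
  show "\<exists>f :: (nat \<Rightarrow> nat) \<Rightarrow> nat. (\<forall>V. open V \<longrightarrow> open (f -` V)) \<and> range f = UNIV"
    using completely_metrizable_separable_analytic_in[OF completely_metrizable_space_nat separable_space_euclidean]
    by (intro souslin_spaceI_analytic) (simp add: analytic_in_euclidean)
qed (rule hausdorff)

instance real :: souslin_space
proof
  show "\<exists>f :: (nat \<Rightarrow> nat) \<Rightarrow> real. (\<forall>V. open V \<longrightarrow> open (f -` V)) \<and> range f = UNIV"
    using completely_metrizable_separable_analytic_in[OF completely_metrizable_space_euclidean separable_space_euclidean]
    by (intro souslin_spaceI_analytic) (simp add: analytic_in_euclidean)
qed (rule hausdorff)

section \<open>Analytic sets\<close>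

text \<open>The diagonal is closed by the Hausdorff axiom, and second countability makes a pair of
  Borel maps a Borel map into the product.\<close>

lemma measurable_eq_souslin [measurable]:
  fixes f g :: "'b \<Rightarrow> 'a::souslin_space"
  assumes [measurable]: "f \<in> borel_measurable M" "g \<in> borel_measurable M"
  shows "Measurable.pred M (\<lambda>x. f x = g x)"
proof -
  have "open {x :: 'a \<times> 'a. fst x \<noteq> snd x}"
  proof (rule topological_space_class.openI)
    fix x :: "'a \<times> 'a" assume "x \<in> {x. fst x \<noteq> snd x}"
    then obtain U V where UV: "open U" "open V" "fst x \<in> U" "snd x \<in> V" "U \<inter> V = {}"
      using souslin_hausdorff[of "fst x" "snd x"] by auto
    then show "\<exists>T. open T \<and> x \<in> T \<and> T \<subseteq> {x. fst x \<noteq> snd x}"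
      by (intro exI[of _ "U \<times> V"]) (auto simp: open_Times mem_Times_iff)
  qed
  then have "{x :: 'a \<times> 'a. fst x \<noteq> snd x} \<in> sets borel"
    by simp
  moreover have "(\<lambda>x. (f x, g x)) \<in> borel_measurable M"
    by measurable
  ultimately have "(\<lambda>x. (f x, g x)) -` {x. fst x \<noteq> snd x} \<inter> space M \<in> sets M"
    by (intro measurable_sets)
  then have "space M - (\<lambda>x. (f x, g x)) -` {x. fst x \<noteq> snd x} \<inter> space M \<in> sets M"
    by auto
  also have "space M - (\<lambda>x. (f x, g x)) -` {x. fst x \<noteq> snd x} \<inter> space M = {x \<in> space M. f x = g x}"
    by auto
  finally show ?thesis
    by (simp add: pred_def)
qed

lemma baire_borel_analytic:
  assumes "E \<in> sets (borel :: (nat \<Rightarrow> nat) measure)"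
  shows "analytic E"
proof -
  have "E \<in> sigma_sets (topspace euclidean) {V. openin euclidean V}"
    using assms by (simp add: borel_def)
  then show ?thesis
    unfolding analytic_in_euclidean[symmetric]
    by (intro borel_imp_analytic_in completely_metrizable_space_fun completely_metrizable_space_nat
        separable_space_euclidean)
qed

section \<open>Borel images and preimages of analytic sets\<close>

lemma measurable_evens [measurable]: "evens \<in> borel_measurable borel"
  by (intro borel_measurable_continuous_onI continuous_reindex)

lemma measurable_odds [measurable]: "odds \<in> borel_measurable borel"
  by (intro borel_measurable_continuous_onI continuous_reindex)

lemma analytic_continuous_image:
  fixes A :: "'a::topological_space set" and h :: "'a \<Rightarrow> 'b::topological_space"
  assumes "analytic A" "continuous_on UNIV h"
  shows "analytic (h ` A)"
proof (cases "A = {}")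
  case False
  then obtain f :: "(nat \<Rightarrow> nat) \<Rightarrow> 'a" where f: "continuous_on UNIV f" "range f = A"
    using assms by (auto simp: analytic_def)
  have "continuous_on UNIV (\<lambda>y. h (f y))" "range (\<lambda>y. h (f y)) = h ` A"
    using f assms(2) by (auto intro: continuous_compose_UNIV)
  then show ?thesis
    unfolding analytic_def by blast
qed (simp add: analytic_def)

text \<open>Borel maps are reduced to continuous ones through the graph. The even entries code an
  argument and the odd entries a parameter of its value; the pairs that match form a Borel subset of
  the Baire space, and the value depends continuously on the odd entries.\<close>

lemma analytic_baire_borel_image:
  fixes g :: "(nat \<Rightarrow> nat) \<Rightarrow> 'a::souslin_space"
  assumes g [measurable]: "g \<in> borel_measurable borel" and B [measurable]: "B \<in> sets borel"
  shows "analytic (g ` B)"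
proof -
  obtain c :: "(nat \<Rightarrow> nat) \<Rightarrow> 'a" where c: "continuous_on UNIV c" "range c = UNIV"
    using analytic_UNIV[where 'a='a] by (auto simp: analytic_def)
  have c' [measurable]: "c \<in> borel_measurable borel"
    using c by (intro borel_measurable_continuous_onI)
  define E where "E = {y. evens y \<in> B \<and> g (evens y) = c (odds y)}"
  have "E \<in> sets borel"
    unfolding E_def by measurable
  then have "analytic E"
    by (rule baire_borel_analytic)
  then have "analytic ((\<lambda>y. c (odds y)) ` E)"
    by (rule analytic_continuous_image) (intro continuous_compose_UNIV[OF c(1)] continuous_reindex)
  also have "(\<lambda>y. c (odds y)) ` E = g ` B"
  proof safe
    fix y assume "y \<in> E"
    then show "c (odds y) \<in> g ` B"
      unfolding E_def by (metis (mono_tags, lifting) imageI mem_Collect_eq)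
  next
    fix u assume u: "u \<in> B"
    obtain v where v: "c v = g u"
      using c(2) by (metis UNIV_I imageE)
    obtain y where y: "evens y = u" "odds y = v"
      using ex_evens_odds by blast
    then have "y \<in> E" "c (odds y) = g u"
      using u v by (auto simp: E_def)
    then show "g u \<in> (\<lambda>y. c (odds y)) ` E"
      by (metis imageI)
  qed
  finally show ?thesis .
qed

lemma analyticE_measurable:
  fixes A :: "'a::topological_space set"
  assumes "analytic A" "A \<noteq> {}"
  obtains f :: "(nat \<Rightarrow> nat) \<Rightarrow> 'a"
  where "continuous_on UNIV f" "f \<in> borel_measurable borel" "range f = A"
  using assms by (auto simp: analytic_def intro: borel_measurable_continuous_onI)

lemma ex_measurable_surjection:
  obtains c :: "(nat \<Rightarrow> nat) \<Rightarrow> 'a::souslin_space"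
  where "continuous_on UNIV c" "c \<in> borel_measurable borel" "range c = UNIV"
  using analyticE_measurable[OF analytic_UNIV[where 'a='a]] by auto

lemma analytic_image:
  fixes h :: "'a::topological_space \<Rightarrow> 'b::souslin_space"
  assumes "analytic A" "h \<in> borel_measurable borel"
  shows "analytic (h ` A)"
proof (cases "A = {}")
  case False
  with assms(1) obtain f :: "(nat \<Rightarrow> nat) \<Rightarrow> 'a" where f: "f \<in> borel_measurable borel" "range f = A"
    using False by (metis analyticE_measurable)
  have "analytic ((\<lambda>y. h (f y)) ` UNIV)"
    using measurable_compose[OF f(1) assms(2)] by (intro analytic_baire_borel_image) auto
  also have "(\<lambda>y. h (f y)) ` UNIV = h ` A"
    using f(2) by auto
  finally show ?thesis .
qed (simp add: analytic_def)

lemma borel_imp_analytic: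
  fixes B :: "'a::souslin_space set"
  assumes [measurable]: "B \<in> sets borel"
  shows "analytic B"
proof -
  obtain c :: "(nat \<Rightarrow> nat) \<Rightarrow> 'a" where c [measurable]: "c \<in> borel_measurable borel" and r: "range c = UNIV"
    by (rule ex_measurable_surjection)
  have "c -` B \<inter> space borel \<in> sets borel"
    by measurable
  then have "analytic (c ` (c -` B))"
    by (intro analytic_baire_borel_image c) simp
  also have "c ` (c -` B) = B"
    using r by auto
  finally show ?thesis .
qed

text \<open>With \<open>f\<close> parametrizing \<open>A\<close>, membership of \<open>h x\<close>
  in \<open>A\<close> says that \<open>h x = f v\<close> for some \<open>v\<close>. This equation is
  Borel in the codes of \<open>x\<close> and \<open>v\<close>, and the preimage is its projection to
  \<open>x\<close>.\<close>

lemma analytic_vimage: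
  fixes h :: "'a::souslin_space \<Rightarrow> 'b::souslin_space"
  assumes A: "analytic A" and h [measurable]: "h \<in> borel_measurable borel"
  shows "analytic (h -` A)"
proof (cases "A = {}")
  case False
  with A obtain f :: "(nat \<Rightarrow> nat) \<Rightarrow> 'b" where f [measurable]: "f \<in> borel_measurable borel" and r: "range f = A"
    using False by (metis analyticE_measurable)
  obtain c :: "(nat \<Rightarrow> nat) \<Rightarrow> 'a" where c [measurable]: "c \<in> borel_measurable borel" and s: "range c = UNIV"
    by (rule ex_measurable_surjection)
  have "{y \<in> space borel. h (c (evens y)) = f (odds y)} \<in> sets borel"
    by measurable
  then have "analytic ((\<lambda>y. c (evens y)) ` {y. h (c (evens y)) = f (odds y)})"
    by (intro analytic_baire_borel_image) (auto intro: measurable_compose[OF measurable_evens c])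
  also have "(\<lambda>y. c (evens y)) ` {y. h (c (evens y)) = f (odds y)} = h -` A"
  proof safe
    fix y assume "h (c (evens y)) = f (odds y)"
    then show "c (evens y) \<in> h -` A"
      using r by auto
  next
    fix x assume "h x \<in> A"
    then obtain v where "f v = h x"
      using r by auto
    moreover obtain u where "c u = x"
      using s by (metis UNIV_I imageE)
    moreover obtain y where "evens y = u" "odds y = v"
      using ex_evens_odds by blast
    ultimately have "x = c (evens y) \<and> h (c (evens y)) = f (odds y)"
      by simp
    then show "x \<in> (\<lambda>y. c (evens y)) ` {y. h (c (evens y)) = f (odds y)}"
      by blast
  qed
  finally show ?thesis .
qed (simp add: analytic_def)

lemma analytic_UN_countable:
  fixes A :: "'i::countable \<Rightarrow> 'a::topological_space set"
  assumes "\<And>i. analytic (A i)"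
  shows "analytic (\<Union>i. A i)"
proof -
  have "analytic (\<Union>n. A (from_nat n))"
    using analytic_in_UN[of euclidean "\<lambda>n. A (from_nat n)"] assms by (simp add: analytic_in_euclidean)
  also have "(\<Union>n. A (from_nat n)) = (\<Union>i. A i)"
    by (auto, metis from_nat_to_nat)
  finally show ?thesis .
qed

lemma analytic_INT_countable:
  fixes A :: "'i::countable \<Rightarrow> 'a::souslin_space set"
  assumes "\<And>i. analytic (A i)"
  shows "analytic (\<Inter>i. A i)"
proof -
  have "analytic (\<Inter>n. A (from_nat n))"
    using analytic_in_INT[of euclidean "\<lambda>n. A (from_nat n)"] assms Hausdorff_space_souslin
    by (simp add: analytic_in_euclidean)
  also have "(\<Inter>n. A (from_nat n)) = (\<Inter>i. A i)"
    by (auto, metis from_nat_to_nat)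
  finally show ?thesis .
qed

lemma analytic_Int: "analytic A \<Longrightarrow> analytic B \<Longrightarrow> analytic (A \<inter> B :: 'a::souslin_space set)"
  using analytic_INT_countable[of "\<lambda>b. if b then A else B"] by (simp add: UNIV_bool Int_commute)

section \<open>Universal measurability\<close>

text \<open>The generating family is already a \<sigma>-algebra, so universal measurability can be
  tested one law at a time.\<close>

lemma sets_univ_completion:
  "sets (univ_completion M) =
     {A. A \<subseteq> space M \<and> (\<forall>p. prob_space p \<and> sets p = sets M \<longrightarrow> A \<in> sets (completion p))}"
    (is "_ = ?S")
proof -
  have "sigma_algebra (space M) ?S"
  proof (rule sigma_algebra_iff2[THEN iffD2], intro conjI ballI allI impI)
    fix A assume "A \<in> ?S"
    moreover have "space M - A \<in> sets (completion p)" if "A \<in> sets (completion p)" "sets p = sets M" for p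
    proof -
      have "space (completion p) - A \<in> sets (completion p)"
        using that by auto
      then show ?thesis
        using sets_eq_imp_space_eq[OF that(2)] by simp
    qed
    ultimately show "space M - A \<in> ?S" by auto
  qed auto
  then show ?thesis
    unfolding univ_completion_def by (subst sets_measure_of) (auto simp: sigma_algebra.sigma_sets_eq)
qed

lemma space_univ_completion [simp]: "space (univ_completion M) = space M"
  unfolding univ_completion_def by (rule space_measure_of) auto

lemma univ_completionD:
  assumes "f \<in> univ_completion M \<rightarrow>\<^sub>M N" "prob_space p" "sets p = sets M"
  shows "f \<in> completion p \<rightarrow>\<^sub>M N"
  using assms sets_eq_imp_space_eq[OF assms(3)]
  by (auto simp: measurable_def sets_univ_completion)

lemma univ_completionI:
  assumes "f \<in> M \<rightarrow>\<^sub>M N"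
  shows "f \<in> univ_completion M \<rightarrow>\<^sub>M N"
proof (rule measurableI)
  fix x assume "x \<in> space (univ_completion M)"
  then show "f x \<in> space N"
    using measurable_space[OF assms] by simp
next
  fix B assume "B \<in> sets N"
  then have "f -` B \<inter> space M \<in> sets M"
    using assms by (rule measurable_sets[rotated])
  then show "f -` B \<inter> space (univ_completion M) \<in> sets (univ_completion M)"
    by (simp add: sets_univ_completion)
qed

text \<open>A law on \<open>L\<close> is pushed forward along \<open>f\<close>. With respect to the
  image law, the preimage under \<open>g\<close> is measurable up to a null set, and
  \<open>f\<close> pulls null sets of the image law back to null sets.\<close>

lemma univ_completion_compose:
  assumes g: "g \<in> univ_completion M \<rightarrow>\<^sub>M N" and f: "f \<in> L \<rightarrow>\<^sub>M M"
  shows "(\<lambda>x. g (f x)) \<in> univ_completion L \<rightarrow>\<^sub>M N"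
proof (rule measurableI)
  fix x assume "x \<in> space (univ_completion L)"
  then show "g (f x) \<in> space N"
    using measurable_space[OF f] measurable_space[OF g] by simp
next
  fix B assume "B \<in> sets N"
  then have B: "g -` B \<inter> space M \<in> sets (univ_completion M)"
    using measurable_sets[OF g] by simp
  have "(\<lambda>x. g (f x)) -` B \<inter> space L \<in> sets (completion p)" if p: "prob_space p" "sets p = sets L" for p
  proof -
    have f': "f \<in> p \<rightarrow>\<^sub>M M" and sp: "space p = space L"
      using f p(2) sets_eq_imp_space_eq[OF p(2)] by (auto cong: measurable_cong_sets)
    then have "prob_space (distr p M f)"
      using p(1) by (intro prob_space.prob_space_distr)
    then have "g -` B \<inter> space M \<in> sets (completion (distr p M f))"
      using B by (auto simp: sets_univ_completion)
    then obtain S N' N'' where *: "g -` B \<inter> space M = S \<union> N''" "N'' \<subseteq> N'" "N' \<in> null_sets (distr p M f)"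
      "S \<in> sets M"
      by (auto elim!: sets_completionE)
    have "(\<lambda>x. g (f x)) -` B \<inter> space L = f -` (g -` B \<inter> space M) \<inter> space L"
      using measurable_space[OF f] by auto
    also have "\<dots> = (f -` S \<inter> space p) \<union> (f -` N'' \<inter> space p)"
      using * sp by auto
    finally have eq: "(\<lambda>x. g (f x)) -` B \<inter> space L = (f -` S \<inter> space p) \<union> (f -` N'' \<inter> space p)" .
    have "f -` N' \<inter> space p \<in> null_sets p"
      using *(3) f' by (auto simp: null_sets_def emeasure_distr)
    then show ?thesis
      unfolding eq using *(2,4) f' by (intro sets_completionI[OF refl, of _ "f -` N' \<inter> space p"]) auto
  qed
  then show "(\<lambda>x. g (f x)) -` B \<inter> space (univ_completion L) \<in> sets (univ_completion L)"
    by (auto simp: sets_univ_completion)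
qed

text \<open>
  The capacity argument: an analytic set \<open>f ` UNIV\<close> is approximated from inside by the sets
  \<open>\<Inter>n. closure (f ` prefix_box (map z [0..<n]))\<close>, which are compact images of boxes in the Baire
  space. Only countably many closed sets occur, so the approximation is uniformly Borel in \<open>z\<close>.
\<close>

definition prefix_box :: "nat list \<Rightarrow> (nat \<Rightarrow> nat) set" where
  "prefix_box l = {y. \<forall>i<length l. y i \<le> l ! i}"

lemma prefix_box_map: "prefix_box (map z [0..<n]) = {y. \<forall>i<n. y i \<le> z i}"
  by (auto simp: prefix_box_def)

text \<open>The sequences below \<open>z\<close> form a compact set, and so do their images. A point
  outside \<open>range f\<close> is separated from this image by disjoint open sets, and compactness
  pushes a whole box of finite depth into the open set around the image; the closure of its image
  then misses the point.\<close>

lemma Inter_closure_box_subset: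
  fixes f :: "(nat \<Rightarrow> nat) \<Rightarrow> 'a::souslin_space"
  assumes f: "continuous_on UNIV f"
  shows "(\<Inter>n. closure (f ` prefix_box (map z [0..<n]))) \<subseteq> range f"
proof
  fix p assume p: "p \<in> (\<Inter>n. closure (f ` prefix_box (map z [0..<n])))"
  define K where "K = Pi\<^sub>E UNIV (\<lambda>i. {..z i})"
  have "compactin (product_topology (\<lambda>_. euclidean) UNIV) K"
    unfolding K_def compactin_PiE by (auto intro!: finite_imp_compact)
  then have K: "compact K"
    by (simp add: euclidean_product_topology)
  show "p \<in> range f"
  proof (rule ccontr)
    assume "p \<notin> range f"
    then have "disjnt (f ` K) {p}"
      by (auto simp: disjnt_def)
    moreover have "compact (f ` K)"
      using K f by (intro compact_continuous_image continuous_on_subset[OF f]) auto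
    ultimately obtain U V where UV: "open U" "open V" "f ` K \<subseteq> U" "p \<in> V" "disjnt U V"
      using Hausdorff_space_compact_separation[OF Hausdorff_space_souslin, of "f ` K" "{p}"] by auto
    have oU: "open (f -` U)"
      using UV f by (intro open_vimage)
    have "\<exists>n. {x. \<forall>i<n. x i = y i} \<subseteq> f -` U" if "y \<in> K" for y
    proof -
      have "y \<in> f -` U"
        using that UV(3) by blast
      show ?thesis
        by (rule ex_agree_prefix_subset[OF oU \<open>y \<in> f -` U\<close>]) (rule exI)
    qed
    then have "\<exists>N. \<forall>y\<in>K. {x. \<forall>i<N y. x i = y i} \<subseteq> f -` U"
      by (intro bchoice) simp
    then obtain N where N: "\<And>y. y \<in> K \<Longrightarrow> {x. \<forall>i<N y. x i = y i} \<subseteq> f -` U"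
      by blast
    obtain C where C: "C \<subseteq> K" "finite C" "K \<subseteq> (\<Union>y\<in>C. {x. \<forall>i<N y. x i = y i})"
      by (rule compactE_image[OF K, of K "\<lambda>y. {x. \<forall>i<N y. x i = y i}"]) (auto simp: open_agree_prefix)
    define n where "n = Max (insert 0 (N ` C))"
    have n: "N y \<le> n" if "y \<in> C" for y
      using that C(2) by (auto simp: n_def)
    have "f ` prefix_box (map z [0..<n]) \<subseteq> U"
    proof safe
      fix x assume x: "x \<in> prefix_box (map z [0..<n])"
      \<comment> \<open>Truncation to zero puts \<open>x\<close> into the compact set
        \<open>K\<close> without touching the first \<open>n\<close> entries, the only ones that the
        finite subcover inspects.\<close>
      define x' where "x' i = (if i < n then x i else 0)" for i
      have "x' \<in> K"
        using x by (auto simp: K_def x'_def prefix_box_map PiE_iff)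
      then obtain y where y: "y \<in> C" "\<And>i. i < N y \<Longrightarrow> x' i = y i"
        using C(3) by blast
      then have "\<forall>i<N y. x i = y i"
        using n[OF y(1)] by (auto simp: x'_def)
      then show "f x \<in> U"
        using N[of y] y(1) C(1) by blast
    qed
    then have "V \<inter> f ` prefix_box (map z [0..<n]) = {}"
      using UV(5) by (auto simp: disjnt_def)
    then have "V \<inter> closure (f ` prefix_box (map z [0..<n])) = {}"
      using open_Int_closure_eq_empty[OF UV(2)] by blast
    then show False
      using p UV(4) by blast
  qed
qed

text \<open>Bounding one more entry by \<open>m\<close> gives boxes that increase to the previous
  one as \<open>m\<close> grows. Outer measure is continuous along increasing sequences of arbitrary
  sets, so some \<open>m\<close> keeps the value above \<open>c\<close>.\<close>

lemma outer_measure_box: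
  fixes f :: "(nat \<Rightarrow> nat) \<Rightarrow> 'a"
  assumes c: "c < outer_measure_of M (range f)" and sp: "range f \<subseteq> space M"
  shows "\<exists>z. \<forall>n. c < outer_measure_of M (f ` prefix_box (map z [0..<n]))"
proof -
  have "\<exists>g :: nat \<Rightarrow> nat list. \<forall>n. (length (g n) = n \<and> c < outer_measure_of M (f ` prefix_box (g n))) \<and>
      (\<exists>m. g (Suc n) = g n @ [m])"
  proof (rule dependent_nat_choice)
    show "\<exists>x. length x = 0 \<and> c < outer_measure_of M (f ` prefix_box x)"
      using c by (auto simp: prefix_box_def)
  next
    fix l :: "nat list" and n
    assume l: "length l = n \<and> c < outer_measure_of M (f ` prefix_box l)"
    have "prefix_box l = (\<Union>m. prefix_box (l @ [m]))"
      by (auto simp: prefix_box_def nth_append less_Suc_eq intro!: exI[of _ "_ (length l)"])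
    then have "f ` prefix_box l = (\<Union>m. f ` prefix_box (l @ [m]))"
      by auto
    moreover have "incseq (\<lambda>m. f ` prefix_box (l @ [m]))"
      by (intro incseq_SucI image_mono) (auto simp: prefix_box_def nth_append le_Suc_eq)
    ultimately have "outer_measure_of M (f ` prefix_box l) = (SUP m. outer_measure_of M (f ` prefix_box (l @ [m])))"
      using sp by (subst SUP_outer_measure_of_incseq) auto
    then obtain m where "c < outer_measure_of M (f ` prefix_box (l @ [m]))"
      using l by (auto simp: less_SUP_iff)
    then show "\<exists>y. (length y = Suc n \<and> c < outer_measure_of M (f ` prefix_box y)) \<and> (\<exists>m. y = l @ [m])"
      using l by (intro exI[of _ "l @ [m]"]) auto
  qed
  then obtain g :: "nat \<Rightarrow> nat list" where g: "\<And>n. length (g n) = n"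
    "\<And>n. c < outer_measure_of M (f ` prefix_box (g n))" "\<And>n. \<exists>m. g (Suc n) = g n @ [m]"
    by auto
  \<comment> \<open>The chosen lists extend one another, hence they are the prefixes of a single
    sequence.\<close>
  have "g n = map (\<lambda>i. g (Suc i) ! i) [0..<n]" for n
  proof (induction n)
    case (Suc n)
    obtain m where m: "g (Suc n) = g n @ [m]"
      using g(3) by blast
    then have "m = g (Suc n) ! n"
      using g(1)[of n] by (simp add: nth_append)
    then show ?case
      using Suc m by simp
  qed (use g(1)[of 0] in simp)
  then show ?thesis
    using g(2) by metis
qed

lemma analytic_inner_closed:
  fixes f :: "(nat \<Rightarrow> nat) \<Rightarrow> 'a::souslin_space"
  assumes p: "prob_space p" "sets p = sets borel" and f: "continuous_on UNIV f"
    and c: "c < outer_measure_of p (range f)"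
  obtains z where "\<And>n. c < emeasure p (closure (f ` prefix_box (map z [0..<n])))"
proof -
  have sp: "space p = UNIV"
    using sets_eq_imp_space_eq[OF p(2)] by simp
  obtain z where z: "\<And>n. c < outer_measure_of p (f ` prefix_box (map z [0..<n]))"
    using outer_measure_box[OF c] sp by auto
  have "outer_measure_of p (f ` prefix_box (map z [0..<n]))
      \<le> emeasure p (closure (f ` prefix_box (map z [0..<n])))" for n
    using p(2) outer_measure_of_mono[OF closure_subset, of p "f ` prefix_box (map z [0..<n])"] by simp
  with z show ?thesis
    by (intro that[of z]) (meson less_le_trans)
qed

lemma emeasure_Inter_box:
  fixes f :: "(nat \<Rightarrow> nat) \<Rightarrow> 'a::souslin_space"
  assumes p: "prob_space p" "sets p = sets borel"
    and c: "\<And>n. c \<le> emeasure p (closure (f ` prefix_box (map z [0..<n])))"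
  shows "c \<le> emeasure p (\<Inter>n. closure (f ` prefix_box (map z [0..<n])))"
proof -
  interpret prob_space p by fact
  have "decseq (\<lambda>n. closure (f ` prefix_box (map z [0..<n])))"
    by (intro decseq_SucI closure_mono image_mono) (auto simp: prefix_box_map simp del: upt_Suc)
  moreover have "range (\<lambda>n. closure (f ` prefix_box (map z [0..<n]))) \<subseteq> sets p"
    unfolding p(2) by (intro image_subsetI borel_closed closed_closure)
  ultimately have "(INF n. emeasure p (closure (f ` prefix_box (map z [0..<n])))) =
      emeasure p (\<Inter>n. closure (f ` prefix_box (map z [0..<n])))"
    by (intro INF_emeasure_decseq) simp_all
  moreover have "c \<le> (INF n. emeasure p (closure (f ` prefix_box (map z [0..<n]))))"
    using c by (intro INF_greatest)
  ultimately show ?thesis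
    by simp
qed

section \<open>Measurability of analytic sets and of their measure\<close>

text \<open>The capacity argument exhausts a measurable hull \<open>E\<close> of \<open>A\<close>,
  up to measure zero, by countably many measurable sets contained in \<open>A\<close>. What
  \<open>A\<close> has beyond their union lies in a null set.\<close>

lemma analytic_sets_completion:
  fixes A :: "'a::souslin_space set"
  assumes p: "prob_space p" "sets p = sets borel" and A: "analytic A"
  shows "A \<in> sets (completion p)"
proof (cases "A = {}")
  case False
  with A obtain f :: "(nat \<Rightarrow> nat) \<Rightarrow> 'a" where f: "continuous_on UNIV f" "range f = A"
    by (auto simp: analytic_def)
  interpret prob_space p by fact
  have sp: "space p = UNIV"
    using sets_eq_imp_space_eq[OF p(2)] by simp
  obtain E where E: "E \<in> sets p" "A \<subseteq> E" "outer_measure_of p A = emeasure p E"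
    using outer_measure_of_attain[of A p] sp by auto
  have ex: "\<exists>C. C \<in> sets p \<and> C \<subseteq> A \<and> ennreal (measure p E - 1 / Suc k) \<le> emeasure p C" for k
  proof (cases "0 < measure p E")
    case True
    have "ennreal (measure p E - 1 / Suc k) < outer_measure_of p (range f)"
      using True unfolding f(2) E(3) by (auto simp: emeasure_eq_measure intro!: ennreal_lessI)
    then obtain z where "\<And>n. ennreal (measure p E - 1 / Suc k) < emeasure p (closure (f ` prefix_box (map z [0..<n])))"
      using analytic_inner_closed[OF p f(1)] by metis
    then have "ennreal (measure p E - 1 / Suc k) \<le> emeasure p (\<Inter>n. closure (f ` prefix_box (map z [0..<n])))"
      by (intro emeasure_Inter_box p) (simp add: less_imp_le)
    then show ?thesis
      using Inter_closure_box_subset[OF f(1), of z] f(2) p(2)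
      by (intro exI[of _ "\<Inter>n. closure (f ` prefix_box (map z [0..<n]))"]) auto
  next
    case False
    then have "measure p E = 0"
      using measure_nonneg[of p E] by linarith
    then show ?thesis
      by (intro exI[of _ "{}"]) (auto simp: ennreal_neg)
  qed
  then obtain C where C: "\<And>k. C k \<in> sets p" "\<And>k. C k \<subseteq> A"
    "\<And>k. ennreal (measure p E - 1 / Suc k) \<le> emeasure p (C k)"
    by metis
  have "measure p E \<le> measure p (\<Union>k. C k)"
  proof (rule field_le_epsilon)
    fix e :: real assume "0 < e"
    then obtain k where k: "1 / Suc k < e"
      using nat_approx_posE by blast
    have "measure p E - 1 / Suc k \<le> measure p (C k)"
      using C(3)[of k] by (simp add: emeasure_eq_measure del: of_nat_Suc)
    also have "\<dots> \<le> measure p (\<Union>k. C k)"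
      using C(1) by (intro finite_measure_mono) auto
    finally show "measure p E \<le> measure p (\<Union>k. C k) + e"
      using k by simp
  qed
  moreover have "(\<Union>k. C k) \<subseteq> E"
    using C(2) E(2) by blast
  ultimately have "measure p (E - (\<Union>k. C k)) = 0"
    using E(1) C(1) measure_nonneg[of p "E - (\<Union>k. C k)"] by (subst finite_measure_Diff) (auto simp: finite_measure_Diff)
  then have "E - (\<Union>k. C k) \<in> null_sets p"
    using E(1) C(1) by (auto simp: null_sets_def emeasure_eq_measure)
  moreover have "A = (\<Union>k. C k) \<union> (A - (\<Union>k. C k))"
    using C(2) by auto
  ultimately show ?thesis
    using C(1) E(2) by (intro sets_completionI[of A "\<Union>k. C k" "A - (\<Union>k. C k)" "E - (\<Union>k. C k)"]) auto
qed simp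

lemma outer_measure_of_completion:
  assumes "A \<in> sets (completion p)"
  shows "outer_measure_of p A = emeasure (completion p) A"
proof -
  obtain E where E: "E \<in> sets p" "A \<subseteq> E" "outer_measure_of p A = emeasure p E"
    using outer_measure_of_attain[of A p] sets.sets_into_space[OF assms] by auto
  obtain E' where E': "E' \<in> sets p" "A \<subseteq> E'" "emeasure p E' = emeasure (completion p) A"
    using completion_upper[OF assms] by metis
  have "emeasure (completion p) A \<le> emeasure (completion p) E"
    using E by (intro emeasure_mono) auto
  moreover have "outer_measure_of p A \<le> outer_measure_of p E'"
    using E' by (intro outer_measure_of_mono)
  ultimately show ?thesis
    using E E' by simp
qed

lemma analytic_univ_completion:
  "analytic A \<Longrightarrow> A \<in> sets (univ_completion (borel :: 'a::souslin_space measure))"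
  by (auto simp: sets_univ_completion intro: analytic_sets_completion)

text \<open>A strict lower bound degrades to a weak one in the decreasing limit of closed sets. The
  rational \<open>q\<close> strictly above \<open>c\<close> absorbs this loss and leaves countably
  many conditions of the form "there is \<open>z\<close>".\<close>

lemma analytic_emeasure_gt_iff:
  fixes f :: "(nat \<Rightarrow> nat) \<Rightarrow> 'a::souslin_space"
  assumes p: "prob_space p" "sets p = sets borel" and f: "continuous_on UNIV f" and c: "0 \<le> c"
  shows "c < measure (completion p) (range f) \<longleftrightarrow>
    (\<exists>q::rat. c < real_of_rat q \<and> (\<exists>z. \<forall>n. real_of_rat q \<le> measure p (closure (f ` prefix_box (map z [0..<n])))))"
    (is "_ \<longleftrightarrow> ?R")
proof -
  interpret prob_space p by fact
  interpret C: prob_space "completion p"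
    by (rule prob_space.prob_space_completion) fact
  have A: "range f \<in> sets (completion p)"
    using f by (intro analytic_sets_completion[OF p]) (auto simp: analytic_def)
  show ?thesis
  proof
    assume "c < measure (completion p) (range f)"
    then obtain q where q: "c < real_of_rat q" "real_of_rat q < measure (completion p) (range f)"
      using of_rat_dense by blast
    have "ennreal (real_of_rat q) < outer_measure_of p (range f)"
      unfolding outer_measure_of_completion[OF A] using q c
      by (auto simp: C.emeasure_eq_measure simp del: emeasure_completion intro!: ennreal_lessI)
    then obtain z where "\<And>n. ennreal (real_of_rat q) < emeasure p (closure (f ` prefix_box (map z [0..<n])))"
      using analytic_inner_closed[OF p f] by metis
    then have "real_of_rat q \<le> measure p (closure (f ` prefix_box (map z [0..<n])))" for n
      using q c by (metis emeasure_eq_measure ennreal_le_iff less_imp_le measure_nonneg)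
    with q show ?R by blast
  next
    assume ?R
    then obtain q z where q: "c < real_of_rat q"
      and z: "\<And>n. real_of_rat q \<le> measure p (closure (f ` prefix_box (map z [0..<n])))"
      by blast
    have "ennreal (real_of_rat q) \<le> emeasure p (\<Inter>n. closure (f ` prefix_box (map z [0..<n])))"
      using z by (intro emeasure_Inter_box p) (auto simp: emeasure_eq_measure intro: ennreal_leI)
    then have "real_of_rat q \<le> measure p (\<Inter>n. closure (f ` prefix_box (map z [0..<n])))"
      by (simp add: emeasure_eq_measure)
    also have "\<dots> = measure (completion p) (\<Inter>n. closure (f ` prefix_box (map z [0..<n])))"
      using p(2) by (subst measure_completion) auto
    also have "\<dots> \<le> measure (completion p) (range f)"
      using Inter_closure_box_subset[OF f] A by (intro C.finite_measure_mono)
    finally show "c < measure (completion p) (range f)"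
      using q by simp
  qed
qed

lemma measurable_prefix [measurable]:
  "(\<lambda>z :: nat \<Rightarrow> nat. map z [0..<n]) \<in> borel \<rightarrow>\<^sub>M count_space UNIV"
proof (rule measurable_count_space_eq_countable[THEN iffD2], safe)
  fix l :: "nat list"
  have "map z [0..<n] = l \<longleftrightarrow> n = length l \<and> (\<forall>i<n. z i = l ! i)" for z
    by (simp add: list_eq_iff_nth_eq)
  then have "(\<lambda>z. map z [0..<n]) -` {l} = (if length l = n then {z. \<forall>i<n. z i = l ! i} else {})"
    by auto
  moreover have "open {z :: nat \<Rightarrow> nat. \<forall>i<n. z i = l ! i}"
    by (rule open_agree_prefix)
  ultimately show "(\<lambda>z. map z [0..<n]) -` {l} \<inter> space borel \<in> sets borel"
    by auto
qed auto

text \<open>For a fixed rational threshold, the parameters together with a bounding sequence form a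
  Borel set. The existential quantifier over that sequence is a projection along the Baire space,
  and the one over the rationals is a countable union.\<close>

lemma analytic_measure_gt:
  fixes \<kappa> :: "'z::souslin_space \<Rightarrow> 'a::souslin_space measure"
  assumes \<kappa> [measurable]: "\<kappa> \<in> borel \<rightarrow>\<^sub>M prob_algebra borel" and A: "analytic A"
  shows "analytic {z. c < measure (completion (\<kappa> z)) A}"
proof -
  have p: "prob_space (\<kappa> z)" "sets (\<kappa> z) = sets borel" for z
    using measurable_space[OF \<kappa>] by (auto simp: space_prob_algebra)
  consider "A = {}" | "c < 0" | "A \<noteq> {}" "c \<ge> 0" by linarith
  then show ?thesis
  proof cases
    case 1
    then have "{z. c < measure (completion (\<kappa> z)) A} = (if c < 0 then UNIV else {})"
      by auto
    then show ?thesis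
      using analytic_UNIV[where 'a='z] by (cases "c < 0") (simp_all, simp add: analytic_def)
  next
    case 2
    then have "{z. c < measure (completion (\<kappa> z)) A} = UNIV"
      by (auto intro: less_le_trans)
    then show ?thesis
      using analytic_UNIV by simp
  next
    case 3
    then obtain f :: "(nat \<Rightarrow> nat) \<Rightarrow> 'a" where f: "continuous_on UNIV f" "range f = A"
      using A by (auto simp: analytic_def)
    let ?m = "\<lambda>z w n. measure (\<kappa> z) (closure (f ` prefix_box (map w [0..<n])))"
    have "analytic {(z, w). \<forall>n. real_of_rat q \<le> ?m z w n}" for q :: rat
    proof -
      have [measurable]: "(\<lambda>(z, w). ?m z w n) \<in> borel_measurable borel" for n
      proof -
        \<comment> \<open>The closed set depends on the bounding sequence only through a list. Lists
          are countable, so measurability may be checked with the list fixed.\<close>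
        have "(\<lambda>x. measure (\<kappa> (fst x)) (closure (f ` prefix_box (map (snd x) [0..<n]))))
            \<in> borel_measurable (borel \<Otimes>\<^sub>M borel)"
          by (rule measurable_compose_countable[where f = "\<lambda>l x. measure (\<kappa> (fst x)) (closure (f ` prefix_box l))"])
            (rule measurable_compose[OF measurable_compose[OF measurable_fst \<kappa>] measurable_measure_prob_algebra], simp,
              rule measurable_compose[OF measurable_snd measurable_prefix])
        then show ?thesis
          by (simp add: borel_prod split_beta)
      qed
      have "{x \<in> space borel. \<forall>n. real_of_rat q \<le> (\<lambda>(z, w). ?m z w n) x} \<in> sets borel"
        by measurable
      then show ?thesis
        by (intro borel_imp_analytic) (simp add: case_prod_beta')
    qed
    then have "analytic (fst ` {(z, w). \<forall>n. real_of_rat q \<le> ?m z w n})" for q :: rat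
      by (rule analytic_image) (auto intro!: borel_measurable_continuous_onI continuous_intros)
    then have "analytic (if c < real_of_rat q then fst ` {(z, w). \<forall>n. real_of_rat q \<le> ?m z w n} else {})" for q :: rat
      by (simp add: analytic_def)
    then have "analytic (\<Union>q::rat. if c < real_of_rat q then fst ` {(z, w). \<forall>n. real_of_rat q \<le> ?m z w n} else {})"
      by (rule analytic_UN_countable)
    also have "\<dots> = {z. c < measure (completion (\<kappa> z)) A}"
      unfolding f(2)[symmetric] analytic_emeasure_gt_iff[OF p f(1) 3(2)]
      by (auto split: if_splits simp: image_iff) blast+
    finally show ?thesis .
  qed
qed


section \<open>The Jankov--von Neumann selection theorem\<close>

definition cylinder :: "nat list \<Rightarrow> (nat \<Rightarrow> nat) set" where
  "cylinder l = {y. \<forall>i<length l. y i = l ! i}"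

lemma cylinder_snoc: "y \<in> cylinder l \<Longrightarrow> y \<in> cylinder (l @ [y (length l)])"
  by (auto simp: cylinder_def nth_append less_Suc_eq)

text \<open>The leftmost branch of the tree of those lists whose cylinder contains a preimage of
  \<open>a\<close>.\<close>

primrec leftmost :: "((nat \<Rightarrow> nat) \<Rightarrow> 'a) \<Rightarrow> 'a \<Rightarrow> nat \<Rightarrow> nat list" where
  "leftmost f a 0 = []"
| "leftmost f a (Suc n) = leftmost f a n @ [LEAST m. a \<in> f ` cylinder (leftmost f a n @ [m])]"

lemma length_leftmost [simp]: "length (leftmost f a n) = n"
  by (induction n) auto

lemma leftmost_nonempty:
  assumes "a \<in> range f"
  shows "a \<in> f ` cylinder (leftmost f a n)"
proof (induction n)
  case 0
  then show ?case
    using assms by (simp add: cylinder_def)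
next
  case (Suc n)
  then obtain y where "y \<in> cylinder (leftmost f a n)" "a = f y"
    by auto
  then have "a \<in> f ` cylinder (leftmost f a n @ [y n])"
    using cylinder_snoc[of y "leftmost f a n"] by auto
  then have "a \<in> f ` cylinder (leftmost f a n @ [LEAST m. a \<in> f ` cylinder (leftmost f a n @ [m])])"
    by (rule LeastI)
  then show ?case
    by simp
qed

lemma leftmost_nth: "i < n \<Longrightarrow> leftmost f a n ! i = leftmost f a (Suc i) ! i"
proof (induction n)
  case (Suc n)
  show ?case
  proof (cases "i = n")
    case False
    with Suc.prems have "i < n"
      by simp
    then have "leftmost f a (Suc n) ! i = leftmost f a n ! i"
      by (simp add: nth_append)
    with Suc.IH \<open>i < n\<close> show ?thesis
      by simp
  qed simp
qed simp

text \<open>The branch \<open>s a\<close> is assembled from prefixes, each of which extends to some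
  true preimage of \<open>a\<close>. If \<open>f (s a)\<close> differed from \<open>a\<close>,
  disjoint neighbourhoods and continuity at \<open>s a\<close> would exclude such preimages for a
  long prefix. Measurability holds because images of cylinders are analytic and each prefix is found
  by countably many membership tests in them.\<close>

theorem Jankov_von_Neumann:
  fixes f :: "(nat \<Rightarrow> nat) \<Rightarrow> 'a::souslin_space"
  assumes f: "continuous_on UNIV f"
  obtains s where "s \<in> univ_completion borel \<rightarrow>\<^sub>M borel" "\<And>a. a \<in> range f \<Longrightarrow> f (s a) = a"
proof
  define s where "s a = (\<lambda>n. leftmost f a (Suc n) ! n)" for a
  have cyl: "analytic (f ` cylinder l)" for l
  proof -
    have "cylinder l \<in> sets borel"
      unfolding cylinder_def by (intro borel_open open_agree_prefix)
    then show ?thesis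
      by (intro analytic_baire_borel_image borel_measurable_continuous_onI f)
  qed
  have meas: "(\<lambda>a. leftmost f a n) \<in> univ_completion borel \<rightarrow>\<^sub>M count_space UNIV" for n
  proof (induction n)
    case (Suc n)
    have "(\<lambda>a. l @ [LEAST m. a \<in> f ` cylinder (l @ [m])]) \<in> univ_completion borel \<rightarrow>\<^sub>M count_space UNIV" for l
    proof -
      have "Measurable.pred (univ_completion borel) (\<lambda>a. a \<in> f ` cylinder (l @ [m]))" for m
        using analytic_univ_completion[OF cyl] by (simp add: pred_def)
      then have "(\<lambda>a. LEAST m. a \<in> f ` cylinder (l @ [m])) \<in> univ_completion borel \<rightarrow>\<^sub>M count_space UNIV"
        by (rule measurable_Least)
      then show ?thesis
        by (rule measurable_compose) simp
    qed
    from measurable_compose_countable[OF this Suc] show ?case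
      by simp
  qed simp
  show "s \<in> univ_completion borel \<rightarrow>\<^sub>M borel"
  proof (rule measurable_coordinatewise_then_product)
    fix i
    show "(\<lambda>a. s a i) \<in> univ_completion borel \<rightarrow>\<^sub>M borel"
      unfolding s_def by (rule measurable_compose[OF meas]) simp
  qed
  fix a assume a: "a \<in> range f"
  show "f (s a) = a"
  proof (rule ccontr)
    assume "f (s a) \<noteq> a"
    then obtain U V where UV: "open U" "open V" "f (s a) \<in> U" "a \<in> V" "U \<inter> V = {}"
      using souslin_hausdorff[of "f (s a)" a] by auto
    have "open (f -` U)" "s a \<in> f -` U"
      using UV f by (auto intro: open_vimage)
    then obtain n where n: "{z. \<forall>i<n. z i = s a i} \<subseteq> f -` U"
      by (rule ex_agree_prefix_subset)
    obtain y where y: "y \<in> cylinder (leftmost f a n)" "a = f y"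
      using leftmost_nonempty[OF a, of n] by auto
    then have "\<forall>i<n. y i = s a i"
      using leftmost_nth[of _ n f a] by (auto simp: cylinder_def s_def simp del: leftmost.simps)
    then show False
      using n y UV by auto
  qed
qed

section \<open>Semi-analytic functions\<close>

definition upper_semianalytic :: "('a::topological_space \<Rightarrow> real) \<Rightarrow> bool" where
  "upper_semianalytic f \<longleftrightarrow> (\<forall>c. analytic {x. c < f x})"

lemma upper_semianalytic_measurable:
  fixes f :: "'a::souslin_space \<Rightarrow> real"
  assumes "upper_semianalytic f"
  shows "f \<in> univ_completion borel \<rightarrow>\<^sub>M borel"
  unfolding borel_measurable_iff_greater
  using assms analytic_univ_completion by (auto simp: upper_semianalytic_def)

text \<open>A rational between \<open>t\<close> and \<open>f x\<close> writes the region below the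
  graph as a countable union of analytic rectangles.\<close>

lemma analytic_subgraph:
  fixes f :: "'a::souslin_space \<Rightarrow> real"
  assumes "upper_semianalytic f"
  shows "analytic {(x, t). t < f x}"
proof -
  have "analytic (fst -` {x. real_of_rat q < f x} \<inter> {xt :: 'a \<times> real. snd xt < real_of_rat q})" for q
  proof (rule analytic_Int)
    have "analytic {x. real_of_rat q < f x}"
      using assms by (simp add: upper_semianalytic_def)
    then show "analytic (fst -` {x. real_of_rat q < f x} :: ('a \<times> real) set)"
      by (rule analytic_vimage) (intro borel_measurable_continuous_onI continuous_intros)
    show "analytic {xt :: 'a \<times> real. snd xt < real_of_rat q}"
      by (intro borel_imp_analytic borel_open open_Collect_less continuous_intros)
  qed
  then have "analytic (\<Union>q. fst -` {x. real_of_rat q < f x} \<inter> {xt :: 'a \<times> real. snd xt < real_of_rat q})"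
    by (rule analytic_UN_countable)
  also have "(\<Union>q. fst -` {x. real_of_rat q < f x} \<inter> {xt :: 'a \<times> real. snd xt < real_of_rat q}) = {(x, t). t < f x}"
    using of_rat_dense by fastforce
  finally show ?thesis .
qed

lemma AE_pair_fst:
  assumes M: "prob_space M" and N: "prob_space N" and P: "AE x in M. P x"
  shows "AE z in M \<Otimes>\<^sub>M N. P (fst z)"
proof -
  interpret M: prob_space M by fact
  interpret N: prob_space N by fact
  obtain Z where Z: "{x \<in> space M. \<not> P x} \<subseteq> Z" "Z \<in> null_sets M"
    using P by (auto elim!: AE_E simp: null_sets_def)
  have "Z \<times> space N \<in> null_sets (M \<Otimes>\<^sub>M N)"
    using Z(2) by (auto simp: null_sets_def N.emeasure_pair_measure_Times)
  moreover have "{z \<in> space (M \<Otimes>\<^sub>M N). \<not> P (fst z)} \<subseteq> Z \<times> space N"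
    using Z(1) by (auto simp: space_pair_measure)
  ultimately show ?thesis
    by (rule AE_I')
qed

text \<open>An integral of \<open>f\<close> is the measure of the region below the graph of \<open>f\<close>.\<close>

lemma integral_eq_measure_subgraph:
  fixes f :: "'a::souslin_space \<Rightarrow> real"
  assumes p: "prob_space p" "sets p = sets borel" and f: "upper_semianalytic f"
    and bd: "\<And>x. 0 \<le> f x" "\<And>x. f x \<le> 1"
  shows "(LINT x|completion p. f x) =
    measure (completion (p \<Otimes>\<^sub>M uniform_measure lborel {0<..<1})) {(x, t). t < f x}"
proof -
  let ?U = "uniform_measure lborel {0<..<1::real}"
  interpret p: prob_space p by fact
  interpret U: prob_space ?U
    by (intro prob_space_uniform_measure) auto
  interpret pU: prob_space "p \<Otimes>\<^sub>M ?U"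
    by (intro prob_space_pair p.prob_space_axioms U.prob_space_axioms)
  have sp: "space p = UNIV"
    using sets_eq_imp_space_eq[OF p(2)] by simp
  have sb: "sets (p \<Otimes>\<^sub>M ?U) = sets (borel :: ('a \<times> real) measure)"
    unfolding borel_prod[symmetric] by (intro sets_pair_measure_cong) (simp_all add: p(2))
  have fm: "f \<in> borel_measurable (completion p)"
    using univ_completionD[OF upper_semianalytic_measurable[OF f] p] .
  \<comment> \<open>Fubini is applied to the Borel version \<open>f'\<close>, since the region below
    \<open>f\<close> itself is only measurable for the completion of the product. The two regions
    agree almost surely.\<close>
  then obtain f' where f' [measurable]: "f' \<in> borel_measurable p" and eq: "AE x in p. f x = f' x"
    using completion_ex_borel_measurable_real by blast
  have bd': "AE x in p. 0 \<le> f' x \<and> f' x \<le> 1"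
    using eq bd by (auto elim!: eventually_mono) metis+
  have U: "emeasure ?U {t. t < a} = ennreal a" if "0 \<le> a" "a \<le> 1" for a
  proof -
    have "{0<..<1} \<inter> {t. t < a} = {0<..<a}"
      using that by auto
    then show ?thesis
      using that divide_ennreal[of a 1] by simp
  qed
  have D' [measurable]: "{(x, t). t < f' x} \<in> sets (p \<Otimes>\<^sub>M ?U)"
  proof -
    have "{z \<in> space (p \<Otimes>\<^sub>M ?U). snd z < f' (fst z)} \<in> sets (p \<Otimes>\<^sub>M ?U)"
      by measurable
    then show ?thesis
      by (simp add: space_pair_measure sp case_prod_beta')
  qed
  have D: "{(x, t). t < f x} \<in> sets (completion (p \<Otimes>\<^sub>M ?U))"
    by (intro analytic_sets_completion pU.prob_space_axioms sb analytic_subgraph f)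
  have "emeasure (completion (p \<Otimes>\<^sub>M ?U)) {(x, t). t < f x} =
      emeasure (completion (p \<Otimes>\<^sub>M ?U)) {(x, t). t < f' x}"
    using AE_completion[OF AE_pair_fst[OF p(1) U.prob_space_axioms eq]] D D'
    by (intro emeasure_eq_AE) (auto elim!: eventually_mono)
  also have "\<dots> = emeasure (p \<Otimes>\<^sub>M ?U) {(x, t). t < f' x}"
    using D' by simp
  also have "\<dots> = (\<integral>\<^sup>+x. emeasure ?U {t. t < f' x} \<partial>p)"
    using D' by (subst U.emeasure_pair_measure_alt) (auto simp: vimage_def)
  also have "\<dots> = (\<integral>\<^sup>+x. ennreal (f' x) \<partial>p)"
  proof (rule nn_integral_cong_AE)
    show "AE x in p. emeasure ?U {t. t < f' x} = ennreal (f' x)"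
      using bd' by eventually_elim (simp only: U)
  qed
  also have "\<dots> = ennreal (LINT x|p. f' x)"
  proof (intro nn_integral_eq_integral)
    show "integrable p f'"
    proof (rule p.integrable_const_bound[of _ 1])
      show "AE x in p. norm (f' x) \<le> 1"
        using bd' by eventually_elim simp
    qed simp
    show "AE x in p. 0 \<le> f' x"
      using bd' by eventually_elim simp
  qed
  also have "(LINT x|p. f' x) = (LINT x|completion p. f' x)"
    by (rule integral_completion[symmetric]) simp
  also have "\<dots> = (LINT x|completion p. f x)"
  proof (intro integral_cong_AE)
    show "AE x in completion p. f' x = f x"
      using AE_completion[OF eq] by eventually_elim simp
  qed (use fm in \<open>simp_all add: measurable_completion\<close>)
  finally have "emeasure (completion (p \<Otimes>\<^sub>M ?U)) {(x, t). t < f x} = ennreal (LINT x|completion p. f x)" .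
  then show ?thesis
    using bd by (simp add: measure_def Bochner_Integration.integral_nonneg)
qed

lemma upper_semianalytic_affine:
  assumes "upper_semianalytic f" "0 < a"
  shows "upper_semianalytic (\<lambda>x. a * f x + b)"
proof -
  have "{x. c < a * f x + b} = {x. (c - b) / a < f x}" for c
    using assms(2) by (auto simp: field_simps)
  then show ?thesis
    using assms(1) by (simp add: upper_semianalytic_def)
qed

lemma integrable_completion_bounded:
  fixes f :: "'a::souslin_space \<Rightarrow> real"
  assumes p: "prob_space p" "sets p = sets borel" and f: "f \<in> univ_completion borel \<rightarrow>\<^sub>M borel"
    and B: "\<And>x. \<bar>f x\<bar> \<le> B"
  shows "integrable (completion p) f"
proof -
  interpret C: prob_space "completion p"
    by (rule prob_space.prob_space_completion[OF p(1)])
  show ?thesis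
    using B univ_completionD[OF f p] by (intro C.integrable_const_bound[of _ B]) auto
qed

lemma upper_semianalytic_integral:
  fixes f :: "'a::souslin_space \<Rightarrow> real" and \<kappa> :: "'z::souslin_space \<Rightarrow> 'a measure"
  assumes \<kappa> [measurable]: "\<kappa> \<in> borel \<rightarrow>\<^sub>M prob_algebra borel"
    and f: "upper_semianalytic f" and B: "\<And>x. \<bar>f x\<bar> \<le> B"
  shows "upper_semianalytic (\<lambda>z. LINT x|completion (\<kappa> z). f x)"
proof -
  have p: "prob_space (\<kappa> z)" "sets (\<kappa> z) = sets borel" for z
    using measurable_space[OF \<kappa>] by (auto simp: space_prob_algebra)
  \<comment> \<open>An affine change of scale carries \<open>[- C, C]\<close> into the unit
    interval, where an integral is the measure of a subgraph. The added \<open>1\<close> keeps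
    \<open>C\<close> positive.\<close>
  define C where "C = \<bar>B\<bar> + 1"
  define g where "g x = 1 / (2 * C) * f x + 1 / 2" for x
  have C: "C > 0" "\<And>x. \<bar>f x\<bar> \<le> C"
    using order_trans[OF B] by (auto simp: C_def)
  have g: "upper_semianalytic g"
    unfolding g_def using C by (intro upper_semianalytic_affine f) auto
  have bd: "0 \<le> g x" "g x \<le> 1" for x
    using C(1) C(2)[of x] by (auto simp: g_def field_simps)
  let ?U = "uniform_measure lborel {0<..<1::real}"
  have U: "prob_space ?U"
    by (intro prob_space_uniform_measure) auto
  have "(\<lambda>z. \<kappa> z \<Otimes>\<^sub>M ?U) \<in> borel \<rightarrow>\<^sub>M prob_algebra (borel \<Otimes>\<^sub>M borel)"
    using U by (intro measurable_pair_prob \<kappa> measurable_const) (auto simp: space_prob_algebra)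
  then have "(\<lambda>z. \<kappa> z \<Otimes>\<^sub>M ?U) \<in> borel \<rightarrow>\<^sub>M prob_algebra borel"
    by (simp add: borel_prod)
  then have "analytic {z. c < measure (completion (\<kappa> z \<Otimes>\<^sub>M ?U)) {(x, t). t < g x}}" for c
    by (rule analytic_measure_gt[OF _ analytic_subgraph[OF g]])
  then have ug: "upper_semianalytic (\<lambda>z. LINT x|completion (\<kappa> z). g x)"
    unfolding upper_semianalytic_def integral_eq_measure_subgraph[OF p g bd] by blast
  have "(LINT x|completion (\<kappa> z). g x) = 1 / (2 * C) * (LINT x|completion (\<kappa> z). f x) + 1 / 2" for z
  proof -
    interpret prob_space "\<kappa> z"
      by (rule p)
    interpret C: prob_space "completion (\<kappa> z)"
      by (rule prob_space_completion)
    have "integrable (completion (\<kappa> z)) f"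
      by (rule integrable_completion_bounded[OF p upper_semianalytic_measurable[OF f] B])
    then show ?thesis
      unfolding g_def by (subst Bochner_Integration.integral_add) (auto simp: prob_space intro: C.integrable_const)
  qed
  then have "(LINT x|completion (\<kappa> z). f x) = 2 * C * (LINT x|completion (\<kappa> z). g x) + (- C)" for z
    using C(1) by (simp add: field_simps)
  then show ?thesis
    using upper_semianalytic_affine[OF ug, of "2 * C" "- C"] C(1) by simp
qed

section \<open>Countable generators and Borel versions\<close>

text \<open>Finite intersections from a countable basis; the empty intersection contributes the
  whole space. Equality of two finite measures is thereby a countable list of equations, which makes
  the defining identities of strategic measures Borel conditions and lets their exceptional null
  sets be united.\<close>

lemma ex_countable_borel_generator:
  "\<exists>B :: nat \<Rightarrow> 'a::second_countable_topology set.
     Int_stable (range B) \<and> sets borel = sigma_sets UNIV (range B) \<and> UNIV \<in> range B"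
proof -
  obtain \<B> :: "'a set set" where \<B>: "countable \<B>" "topological_basis \<B>"
    using ex_countable_basis by auto
  define \<G> where "\<G> = Inter ` {F. F \<subseteq> \<B> \<and> finite F}"
  have count: "countable \<G>"
    unfolding \<G>_def by (intro countable_image) (use countable_Collect_finite_subset[OF \<B>(1)] in \<open>simp add: conj_commute\<close>)
  have U: "UNIV \<in> \<G>"
    unfolding \<G>_def by (rule image_eqI[of _ _ "{}"]) auto
  have stable: "Int_stable \<G>"
  proof (rule Int_stableI)
    fix a b assume "a \<in> \<G>" "b \<in> \<G>"
    then obtain F F' where "F \<subseteq> \<B>" "finite F" "a = \<Inter>F" "F' \<subseteq> \<B>" "finite F'" "b = \<Inter>F'"
      by (auto simp: \<G>_def)
    then show "a \<inter> b \<in> \<G>"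
      unfolding \<G>_def by (intro image_eqI[of _ _ "F \<union> F'"]) auto
  qed
  have "sets (borel :: 'a measure) = sigma_sets UNIV \<G>"
  proof
    have "\<B> \<subseteq> \<G>"
      unfolding \<G>_def by (auto intro!: image_eqI[of _ _ "{_}"])
    then show "sets (borel :: 'a measure) \<subseteq> sigma_sets UNIV \<G>"
      unfolding borel_eq_countable_basis[OF \<B>] by (simp add: sigma_sets_mono')
    have "\<G> \<subseteq> sets borel"
    proof
      fix a assume "a \<in> \<G>"
      then obtain F where F: "F \<subseteq> \<B>" "finite F" "a = \<Inter>F"
        by (auto simp: \<G>_def)
      have "open a"
        unfolding F(3) using F topological_basis_open[OF \<B>(2)] by (intro open_Inter) auto
      then show "a \<in> sets borel"
        by simp
    qed
    then show "sigma_sets UNIV \<G> \<subseteq> sets borel"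
      using sets.sigma_sets_subset[of \<G> borel] by simp
  qed
  moreover have "range (from_nat_into \<G>) = \<G>"
    using count U by (intro range_from_nat_into) auto
  ultimately show ?thesis
    using stable U by (intro exI[of _ "from_nat_into \<G>"]) simp
qed

definition borel_gen :: "nat \<Rightarrow> 'a::second_countable_topology set" where
  "borel_gen = (SOME B. Int_stable (range B) \<and> sets borel = sigma_sets UNIV (range B) \<and> UNIV \<in> range B)"

lemma borel_gen:
  "Int_stable (range (borel_gen :: nat \<Rightarrow> 'a::second_countable_topology set))"
  "sets (borel :: 'a::second_countable_topology measure) = sigma_sets UNIV (range borel_gen)"
  "(UNIV :: 'a::second_countable_topology set) \<in> range borel_gen"
proof -
  have "Int_stable (range (borel_gen :: nat \<Rightarrow> 'a set)) \<and>
      sets (borel :: 'a measure) = sigma_sets UNIV (range borel_gen) \<and> (UNIV :: 'a set) \<in> range borel_gen"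
    unfolding borel_gen_def by (rule someI_ex[OF ex_countable_borel_generator])
  then show "Int_stable (range (borel_gen :: nat \<Rightarrow> 'a::second_countable_topology set))"
    "sets (borel :: 'a::second_countable_topology measure) = sigma_sets UNIV (range borel_gen)"
    "(UNIV :: 'a::second_countable_topology set) \<in> range borel_gen"
    by auto
qed

lemma sets_borel_gen [measurable]: "borel_gen i \<in> sets borel"
  unfolding borel_gen(2) by (intro sigma_sets.Basic) simp

lemma measure_eqI_borel_gen:
  fixes M N :: "'a::second_countable_topology measure"
  assumes "finite_measure M" "sets M = sets borel" "sets N = sets borel"
    and eq: "\<And>i. emeasure M (borel_gen i) = emeasure N (borel_gen i)"
  shows "M = N"
proof (rule measure_eqI_generator_eq[where E = "range borel_gen" and \<Omega> = UNIV and A = "\<lambda>_. UNIV"])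
  show "emeasure M X = emeasure N X" if "X \<in> range borel_gen" for X
    using that eq by auto
  show "emeasure M UNIV \<noteq> \<infinity>"
    using finite_measure.emeasure_finite[OF assms(1), of UNIV] by simp
qed (use borel_gen assms in auto)

lemma measurable_prob_algebra_borel:
  fixes K :: "'z \<Rightarrow> 'a::second_countable_topology measure"
  assumes "\<And>z. z \<in> space M \<Longrightarrow> prob_space (K z)" "\<And>z. z \<in> space M \<Longrightarrow> sets (K z) = sets borel"
    and "\<And>i. (\<lambda>z. emeasure (K z) (borel_gen i)) \<in> borel_measurable M"
  shows "K \<in> M \<rightarrow>\<^sub>M prob_algebra borel"
  using assms by (intro measurable_prob_algebra_generated[OF borel_gen(2) borel_gen(1)]) auto

section \<open>Borel versions modulo a null set\<close>

text \<open>Countably many functions have Borel versions off one common null set, because the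
  exceptional sets can be united.\<close>

lemma completion_ex_null_set:
  fixes \<phi> :: "'i::countable \<Rightarrow> 'a \<Rightarrow> ennreal"
  assumes "\<And>i. \<phi> i \<in> borel_measurable (completion p)"
  shows "\<exists>N\<in>null_sets p. \<forall>i. (\<lambda>x. if x \<in> N then 0 else \<phi> i x) \<in> borel_measurable p"
proof -
  have "\<exists>g. g \<in> borel_measurable p \<and> (AE x in p. \<phi> i x = g x)" for i
    using completion_ex_borel_measurable[OF assms[of i]] by blast
  then obtain g where g: "\<And>i. g i \<in> borel_measurable p" "\<And>i. AE x in p. \<phi> i x = g i x"
    by metis
  have "AE x in p. \<forall>i. \<phi> i x = g i x"
    using g(2) by (simp add: AE_all_countable)
  then obtain N where N: "{x \<in> space p. \<not> (\<forall>i. \<phi> i x = g i x)} \<subseteq> N" "N \<in> null_sets p"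
    by (auto elim!: AE_E simp: null_sets_def)
  have "(\<lambda>x. if x \<in> N then 0 else \<phi> i x) \<in> borel_measurable p" for i
  proof -
    have [measurable]: "N \<in> sets p" "g i \<in> borel_measurable p"
      using N g by auto
    have "(\<lambda>x. if x \<in> N then 0 else g i x) \<in> borel_measurable p"
      by measurable
    then show ?thesis
      using N by (subst measurable_cong[where g = "\<lambda>x. if x \<in> N then 0 else g i x"]) auto
  qed
  with N(2) show ?thesis by blast
qed

text \<open>Borel measurability into a second countable space is decided by the preimages of
  countably many generators, so one null set corrects them all.\<close>

lemma completion_ex_borel_version:
  fixes f :: "'a \<Rightarrow> 'b::second_countable_topology"
  assumes f: "f \<in> borel_measurable (completion p)"
  obtains f' where "f' \<in> borel_measurable p" "AE x in p. f x = f' x"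
proof -
  have "(\<lambda>x. indicator (borel_gen i) (f x) :: ennreal) \<in> borel_measurable (completion p)" for i
    by (rule measurable_compose[OF f]) simp
  from completion_ex_null_set[of "\<lambda>i x. indicator (borel_gen i) (f x)", OF this]
  obtain N where N: "N \<in> null_sets p"
    "\<And>i. (\<lambda>x. if x \<in> N then 0 else indicator (borel_gen i) (f x) :: ennreal) \<in> borel_measurable p"
    by auto
  define f' where "f' x = (if x \<in> N then undefined else f x)" for x
  have "f' \<in> measurable p (sigma UNIV (range borel_gen))"
  proof (rule measurable_measure_of)
    fix y :: "'b set" assume "y \<in> range borel_gen"
    then obtain i where i: "y = borel_gen i" by auto
    have *: "{x \<in> space p. (if x \<in> N then 0 else indicator (borel_gen i) (f x)) = (1::ennreal)} \<in> sets p"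
      using N(2)[of i] by (intro borel_measurable_eq) auto
    have "N \<in> sets p"
      using N(1) by auto
    have "f' -` y \<inter> space p = {x \<in> space p. (if x \<in> N then 0 else indicator (borel_gen i) (f x)) = (1::ennreal)} \<union>
        (if undefined \<in> y then N \<inter> space p else {})"
      by (auto simp: f'_def i indicator_def split: if_splits)
    then show "f' -` y \<inter> space p \<in> sets p"
      using * \<open>N \<in> sets p\<close> by auto
  qed auto
  moreover have "sets (sigma UNIV (range borel_gen)) = sets (borel :: 'b measure)"
    by (simp add: borel_gen(2))
  ultimately have "f' \<in> borel_measurable p"
    by (simp cong: measurable_cong_sets)
  moreover have "AE x in p. f x = f' x"
    using AE_not_in[OF N(1)] by eventually_elim (simp add: f'_def)
  ultimately show ?thesis ..
qed

text \<open>A kernel is measurable once its values on the countable generator are. On the common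
  exceptional set it is replaced by a Dirac measure, which keeps it a probability kernel
  everywhere.\<close>

lemma completion_ex_kernel_version:
  fixes \<kappa> :: "'a \<Rightarrow> 'b::second_countable_topology measure"
  assumes \<kappa>: "\<kappa> \<in> completion p \<rightarrow>\<^sub>M prob_algebra borel"
  obtains \<kappa>' where "\<kappa>' \<in> p \<rightarrow>\<^sub>M prob_algebra borel" "AE x in p. \<kappa> x = \<kappa>' x"
proof -
  have "(\<lambda>x. emeasure (\<kappa> x) (borel_gen i)) \<in> borel_measurable (completion p)" for i
    using measurable_emeasure_kernel[OF measurable_prob_algebraD[OF \<kappa>] sets_borel_gen] .
  from completion_ex_null_set[of "\<lambda>i x. emeasure (\<kappa> x) (borel_gen i)", OF this]
  obtain N where N: "N \<in> null_sets p"
    "\<And>i. (\<lambda>x. if x \<in> N then 0 else emeasure (\<kappa> x) (borel_gen i)) \<in> borel_measurable p"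
    by auto
  have [measurable]: "N \<in> sets p"
    using N(1) by auto
  define \<kappa>' where "\<kappa>' x = (if x \<in> N then return borel undefined else \<kappa> x)" for x
  have \<kappa>sp: "prob_space (\<kappa> x)" "sets (\<kappa> x) = sets borel" if "x \<in> space p" for x
    using measurable_space[OF \<kappa>, of x] that by (auto simp: space_prob_algebra)
  have "\<kappa>' \<in> p \<rightarrow>\<^sub>M prob_algebra borel"
  proof (rule measurable_prob_algebra_borel)
    fix x assume "x \<in> space p"
    then show "prob_space (\<kappa>' x)" "sets (\<kappa>' x) = sets borel"
      using \<kappa>sp by (auto simp: \<kappa>'_def intro!: prob_space_return)
  next
    fix i
    define g where "g x = (if x \<in> N then 0 else emeasure (\<kappa> x) (borel_gen i))" for x
    have [measurable]: "g \<in> borel_measurable p"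
      using N(2)[of i] by (simp add: g_def[abs_def])
    have "(\<lambda>x. if x \<in> N then emeasure (return borel undefined) (borel_gen i :: 'b set) else g x) \<in> borel_measurable p"
      by measurable
    then show "(\<lambda>x. emeasure (\<kappa>' x) (borel_gen i)) \<in> borel_measurable p"
      by (rule measurable_cong[THEN iffD1, rotated]) (auto simp: \<kappa>'_def g_def)
  qed
  moreover have "AE x in p. \<kappa> x = \<kappa>' x"
    using AE_not_in[OF N(1)] by eventually_elim (simp add: \<kappa>'_def)
  ultimately show ?thesis ..
qed

section \<open>Semidirect products of a measure and a kernel\<close>

definition semidirect :: "'a measure \<Rightarrow> 'b measure \<Rightarrow> ('a \<Rightarrow> 'b measure) \<Rightarrow> ('a \<times> 'b) measure" where
  "semidirect M N \<kappa> = M \<bind> (\<lambda>x. distr (\<kappa> x) (M \<Otimes>\<^sub>M N) (Pair x))"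

lemma semidirect_kernel:
  assumes [measurable]: "\<kappa> \<in> M \<rightarrow>\<^sub>M prob_algebra N"
  shows "(\<lambda>x. distr (\<kappa> x) (M \<Otimes>\<^sub>M N) (Pair x)) \<in> M \<rightarrow>\<^sub>M prob_algebra (M \<Otimes>\<^sub>M N)"
  by (rule measurable_distr_prob_space2[OF assms]) simp

lemma
  assumes M: "prob_space M" and \<kappa>: "\<kappa> \<in> M \<rightarrow>\<^sub>M prob_algebra N"
  shows sets_semidirect: "sets (semidirect M N \<kappa>) = sets (M \<Otimes>\<^sub>M N)"
    and space_semidirect: "space (semidirect M N \<kappa>) = space M \<times> space N"
    and prob_space_semidirect: "prob_space (semidirect M N \<kappa>)"
proof -
  have M': "M \<in> space (prob_algebra M)"
    using M by (simp add: space_prob_algebra)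
  show *: "sets (semidirect M N \<kappa>) = sets (M \<Otimes>\<^sub>M N)"
    unfolding semidirect_def by (rule sets_bind'[OF M' semidirect_kernel[OF \<kappa>]])
  show "space (semidirect M N \<kappa>) = space M \<times> space N"
    using sets_eq_imp_space_eq[OF *] by (simp add: space_pair_measure)
  show "prob_space (semidirect M N \<kappa>)"
    unfolding semidirect_def by (rule prob_space_bind'[OF M' semidirect_kernel[OF \<kappa>]])
qed

lemma nn_integral_semidirect:
  assumes M: "prob_space M" and \<kappa>: "\<kappa> \<in> M \<rightarrow>\<^sub>M prob_algebra N"
    and f [measurable]: "f \<in> borel_measurable (M \<Otimes>\<^sub>M N)"
  shows "(\<integral>\<^sup>+z. f z \<partial>semidirect M N \<kappa>) = (\<integral>\<^sup>+x. \<integral>\<^sup>+y. f (x, y) \<partial>\<kappa> x \<partial>M)"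
proof -
  have "(\<integral>\<^sup>+z. f z \<partial>semidirect M N \<kappa>) = (\<integral>\<^sup>+x. \<integral>\<^sup>+z. f z \<partial>distr (\<kappa> x) (M \<Otimes>\<^sub>M N) (Pair x) \<partial>M)"
    unfolding semidirect_def
    by (rule nn_integral_bind[OF f measurable_prob_algebraD[OF semidirect_kernel[OF \<kappa>]]])
  also have "\<dots> = (\<integral>\<^sup>+x. \<integral>\<^sup>+y. f (x, y) \<partial>\<kappa> x \<partial>M)"
  proof (rule nn_integral_cong)
    fix x assume x: "x \<in> space M"
    then have s: "sets (\<kappa> x) = sets N"
      using measurable_space[OF \<kappa>] by (auto simp: space_prob_algebra)
    have "Pair x \<in> \<kappa> x \<rightarrow>\<^sub>M M \<Otimes>\<^sub>M N"
      using x measurable_Pair1'[of x M N] by (simp add: measurable_cong_sets[OF s refl])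
    then show "(\<integral>\<^sup>+z. f z \<partial>distr (\<kappa> x) (M \<Otimes>\<^sub>M N) (Pair x)) = (\<integral>\<^sup>+y. f (x, y) \<partial>\<kappa> x)"
      by (rule nn_integral_distr) simp
  qed
  finally show ?thesis .
qed

lemma emeasure_semidirect:
  assumes M: "prob_space M" and \<kappa>: "\<kappa> \<in> M \<rightarrow>\<^sub>M prob_algebra N"
    and A: "A \<in> sets M" and B: "B \<in> sets N"
  shows "emeasure (semidirect M N \<kappa>) (A \<times> B) = (\<integral>\<^sup>+x\<in>A. emeasure (\<kappa> x) B \<partial>M)"
proof -
  have "emeasure (semidirect M N \<kappa>) (A \<times> B) = (\<integral>\<^sup>+z. indicator (A \<times> B) z \<partial>semidirect M N \<kappa>)"
    using A B by (intro nn_integral_indicator[symmetric]) (simp add: sets_semidirect[OF M \<kappa>])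
  also have "\<dots> = (\<integral>\<^sup>+x. \<integral>\<^sup>+y. indicator (A \<times> B) (x, y) \<partial>\<kappa> x \<partial>M)"
    using A B by (intro nn_integral_semidirect[OF M \<kappa>]) simp
  also have "\<dots> = (\<integral>\<^sup>+x\<in>A. emeasure (\<kappa> x) B \<partial>M)"
  proof (rule nn_integral_cong)
    fix x assume x: "x \<in> space M"
    then have "sets (\<kappa> x) = sets N"
      using measurable_space[OF \<kappa>] by (auto simp: space_prob_algebra)
    then show "(\<integral>\<^sup>+y. indicator (A \<times> B) (x, y) \<partial>\<kappa> x) = emeasure (\<kappa> x) B * indicator A x"
      using B by (auto simp: indicator_times nn_integral_cmult mult.commute split: split_indicator)
  qed
  finally show ?thesis .
qed

text \<open>\<open>P\<close> may be any predicate here, since it will be membership in the analytic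
  set \<open>K\<close>. The iterated integral is taken of a measurable null set covering the
  failures of \<open>P\<close>.\<close>

lemma AE_semidirect:
  assumes M: "prob_space M" and \<kappa>: "\<kappa> \<in> M \<rightarrow>\<^sub>M prob_algebra N"
    and P: "AE z in semidirect M N \<kappa>. P z"
  shows "AE x in M. AE y in \<kappa> x. P (x, y)"
proof -
  obtain Z where Z: "{z \<in> space (semidirect M N \<kappa>). \<not> P z} \<subseteq> Z" "Z \<in> null_sets (semidirect M N \<kappa>)"
    using P by (auto elim!: AE_E simp: null_sets_def)
  have [measurable]: "Z \<in> sets (M \<Otimes>\<^sub>M N)"
    using Z(2) sets_semidirect[OF M \<kappa>] by auto
  have [measurable]: "\<kappa> \<in> M \<rightarrow>\<^sub>M subprob_algebra N"
    by (rule measurable_prob_algebraD[OF \<kappa>])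
  have "0 = (\<integral>\<^sup>+z. indicator Z z \<partial>semidirect M N \<kappa>)"
    using Z(2) by (simp add: null_sets_def)
  also have "\<dots> = (\<integral>\<^sup>+x. \<integral>\<^sup>+y. indicator Z (x, y) \<partial>\<kappa> x \<partial>M)"
    by (intro nn_integral_semidirect[OF M \<kappa>]) simp
  finally have *: "(\<integral>\<^sup>+x. \<integral>\<^sup>+y. indicator Z (x, y) \<partial>\<kappa> x \<partial>M) = 0"
    by simp
  have "(\<lambda>x. \<integral>\<^sup>+y. indicator Z (x, y) \<partial>\<kappa> x) \<in> borel_measurable M"
    by (rule nn_integral_measurable_subprob_algebra2[where N = N]) measurable
  with * have 0: "AE x in M. (\<integral>\<^sup>+y. indicator Z (x, y) \<partial>\<kappa> x) = 0"
    by (subst (asm) nn_integral_0_iff_AE) auto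
  show ?thesis
  proof (rule AE_mp[OF 0], rule AE_I2, rule impI)
    fix x assume x: "x \<in> space M" and 0: "(\<integral>\<^sup>+y. indicator Z (x, y) \<partial>\<kappa> x) = 0"
    have s: "sets (\<kappa> x) = sets N"
      using measurable_space[OF \<kappa> x] by (auto simp: space_prob_algebra)
    have "(\<lambda>y. indicator Z (x, y) :: ennreal) \<in> borel_measurable (\<kappa> x)"
      using x by (subst measurable_cong_sets[OF s refl]) measurable
    then have 0: "AE y in \<kappa> x. indicator Z (x, y) = (0::ennreal)"
      using 0 by (subst (asm) nn_integral_0_iff_AE) auto
    show "AE y in \<kappa> x. P (x, y)"
    proof (rule AE_mp[OF 0], rule AE_I2, rule impI)
      fix y assume "y \<in> space (\<kappa> x)" "indicator Z (x, y) = (0::ennreal)"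
      then show "P (x, y)"
        using x Z(1) sets_eq_imp_space_eq[OF s] by (auto simp: space_semidirect[OF M \<kappa>] indicator_def split: if_splits)
    qed
  qed
qed

lemma AE_semidirectI:
  assumes M: "prob_space M" and \<kappa>: "\<kappa> \<in> M \<rightarrow>\<^sub>M prob_algebra N"
    and P [measurable]: "Measurable.pred (M \<Otimes>\<^sub>M N) P" and ae: "AE x in M. AE y in \<kappa> x. P (x, y)"
  shows "AE z in semidirect M N \<kappa>. P z"
proof -
  have sp: "space (semidirect M N \<kappa>) = space (M \<Otimes>\<^sub>M N)"
    by (simp add: space_semidirect[OF M \<kappa>] space_pair_measure)
  define Z where "Z = {z \<in> space (M \<Otimes>\<^sub>M N). \<not> P z}"
  have Z [measurable]: "Z \<in> sets (M \<Otimes>\<^sub>M N)"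
    unfolding Z_def by measurable
  have "emeasure (semidirect M N \<kappa>) Z = (\<integral>\<^sup>+z. indicator Z z \<partial>semidirect M N \<kappa>)"
    by (intro nn_integral_indicator[symmetric]) (simp add: sets_semidirect[OF M \<kappa>])
  also have "\<dots> = (\<integral>\<^sup>+x. \<integral>\<^sup>+y. indicator Z (x, y) \<partial>\<kappa> x \<partial>M)"
    by (intro nn_integral_semidirect[OF M \<kappa>]) simp
  also have "\<dots> = (\<integral>\<^sup>+x. 0 \<partial>M)"
  proof (rule nn_integral_cong_AE, rule AE_mp[OF ae], rule AE_I2, rule impI)
    fix x assume "x \<in> space M" "AE y in \<kappa> x. P (x, y)"
    then have "(\<integral>\<^sup>+y. indicator Z (x, y) \<partial>\<kappa> x) = (\<integral>\<^sup>+y. 0 \<partial>\<kappa> x)"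
      by (intro nn_integral_cong_AE) (auto simp: Z_def)
    then show "(\<integral>\<^sup>+y. indicator Z (x, y) \<partial>\<kappa> x) = 0"
      by simp
  qed
  finally have "Z \<in> null_sets (semidirect M N \<kappa>)"
    by (simp add: null_sets_def sets_semidirect[OF M \<kappa>])
  then show ?thesis
    by (rule AE_I') (auto simp: Z_def sp)
qed

lemma semidirect_eqI:
  assumes M: "prob_space M" and \<kappa>: "\<kappa> \<in> M \<rightarrow>\<^sub>M prob_algebra N"
    and P: "sets P = sets (M \<Otimes>\<^sub>M N)"
    and eq: "\<And>A B. A \<in> sets M \<Longrightarrow> B \<in> sets N \<Longrightarrow> emeasure P (A \<times> B) = (\<integral>\<^sup>+x\<in>A. emeasure (\<kappa> x) B \<partial>M)"
  shows "P = semidirect M N \<kappa>"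
proof (rule measure_eqI_generator_eq[where E = "{a \<times> b |a b. a \<in> sets M \<and> b \<in> sets N}"
      and \<Omega> = "space M \<times> space N" and A = "\<lambda>_. space M \<times> space N"])
  interpret prob_space "semidirect M N \<kappa>"
    by (rule prob_space_semidirect[OF M \<kappa>])
  show "Int_stable {a \<times> b |a b. a \<in> sets M \<and> b \<in> sets N}"
    by (rule Int_stable_pair_measure_generator)
  show "{a \<times> b |a b. a \<in> sets M \<and> b \<in> sets N} \<subseteq> Pow (space M \<times> space N)"
    by (rule pair_measure_closed)
  show "emeasure P X = emeasure (semidirect M N \<kappa>) X" if "X \<in> {a \<times> b |a b. a \<in> sets M \<and> b \<in> sets N}" for X
    using that by (auto simp: eq emeasure_semidirect[OF M \<kappa>])
  show "emeasure P (space M \<times> space N) \<noteq> \<infinity>"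
    unfolding eq[OF sets.top sets.top] emeasure_semidirect[OF M \<kappa> sets.top sets.top, symmetric]
    by simp
  show "sets P = sigma_sets (space M \<times> space N) {a \<times> b |a b. a \<in> sets M \<and> b \<in> sets N}"
    unfolding P by (rule sets_pair_measure)
  show "sets (semidirect M N \<kappa>) = sigma_sets (space M \<times> space N) {a \<times> b |a b. a \<in> sets M \<and> b \<in> sets N}"
    unfolding sets_semidirect[OF M \<kappa>] by (rule sets_pair_measure)
qed auto

section \<open>Coding probability measures by points of the Baire space\<close>

text \<open>Base three with digits 0 and 1 only: what follows digit \<open>n\<close> is at most half
  a unit of that place. No carry can occur, and the digit is recovered by rounding down and reducing
  modulo three.\<close>

lemma nat_floor_ternary_mod:
  fixes d :: "nat \<Rightarrow> nat"
  assumes d: "\<And>n. d n \<le> 1"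
  defines "t \<equiv> (\<Sum>n. real (d n) / 3 ^ Suc n)"
  shows "nat \<lfloor>3 ^ Suc n * t\<rfloor> mod 3 = d n"
    and "0 \<le> t" and "t \<le> 1"
proof -
  have geo: "(\<lambda>k. 1 / 3 ^ Suc (k + m)) sums (1 / (2 * 3 ^ m) :: real)" for m
  proof -
    have "(\<lambda>k. (1/3) ^ k) sums (1 / (1 - 1/3) :: real)"
      by (rule geometric_sums) simp
    then have "(\<lambda>k. (1 / 3 ^ Suc m) * (1/3) ^ k) sums ((1 / 3 ^ Suc m) * (1 / (1 - 1/3)) :: real)"
      by (rule sums_mult)
    then show ?thesis
      by (simp add: power_add power_one_over field_simps)
  qed
  have le: "real (d n) / 3 ^ Suc n \<le> 1 / 3 ^ Suc n" for n
    using d[of n] by (intro divide_right_mono) auto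
  have summ: "summable (\<lambda>k. real (d (k + m)) / 3 ^ Suc (k + m))" for m
    by (rule summable_comparison_test'[OF sums_summable[OF geo[of m]], of 0]) (use le in auto)
  have s0: "summable (\<lambda>k. real (d k) / 3 ^ Suc k)"
    using summ[of 0] by simp
  show "0 \<le> t"
    unfolding t_def by (intro suminf_nonneg s0) auto
  have "t \<le> 1 / (2 * 3 ^ 0)"
    unfolding t_def using suminf_le[OF le s0 sums_summable[OF geo[of 0, simplified add_0_right]]]
      sums_unique[OF geo[of 0]] by simp
  then show "t \<le> 1"
    by simp
  define m where "m = (\<Sum>k<Suc n. d k * 3 ^ (n - k))"
  define r where "r = (\<Sum>k. real (d (k + Suc n)) / 3 ^ Suc (k + Suc n))"
  have t: "t = r + (\<Sum>k<Suc n. real (d k) / 3 ^ Suc k)"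
    unfolding t_def r_def by (rule suminf_split_initial_segment[OF s0])
  have "3 ^ Suc n * (\<Sum>k<Suc n. real (d k) / 3 ^ Suc k) = (\<Sum>k<Suc n. real (d k) * 3 ^ (n - k))"
    unfolding sum_distrib_left
  proof (rule sum.cong[OF refl])
    fix k assume "k \<in> {..<Suc n}"
    then have "(3::real) ^ Suc n = 3 ^ (n - k) * 3 ^ Suc k"
      unfolding power_add[symmetric] by simp
    then show "3 ^ Suc n * (real (d k) / 3 ^ Suc k) = real (d k) * 3 ^ (n - k)"
      by simp
  qed
  then have tm: "3 ^ Suc n * t = 3 ^ Suc n * r + real m"
    unfolding t distrib_left m_def by simp
  have "0 \<le> r"
    unfolding r_def by (intro suminf_nonneg summ) auto
  have "r \<le> 1 / (2 * 3 ^ Suc n)"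
    unfolding r_def sums_unique[OF geo[of "Suc n"]]
    by (rule suminf_le[OF le summ sums_summable[OF geo[of "Suc n"]]])
  then have "3 ^ Suc n * r \<le> 1 / 2"
    by (simp add: field_simps)
  then have "\<lfloor>3 ^ Suc n * t\<rfloor> = int m"
    unfolding tm using \<open>0 \<le> r\<close> by (intro floor_unique) auto
  then have "nat \<lfloor>3 ^ Suc n * t\<rfloor> = m"
    by simp
  moreover have "m mod 3 = d n"
  proof -
    have "3 dvd (\<Sum>k<n. d k * 3 ^ (n - k))"
      by (intro dvd_sum dvd_mult) (simp add: dvd_power)
    then have "m mod 3 = d n mod 3"
      unfolding m_def by (auto elim!: dvdE)
    then show ?thesis
      using d[of n] by simp
  qed
  ultimately show "nat \<lfloor>3 ^ Suc n * t\<rfloor> mod 3 = d n"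
    by simp
qed

lemma ex_baire_real_coding:
  obtains j :: "(nat \<Rightarrow> nat) \<Rightarrow> real" and r :: "real \<Rightarrow> nat \<Rightarrow> nat"
  where "j \<in> borel_measurable borel" "r \<in> borel_measurable borel"
    "\<And>y. r (j y) = y" "\<And>y. 0 \<le> j y" "\<And>y. j y \<le> 1"
proof
  \<comment> \<open>The digits are the indicator of the graph of \<open>y\<close> along an
    enumeration of pairs. The value \<open>y i\<close> is then the only \<open>m\<close> whose digit
    at \<open>(i, m)\<close> is one.\<close>
  define d where "d y n = (if y (fst (prod_decode n)) = snd (prod_decode n) then 1 else 0 :: nat)"
    for y :: "nat \<Rightarrow> nat" and n
  have d: "d y n \<le> 1" for y n
    by (simp add: d_def)
  define j where "j y = (\<Sum>n. real (d y n) / 3 ^ Suc n)" for y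
  define r where "r t = (\<lambda>i. LEAST m. nat \<lfloor>3 ^ Suc (prod_encode (i, m)) * t\<rfloor> mod 3 = 1)" for t :: real
  have [measurable]: "(\<lambda>y. real (d y n)) \<in> borel_measurable borel" for n
    unfolding d_def by measurable
  show "j \<in> borel_measurable borel"
    unfolding j_def by measurable
  show "r \<in> borel_measurable borel"
  proof (rule measurable_coordinatewise_then_product)
    fix i
    have "(\<lambda>t. r t i) \<in> borel \<rightarrow>\<^sub>M count_space UNIV"
      unfolding r_def by measurable
    then show "(\<lambda>t. r t i) \<in> borel_measurable borel"
      by (rule measurable_compose) simp
  qed
  show "r (j y) = y" for y
  proof
    fix i
    have "nat \<lfloor>3 ^ Suc (prod_encode (i, m)) * j y\<rfloor> mod 3 = 1 \<longleftrightarrow> y i = m" for m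
      using nat_floor_ternary_mod(1)[where d = "d y" and n = "prod_encode (i, m)", OF d]
      by (simp add: j_def d_def)
    then show "r (j y) i = y i"
      unfolding r_def by (simp add: Least_equality)
  qed
  show "0 \<le> j y" "j y \<le> 1" for y
    using nat_floor_ternary_mod(2,3)[where d = "d y", OF d] by (simp_all add: j_def)
qed

text \<open>This stands in for a Borel isomorphism with a subset of the unit interval. The map
  \<open>h\<close> is fixed, while its inverse \<open>i\<close> depends on the law: the section of a
  continuous surjection is only universally measurable and becomes Borel after a correction on a
  null set.\<close>

lemma ex_real_surjection:
  "\<exists>h :: real \<Rightarrow> 'a::souslin_space. h \<in> borel_measurable borel \<and>
    (\<forall>p. prob_space p \<and> sets p = sets borel \<longrightarrow>
      (\<exists>i. i \<in> borel_measurable p \<and> (\<forall>a. 0 \<le> i a \<and> i a \<le> 1) \<and> (AE a in p. h (i a) = a)))"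
proof -
  obtain c :: "(nat \<Rightarrow> nat) \<Rightarrow> 'a" where c: "continuous_on UNIV c" "c \<in> borel_measurable borel" "range c = UNIV"
    by (rule ex_measurable_surjection)
  obtain s where s: "s \<in> univ_completion borel \<rightarrow>\<^sub>M borel" "\<And>a. a \<in> range c \<Longrightarrow> c (s a) = a"
    by (metis Jankov_von_Neumann[OF c(1)])
  obtain j :: "(nat \<Rightarrow> nat) \<Rightarrow> real" and r where j: "j \<in> borel_measurable borel" "r \<in> borel_measurable borel"
    "\<And>y. r (j y) = y" "\<And>y. 0 \<le> j y" "\<And>y. j y \<le> 1"
    using ex_baire_real_coding by blast
  show ?thesis
  proof (intro exI[of _ "\<lambda>t. c (r t)"] conjI allI impI)
    show "(\<lambda>t. c (r t)) \<in> borel_measurable borel"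
      by (rule measurable_compose[OF j(2) c(2)])
    fix p :: "'a measure" assume "prob_space p \<and> sets p = sets borel"
    then have p: "prob_space p" "sets p = sets borel"
      by auto
    obtain s' where s': "s' \<in> borel_measurable p" "AE a in p. s a = s' a"
      using completion_ex_borel_version[OF univ_completionD[OF s(1) p]] .
    have "AE a in p. c (r (j (s' a))) = a"
      using s'(2)
    proof eventually_elim
      case (elim a)
      have "c (s a) = a"
        using s(2) c(3) by simp
      with elim show ?case
        by (simp add: j(3))
    qed
    then show "\<exists>i. i \<in> borel_measurable p \<and> (\<forall>a. 0 \<le> i a \<and> i a \<le> 1) \<and> (AE a in p. c (r (i a)) = a)"
      using measurable_compose[OF s'(1) j(1)] j(4,5) by (intro exI[of _ "\<lambda>a. j (s' a)"]) auto
  qed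
qed

text \<open>
  A probability measure on the unit interval is coded by the restriction of its distribution
  function to the rationals; \<open>rat_cdf F t = inf {F q | q > t}\<close> restores right continuity.
\<close>

definition cdf_codes :: "(rat \<Rightarrow> real) set" where
  "cdf_codes = {F. (\<forall>q r. q \<le> r \<longrightarrow> F q \<le> F r) \<and> (\<forall>q<0. F q = 0) \<and> (\<forall>q\<ge>1. F q = 1)}"

definition rat_cdf :: "(rat \<Rightarrow> real) \<Rightarrow> real \<Rightarrow> real" where
  "rat_cdf F t = (INF q\<in>{q. t < real_of_rat q}. max 0 (F q))"

text \<open>The Dirac measure for non-codes makes decoding total, with a probability measure for
  every \<open>F\<close>.\<close>

definition decode_cdf :: "(rat \<Rightarrow> real) \<Rightarrow> real measure" where
  "decode_cdf F = (if F \<in> cdf_codes then interval_measure (rat_cdf F) else return borel 0)"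

lemma ex_rat_greater: "\<exists>q. t < real_of_rat q"
  using of_rat_dense[of t "t + 1"] by auto

lemma rat_cdf_lower: "t < real_of_rat q \<Longrightarrow> rat_cdf F t \<le> max 0 (F q)"
  unfolding rat_cdf_def by (intro cINF_lower bdd_belowI2[of _ 0]) auto

lemma rat_cdf_greatest: "(\<And>q. t < real_of_rat q \<Longrightarrow> x \<le> max 0 (F q)) \<Longrightarrow> x \<le> rat_cdf F t"
  unfolding rat_cdf_def using ex_rat_greater by (intro cINF_greatest) auto

lemma cdf_codes_nonneg:
  assumes "F \<in> cdf_codes"
  shows "0 \<le> F q"
proof -
  have "F (min q (-1)) \<le> F q"
    using assms unfolding cdf_codes_def by (metis (mono_tags, lifting) mem_Collect_eq min.cobounded1)
  moreover have "F (min q (-1)) = 0"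
    using assms by (auto simp: cdf_codes_def min_less_iff_disj)
  ultimately show ?thesis
    by simp
qed

lemma rat_cdf_code:
  assumes F: "F \<in> cdf_codes"
  shows "x \<le> y \<Longrightarrow> rat_cdf F x \<le> rat_cdf F y" and "continuous (at_right a) (rat_cdf F)"
    and "(rat_cdf F \<longlongrightarrow> 0) at_bot" and "(rat_cdf F \<longlongrightarrow> 1) at_top"
proof -
  show mono: "rat_cdf F x \<le> rat_cdf F y" if "x \<le> y" for x y
    using that by (intro rat_cdf_greatest rat_cdf_lower) simp
  show "continuous (at_right a) (rat_cdf F)"
  proof (subst continuous_at_right_real_increasing, rule mono, assumption, intro allI impI)
    fix e :: real assume "0 < e"
    then have "\<not> rat_cdf F a + e \<le> rat_cdf F a"
      by simp
    then obtain q where q: "a < real_of_rat q" "max 0 (F q) < rat_cdf F a + e"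
      using rat_cdf_greatest[of a "rat_cdf F a + e" F] by force
    define \<delta> where "\<delta> = (real_of_rat q - a) / 2"
    have "rat_cdf F (a + \<delta>) \<le> max 0 (F q)"
      using q(1) by (intro rat_cdf_lower) (simp add: \<delta>_def field_simps)
    then show "\<exists>\<delta>>0. rat_cdf F (a + \<delta>) - rat_cdf F a < e"
      using q by (intro exI[of _ \<delta>]) (auto simp: \<delta>_def)
  qed
  have "rat_cdf F t = 0" if t: "t < 0" for t
  proof (rule antisym)
    obtain q where q: "t < real_of_rat q" "real_of_rat q < 0"
      using of_rat_dense[OF t] by auto
    have "F q = 0"
      using F q(2) by (simp add: cdf_codes_def)
    then show "rat_cdf F t \<le> 0"
      using rat_cdf_lower[OF q(1), of F] by simp
    show "0 \<le> rat_cdf F t"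
      by (intro rat_cdf_greatest) simp
  qed
  then show "(rat_cdf F \<longlongrightarrow> 0) at_bot"
    by (intro tendsto_eventually) (auto simp: eventually_at_bot_dense)
  have "rat_cdf F t = 1" if t: "1 \<le> t" for t
  proof (rule antisym)
    have 1: "F q = 1" if "t < real_of_rat q" for q
    proof -
      have "real_of_rat 1 < real_of_rat q"
        unfolding of_rat_1 using t that by linarith
      then have "1 \<le> q"
        unfolding of_rat_less by simp
      then show ?thesis
        using F by (simp add: cdf_codes_def)
    qed
    obtain q where "t < real_of_rat q"
      using ex_rat_greater by auto
    then show "rat_cdf F t \<le> 1"
      using rat_cdf_lower[of t q F] 1[of q] by simp
    show "1 \<le> rat_cdf F t"
      using 1 by (intro rat_cdf_greatest) simp
  qed
  then show "(rat_cdf F \<longlongrightarrow> 1) at_top"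
    by (intro tendsto_eventually) (auto simp: eventually_at_top_linorder)
qed

lemma emeasure_decode_cdf:
  "F \<in> cdf_codes \<Longrightarrow> emeasure (decode_cdf F) {..t} = ennreal (rat_cdf F t)"
  using emeasure_interval_measure_Iic[of "rat_cdf F" t] rat_cdf_code[of F] by (simp add: decode_cdf_def)

lemma sets_decode_cdf: "sets (decode_cdf F) = sets borel"
  by (simp add: decode_cdf_def)

lemma prob_space_decode_cdf: "prob_space (decode_cdf F)"
proof (cases "F \<in> cdf_codes")
  case True
  have "real_distribution (interval_measure (rat_cdf F))"
    using rat_cdf_code[OF True] by (intro real_distribution_interval_measure)
  then show ?thesis
    using True by (simp add: decode_cdf_def real_distribution_def)
qed (simp add: decode_cdf_def prob_space_return)

lemma cdf_codes_borel [measurable]: "cdf_codes \<in> sets borel"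
proof -
  have "closed cdf_codes"
    unfolding cdf_codes_def
    by (intro closed_Collect_conj closed_Collect_all closed_Collect_imp open_Collect_const closed_Collect_le
        closed_Collect_eq continuous_on_product_coordinates continuous_on_const)
  then show ?thesis
    by (rule borel_closed)
qed

lemma sets_borel_atMost: "sets (borel :: real measure) = sigma_sets UNIV (range (\<lambda>t. {..t}))"
  unfolding borel_eq_atMost by simp

lemma Int_stable_atMost: "Int_stable (range (\<lambda>t :: real. {..t}))"
proof (rule Int_stableI)
  fix a b :: "real set" assume "a \<in> range (\<lambda>t. {..t})" "b \<in> range (\<lambda>t. {..t})"
  then obtain s t where "a = {..s}" "b = {..t}"
    by auto
  then have "a \<inter> b = {..min s t}"
    by auto
  then show "a \<inter> b \<in> range (\<lambda>t. {..t})"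
    by simp
qed

lemma decode_cdf_measurable [measurable]: "decode_cdf \<in> borel \<rightarrow>\<^sub>M prob_algebra borel"
proof (rule measurable_prob_algebra_generated[OF sets_borel_atMost Int_stable_atMost])
  fix A :: "real set" assume "A \<in> range (\<lambda>t. {..t})"
  then obtain t where A: "A = {..t}" by auto
  \<comment> \<open>The truncation at zero in \<open>rat_cdf\<close> bounds the infimum below for
    every \<open>F\<close>, code or not, so this countable infimum is measurable on the whole
    space.\<close>
  have [measurable]: "(\<lambda>F. rat_cdf F t) \<in> borel_measurable borel"
    unfolding rat_cdf_def by (intro borel_measurable_cINF bdd_belowI2[of _ 0]) auto
  have "(\<lambda>F. if F \<in> cdf_codes then ennreal (rat_cdf F t) else indicator A 0) \<in> borel_measurable borel"
    by measurable
  also have "(\<lambda>F. if F \<in> cdf_codes then ennreal (rat_cdf F t) else indicator A 0) = (\<lambda>F. emeasure (decode_cdf F) A)"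
    using emeasure_decode_cdf[of _ t] by (auto simp: A decode_cdf_def fun_eq_iff)
  finally show "(\<lambda>F. emeasure (decode_cdf F) A) \<in> borel_measurable borel" .
qed (auto simp: prob_space_decode_cdf sets_decode_cdf)

lemma prob_measure_eqI_atMost:
  assumes "prob_space M" "sets M = sets borel" "sets N = sets borel"
    and eq: "\<And>t::real. emeasure M {..t} = emeasure N {..t}"
  shows "M = N"
proof (rule measure_eqI_generator_eq[where E = "range (\<lambda>t::real. {..t})" and \<Omega> = UNIV and A = "\<lambda>i. {..real i}"])
  interpret prob_space M by fact
  show "emeasure M X = emeasure N X" if "X \<in> range (\<lambda>t::real. {..t})" for X
    using that eq by auto
  show "emeasure M {..real i} \<noteq> \<infinity>" for i
    by simp
  show "(\<Union>i. {..real i}) = UNIV"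
    using real_arch_simple by auto
qed (use assms sets_borel_atMost Int_stable_atMost in auto)

lemma decode_cdf_surj:
  assumes p: "prob_space p" "sets p = sets borel" and ae: "AE t in p. 0 \<le> t \<and> t \<le> 1"
  shows "\<exists>F. decode_cdf F = p"
proof -
  interpret real_distribution p
    by (intro real_distribution.intro real_distribution_axioms.intro p)
  define F where "F q = measure p {..real_of_rat q}" for q
  have "F \<in> cdf_codes"
    unfolding cdf_codes_def
  proof (intro CollectI conjI allI impI)
    fix q r :: rat assume "q \<le> r"
    then show "F q \<le> F r"
      unfolding F_def by (intro finite_measure_mono) (auto simp: of_rat_less_eq)
  next
    fix q :: rat assume q: "q < 0"
    have "real_of_rat q < 0"
      using q by simp
    have "AE t in p. \<not> t \<le> real_of_rat q"
      using ae
    proof eventually_elim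
      case (elim t)
      then show ?case
        using \<open>real_of_rat q < 0\<close> by linarith
    qed
    then have "AE t in p. t \<notin> {..real_of_rat q}"
      by simp
    then show "F q = 0"
      unfolding F_def by (subst prob_eq_0) auto
  next
    fix q :: rat assume q: "1 \<le> q"
    have "AE t in p. t \<in> {..real_of_rat q}"
      using ae
    proof eventually_elim
      case (elim t)
      have "1 \<le> real_of_rat q"
        using q by simp
      with elim show ?case
        unfolding atMost_iff by linarith
    qed
    then show "F q = 1"
      unfolding F_def by (subst prob_eq_1) auto
  qed
  moreover have "rat_cdf F t = measure p {..t}" for t
  proof (rule antisym)
    show "measure p {..t} \<le> rat_cdf F t"
      by (intro rat_cdf_greatest max.coboundedI2) (auto simp: F_def intro!: finite_measure_mono)
    show "rat_cdf F t \<le> measure p {..t}"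
    proof (rule field_le_epsilon)
      fix e :: real assume "0 < e"
      moreover have "continuous (at_right t) (cdf p)"
        by (rule cdf_is_right_cont)
      ultimately obtain \<delta> where \<delta>: "\<delta> > 0" "cdf p (t + \<delta>) - cdf p t < e"
        by (subst (asm) continuous_at_right_real_increasing) (auto intro: cdf_nondecreasing)
      obtain q where q: "t < real_of_rat q" "real_of_rat q < t + \<delta>"
        using of_rat_dense[of t "t + \<delta>"] \<delta>(1) by auto
      have "rat_cdf F t \<le> max 0 (F q)"
        using q(1) by (rule rat_cdf_lower)
      also have "\<dots> = cdf p (real_of_rat q)"
        by (simp add: F_def cdf_def)
      also have "\<dots> \<le> cdf p (t + \<delta>)"
        using q(2) by (intro cdf_nondecreasing) simp
      also have "\<dots> \<le> measure p {..t} + e"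
        using \<delta>(2) by (simp add: cdf_def)
      finally show "rat_cdf F t \<le> measure p {..t} + e" .
    qed
  qed
  ultimately have "decode_cdf F = p"
    using p by (intro prob_measure_eqI_atMost) (auto simp: prob_space_decode_cdf sets_decode_cdf emeasure_decode_cdf emeasure_eq_measure)
  then show ?thesis
    by blast
qed

text \<open>A law is moved to the unit interval by its almost sure inverse, coded there by a
  distribution function, and pushed back by \<open>h\<close>. Quantifiers over laws thereby become
  projections along the Baire space.\<close>

theorem ex_prob_coding:
  obtains c :: "(nat \<Rightarrow> nat) \<Rightarrow> 'a::souslin_space measure"
  where "c \<in> borel \<rightarrow>\<^sub>M prob_algebra borel"
    and "\<And>p. prob_space p \<Longrightarrow> sets p = sets borel \<Longrightarrow> p \<in> range c"
proof -
  obtain e :: "(nat \<Rightarrow> nat) \<Rightarrow> rat \<Rightarrow> real" where e: "e \<in> borel_measurable borel" "range e = UNIV"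
    using ex_measurable_surjection by metis
  obtain h :: "real \<Rightarrow> 'a" where h: "h \<in> borel_measurable borel"
    and i: "\<forall>p. prob_space p \<and> sets p = sets borel \<longrightarrow>
      (\<exists>i. i \<in> borel_measurable p \<and> (\<forall>a. 0 \<le> i a \<and> i a \<le> 1) \<and> (AE a in p. h (i a) = a))"
    using ex_real_surjection by (elim exE conjE)
  show ?thesis
  proof
    show "(\<lambda>y. distr (decode_cdf (e y)) borel h) \<in> borel \<rightarrow>\<^sub>M prob_algebra borel"
      by (rule measurable_compose[OF measurable_compose[OF e(1) decode_cdf_measurable] measurable_distr_prob_space[OF h]])
    fix p :: "'a measure" assume p: "prob_space p" "sets p = sets borel"
    obtain i where i: "i \<in> borel_measurable p" "\<And>a. 0 \<le> i a \<and> i a \<le> 1" "AE a in p. h (i a) = a"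
      using i p by blast
    have "prob_space (distr p borel i)"
      using i(1) by (rule prob_space.prob_space_distr[OF p(1)])
    moreover have "AE t in distr p borel i. 0 \<le> t \<and> t \<le> 1"
      using i(1,2) by (subst AE_distr_iff) auto
    ultimately obtain F where F: "decode_cdf F = distr p borel i"
      using decode_cdf_surj[of "distr p borel i"] by auto
    obtain y where y: "e y = F"
      using e(2) by (metis UNIV_I imageE)
    have "distr (distr p borel i) borel h = distr p borel (\<lambda>a. h (i a))"
      using h i(1) by (simp add: distr_distr o_def)
    also have "\<dots> = distr p borel (\<lambda>a. a)"
      by (rule distr_cong_AE[OF refl refl i(3) measurable_compose[OF i(1) h] measurable_ident_sets[OF p(2)]])
    also have "\<dots> = p"
      using p(2)[symmetric] by (rule distr_id2)
    finally show "p \<in> range (\<lambda>y. distr (decode_cdf (e y)) borel h)"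
      using F y by (intro image_eqI[of _ _ y]) auto
  qed
qed

section \<open>Disintegration\<close>

text \<open>
  For a law on \<open>Z \<times> [0, 1]\<close> the Radon--Nikodym derivatives of \<open>A \<mapsto> P (A \<times> (-\<infinity>, q])\<close> form, for almost
  every \<open>z\<close>, the code of a distribution function.
\<close>

lemma sets_borel_rat_atMost: "sets (borel :: real measure) = sigma_sets UNIV (range (\<lambda>q. {..real_of_rat q}))"
proof
  have "{..t} \<in> sigma_sets UNIV (range (\<lambda>q. {..real_of_rat q}))" for t :: real
  proof -
    have "{..t} = (\<Inter>q\<in>{q. t < real_of_rat q}. {..real_of_rat q})"
    proof safe
      fix s assume s: "s \<in> (\<Inter>q\<in>{q. t < real_of_rat q}. {..real_of_rat q})"
      show "s \<le> t"
      proof (rule ccontr)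
        assume "\<not> s \<le> t"
        then obtain q where "t < real_of_rat q" "real_of_rat q < s"
          using of_rat_dense[of t s] by auto
        with s show False by force
      qed
    qed auto
    moreover have "(\<Inter>q\<in>{q. t < real_of_rat q}. {..real_of_rat q}) \<in>
        sigma_sets UNIV (range (\<lambda>q. {..real_of_rat q}))"
    proof -
      interpret sigma_algebra UNIV "sigma_sets UNIV (range (\<lambda>q. {..real_of_rat q}))"
        by (rule sigma_algebra_sigma_sets) simp
      show ?thesis
        using ex_rat_greater by (intro countable_INT'') auto
    qed
    ultimately show ?thesis
      by simp
  qed
  then show "sets (borel :: real measure) \<subseteq> sigma_sets UNIV (range (\<lambda>q. {..real_of_rat q}))"
    unfolding sets_borel_atMost by (intro sigma_sets_mono) auto
  show "sigma_sets UNIV (range (\<lambda>q. {..real_of_rat q})) \<subseteq> sets borel"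
    using sets.sigma_sets_subset[of "range (\<lambda>q. {..real_of_rat q})" borel] by (simp add: image_subset_iff)
qed

lemma Int_stable_rat_atMost: "Int_stable (range (\<lambda>q. {..real_of_rat q}))"
proof (rule Int_stableI)
  fix a b :: "real set" assume "a \<in> range (\<lambda>q. {..real_of_rat q})" "b \<in> range (\<lambda>q. {..real_of_rat q})"
  then obtain q r where "a = {..real_of_rat q}" "b = {..real_of_rat r}"
    by auto
  then have "a \<inter> b = {..real_of_rat (min q r)}"
    by (auto simp: min_def of_rat_less_eq)
  then show "a \<inter> b \<in> range (\<lambda>q. {..real_of_rat q})"
    by blast
qed

text \<open>A Dynkin argument in the second factor with \<open>A\<close> fixed; \<open>top\<close>
  supplies the step to complements.\<close>

lemma kernel_rectangle_measure:
  assumes M: "prob_space M" and \<kappa>: "\<kappa> \<in> M \<rightarrow>\<^sub>M prob_algebra N" and A: "A \<in> sets M"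
    and P: "prob_space P" "sets P = sets (M \<Otimes>\<^sub>M N)"
    and G: "Int_stable G" "sets N = sigma_sets (space N) G" "G \<subseteq> Pow (space N)"
    and eq: "\<And>B. B \<in> G \<Longrightarrow> emeasure P (A \<times> B) = (\<integral>\<^sup>+x\<in>A. emeasure (\<kappa> x) B \<partial>M)"
    and top: "emeasure P (A \<times> space N) = emeasure M A"
    and B: "B \<in> sets N"
  shows "emeasure P (A \<times> B) = (\<integral>\<^sup>+x\<in>A. emeasure (\<kappa> x) B \<partial>M)"
proof -
  let ?S = "semidirect M N \<kappa>"
  interpret P: prob_space P by fact
  interpret S: prob_space ?S
    by (rule prob_space_semidirect[OF M \<kappa>])
  have meas: "A \<times> B \<in> sets P" "A \<times> B \<in> sets ?S" if "B \<in> sets N" for B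
    using A that by (auto simp: P(2) sets_semidirect[OF M \<kappa>])
  have top': "emeasure ?S (A \<times> space N) = emeasure M A"
  proof -
    have "emeasure ?S (A \<times> space N) = (\<integral>\<^sup>+x\<in>A. emeasure (\<kappa> x) (space N) \<partial>M)"
      by (rule emeasure_semidirect[OF M \<kappa> A sets.top])
    also have "\<dots> = (\<integral>\<^sup>+x. indicator A x \<partial>M)"
      by (intro nn_integral_cong) (simp add: in_space_prob_algebra[OF measurable_space[OF \<kappa>]])
    finally show ?thesis
      using A by simp
  qed
  have "B \<in> sigma_sets (space N) G"
    using B G(2) by simp
  from G(1,3) this have "emeasure P (A \<times> B) = emeasure ?S (A \<times> B)"
  proof (induction rule: sigma_sets_induct_disjoint)
    case (basic B)
    then have "B \<in> sets N"
      using G(2) by (auto intro: sigma_sets.Basic)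
    then show ?case
      using eq[OF basic] by (simp add: emeasure_semidirect[OF M \<kappa> A])
  next
    case empty
    show ?case by simp
  next
    case (compl B)
    then have B: "B \<in> sets N"
      using G(2) by simp
    have *: "A \<times> (space N - B) = A \<times> space N - A \<times> B"
      by auto
    have sub: "A \<times> B \<subseteq> A \<times> space N"
      using sets.sets_into_space[OF B] by auto
    show ?case
      unfolding * using compl.IH top top' sub meas[OF B] meas[OF sets.top]
      by (simp add: emeasure_Diff)
  next
    case (union B)
    have "range B \<subseteq> sets N"
      using union.hyps G(2) by auto
    then have r: "range (\<lambda>i. A \<times> B i) \<subseteq> sets P" "range (\<lambda>i. A \<times> B i) \<subseteq> sets ?S"
      using meas by auto
    have d: "disjoint_family (\<lambda>i. A \<times> B i)"
      using union.hyps by (auto simp: disjoint_family_on_def)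
    have "A \<times> (\<Union>i. B i) = (\<Union>i. A \<times> B i)"
      by auto
    then show ?case
      using suminf_emeasure[OF r(1) d] suminf_emeasure[OF r(2) d] union.IH by simp
  qed
  then show ?thesis
    by (simp add: emeasure_semidirect[OF M \<kappa> A B])
qed

lemma disintegration_unit_interval:
  fixes P :: "('z \<times> real) measure"
  assumes P: "prob_space P" "sets P = sets (M \<Otimes>\<^sub>M borel)" and ae: "AE z in P. 0 \<le> snd z \<and> snd z \<le> 1"
  shows "\<exists>\<kappa>. \<kappa> \<in> distr P M fst \<rightarrow>\<^sub>M prob_algebra borel \<and> P = semidirect (distr P M fst) borel \<kappa>"
proof -
  interpret P: prob_space P by fact
  define \<nu> where "\<nu> = distr P M fst"
  have fst [measurable]: "fst \<in> P \<rightarrow>\<^sub>M M"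
    using measurable_fst by (simp cong: measurable_cong_sets add: P(2))
  have snd [measurable]: "snd \<in> borel_measurable P"
    using measurable_snd by (simp cong: measurable_cong_sets add: P(2))
  have sp: "space P = space M \<times> UNIV"
    using sets_eq_imp_space_eq[OF P(2)] by (simp add: space_pair_measure)
  have \<nu>: "prob_space \<nu>" "sets \<nu> = sets M" "space \<nu> = space M"
    by (auto simp: \<nu>_def intro!: P.prob_space_distr)
  interpret \<nu>: prob_space \<nu> by fact
  have em\<nu>: "emeasure \<nu> A = emeasure P (A \<times> UNIV)" if "A \<in> sets M" for A
  proof -
    have "fst -` A \<inter> space P = A \<times> UNIV"
      using sets.sets_into_space[OF that] sp by auto
    then show ?thesis
      using that by (simp add: \<nu>_def emeasure_distr)
  qed
  \<comment> \<open>\<open>\<rho> B\<close> is the measure that assigns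
    \<open>P (A \<times> B)\<close> to \<open>A\<close>. It is dominated by the first marginal, and
    its density is a version of the conditional probability of \<open>B\<close>.\<close>
  define \<rho> where "\<rho> B = distr (density P (indicator (snd -` B \<inter> space P))) \<nu> fst" for B :: "real set"
  have sets\<rho>: "sets (\<rho> B) = sets \<nu>" for B
    by (simp add: \<rho>_def)
  have em\<rho>: "emeasure (\<rho> B) A = emeasure P (A \<times> B)" if A: "A \<in> sets M" and B: "B \<in> sets borel" for A B
  proof -
    have A': "fst -` A \<inter> space P \<in> sets P" and B': "snd -` B \<inter> space P \<in> sets P"
      by (rule measurable_sets[OF fst A], rule measurable_sets[OF snd B])
    have "fst \<in> density P (indicator (snd -` B \<inter> space P)) \<rightarrow>\<^sub>M \<nu>"
      using fst by (simp cong: measurable_cong_sets add: \<nu>(2))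
    then have "emeasure (\<rho> B) A = emeasure (density P (indicator (snd -` B \<inter> space P))) (fst -` A \<inter> space P)"
      using A by (simp add: \<rho>_def emeasure_distr \<nu>(2))
    also have "\<dots> = (\<integral>\<^sup>+z. indicator (snd -` B \<inter> space P) z * indicator (fst -` A \<inter> space P) z \<partial>P)"
      using A' B' by (intro emeasure_density) auto
    also have "\<dots> = (\<integral>\<^sup>+z. indicator (A \<times> B) z \<partial>P)"
      using sets.sets_into_space[OF A] by (intro nn_integral_cong) (auto split: split_indicator simp: sp)
    also have "\<dots> = emeasure P (A \<times> B)"
      using A B by (intro nn_integral_indicator) (simp add: P(2))
    finally show ?thesis .
  qed
  have ac: "absolutely_continuous \<nu> (\<rho> B)" if B: "B \<in> sets borel" for B
    unfolding absolutely_continuous_def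
  proof
    fix A assume "A \<in> null_sets \<nu>"
    then have A: "A \<in> sets M" "emeasure P (A \<times> UNIV) = 0"
      using em\<nu> by (auto simp: null_sets_def \<nu>(2))
    have "emeasure P (A \<times> B) \<le> emeasure P (A \<times> UNIV)"
      using A(1) by (intro emeasure_mono) (auto simp: P(2))
    then have "emeasure (\<rho> B) A = 0"
      using A B by (simp add: em\<rho>)
    with A show "A \<in> null_sets (\<rho> B)"
      by (simp add: null_sets_def sets\<rho> \<nu>(2))
  qed
  define g where "g B = RN_deriv \<nu> (\<rho> B)" for B
  have [measurable]: "g B \<in> borel_measurable \<nu>" for B
    unfolding g_def by simp
  have dens: "density \<nu> (g B) = \<rho> B" if "B \<in> sets borel" for B
    unfolding g_def by (rule \<nu>.density_RN_deriv[OF ac[OF that] sets\<rho>])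
  define f where "f q = g {..real_of_rat q}" for q
  have f [measurable]: "f q \<in> borel_measurable \<nu>" for q
    unfolding f_def by measurable
  have fint: "(\<integral>\<^sup>+x\<in>A. f q x \<partial>\<nu>) = emeasure P (A \<times> {..real_of_rat q})" if A: "A \<in> sets M" for A q
  proof -
    have "(\<integral>\<^sup>+x\<in>A. f q x \<partial>\<nu>) = emeasure (density \<nu> (f q)) A"
      using A f by (intro emeasure_density[symmetric]) (simp_all add: \<nu>(2))
    also have "\<dots> = emeasure P (A \<times> {..real_of_rat q})"
      unfolding f_def using A by (simp add: dens em\<rho>)
    finally show ?thesis .
  qed
  \<comment> \<open>The half-line up to \<open>r\<close> is the half-line up to \<open>q\<close> and
    an interval. Uniqueness of densities makes the derivative for \<open>r\<close> the sum of the
    two others, hence the larger one.\<close>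
  have mono: "AE x in \<nu>. f q x \<le> f r x" if "q \<le> r" for q r
  proof -
    let ?I = "{real_of_rat q<..real_of_rat r}"
    have "density \<nu> (\<lambda>x. f q x + g ?I x) = \<rho> {..real_of_rat r}"
    proof (rule measure_eqI)
      fix A assume "A \<in> sets (density \<nu> (\<lambda>x. f q x + g ?I x))"
      then have A [measurable]: "A \<in> sets \<nu>" and A': "A \<in> sets M"
        by (auto simp: \<nu>(2))
      have "emeasure (density \<nu> (\<lambda>x. f q x + g ?I x)) A = emeasure (density \<nu> (f q)) A + emeasure (density \<nu> (g ?I)) A"
        by (simp add: emeasure_density distrib_right nn_integral_add)
      also have "\<dots> = emeasure P (A \<times> {..real_of_rat q}) + emeasure P (A \<times> ?I)"
        using A' by (simp add: f_def dens em\<rho>)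
      also have "\<dots> = emeasure P (A \<times> {..real_of_rat q} \<union> A \<times> ?I)"
        using A' by (intro plus_emeasure) (auto simp: P(2))
      also have "A \<times> {..real_of_rat q} \<union> A \<times> ?I = A \<times> ({..real_of_rat q} \<union> ?I)"
        by auto
      also have "{..real_of_rat q} \<union> ?I = {..real_of_rat r}"
        using that by (intro ivl_disj_un) (simp add: of_rat_less_eq)
      also have "emeasure P (A \<times> {..real_of_rat r}) = emeasure (\<rho> {..real_of_rat r}) A"
        using A' by (simp add: em\<rho>)
      finally show "emeasure (density \<nu> (\<lambda>x. f q x + g ?I x)) A = emeasure (\<rho> {..real_of_rat r}) A" .
    qed (simp add: sets\<rho>)
    then have "AE x in \<nu>. f q x + g ?I x = f r x"
      unfolding f_def[of r] g_def[of "{..real_of_rat r}"] by (intro \<nu>.RN_deriv_unique) auto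
    then show ?thesis
      by eventually_elim (metis le_iff_add)
  qed
  have zero: "AE x in \<nu>. f q x = 0" if "q < 0" for q
  proof -
    have "real_of_rat q < 0"
      using that by simp
    have "AE z in P. z \<notin> space M \<times> {..real_of_rat q}"
      using ae
    proof eventually_elim
      case (elim z)
      then show ?case
        using \<open>real_of_rat q < 0\<close> by (cases z) (simp del: of_rat_less_0_iff)
    qed
    then have "space M \<times> {..real_of_rat q} \<in> null_sets P"
      by (intro AE_iff_null_sets[THEN iffD2]) (simp_all add: P(2))
    then have "emeasure P (space M \<times> {..real_of_rat q}) = 0"
      by (simp add: null_sets_def)
    then have "(\<integral>\<^sup>+x. f q x \<partial>\<nu>) = 0"
      using fint[OF sets.top, of q] \<nu>(3) by (simp cong: nn_integral_cong_simp)
    then show ?thesis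
      by (subst (asm) nn_integral_0_iff_AE) auto
  qed
  have one: "AE x in \<nu>. f q x = 1" if "1 \<le> q" for q
  proof -
    have q: "1 \<le> real_of_rat q"
      using that by simp
    have "density \<nu> (\<lambda>_. 1) = \<rho> {..real_of_rat q}"
    proof (rule measure_eqI)
      fix A assume "A \<in> sets (density \<nu> (\<lambda>_. 1))"
      then have A: "A \<in> sets M"
        by (simp add: \<nu>(2))
      have "AE z in P. z \<in> A \<times> {..real_of_rat q} \<longleftrightarrow> z \<in> A \<times> UNIV"
        using ae
      proof eventually_elim
        case (elim z)
        then have "snd z \<le> real_of_rat q"
          using q by linarith
        then show ?case
          by (simp add: mem_Times_iff)
      qed
      then have "emeasure P (A \<times> {..real_of_rat q}) = emeasure P (A \<times> UNIV)"
        using A by (intro emeasure_eq_AE) (auto simp: P(2))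
      then show "emeasure (density \<nu> (\<lambda>_. 1)) A = emeasure (\<rho> {..real_of_rat q}) A"
        using A by (simp add: em\<rho> em\<nu> density_1)
    qed (simp add: sets\<rho>)
    then have "AE x in \<nu>. 1 = f q x"
      unfolding f_def g_def by (intro \<nu>.RN_deriv_unique) auto
    then show ?thesis
      by eventually_elim simp
  qed
  define F where "F x = (\<lambda>q. enn2real (f q x))" for x
  have F [measurable]: "F \<in> borel_measurable \<nu>"
    unfolding F_def by (intro measurable_coordinatewise_then_product) measurable
  \<comment> \<open>The indices are rational, so all the conditions on a code hold simultaneously
    off one null set.\<close>
  have "AE x in \<nu>. \<forall>q r. q \<le> r \<longrightarrow> f q x \<le> f r x"
    using mono by (simp add: AE_all_countable)
  moreover have "AE x in \<nu>. \<forall>q<0. f q x = 0"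
    using zero by (simp add: AE_all_countable)
  moreover have "AE x in \<nu>. \<forall>q\<ge>1. f q x = 1"
    using one by (simp add: AE_all_countable)
  ultimately have F_code: "AE x in \<nu>. F x \<in> cdf_codes \<and> (\<forall>q. f q x = ennreal (F x q))"
  proof eventually_elim
    case (elim x)
    have le1: "f q x \<le> 1" for q
    proof -
      have "f q x \<le> f (max q 1) x"
        using elim(1) by simp
      also have "\<dots> = 1"
        using elim(3) by simp
      finally show ?thesis .
    qed
    have fin: "f q x < top" for q
      using le1[of q] by (rule le_less_trans) simp
    show ?case
      using elim fin unfolding F_def cdf_codes_def by (auto intro: enn2real_mono)
  qed
  define \<kappa> where "\<kappa> x = decode_cdf (F x)" for x
  have \<kappa>: "\<kappa> \<in> \<nu> \<rightarrow>\<^sub>M prob_algebra borel"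
    unfolding \<kappa>_def by measurable
  have \<kappa>s: "\<kappa> \<in> \<nu> \<rightarrow>\<^sub>M subprob_algebra borel"
    by (rule measurable_prob_algebraD[OF \<kappa>])
  have PM: "sets P = sets (\<nu> \<Otimes>\<^sub>M borel)"
    unfolding P(2) by (intro sets_pair_measure_cong) (simp_all add: \<nu>(2))
  have [measurable]: "(\<lambda>x. emeasure (\<kappa> x) {..t}) \<in> borel_measurable \<nu>" for t
    by (rule measurable_emeasure_kernel[OF \<kappa>s]) simp
  \<comment> \<open>Taking the infimum from the right gives
    \<open>F x q \<le> rat_cdf (F x) (real_of_rat q) \<le> F x r\<close> for \<open>q < r\<close>.
    After integration over \<open>A\<close>, letting \<open>r\<close> decrease to \<open>q\<close>
    closes the gap by continuity of \<open>P\<close> from above.\<close>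
  have key: "emeasure P (A \<times> {..real_of_rat q}) = (\<integral>\<^sup>+x\<in>A. emeasure (\<kappa> x) {..real_of_rat q} \<partial>\<nu>)"
    if A: "A \<in> sets \<nu>" for A q
  proof -
    have A' [measurable]: "A \<in> sets M"
      using A \<nu>(2) by simp
    have lower: "(\<integral>\<^sup>+x\<in>A. emeasure (\<kappa> x) {..real_of_rat q} \<partial>\<nu>) \<ge> emeasure P (A \<times> {..real_of_rat q})"
      unfolding fint[OF A', symmetric]
    proof (rule nn_integral_mono_AE)
      show "AE x in \<nu>. f q x * indicator A x \<le> emeasure (\<kappa> x) {..real_of_rat q} * indicator A x"
        using F_code
      proof eventually_elim
        case (elim x)
        have "F x q \<le> rat_cdf (F x) (real_of_rat q)"
        proof (intro rat_cdf_greatest max.coboundedI2)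
          fix r assume "real_of_rat q < real_of_rat r"
          then have "q \<le> r"
            by (simp add: of_rat_less)
          then show "F x q \<le> F x r"
            using elim by (simp add: cdf_codes_def)
        qed
        then show ?case
          using elim by (auto simp: \<kappa>_def emeasure_decode_cdf intro!: mult_right_mono ennreal_leI)
      qed
    qed
    have upper: "(\<integral>\<^sup>+x\<in>A. emeasure (\<kappa> x) {..real_of_rat q} \<partial>\<nu>) \<le> emeasure P (A \<times> {..real_of_rat r})"
      if q: "q < r" for r
      unfolding fint[OF A', symmetric]
    proof (rule nn_integral_mono_AE)
      show "AE x in \<nu>. emeasure (\<kappa> x) {..real_of_rat q} * indicator A x \<le> f r x * indicator A x"
        using F_code
      proof eventually_elim
        case (elim x)
        have "rat_cdf (F x) (real_of_rat q) \<le> F x r"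
          using rat_cdf_lower[of "real_of_rat q" r "F x"] cdf_codes_nonneg[of "F x" r] elim q
          by (simp add: of_rat_less)
        then show ?case
          using elim by (auto simp: \<kappa>_def emeasure_decode_cdf intro!: mult_right_mono ennreal_leI)
      qed
    qed
    define r where "r n = q + 1 / rat_of_nat (Suc n)" for n
    have r: "q < r n" "real_of_rat (r n) = real_of_rat q + 1 / real (Suc n)" for n
      by (simp_all add: r_def of_rat_add of_rat_divide)
    have "(\<Inter>n. A \<times> {..real_of_rat (r n)}) = A \<times> {..real_of_rat q}"
    proof (intro equalityI subsetI)
      fix z assume z: "z \<in> (\<Inter>n. A \<times> {..real_of_rat (r n)})"
      then have "snd z \<le> real_of_rat q + 1 / real (Suc n)" for n
        unfolding r(2)[symmetric] by (auto simp: mem_Times_iff)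
      moreover have "(\<lambda>n. real_of_rat q + 1 / real (Suc n)) \<longlonglongrightarrow> real_of_rat q + 0"
        by (intro tendsto_add tendsto_const lim_1_over_n[THEN LIMSEQ_Suc])
      ultimately have "snd z \<le> real_of_rat q + 0"
        by (intro LIMSEQ_le_const[of _ "real_of_rat q + 0"]) auto
      then show "z \<in> A \<times> {..real_of_rat q}"
        using z by (auto simp: mem_Times_iff)
    next
      fix z assume z: "z \<in> A \<times> {..real_of_rat q}"
      have "snd z \<le> real_of_rat (r n)" for n
      proof -
        have "real_of_rat q \<le> real_of_rat (r n)"
          using r(1)[of n] by (simp add: of_rat_less_eq)
        then show ?thesis
          using z by (auto simp: mem_Times_iff)
      qed
      then show "z \<in> (\<Inter>n. A \<times> {..real_of_rat (r n)})"
        using z by (auto simp: mem_Times_iff)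
    qed
    moreover have "decseq (\<lambda>n. A \<times> {..real_of_rat (r n)})"
      by (intro decseq_SucI Sigma_mono) (auto simp: r(2) field_simps intro: order_trans)
    moreover have "range (\<lambda>n. A \<times> {..real_of_rat (r n)}) \<subseteq> sets P"
      using A' by (auto simp: P(2))
    ultimately have "emeasure P (A \<times> {..real_of_rat q}) = (INF n. emeasure P (A \<times> {..real_of_rat (r n)}))"
      using INF_emeasure_decseq[of "\<lambda>n. A \<times> {..real_of_rat (r n)}" P] by simp
    moreover have "(\<integral>\<^sup>+x\<in>A. emeasure (\<kappa> x) {..real_of_rat q} \<partial>\<nu>) \<le> (INF n. emeasure P (A \<times> {..real_of_rat (r n)}))"
      by (intro INF_greatest upper r)
    ultimately show ?thesis
      using lower by (intro antisym) simp_all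
  qed
  have "P = semidirect \<nu> borel \<kappa>"
  proof (rule semidirect_eqI[OF \<nu>(1) \<kappa> PM])
    fix A :: "'z set" and B :: "real set" assume A: "A \<in> sets \<nu>" and B: "B \<in> sets borel"
    show "emeasure P (A \<times> B) = (\<integral>\<^sup>+x\<in>A. emeasure (\<kappa> x) B \<partial>\<nu>)"
    proof (rule kernel_rectangle_measure[OF \<nu>(1) \<kappa> A P(1) PM Int_stable_rat_atMost _ _ _ _ B])
      show "sets borel = sigma_sets (space borel) (range (\<lambda>q. {..real_of_rat q}))"
        using sets_borel_rat_atMost by simp
      show "emeasure P (A \<times> space borel) = emeasure \<nu> A"
        using em\<nu> A \<nu>(2) by simp
    qed (use key[OF A] in auto)
  qed
  with \<kappa> show ?thesis
    unfolding \<nu>_def by blast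
qed

text \<open>The second coordinate is carried into the unit interval by \<open>i\<close>,
  disintegrated there, and the kernel is carried back by \<open>h\<close>. Since \<open>h\<close>
  undoes \<open>i\<close> almost surely under the second marginal, rectangles keep their
  measure.\<close>

theorem disintegration:
  fixes P :: "('z \<times> 'a::souslin_space) measure"
  assumes P: "prob_space P" "sets P = sets (M \<Otimes>\<^sub>M borel)"
  obtains \<kappa> where "\<kappa> \<in> M \<rightarrow>\<^sub>M prob_algebra borel" "P = semidirect (distr P M fst) borel \<kappa>"
proof -
  interpret P: prob_space P by fact
  have fst: "fst \<in> P \<rightarrow>\<^sub>M M"
    using measurable_fst by (simp cong: measurable_cong_sets add: P(2))
  have snd: "snd \<in> borel_measurable P"
    using measurable_snd by (simp cong: measurable_cong_sets add: P(2))
  obtain h :: "real \<Rightarrow> 'a" where h: "h \<in> borel_measurable borel"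
    and i: "\<forall>p. prob_space p \<and> sets p = sets borel \<longrightarrow>
      (\<exists>i. i \<in> borel_measurable p \<and> (\<forall>a. 0 \<le> i a \<and> i a \<le> 1) \<and> (AE a in p. h (i a) = a))"
    using ex_real_surjection by (elim exE conjE)
  obtain i where i: "i \<in> borel_measurable (distr P borel snd)" "\<And>a. 0 \<le> i a \<and> i a \<le> 1"
    "AE a in distr P borel snd. h (i a) = a"
    using i P.prob_space_distr[OF snd] sets_distr[of P borel snd] by blast
  have i': "i \<in> borel_measurable borel"
    using i(1) by simp
  have isnd: "(\<lambda>z. i (snd z)) \<in> borel_measurable P"
    by (rule measurable_compose[OF snd i'])
  have hi: "AE z in P. h (i (snd z)) = snd z"
    using AE_distrD[OF snd i(3)] .
  define Q where "Q = distr P (M \<Otimes>\<^sub>M borel) (\<lambda>z. (fst z, i (snd z)))"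
  have pair: "(\<lambda>z. (fst z, i (snd z))) \<in> P \<rightarrow>\<^sub>M M \<Otimes>\<^sub>M borel"
    by (rule measurable_Pair[OF fst isnd])
  have Q: "prob_space Q" "sets Q = sets (M \<Otimes>\<^sub>M borel)"
    by (simp_all add: Q_def P.prob_space_distr[OF pair])
  have "AE z in Q. 0 \<le> snd z \<and> snd z \<le> 1"
    unfolding Q_def using pair i(2) by (subst AE_distr_iff) auto
  from disintegration_unit_interval[OF Q this]
  obtain \<kappa> where \<kappa>: "\<kappa> \<in> distr Q M fst \<rightarrow>\<^sub>M prob_algebra borel" "Q = semidirect (distr Q M fst) borel \<kappa>"
    by (elim exE conjE)
  have Qfst: "distr Q M fst = distr P M fst"
    unfolding Q_def using distr_distr[OF measurable_fst pair] by (simp add: o_def)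
  note \<kappa> = \<kappa>[unfolded Qfst]
  have \<nu>: "prob_space (distr P M fst)"
    by (rule P.prob_space_distr[OF fst])
  have \<kappa>M: "\<kappa> \<in> M \<rightarrow>\<^sub>M prob_algebra borel"
    using \<kappa>(1) by simp
  have \<kappa>h: "(\<lambda>x. distr (\<kappa> x) borel h) \<in> M \<rightarrow>\<^sub>M prob_algebra borel"
    by (rule measurable_compose[OF \<kappa>M measurable_distr_prob_space[OF h]])
  show ?thesis
  proof (rule that[OF \<kappa>h], rule semidirect_eqI[OF \<nu>])
    show "(\<lambda>x. distr (\<kappa> x) borel h) \<in> distr P M fst \<rightarrow>\<^sub>M prob_algebra borel"
      using \<kappa>h by simp
    show "sets P = sets (distr P M fst \<Otimes>\<^sub>M borel)"
      unfolding P(2) by (intro sets_pair_measure_cong) simp_all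
    fix A and B :: "'a set" assume A: "A \<in> sets (distr P M fst)" and B: "B \<in> sets borel"
    have A': "A \<in> sets M"
      using A by simp
    have hB: "h -` B \<in> sets borel"
      using measurable_sets[OF h B] by simp
    have "emeasure P (A \<times> B) = emeasure P ((\<lambda>z. (fst z, i (snd z))) -` (A \<times> h -` B) \<inter> space P)"
    proof (rule emeasure_eq_AE)
      show "AE z in P. z \<in> A \<times> B \<longleftrightarrow> z \<in> (\<lambda>z. (fst z, i (snd z))) -` (A \<times> h -` B) \<inter> space P"
        using hi by (rule AE_mp) (auto intro!: AE_I2)
      show "A \<times> B \<in> sets P"
        using A' B by (simp add: P(2))
      show "(\<lambda>z. (fst z, i (snd z))) -` (A \<times> h -` B) \<inter> space P \<in> sets P"
        using A' hB by (intro measurable_sets[OF pair]) simp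
    qed
    also have "\<dots> = emeasure Q (A \<times> h -` B)"
      unfolding Q_def using A' hB by (intro emeasure_distr[OF pair, symmetric]) simp
    also have "\<dots> = (\<integral>\<^sup>+x\<in>A. emeasure (\<kappa> x) (h -` B) \<partial>distr P M fst)"
      unfolding \<kappa>(2) by (rule emeasure_semidirect[OF \<nu> \<kappa>(1) A hB])
    also have "\<dots> = (\<integral>\<^sup>+x\<in>A. emeasure (distr (\<kappa> x) borel h) B \<partial>distr P M fst)"
    proof (rule nn_integral_cong)
      fix x assume "x \<in> space (distr P M fst)"
      then have s: "sets (\<kappa> x) = sets borel"
        using measurable_space[OF \<kappa>(1)] by (auto simp: space_prob_algebra)
      have "h \<in> \<kappa> x \<rightarrow>\<^sub>M borel"
        using h by (simp only: measurable_cong_sets[OF s refl])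
      from emeasure_distr[OF this B]
      have "emeasure (distr (\<kappa> x) borel h) B = emeasure (\<kappa> x) (h -` B)"
        using sets_eq_imp_space_eq[OF s] by simp
      then show "emeasure (\<kappa> x) (h -` B) * indicator A x = emeasure (distr (\<kappa> x) borel h) B * indicator A x"
        by simp
    qed
    finally show "emeasure P (A \<times> B) = (\<integral>\<^sup>+x\<in>A. emeasure (distr (\<kappa> x) borel h) B \<partial>distr P M fst)" .
  qed
qed

section \<open>Strategic measures\<close>

lemma sets_path_space: "sets (path_space :: ('x::borel_space, 'u::borel_space) path measure) = sets borel"
  unfolding path_space_def by (rule sets_PiM_equal_borel)

lemma measurable_fst_borel [measurable]:
  "fst \<in> borel_measurable (borel :: ('a::second_countable_topology \<times> 'b::second_countable_topology) measure)"
  unfolding borel_prod[symmetric] by simp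

lemma measurable_snd_borel [measurable]:
  "snd \<in> borel_measurable (borel :: ('a::second_countable_topology \<times> 'b::second_countable_topology) measure)"
  unfolding borel_prod[symmetric] by simp

text \<open>
  \<open>freeze n \<omega>\<close> generates the \<open>\<sigma>\<close>-algebra of the first \<open>n + 1\<close> coordinates and takes values in the
  path space itself, which avoids a change of type with \<open>n\<close>.
\<close>

definition freeze :: "nat \<Rightarrow> (nat \<Rightarrow> 'a) \<Rightarrow> nat \<Rightarrow> 'a" where
  "freeze n \<omega> = (\<lambda>i. \<omega> (min i n))"

lemma measurable_freeze [measurable]:
  "freeze n \<in> borel_measurable (borel :: (nat \<Rightarrow> 'a::second_countable_topology) measure)"
  unfolding freeze_def by (intro measurable_coordinatewise_then_product measurable_product_coordinates)

lemma freeze_last: "freeze n \<omega> n = \<omega> n"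
  by (simp add: freeze_def)

definition action_history :: "nat \<Rightarrow> ('x, 'u) path \<Rightarrow> ('x, 'u) hist \<times> 'u" where
  "action_history n \<omega> = (hist_of n \<omega>, snd (\<omega> n))"

text \<open>The last pair is repeated for ever, so that a history with its action is turned into a
  frozen path by a measurable map.\<close>

definition path_of_history :: "nat \<Rightarrow> ('x, 'u) hist \<times> 'u \<Rightarrow> ('x, 'u) path" where
  "path_of_history n z = (\<lambda>i. if i < n then fst (fst z) i else (snd (fst z), snd z))"

lemma path_of_action_history: "path_of_history n (action_history n \<omega>) = freeze n \<omega>"
  by (auto simp: path_of_history_def action_history_def hist_of_def freeze_def min_def fun_eq_iff)

lemma action_history_freeze: "action_history n (freeze n \<omega>) = action_history n \<omega>"
  by (auto simp: action_history_def hist_of_def freeze_def restrict_def fun_eq_iff min_def)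

lemma measurable_hist_of [measurable]:
  "hist_of n \<in> borel \<rightarrow>\<^sub>M (hist_space n :: ('x::borel_space, 'u::borel_space) hist measure)"
  unfolding hist_of_def hist_space_def
proof (rule measurable_Pair)
  show "(\<lambda>\<omega> :: ('x, 'u) path. restrict \<omega> {..<n}) \<in> borel \<rightarrow>\<^sub>M (\<Pi>\<^sub>M k\<in>{..<n}. borel)"
    by (intro measurable_restrict measurable_product_coordinates)
  show "(\<lambda>\<omega> :: ('x, 'u) path. fst (\<omega> n)) \<in> borel \<rightarrow>\<^sub>M borel"
    by (rule measurable_compose[OF measurable_product_coordinates measurable_fst_borel])
qed

lemma measurable_action_history [measurable]:
  "action_history n \<in> borel \<rightarrow>\<^sub>M (hist_space n \<Otimes>\<^sub>M borel :: (('x::borel_space, 'u::borel_space) hist \<times> 'u) measure)"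
  unfolding action_history_def
  by (intro measurable_Pair measurable_hist_of measurable_compose[OF measurable_product_coordinates measurable_snd_borel])

lemma measurable_path_of_history [measurable]:
  "path_of_history n \<in> (hist_space n \<Otimes>\<^sub>M borel :: (('x::borel_space, 'u::borel_space) hist \<times> 'u) measure) \<rightarrow>\<^sub>M borel"
proof (rule measurable_coordinatewise_then_product)
  fix i
  show "(\<lambda>z :: ('x, 'u) hist \<times> 'u. path_of_history n z i) \<in> hist_space n \<Otimes>\<^sub>M borel \<rightarrow>\<^sub>M borel"
  proof (cases "i < n")
    case True
    have "(\<lambda>z. fst (fst z) i) \<in> ((\<Pi>\<^sub>M k\<in>{..<n}. borel) \<Otimes>\<^sub>M borel) \<Otimes>\<^sub>M (borel :: 'u measure) \<rightarrow>\<^sub>M (borel :: ('x \<times> 'u) measure)"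
      using True
      by (intro measurable_compose[OF measurable_compose[OF measurable_fst measurable_fst] measurable_component_singleton]) simp
    then show ?thesis
      using True by (simp add: path_of_history_def hist_space_def)
  next
    case False
    have "(\<lambda>z. (snd (fst z), snd z)) \<in> ((\<Pi>\<^sub>M k\<in>{..<n}. (borel :: ('x \<times> 'u) measure)) \<Otimes>\<^sub>M borel) \<Otimes>\<^sub>M (borel :: 'u measure) \<rightarrow>\<^sub>M (borel :: ('x \<times> 'u) measure)"
      by (intro borel_measurable_Pair measurable_compose[OF measurable_fst measurable_snd] measurable_snd)
    then show ?thesis
      using False by (simp add: path_of_history_def hist_space_def)
  qed
qed

section \<open>Almost sure membership in analytic sets\<close>

text \<open>Under the law of \<open>f\<close> the complement of \<open>A\<close> consists of a Borel
  set disjoint from \<open>A\<close> and a part of a Borel null set. Testing Borel sets disjoint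
  from \<open>A\<close> therefore suffices, and these tests can be integrated.\<close>

lemma AE_analytic_iff:
  fixes A :: "'b::souslin_space set"
  assumes P: "prob_space P" and f: "f \<in> borel_measurable P" and A: "analytic A"
  shows "(AE \<omega> in P. f \<omega> \<in> A) \<longleftrightarrow> (\<forall>S\<in>sets borel. S \<inter> A = {} \<longrightarrow> (AE \<omega> in P. f \<omega> \<notin> S))"
proof (intro iffI ballI impI)
  fix S assume "AE \<omega> in P. f \<omega> \<in> A" "S \<inter> A = {}"
  then show "AE \<omega> in P. f \<omega> \<notin> S"
    by (auto elim!: eventually_mono)
next
  assume *: "\<forall>S\<in>sets borel. S \<inter> A = {} \<longrightarrow> (AE \<omega> in P. f \<omega> \<notin> S)"
  let ?L = "distr P borel f"
  have "A \<in> sets (completion ?L)"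
    by (rule analytic_sets_completion[OF prob_space.prob_space_distr[OF P f] _ A]) simp
  then have "space (completion ?L) - A \<in> sets (completion ?L)"
    by (rule sets.compl_sets)
  then obtain S N N' where SN: "- A = S \<union> N" "N \<subseteq> N'" "N' \<in> null_sets ?L" "S \<in> sets ?L"
    by (auto elim!: sets_completionE simp: Compl_eq_Diff_UNIV)
  then have "S \<inter> A = {}"
    by auto
  then have "AE \<omega> in P. f \<omega> \<notin> S"
    using * SN(4) by simp
  moreover have "AE \<omega> in P. f \<omega> \<notin> N'"
    using AE_distrD[OF f AE_not_in[OF SN(3)]] .
  ultimately show "AE \<omega> in P. f \<omega> \<in> A"
  proof eventually_elim
    case (elim \<omega>)
    then have "f \<omega> \<notin> - A"
      unfolding SN(1) using SN(2) by auto
    then show ?case by simp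
  qed
qed

text \<open>\<open>A\<close> need not be Borel. A Borel set covering its complement gives a
  measurable condition that can be transported to image laws and kernels.\<close>

lemma AE_analytic_null_cover:
  fixes A :: "'b::souslin_space set"
  assumes P: "prob_space P" and f: "f \<in> borel_measurable P" and A: "analytic A" and ae: "AE \<omega> in P. f \<omega> \<in> A"
  obtains Z where "Z \<in> sets borel" "- A \<subseteq> Z" "AE \<omega> in P. f \<omega> \<notin> Z"
proof -
  have "AE a in distr P borel f. a \<in> A"
    using ae f prob_space.prob_space_distr[OF P f]
    by (subst AE_analytic_iff) (auto simp: AE_distr_iff AE_analytic_iff[OF P f A] A)
  then obtain Z where Z: "{a \<in> space (distr P borel f). a \<notin> A} \<subseteq> Z" "Z \<in> null_sets (distr P borel f)"
    by (auto elim!: AE_E simp: null_sets_def)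
  show ?thesis
    using Z AE_distrD[OF f AE_not_in[OF Z(2)]] by (intro that[of Z]) auto
qed

lemma measurable_last_pair [measurable]:
  "(\<lambda>z. (snd (fst z), snd z)) \<in> hist_space n \<Otimes>\<^sub>M borel \<rightarrow>\<^sub>M (borel :: ('x::borel_space \<times> 'u::borel_space) measure)"
  unfolding hist_space_def
  by (intro borel_measurable_Pair measurable_compose[OF measurable_fst measurable_snd] measurable_snd)

locale controlled_process =
  fixes K :: "('x::borel_space \<times> 'u::borel_space) set" and T :: "'x \<times> 'u \<Rightarrow> 'x measure"
  assumes cdt_MP: "cdt_MP K T"
begin

lemma T [measurable]: "T \<in> borel \<rightarrow>\<^sub>M prob_algebra borel"
  using cdt_MP by (simp add: cdt_MP_def)

lemma prob_space_T: "prob_space (T z)" and sets_T: "sets (T z) = sets borel"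
  using measurable_space[OF T, of z] by (auto simp: space_prob_algebra)

lemma space_T [simp]: "space (T z) = UNIV"
  using sets_eq_imp_space_eq[OF sets_T] by simp

lemma analytic_K: "analytic K"
  using cdt_MP by (simp add: cdt_MP_def)

lemma T_coordinate [measurable]: "(\<lambda>\<omega> :: ('x, 'u) path. T (\<omega> n)) \<in> borel \<rightarrow>\<^sub>M prob_algebra borel"
  by (rule measurable_compose[OF measurable_product_coordinates T])

text \<open>A section of the first component of a parametrization of \<open>K\<close> picks a point
  of \<open>K\<close> above each state, and its second component is an admissible action.\<close>

lemma ex_selector:
  obtains s where "s \<in> univ_completion borel \<rightarrow>\<^sub>M borel" "\<And>x. (x, s x) \<in> K"
proof -
  have "K \<noteq> {}" "\<forall>x. K `` {x} \<noteq> {}"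
    using cdt_MP by (auto simp: cdt_MP_def)
  then obtain k :: "(nat \<Rightarrow> nat) \<Rightarrow> 'x \<times> 'u" where k: "continuous_on UNIV k" "range k = K"
    using analytic_K by (auto simp: analytic_def)
  have kb: "k \<in> borel_measurable borel"
    using k(1) by (rule borel_measurable_continuous_onI)
  have "continuous_on UNIV (\<lambda>y. fst (k y))"
    using k(1) by (rule continuous_on_fst)
  then obtain s where s: "s \<in> univ_completion borel \<rightarrow>\<^sub>M borel"
    "\<And>a. a \<in> range (\<lambda>y. fst (k y)) \<Longrightarrow> fst (k (s a)) = a"
    by (metis Jankov_von_Neumann)
  show ?thesis
  proof
    show "(\<lambda>x. snd (k (s x))) \<in> univ_completion borel \<rightarrow>\<^sub>M borel"
      by (intro measurable_compose[OF s(1)] measurable_compose[OF kb] measurable_snd_borel)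
    fix x
    obtain u where "(x, u) \<in> K"
      using \<open>\<forall>x. K `` {x} \<noteq> {}\<close> by auto
    then obtain y where "k y = (x, u)"
      using k(2) by (metis imageE)
    then have "x \<in> range (\<lambda>y. fst (k y))"
      by (metis fst_conv rangeI)
    then have "fst (k (s x)) = x"
      by (rule s(2))
    moreover have "k (s x) \<in> K"
      using k(2) by auto
    ultimately show "(x, snd (k (s x))) \<in> K"
      by (metis prod.collapse)
  qed
qed

section \<open>Strategic measures and their transition identities\<close>

definition transition_law :: "nat \<Rightarrow> ('x, 'u) path measure \<Rightarrow> (('x, 'u) path \<times> 'x) measure" where
  "transition_law n P = distr P borel (\<lambda>\<omega>. (freeze n \<omega>, fst (\<omega> (Suc n))))"

definition transition_kernel :: "nat \<Rightarrow> ('x, 'u) path \<Rightarrow> (('x, 'u) path \<times> 'x) measure" where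
  "transition_kernel n \<omega> = distr (T (\<omega> n)) borel (Pair (freeze n \<omega>))"

text \<open>The conditional law of the next state is stated as equality of two joint laws of frozen
  past and next state. No kernel for the actions occurs, so this is a property of the path law
  alone.\<close>

definition strategic :: "('x, 'u) path measure \<Rightarrow> bool" where
  "strategic P \<longleftrightarrow> prob_space P \<and> sets P = sets borel \<and> (\<forall>n. AE \<omega> in P. \<omega> n \<in> K) \<and>
     (\<forall>n. transition_law n P = P \<bind> transition_kernel n)"

lemma freeze_state_measurable [measurable]:
  "(\<lambda>\<omega> :: ('x, 'u) path. (freeze n \<omega>, fst (\<omega> m))) \<in> borel_measurable borel"
  by (intro borel_measurable_Pair measurable_freeze measurable_compose[OF measurable_product_coordinates measurable_fst_borel])

lemma transition_kernel_measurable [measurable]: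
  "transition_kernel n \<in> borel \<rightarrow>\<^sub>M prob_algebra borel"
  unfolding transition_kernel_def
proof (rule measurable_distr_prob_space2[OF T_coordinate])
  have "(\<lambda>z :: ('x, 'u) path \<times> 'x. (freeze n (fst z), snd z)) \<in> borel \<Otimes>\<^sub>M borel \<rightarrow>\<^sub>M borel"
    by (intro borel_measurable_Pair measurable_compose[OF measurable_fst measurable_freeze] measurable_snd)
  then show "(\<lambda>(\<omega> :: ('x, 'u) path, x :: 'x). (freeze n \<omega>, x)) \<in> borel \<Otimes>\<^sub>M borel \<rightarrow>\<^sub>M borel"
    by (simp add: case_prod_beta')
qed

lemma emeasure_transition_kernel:
  assumes D: "D \<in> sets borel"
  shows "emeasure (transition_kernel n \<omega>) D = emeasure (T (\<omega> n)) {x. (freeze n \<omega>, x) \<in> D}"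
proof -
  have "Pair (freeze n \<omega>) \<in> borel_measurable borel"
    by (intro borel_measurable_continuous_onI continuous_intros)
  then have "Pair (freeze n \<omega>) \<in> T (\<omega> n) \<rightarrow>\<^sub>M borel"
    by (simp only: measurable_cong_sets[OF sets_T refl])
  from emeasure_distr[OF this D] show ?thesis
    by (simp add: transition_kernel_def vimage_def)
qed

lemma emeasure_transition_law:
  assumes P: "sets P = sets borel" and D: "D \<in> sets borel"
  shows "emeasure (transition_law n P) D = emeasure P {\<omega>. (freeze n \<omega>, fst (\<omega> (Suc n))) \<in> D}"
proof -
  have "(\<lambda>\<omega>. (freeze n \<omega>, fst (\<omega> (Suc n)))) \<in> P \<rightarrow>\<^sub>M borel"
    using freeze_state_measurable by (simp only: measurable_cong_sets[OF P refl])
  from emeasure_distr[OF this D] show ?thesis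
    using sets_eq_imp_space_eq[OF P] by (simp add: transition_law_def vimage_def)
qed

lemma emeasure_bind_transition_kernel:
  assumes P: "prob_space P" "sets P = sets borel" and D: "D \<in> sets borel"
  shows "emeasure (P \<bind> transition_kernel n) D = (\<integral>\<^sup>+\<omega>. emeasure (T (\<omega> n)) {x. (freeze n \<omega>, x) \<in> D} \<partial>P)"
  using emeasure_bind_prob_algebra[OF _ transition_kernel_measurable D, of P] P emeasure_transition_kernel[OF D]
  by (simp add: space_prob_algebra)

text \<open>The transition identity is reduced to countably many numerical equations, which is what
  permits its almost sure verification for conditional laws.\<close>

lemma transition_eqI:
  assumes P: "prob_space P" "sets P = sets borel"
    and eq: "\<And>i. emeasure P {\<omega>. (freeze n \<omega>, fst (\<omega> (Suc n))) \<in> borel_gen i} =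
      (\<integral>\<^sup>+\<omega>. emeasure (T (\<omega> n)) {x. (freeze n \<omega>, x) \<in> borel_gen i} \<partial>P)"
  shows "transition_law n P = P \<bind> transition_kernel n"
proof (rule measure_eqI_borel_gen)
  have m: "(\<lambda>\<omega>. (freeze n \<omega>, fst (\<omega> (Suc n)))) \<in> P \<rightarrow>\<^sub>M borel"
    using freeze_state_measurable by (simp only: measurable_cong_sets[OF P(2) refl])
  then have "prob_space (transition_law n P)"
    unfolding transition_law_def by (rule prob_space.prob_space_distr[OF P(1)])
  then show "finite_measure (transition_law n P)"
    by (rule prob_space.finite_measure)
  show "sets (transition_law n P) = sets borel"
    by (simp add: transition_law_def)
  show "sets (P \<bind> transition_kernel n) = sets borel"
    using P by (intro sets_bind'[OF _ transition_kernel_measurable]) (simp add: space_prob_algebra)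
  show "emeasure (transition_law n P) (borel_gen i) = emeasure (P \<bind> transition_kernel n) (borel_gen i)" for i
    by (simp add: emeasure_transition_law[OF P(2)] emeasure_bind_transition_kernel[OF P] eq)
qed

lemma strategicD:
  assumes "strategic P"
  shows "prob_space P" "sets P = sets borel" "AE \<omega> in P. \<omega> n \<in> K"
    and "D \<in> sets borel \<Longrightarrow> emeasure P {\<omega>. (freeze n \<omega>, fst (\<omega> (Suc n))) \<in> D} =
      (\<integral>\<^sup>+\<omega>. emeasure (T (\<omega> n)) {x. (freeze n \<omega>, x) \<in> D} \<partial>P)"
proof -
  show P: "prob_space P" "sets P = sets borel" "AE \<omega> in P. \<omega> n \<in> K"
    using assms by (auto simp: strategic_def)
  show "emeasure P {\<omega>. (freeze n \<omega>, fst (\<omega> (Suc n))) \<in> D} =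
      (\<integral>\<^sup>+\<omega>. emeasure (T (\<omega> n)) {x. (freeze n \<omega>, x) \<in> D} \<partial>P)" if "D \<in> sets borel"
    using assms emeasure_transition_law[OF P(2) that, of n] emeasure_bind_transition_kernel[OF P(1,2) that, of n]
    by (simp add: strategic_def)
qed

lemma strategicI:
  assumes P: "prob_space P" "sets P = sets borel" "\<And>n. AE \<omega> in P. \<omega> n \<in> K"
    and eq: "\<And>n i. emeasure P {\<omega>. (freeze n \<omega>, fst (\<omega> (Suc n))) \<in> borel_gen i} =
      (\<integral>\<^sup>+\<omega>. emeasure (T (\<omega> n)) {x. (freeze n \<omega>, x) \<in> borel_gen i} \<partial>P)"
  shows "strategic P"
  unfolding strategic_def using P transition_eqI[OF P(1,2) eq] by blast

section \<open>Path measures of policies\<close>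

lemma is_path_measureD:
  assumes "is_path_measure T \<pi> x P"
  shows "prob_space P" "sets P = sets borel" "AE \<omega> in P. fst (\<omega> 0) = x"
    and "A \<in> sets (hist_space n) \<Longrightarrow> B \<in> sets borel \<Longrightarrow>
      emeasure P {\<omega>. hist_of n \<omega> \<in> A \<and> snd (\<omega> n) \<in> B} =
        (\<integral>\<^sup>+\<omega>\<in>{\<omega>. hist_of n \<omega> \<in> A}. emeasure (\<pi> n (hist_of n \<omega>)) B \<partial>P)"
    and "C \<in> sets (hist_space n \<Otimes>\<^sub>M borel) \<Longrightarrow> B' \<in> sets borel \<Longrightarrow>
        emeasure P {\<omega>. action_history n \<omega> \<in> C \<and> fst (\<omega> (Suc n)) \<in> B'} =
        (\<integral>\<^sup>+\<omega>\<in>{\<omega>. action_history n \<omega> \<in> C}. emeasure (T (\<omega> n)) B' \<partial>P)"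
  using assms unfolding is_path_measure_def sets_path_space nn_integral_completion action_history_def by blast+

lemma is_path_measureI:
  assumes "prob_space P" "sets P = sets borel" "AE \<omega> in P. fst (\<omega> 0) = x"
    and "\<And>n A B. A \<in> sets (hist_space n) \<Longrightarrow> B \<in> sets borel \<Longrightarrow>
      emeasure P {\<omega>. hist_of n \<omega> \<in> A \<and> snd (\<omega> n) \<in> B} =
        (\<integral>\<^sup>+\<omega>\<in>{\<omega>. hist_of n \<omega> \<in> A}. emeasure (\<pi> n (hist_of n \<omega>)) B \<partial>P)"
    and "\<And>n A B. A \<in> sets (hist_space n \<Otimes>\<^sub>M borel) \<Longrightarrow> B \<in> sets borel \<Longrightarrow>
        emeasure P {\<omega>. action_history n \<omega> \<in> A \<and> fst (\<omega> (Suc n)) \<in> B} =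
        (\<integral>\<^sup>+\<omega>\<in>{\<omega>. action_history n \<omega> \<in> A}. emeasure (T (\<omega> n)) B \<partial>P)"
  shows "is_path_measure T \<pi> x P"
  using assms unfolding is_path_measure_def sets_path_space nn_integral_completion action_history_def by blast

text \<open>Replacing the universally measurable \<open>\<pi> n\<close> by a version
  \<open>\<kappa>\<close> measurable on \<open>hist_space n\<close> makes the joint law of history
  and action an ordinary semidirect product.\<close>

lemma hist_law_semidirect:
  assumes P: "is_path_measure T \<pi> x P"
    and \<kappa>: "\<kappa> \<in> hist_space n \<rightarrow>\<^sub>M prob_algebra borel"
    and eq: "AE h in distr P (hist_space n) (hist_of n). \<pi> n h = \<kappa> h"
  shows "distr P (hist_space n \<Otimes>\<^sub>M borel) (action_history n) = semidirect (distr P (hist_space n) (hist_of n)) borel \<kappa>"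
proof (rule semidirect_eqI)
  note D = is_path_measureD[OF P]
  have hm: "hist_of n \<in> P \<rightarrow>\<^sub>M hist_space n"
    using measurable_hist_of by (simp only: measurable_cong_sets[OF D(2) refl])
  have am: "action_history n \<in> P \<rightarrow>\<^sub>M hist_space n \<Otimes>\<^sub>M borel"
    using measurable_action_history by (simp only: measurable_cong_sets[OF D(2) refl])
  have sp: "space P = UNIV"
    using sets_eq_imp_space_eq[OF D(2)] by simp
  show "prob_space (distr P (hist_space n) (hist_of n))"
    by (rule prob_space.prob_space_distr[OF D(1) hm])
  show "\<kappa> \<in> distr P (hist_space n) (hist_of n) \<rightarrow>\<^sub>M prob_algebra borel"
    using \<kappa> by simp
  show "sets (distr P (hist_space n \<Otimes>\<^sub>M borel) (action_history n)) = sets (distr P (hist_space n) (hist_of n) \<Otimes>\<^sub>M borel)"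
    unfolding sets_distr by (intro sets_pair_measure_cong) simp_all
  fix A :: "('x, 'u) hist set" and B :: "'u set"
  assume "A \<in> sets (distr P (hist_space n) (hist_of n))" and B: "B \<in> sets borel"
  then have A: "A \<in> sets (hist_space n)"
    by simp
  have "emeasure (distr P (hist_space n \<Otimes>\<^sub>M borel) (action_history n)) (A \<times> B) = emeasure P {\<omega>. hist_of n \<omega> \<in> A \<and> snd (\<omega> n) \<in> B}"
    using A B am by (subst emeasure_distr) (auto simp: sp action_history_def intro!: arg_cong[where f = "emeasure P"])
  also have "\<dots> = (\<integral>\<^sup>+\<omega>\<in>{\<omega>. hist_of n \<omega> \<in> A}. emeasure (\<pi> n (hist_of n \<omega>)) B \<partial>P)"
    by (rule D(4)[OF A B])
  also have "\<dots> = (\<integral>\<^sup>+\<omega>. emeasure (\<kappa> (hist_of n \<omega>)) B * indicator A (hist_of n \<omega>) \<partial>P)"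
  proof (rule nn_integral_cong_AE)
    show "AE \<omega> in P. emeasure (\<pi> n (hist_of n \<omega>)) B * indicator {\<omega>. hist_of n \<omega> \<in> A} \<omega> =
        emeasure (\<kappa> (hist_of n \<omega>)) B * indicator A (hist_of n \<omega>)"
      using AE_distrD[OF hm eq] by eventually_elim (auto split: split_indicator)
  qed
  also have "\<dots> = (\<integral>\<^sup>+h\<in>A. emeasure (\<kappa> h) B \<partial>distr P (hist_space n) (hist_of n))"
  proof (rule nn_integral_distr[OF hm, symmetric])
    have "(\<lambda>h. emeasure (\<kappa> h) B) \<in> borel_measurable (hist_space n)"
      by (rule measurable_emeasure_kernel[OF measurable_prob_algebraD[OF \<kappa>] B])
    then show "(\<lambda>h. emeasure (\<kappa> h) B * indicator A h) \<in> borel_measurable (distr P (hist_space n) (hist_of n))"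
      using A by simp
  qed
  finally show "emeasure (distr P (hist_space n \<Otimes>\<^sub>M borel) (action_history n)) (A \<times> B) =
      (\<integral>\<^sup>+h\<in>A. emeasure (\<kappa> h) B \<partial>distr P (hist_space n) (hist_of n))" .
qed

lemma path_measure_kernel_version:
  assumes q: "q \<in> univ_completion (hist_space n) \<rightarrow>\<^sub>M prob_algebra borel" and P: "prob_space P" "sets P = sets borel"
  obtains \<kappa> where "\<kappa> \<in> hist_space n \<rightarrow>\<^sub>M prob_algebra borel"
    "AE h in distr P (hist_space n) (hist_of n). (q h :: 'u measure) = \<kappa> h"
proof -
  have hm: "hist_of n \<in> P \<rightarrow>\<^sub>M hist_space n"
    using measurable_hist_of by (simp only: measurable_cong_sets[OF P(2) refl])
  have "q \<in> completion (distr P (hist_space n) (hist_of n)) \<rightarrow>\<^sub>M prob_algebra borel"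
    by (rule univ_completionD[OF q prob_space.prob_space_distr[OF P(1) hm]]) simp
  then obtain \<kappa> where "\<kappa> \<in> distr P (hist_space n) (hist_of n) \<rightarrow>\<^sub>M prob_algebra borel"
    "AE h in distr P (hist_space n) (hist_of n). q h = \<kappa> h"
    by (rule completion_ex_kernel_version)
  then show ?thesis
    by (intro that) simp_all
qed

lemma transition_law_path_measure:
  assumes P: "is_path_measure T \<pi> x P"
  shows "transition_law n P = semidirect (distr P borel (freeze n)) borel (\<lambda>\<eta>. T (\<eta> n))"
    and "transition_law n P = P \<bind> transition_kernel n"
proof -
  note D = is_path_measureD[OF P]
  have sp: "space P = UNIV"
    using sets_eq_imp_space_eq[OF D(2)] by simp
  have fm: "freeze n \<in> P \<rightarrow>\<^sub>M borel"
    using measurable_freeze by (simp only: measurable_cong_sets[OF D(2) refl])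
  let ?\<nu> = "distr P borel (freeze n)"
  have Tn: "(\<lambda>\<eta>. T (\<eta> n)) \<in> ?\<nu> \<rightarrow>\<^sub>M prob_algebra borel"
    using T_coordinate by simp
  have \<nu>: "prob_space ?\<nu>"
    by (rule prob_space.prob_space_distr[OF D(1) fm])
  have "sets (?\<nu> \<Otimes>\<^sub>M (borel :: 'x measure)) = sets ((borel :: ('x, 'u) path measure) \<Otimes>\<^sub>M (borel :: 'x measure))"
    by (intro sets_pair_measure_cong) simp_all
  also have "(borel :: ('x, 'u) path measure) \<Otimes>\<^sub>M (borel :: 'x measure) = borel"
    by (rule borel_prod)
  finally have spair: "sets (?\<nu> \<Otimes>\<^sub>M borel) = sets (borel :: (('x, 'u) path \<times> 'x) measure)" .
  have "transition_law n P = semidirect ?\<nu> borel (\<lambda>\<eta>. T (\<eta> n))"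
  proof (rule semidirect_eqI[OF \<nu> Tn])
    show "sets (transition_law n P) = sets (?\<nu> \<Otimes>\<^sub>M borel)"
      unfolding spair by (simp add: transition_law_def)
    fix A :: "('x, 'u) path set" and B :: "'x set"
    assume "A \<in> sets ?\<nu>" and B: "B \<in> sets borel"
    then have A: "A \<in> sets borel"
      by simp
    define C where "C = path_of_history n -` A \<inter> space (hist_space n \<Otimes>\<^sub>M borel)"
    have C: "C \<in> sets (hist_space n \<Otimes>\<^sub>M borel)"
      unfolding C_def by (rule measurable_sets[OF measurable_path_of_history A])
    have AC: "freeze n \<omega> \<in> A \<longleftrightarrow> action_history n \<omega> \<in> C" for \<omega>
      using measurable_space[OF measurable_action_history[of n], of \<omega>] by (simp add: C_def path_of_action_history)
    have AB: "A \<times> B \<in> sets borel"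
      using A B borel_prod by (metis pair_measureI)
    have "emeasure (transition_law n P) (A \<times> B) = emeasure P {\<omega>. action_history n \<omega> \<in> C \<and> fst (\<omega> (Suc n)) \<in> B}"
      by (simp add: emeasure_transition_law[OF D(2) AB] AC)
    also have "\<dots> = (\<integral>\<^sup>+\<omega>\<in>{\<omega>. action_history n \<omega> \<in> C}. emeasure (T (\<omega> n)) B \<partial>P)"
      by (rule D(5)[OF C B])
    also have "\<dots> = (\<integral>\<^sup>+\<omega>. emeasure (T (freeze n \<omega> n)) B * indicator A (freeze n \<omega>) \<partial>P)"
      by (intro nn_integral_cong) (auto simp: AC freeze_last split: split_indicator)
    also have "\<dots> = (\<integral>\<^sup>+\<eta>\<in>A. emeasure (T (\<eta> n)) B \<partial>?\<nu>)"
    proof (rule nn_integral_distr[OF fm, symmetric])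
      have "(\<lambda>\<eta> :: ('x, 'u) path. emeasure (T (\<eta> n)) B) \<in> borel_measurable borel"
        by (rule measurable_emeasure_kernel[OF measurable_prob_algebraD[OF T_coordinate] B])
      then show "(\<lambda>\<eta>. emeasure (T (\<eta> n)) B * indicator A \<eta>) \<in> borel_measurable ?\<nu>"
        using A by simp
    qed
    finally show "emeasure (transition_law n P) (A \<times> B) = (\<integral>\<^sup>+\<eta>\<in>A. emeasure (T (\<eta> n)) B \<partial>?\<nu>)" .
  qed
  then show "transition_law n P = semidirect ?\<nu> borel (\<lambda>\<eta>. T (\<eta> n))" .
  show "transition_law n P = P \<bind> transition_kernel n"
  proof (rule transition_eqI[OF D(1,2)])
    fix i
    let ?D = "borel_gen i :: (('x, 'u) path \<times> 'x) set"
    have meas: "(\<lambda>\<eta>. emeasure (T (\<eta> n)) {y. (\<eta>, y) \<in> ?D}) \<in> borel_measurable borel"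
    proof (rule emeasure_measurable_subprob_algebra2[OF _ measurable_prob_algebraD[OF T_coordinate]])
      have "?D \<in> sets (borel \<Otimes>\<^sub>M borel)"
        unfolding borel_prod by (rule sets_borel_gen)
      moreover have "Sigma (space borel) (\<lambda>\<eta>. {y. (\<eta>, y) \<in> ?D}) = ?D"
        by auto
      ultimately show "Sigma (space borel) (\<lambda>\<eta>. {y. (\<eta>, y) \<in> ?D}) \<in> sets (borel \<Otimes>\<^sub>M borel)"
        by simp
    qed
    have Dm: "?D \<in> sets (?\<nu> \<Otimes>\<^sub>M borel)"
      unfolding spair by simp
    have "emeasure P {\<omega>. (freeze n \<omega>, fst (\<omega> (Suc n))) \<in> ?D} = emeasure (semidirect ?\<nu> borel (\<lambda>\<eta>. T (\<eta> n))) ?D"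
      unfolding \<open>transition_law n P = _\<close>[symmetric]
      by (rule emeasure_transition_law[OF D(2) sets_borel_gen, symmetric])
    also have "\<dots> = (\<integral>\<^sup>+z. indicator ?D z \<partial>semidirect ?\<nu> borel (\<lambda>\<eta>. T (\<eta> n)))"
      using Dm by (intro nn_integral_indicator[symmetric]) (simp add: sets_semidirect[OF \<nu> Tn])
    also have "\<dots> = (\<integral>\<^sup>+\<eta>. \<integral>\<^sup>+y. indicator ?D (\<eta>, y) \<partial>T (\<eta> n) \<partial>?\<nu>)"
      using Dm by (intro nn_integral_semidirect[OF \<nu> Tn]) simp
    also have "\<dots> = (\<integral>\<^sup>+\<eta>. emeasure (T (\<eta> n)) {y. (\<eta>, y) \<in> ?D} \<partial>?\<nu>)"
    proof (rule nn_integral_cong)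
      fix \<eta> :: "('x, 'u) path"
      have "Pair \<eta> -` ?D \<inter> space borel \<in> sets borel"
        by (rule measurable_sets[OF borel_measurable_continuous_onI sets_borel_gen]) (intro continuous_intros)
      then have "{y. (\<eta>, y) \<in> ?D} \<in> sets (T (\<eta> n))"
        by (simp add: sets_T vimage_def)
      then have "(\<integral>\<^sup>+y. indicator {y. (\<eta>, y) \<in> ?D} y \<partial>T (\<eta> n)) = emeasure (T (\<eta> n)) {y. (\<eta>, y) \<in> ?D}"
        by simp
      then show "(\<integral>\<^sup>+y. indicator ?D (\<eta>, y) \<partial>T (\<eta> n)) = emeasure (T (\<eta> n)) {y. (\<eta>, y) \<in> ?D}"
        by (simp add: indicator_def)
    qed
    also have "\<dots> = (\<integral>\<^sup>+\<omega>. emeasure (T (freeze n \<omega> n)) {y. (freeze n \<omega>, y) \<in> ?D} \<partial>P)"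
      by (rule nn_integral_distr[OF fm]) (use meas in simp)
    finally show "emeasure P {\<omega>. (freeze n \<omega>, fst (\<omega> (Suc n))) \<in> ?D} =
        (\<integral>\<^sup>+\<omega>. emeasure (T (\<omega> n)) {y. (freeze n \<omega>, y) \<in> ?D} \<partial>P)"
      by (simp add: freeze_last)
  qed
qed

section \<open>Uniqueness of the path measure\<close>

lemma path_measure_unique:
  assumes \<pi>: "\<pi> \<in> policies K" and P: "is_path_measure T \<pi> x P" and Q: "is_path_measure T \<pi> x Q"
  shows "P = Q"
proof -
  note DP = is_path_measureD[OF P] and DQ = is_path_measureD[OF Q]
  have mP: "measurable P M = measurable borel M" and mQ: "measurable Q M = measurable borel M" for M :: "'m measure"
    by (rule measurable_cong_sets[OF DP(2) refl], rule measurable_cong_sets[OF DQ(2) refl])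
  have \<pi>': "\<pi> n \<in> univ_completion (hist_space n) \<rightarrow>\<^sub>M prob_algebra borel" for n
    using \<pi> by (auto simp: policies_def)
  have frz: "distr P borel (freeze n) = distr Q borel (freeze n)"
    if eq: "distr P (hist_space n) (hist_of n) = distr Q (hist_space n) (hist_of n)" for n
  proof -
    obtain \<kappa> where \<kappa>: "\<kappa> \<in> hist_space n \<rightarrow>\<^sub>M prob_algebra borel"
      "AE h in distr P (hist_space n) (hist_of n). \<pi> n h = \<kappa> h"
      using path_measure_kernel_version[OF \<pi>' DP(1,2)] .
    have "distr P (hist_space n \<Otimes>\<^sub>M borel) (action_history n) = distr Q (hist_space n \<Otimes>\<^sub>M borel) (action_history n)"
      using hist_law_semidirect[OF P \<kappa>] hist_law_semidirect[OF Q \<kappa>(1) \<kappa>(2)[unfolded eq]] eq by simp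
    then have "distr (distr P (hist_space n \<Otimes>\<^sub>M borel) (action_history n)) borel (path_of_history n) =
        distr (distr Q (hist_space n \<Otimes>\<^sub>M borel) (action_history n)) borel (path_of_history n)"
      by simp
    then show ?thesis
      by (simp add: distr_distr mP mQ o_def path_of_action_history)
  qed
  have hist: "distr P (hist_space n) (hist_of n) = distr Q (hist_space n) (hist_of n)" for n
  proof (induction n)
    case 0
    have eq: "distr R (hist_space 0) (hist_of 0) = return (hist_space 0) (\<lambda>_. undefined, x)"
      if R: "is_path_measure T \<pi> x R" for R
    proof -
      note D = is_path_measureD[OF R]
      have mR: "measurable R M = measurable borel M" for M :: "'m measure"
        by (rule measurable_cong_sets[OF D(2) refl])
      have c: "(\<lambda>_. undefined, x) \<in> space (hist_space 0 :: ('x, 'u) hist measure)"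
        by (simp add: hist_space_def space_pair_measure space_PiM)
      have "distr R (hist_space 0) (hist_of 0) = distr R (hist_space 0) (\<lambda>_. (\<lambda>_. undefined, x))"
      proof (rule distr_cong_AE[OF refl refl])
        show "AE \<omega> in R. hist_of 0 \<omega> = (\<lambda>_. undefined, x)"
          using D(3) by eventually_elim (simp add: hist_of_def restrict_def)
      qed (use c in \<open>simp_all add: mR\<close>)
      also have "\<dots> = return (hist_space 0) (\<lambda>_. undefined, x)"
        by (rule prob_space.distr_const[OF D(1) c])
      finally show ?thesis .
    qed
    show ?case
      using eq[OF P] eq[OF Q] by simp
  next
    case (Suc n)
    have law: "transition_law n P = transition_law n Q"
      unfolding transition_law_path_measure(1)[OF P] transition_law_path_measure(1)[OF Q] frz[OF Suc] ..
    have m: "(\<lambda>z. (restrict (fst z) {..<Suc n}, snd z)) \<in> borel \<rightarrow>\<^sub>M (hist_space (Suc n) :: ('x, 'u) hist measure)"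
      unfolding hist_space_def
      by (intro measurable_Pair measurable_restrict measurable_snd_borel
          measurable_compose[OF measurable_fst_borel measurable_product_coordinates])
    have proj: "distr (transition_law n R) (hist_space (Suc n)) (\<lambda>z. (restrict (fst z) {..<Suc n}, snd z)) =
        distr R (hist_space (Suc n)) (hist_of (Suc n))" if R: "sets R = sets borel" for R :: "('x, 'u) path measure"
    proof -
      have "(\<lambda>\<omega>. (freeze n \<omega>, fst (\<omega> (Suc n)))) \<in> R \<rightarrow>\<^sub>M borel"
        using freeze_state_measurable by (simp only: measurable_cong_sets[OF R refl])
      moreover have "(restrict (freeze n \<omega>) {..<Suc n}, fst (\<omega> (Suc n))) = hist_of (Suc n) \<omega>" for \<omega> :: "('x, 'u) path"
        by (auto simp: hist_of_def freeze_def restrict_def fun_eq_iff min_def)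
      ultimately show ?thesis
        unfolding transition_law_def by (simp add: distr_distr[OF m] o_def)
    qed
    show ?case
      using law proj[OF DP(2)] proj[OF DQ(2)] by simp
  qed
  show ?thesis
  proof (rule measure_eqI_PiM_infinite[where I = UNIV and M = "\<lambda>_. borel"])
    show "sets P = sets (Pi\<^sub>M UNIV (\<lambda>_. borel))" "sets Q = sets (Pi\<^sub>M UNIV (\<lambda>_. borel))"
      by (simp_all add: DP(2) DQ(2) sets_PiM_equal_borel)
    show "finite_measure P"
      using DP(1) by (rule prob_space.finite_measure)
    fix J :: "nat set" and A :: "nat \<Rightarrow> ('x \<times> 'u) set"
    assume J: "finite J" "J \<subseteq> UNIV" and A: "\<And>i. i \<in> J \<Longrightarrow> A i \<in> sets borel"
    obtain n where n: "\<And>j. j \<in> J \<Longrightarrow> j \<le> n"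
      using J(1) by (meson finite_nat_set_iff_bounded_le)
    let ?E = "prod_emb UNIV (\<lambda>_. borel :: ('x \<times> 'u) measure) J (Pi\<^sub>E J A)"
    have E: "?E \<in> sets borel"
      using A J sets_PiM_I[of J UNIV A "\<lambda>_. borel :: ('x \<times> 'u) measure"] by (simp add: sets_PiM_equal_borel)
    have Efr: "freeze n \<omega> \<in> ?E \<longleftrightarrow> \<omega> \<in> ?E" for \<omega>
      using n by (auto simp: prod_emb_def PiE_iff freeze_def min_def restrict_def extensional_def)
    have emf: "emeasure R ?E = emeasure (distr R borel (freeze n)) ?E" if R: "sets R = sets borel" for R
    proof -
      have "freeze n \<in> R \<rightarrow>\<^sub>M borel"
        using measurable_freeze by (simp only: measurable_cong_sets[OF R refl])
      then show ?thesis
        using E Efr sets_eq_imp_space_eq[OF R] by (simp add: emeasure_distr vimage_def)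
    qed
    show "emeasure P ?E = emeasure Q ?E"
      unfolding emf[OF DP(2)] emf[OF DQ(2)] frz[OF hist] ..
  qed
qed

lemma path_measure_eqI:
  "\<pi> \<in> policies K \<Longrightarrow> is_path_measure T \<pi> x P \<Longrightarrow> path_measure T \<pi> x = P"
  unfolding path_measure_def using path_measure_unique by blast

section \<open>From policies to strategic measures and back\<close>

lemma strategic_path_measure:
  assumes \<pi>: "\<pi> \<in> policies K" and P: "is_path_measure T \<pi> x P"
  shows "strategic P"
  unfolding strategic_def
proof (intro conjI allI)
  note D = is_path_measureD[OF P]
  show "prob_space P" "sets P = sets borel" "transition_law n P = P \<bind> transition_kernel n" for n
    using D transition_law_path_measure(2)[OF P] by auto
  fix n
  interpret P: prob_space P by (rule D)
  have cm: "(\<lambda>\<omega>. \<omega> n) \<in> P \<rightarrow>\<^sub>M borel"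
    using measurable_product_coordinates by (simp only: measurable_cong_sets[OF D(2) refl])
  have hm: "hist_of n \<in> P \<rightarrow>\<^sub>M hist_space n"
    using measurable_hist_of by (simp only: measurable_cong_sets[OF D(2) refl])
  have am: "action_history n \<in> P \<rightarrow>\<^sub>M hist_space n \<Otimes>\<^sub>M borel"
    using measurable_action_history by (simp only: measurable_cong_sets[OF D(2) refl])
  let ?\<nu> = "distr P (hist_space n) (hist_of n)"
  have \<nu>: "prob_space ?\<nu>"
    by (rule P.prob_space_distr[OF hm])
  have \<pi>': "\<pi> n \<in> univ_completion (hist_space n) \<rightarrow>\<^sub>M prob_algebra borel"
    and \<pi>K: "\<And>h. h \<in> space (hist_space n) \<Longrightarrow> emeasure (completion (\<pi> n h)) (K `` {snd h}) = 1"
    using \<pi> by (auto simp: policies_def)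
  obtain \<kappa> where \<kappa>: "\<kappa> \<in> hist_space n \<rightarrow>\<^sub>M prob_algebra borel"
    "AE h in distr P (hist_space n) (hist_of n). \<pi> n h = \<kappa> h"
    using path_measure_kernel_version[OF \<pi>' D(1,2)] .
  have \<kappa>': "\<kappa> \<in> ?\<nu> \<rightarrow>\<^sub>M prob_algebra borel"
    using \<kappa>(1) by simp
  \<comment> \<open>The constraint on \<open>\<pi> n\<close> lives in the completion. Testing it on
    Borel sets disjoint from \<open>K\<close> gives measurable statements, which pass through the
    semidirect product.\<close>
  show "AE \<omega> in P. \<omega> n \<in> K"
  proof (subst AE_analytic_iff[OF D(1) cm analytic_K], intro ballI impI)
  fix S :: "('x \<times> 'u) set" assume S: "S \<in> sets borel" "S \<inter> K = {}"
  have "AE h in ?\<nu>. AE u in \<kappa> h. (snd h, u) \<notin> S"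
  proof (rule AE_mp[OF \<kappa>(2)], rule AE_I2, rule impI)
    fix h assume h: "h \<in> space ?\<nu>" "\<pi> n h = \<kappa> h"
    have \<kappa>h: "prob_space (\<kappa> h)" "sets (\<kappa> h) = sets borel"
      using measurable_space[OF \<kappa>', of h] h by (auto simp: space_prob_algebra)
    interpret C: prob_space "completion (\<kappa> h)"
      by (rule prob_space.prob_space_completion[OF \<kappa>h(1)])
    have one: "emeasure (completion (\<kappa> h)) (K `` {snd h}) = 1"
      using \<pi>K[of h] h by simp
    then have "K `` {snd h} \<in> sets (completion (\<kappa> h))"
      by (metis emeasure_notin_sets zero_neq_one)
    then have "AE u in completion (\<kappa> h). u \<in> K `` {snd h}"
      using one by (subst C.AE_in_set_eq_1) (simp_all add: C.emeasure_eq_measure del: emeasure_completion)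
    then have "AE u in completion (\<kappa> h). (snd h, u) \<notin> S"
      using S(2) by (auto elim!: eventually_mono)
    then show "AE u in \<kappa> h. (snd h, u) \<notin> S"
      by (simp add: AE_completion_iff)
  qed
  then have "AE z in semidirect ?\<nu> borel \<kappa>. (snd (fst z), snd z) \<notin> S"
  proof (intro AE_semidirectI[OF \<nu> \<kappa>'])
    have "(\<lambda>z. (snd (fst z), snd z)) \<in> ?\<nu> \<Otimes>\<^sub>M borel \<rightarrow>\<^sub>M (borel :: ('x \<times> 'u) measure)"
      using measurable_last_pair[of n] by (simp cong: measurable_cong_sets sets_pair_measure_cong)
    then have "Measurable.pred (?\<nu> \<Otimes>\<^sub>M borel) (\<lambda>z. (snd (fst z), snd z) \<in> - S)"
      by (rule measurable_compose[of _ _ borel]) (use S in \<open>simp add: pred_def\<close>)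
    then show "Measurable.pred (?\<nu> \<Otimes>\<^sub>M borel) (\<lambda>z. (snd (fst z), snd z) \<notin> S)"
      by simp
  qed simp
  then have "AE z in distr P (hist_space n \<Otimes>\<^sub>M borel) (action_history n). (snd (fst z), snd z) \<notin> S"
    unfolding hist_law_semidirect[OF P \<kappa>] .
  from AE_distrD[OF am this] show "AE \<omega> in P. \<omega> n \<notin> S"
    by (simp add: action_history_def hist_of_def)
  qed
qed

text \<open>The policy is the conditional law of the action given the history, obtained by
  disintegration. Two things have to be repaired: the constraint must hold for every history, and
  all times are chosen independently.\<close>

lemma strategic_imp_path_measure:
  assumes P: "strategic P" and x: "AE \<omega> in P. fst (\<omega> 0) = x"
  shows "\<exists>\<pi>\<in>policies K. is_path_measure T \<pi> x P"
proof -
  note D = strategicD[OF P]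
  have ver: "\<forall>n. \<exists>\<pi>. \<pi> \<in> univ_completion (hist_space n) \<rightarrow>\<^sub>M prob_algebra borel \<and>
      (\<forall>h\<in>space (hist_space n). emeasure (completion (\<pi> h)) (K `` {snd h}) = 1) \<and>
      (\<forall>A\<in>sets (hist_space n). \<forall>B\<in>sets borel. emeasure P {\<omega>. hist_of n \<omega> \<in> A \<and> snd (\<omega> n) \<in> B} =
        (\<integral>\<^sup>+\<omega>\<in>{\<omega>. hist_of n \<omega> \<in> A}. emeasure (\<pi> (hist_of n \<omega>)) B \<partial>P))"
  proof
    fix n
    interpret P: prob_space P by (rule D)
    have hm: "hist_of n \<in> P \<rightarrow>\<^sub>M hist_space n"
      using measurable_hist_of by (simp only: measurable_cong_sets[OF D(2) refl])
    have am: "action_history n \<in> P \<rightarrow>\<^sub>M hist_space n \<Otimes>\<^sub>M borel"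
      using measurable_action_history by (simp only: measurable_cong_sets[OF D(2) refl])
    have sp: "space P = UNIV"
      using sets_eq_imp_space_eq[OF D(2)] by simp
    define L where "L = distr P (hist_space n \<Otimes>\<^sub>M borel) (action_history n)"
    let ?\<nu> = "distr P (hist_space n) (hist_of n)"
    have L: "prob_space L" "sets L = sets (hist_space n \<Otimes>\<^sub>M borel)"
      unfolding L_def by (rule P.prob_space_distr[OF am], simp)
    obtain \<kappa> where \<kappa>: "\<kappa> \<in> hist_space n \<rightarrow>\<^sub>M prob_algebra borel" "L = semidirect (distr L (hist_space n) fst) borel \<kappa>"
      using disintegration[OF L] .
    have "distr L (hist_space n) fst = ?\<nu>"
      unfolding L_def using am by (subst distr_distr) (auto simp: o_def action_history_def)
    then have L\<kappa>: "L = semidirect ?\<nu> borel \<kappa>"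
      using \<kappa>(2) by simp
    have \<nu>: "prob_space ?\<nu>"
      by (rule P.prob_space_distr[OF hm])
    have \<kappa>': "\<kappa> \<in> ?\<nu> \<rightarrow>\<^sub>M prob_algebra borel"
      using \<kappa>(1) by simp
    have "AE z in L. (snd (fst z), snd z) \<in> K"
    proof -
      have cm: "(\<lambda>\<omega>. \<omega> n) \<in> P \<rightarrow>\<^sub>M borel"
        using measurable_product_coordinates by (simp only: measurable_cong_sets[OF D(2) refl])
      obtain Z where Z: "Z \<in> sets borel" "- K \<subseteq> Z" "AE \<omega> in P. \<omega> n \<notin> Z"
        using AE_analytic_null_cover[OF D(1) cm analytic_K D(3)] .
      have "AE z in L. (snd (fst z), snd z) \<notin> Z"
        unfolding L_def
      proof (subst AE_distr_iff[OF am])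
        show "AE \<omega> in P. (snd (fst (action_history n \<omega>)), snd (action_history n \<omega>)) \<notin> Z"
          using Z(3) by (simp add: action_history_def hist_of_def)
        show "{z \<in> space (hist_space n \<Otimes>\<^sub>M borel). (snd (fst z), snd z) \<notin> Z} \<in> sets (hist_space n \<Otimes>\<^sub>M borel)"
          using measurable_sets[OF measurable_last_pair, of "- Z" n] Z(1)
          by (auto simp: vimage_def Int_def conj_commute)
      qed
      then show ?thesis
        by eventually_elim (use Z(2) in auto)
    qed
    then have "AE z in semidirect ?\<nu> borel \<kappa>. (snd (fst z), snd z) \<in> K"
      by (simp only: L\<kappa>[symmetric])
    from AE_semidirect[OF \<nu> \<kappa>' this] have "AE h in ?\<nu>. AE u in \<kappa> h. (snd h, u) \<in> K"
      by simp
    then obtain Z where Z: "{h \<in> space ?\<nu>. \<not> (AE u in \<kappa> h. (snd h, u) \<in> K)} \<subseteq> Z" "Z \<in> null_sets ?\<nu>"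
      by (auto elim!: AE_E simp: null_sets_def)
    obtain s where s: "s \<in> univ_completion borel \<rightarrow>\<^sub>M borel" "\<And>x. (x, s x) \<in> K"
      using ex_selector by blast
    \<comment> \<open>The disintegrating kernel obeys the constraint for almost every history only.
      On the exceptional set it is overridden by a Dirac measure at a selector, which is why the
      policy is universally measurable rather than Borel.\<close>
    define \<pi> where "\<pi> h = (if h \<in> Z then return borel (s (snd h)) else \<kappa> h)" for h
    have "\<pi> \<in> univ_completion (hist_space n) \<rightarrow>\<^sub>M prob_algebra borel"
      unfolding \<pi>_def
    proof (rule measurable_If_set)
      show "\<kappa> \<in> univ_completion (hist_space n) \<rightarrow>\<^sub>M prob_algebra borel"
        by (rule univ_completionI[OF \<kappa>(1)])
      have "(\<lambda>h. s (snd h)) \<in> univ_completion (hist_space n) \<rightarrow>\<^sub>M borel"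
        by (rule univ_completion_compose[OF s(1)]) (simp add: hist_space_def)
      then show "(\<lambda>h. return borel (s (snd h))) \<in> univ_completion (hist_space n) \<rightarrow>\<^sub>M prob_algebra borel"
        by (rule measurable_compose[OF _ measurable_return_prob_space])
      have "Z \<in> sets (hist_space n)"
        using Z(2) by auto
      then show "Z \<inter> space (univ_completion (hist_space n)) \<in> sets (univ_completion (hist_space n))"
        using sets.sets_into_space[of Z "hist_space n"] by (auto simp: sets_univ_completion)
    qed
    moreover have "emeasure (completion (\<pi> h)) (K `` {snd h}) = 1" if h: "h \<in> space (hist_space n)" for h
    proof -
      have \<pi>h: "prob_space (\<pi> h)" "sets (\<pi> h) = sets borel"
        using measurable_space[OF \<open>\<pi> \<in> _\<close>, of h] h by (auto simp: space_prob_algebra)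
      interpret C: prob_space "completion (\<pi> h)"
        by (rule prob_space.prob_space_completion[OF \<pi>h(1)])
      have "AE u in \<pi> h. u \<in> K `` {snd h}"
      proof (cases "h \<in> Z")
        case True
        have "AE u in return borel (s (snd h)). u = s (snd h)"
          by (subst AE_return) (simp_all, measurable)
        then have "AE u in return borel (s (snd h)). u \<in> K `` {snd h}"
          by eventually_elim (use s(2) in auto)
        moreover have "\<pi> h = return borel (s (snd h))"
          using True by (simp add: \<pi>_def)
        ultimately show ?thesis
          by (simp only:)
      next
        case False
        then have "AE u in \<kappa> h. (snd h, u) \<in> K"
          using Z(1) h by auto
        moreover have "\<pi> h = \<kappa> h"
          using False by (simp add: \<pi>_def)
        ultimately show ?thesis
          by (simp only: Image_singleton_iff)
      qed
      then have "AE u in completion (\<pi> h). u \<in> K `` {snd h}"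
        by (rule AE_completion)
      moreover have "K `` {snd h} \<in> sets (completion (\<pi> h))"
      proof -
        \<comment> \<open>The complement of the section is contained in a null set, so it is
          measurable for the completion, and hence so is the section.\<close>
        have "Measurable.pred (completion (\<pi> h)) (\<lambda>u. u \<notin> K `` {snd h})"
          using \<open>AE u in \<pi> h. u \<in> K `` {snd h}\<close> by (intro sets_completion_AE) simp
        then have "Measurable.pred (completion (\<pi> h)) (\<lambda>u. \<not> u \<notin> K `` {snd h})"
          by (rule pred_intros_logic)
        then show ?thesis
          using sets_eq_imp_space_eq[OF \<pi>h(2)] by (simp add: pred_def Image_singleton)
      qed
      ultimately have "C.prob (K `` {snd h}) = 1"
        by (simp only: C.AE_in_set_eq_1)
      then show ?thesis
        by (simp add: C.emeasure_eq_measure del: emeasure_completion)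
    qed
    moreover have "emeasure P {\<omega>. hist_of n \<omega> \<in> A \<and> snd (\<omega> n) \<in> B} =
        (\<integral>\<^sup>+\<omega>\<in>{\<omega>. hist_of n \<omega> \<in> A}. emeasure (\<pi> (hist_of n \<omega>)) B \<partial>P)"
      if A: "A \<in> sets (hist_space n)" and B: "B \<in> sets borel" for A B
    proof -
      have "emeasure P {\<omega>. hist_of n \<omega> \<in> A \<and> snd (\<omega> n) \<in> B} = emeasure L (A \<times> B)"
        unfolding L_def using A B am
        by (subst emeasure_distr) (auto simp: sp action_history_def intro!: arg_cong[where f = "emeasure P"])
      also have "\<dots> = (\<integral>\<^sup>+h\<in>A. emeasure (\<kappa> h) B \<partial>?\<nu>)"
        unfolding L\<kappa> using A B by (intro emeasure_semidirect[OF \<nu> \<kappa>']) simp_all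
      also have "\<dots> = (\<integral>\<^sup>+\<omega>. emeasure (\<kappa> (hist_of n \<omega>)) B * indicator A (hist_of n \<omega>) \<partial>P)"
      proof (rule nn_integral_distr[OF hm])
        have "(\<lambda>h. emeasure (\<kappa> h) B) \<in> borel_measurable (hist_space n)"
          by (rule measurable_emeasure_kernel[OF measurable_prob_algebraD[OF \<kappa>(1)] B])
        then show "(\<lambda>h. emeasure (\<kappa> h) B * indicator A h) \<in> borel_measurable ?\<nu>"
          using A by simp
      qed
      also have "\<dots> = (\<integral>\<^sup>+\<omega>\<in>{\<omega>. hist_of n \<omega> \<in> A}. emeasure (\<pi> (hist_of n \<omega>)) B \<partial>P)"
      proof (rule nn_integral_cong_AE)
        show "AE \<omega> in P. emeasure (\<kappa> (hist_of n \<omega>)) B * indicator A (hist_of n \<omega>) =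
            emeasure (\<pi> (hist_of n \<omega>)) B * indicator {\<omega>. hist_of n \<omega> \<in> A} \<omega>"
          using AE_distrD[OF hm AE_not_in[OF Z(2)]] by eventually_elim (auto simp: \<pi>_def split: split_indicator)
      qed
      finally show ?thesis .
    qed
    ultimately show "\<exists>\<pi>. \<pi> \<in> univ_completion (hist_space n) \<rightarrow>\<^sub>M prob_algebra borel \<and>
      (\<forall>h\<in>space (hist_space n). emeasure (completion (\<pi> h)) (K `` {snd h}) = 1) \<and>
      (\<forall>A\<in>sets (hist_space n). \<forall>B\<in>sets borel. emeasure P {\<omega>. hist_of n \<omega> \<in> A \<and> snd (\<omega> n) \<in> B} =
        (\<integral>\<^sup>+\<omega>\<in>{\<omega>. hist_of n \<omega> \<in> A}. emeasure (\<pi> (hist_of n \<omega>)) B \<partial>P))"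
      by (intro exI[of _ \<pi>] conjI ballI)
  qed
  from choice[OF ver] obtain \<pi> where \<pi>: "\<forall>n. \<pi> n \<in> univ_completion (hist_space n) \<rightarrow>\<^sub>M prob_algebra borel \<and>
      (\<forall>h\<in>space (hist_space n). emeasure (completion (\<pi> n h)) (K `` {snd h}) = 1) \<and>
      (\<forall>A\<in>sets (hist_space n). \<forall>B\<in>sets borel. emeasure P {\<omega>. hist_of n \<omega> \<in> A \<and> snd (\<omega> n) \<in> B} =
        (\<integral>\<^sup>+\<omega>\<in>{\<omega>. hist_of n \<omega> \<in> A}. emeasure (\<pi> n (hist_of n \<omega>)) B \<partial>P))"
    by (elim exE)
  have \<pi>3: "emeasure P {\<omega>. hist_of n \<omega> \<in> A \<and> snd (\<omega> n) \<in> B} =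
      (\<integral>\<^sup>+\<omega>\<in>{\<omega>. hist_of n \<omega> \<in> A}. emeasure (\<pi> n (hist_of n \<omega>)) B \<partial>P)"
    if "A \<in> sets (hist_space n)" "B \<in> sets borel" for n A B
    by (rule \<pi>[THEN spec, THEN conjunct2, THEN conjunct2, THEN bspec, THEN bspec, OF that])
  have "is_path_measure T \<pi> x P"
  proof (rule is_path_measureI[OF D(1,2) x \<pi>3])
    fix n and C :: "(('x, 'u) hist \<times> 'u) set" and B :: "'x set"
    assume C: "C \<in> sets (hist_space n \<Otimes>\<^sub>M borel)" and B: "B \<in> sets borel"
    have "(\<lambda>z. action_history n (fst z)) -` C \<inter> space borel \<in> sets (borel :: (('x, 'u) path \<times> 'x) measure)"
      by (rule measurable_sets[OF measurable_compose[OF measurable_fst_borel measurable_action_history] C])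
    moreover have "snd -` B \<inter> space borel \<in> sets (borel :: (('x, 'u) path \<times> 'x) measure)"
      by (rule measurable_sets[OF measurable_snd_borel B])
    ultimately have "{z :: ('x, 'u) path \<times> 'x. action_history n (fst z) \<in> C \<and> snd z \<in> B} \<in> sets borel"
      using sets.Int by (simp add: vimage_def Collect_conj_eq)
    from D(4)[OF this, of n]
    have "emeasure P {\<omega>. action_history n \<omega> \<in> C \<and> fst (\<omega> (Suc n)) \<in> B} =
        (\<integral>\<^sup>+\<omega>. emeasure (T (\<omega> n)) {x. action_history n \<omega> \<in> C \<and> x \<in> B} \<partial>P)"
      by (simp add: action_history_freeze)
    also have "\<dots> = (\<integral>\<^sup>+\<omega>\<in>{\<omega>. action_history n \<omega> \<in> C}. emeasure (T (\<omega> n)) B \<partial>P)"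
      by (intro nn_integral_cong) (auto split: split_indicator)
    finally show "emeasure P {\<omega>. action_history n \<omega> \<in> C \<and> fst (\<omega> (Suc n)) \<in> B} = \<dots>" .
  qed
  moreover have "\<pi> \<in> policies K"
    using \<pi> by (simp add: policies_def)
  ultimately show ?thesis
    by blast
qed

subsection \<open>Existence\<close>

text \<open>
  The Ionescu-Tulcea theorem needs Borel kernels, so the universally measurable kernel \<open>\<pi> n\<close> is
  replaced by a Borel version with respect to the law of the history, which is itself built from the
  versions chosen at earlier times.
\<close>

definition kernel_version :: "'h measure \<Rightarrow> ('h \<Rightarrow> 'u measure) \<Rightarrow> 'h \<Rightarrow> 'u measure" where
  "kernel_version \<mu> q = (SOME \<kappa>. \<kappa> \<in> \<mu> \<rightarrow>\<^sub>M prob_algebra borel \<and> (AE h in \<mu>. q h = \<kappa> h))"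

lemma kernel_version:
  assumes q: "q \<in> univ_completion M \<rightarrow>\<^sub>M prob_algebra borel" and \<mu>: "prob_space \<mu>" "sets \<mu> = sets M"
  shows "kernel_version \<mu> q \<in> \<mu> \<rightarrow>\<^sub>M prob_algebra borel" "AE h in \<mu>. q h = kernel_version \<mu> q h"
proof -
  obtain \<kappa> where "\<kappa> \<in> \<mu> \<rightarrow>\<^sub>M prob_algebra borel" "AE x in \<mu>. q x = \<kappa> x"
    using completion_ex_kernel_version[OF univ_completionD[OF q \<mu>]] .
  then have "\<exists>\<kappa>. \<kappa> \<in> \<mu> \<rightarrow>\<^sub>M prob_algebra borel \<and> (AE h in \<mu>. q h = \<kappa> h)"
    by blast
  then have "kernel_version \<mu> q \<in> \<mu> \<rightarrow>\<^sub>M prob_algebra borel \<and> (AE h in \<mu>. q h = kernel_version \<mu> q h)"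
    unfolding kernel_version_def by (rule someI_ex)
  then show "kernel_version \<mu> q \<in> \<mu> \<rightarrow>\<^sub>M prob_algebra borel" "AE h in \<mu>. q h = kernel_version \<mu> q h"
    by auto
qed

abbreviation prefix_space :: "nat \<Rightarrow> (nat \<Rightarrow> 'x \<times> 'u) measure" where
  "prefix_space n \<equiv> \<Pi>\<^sub>M k\<in>{0..<n}. borel"

text \<open>The initial state is treated as a transition from the empty prefix, so that one
  recursion also covers time zero.\<close>

definition next_state :: "'x \<Rightarrow> nat \<Rightarrow> (nat \<Rightarrow> 'x \<times> 'u) \<Rightarrow> 'x measure" where
  "next_state x n \<eta> = (if n = 0 then return borel x else T (\<eta> (n - 1)))"

definition step_version :: "('x, 'u) policy \<Rightarrow> 'x \<Rightarrow> (nat \<Rightarrow> 'x \<times> 'u) measure \<Rightarrow> nat \<Rightarrow> ('x, 'u) hist \<Rightarrow> 'u measure" where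
  "step_version \<pi> x m n = kernel_version (semidirect m borel (next_state x n)) (\<pi> n)"

definition step_kernel :: "('x, 'u) policy \<Rightarrow> 'x \<Rightarrow> (nat \<Rightarrow> 'x \<times> 'u) measure \<Rightarrow> nat \<Rightarrow> (nat \<Rightarrow> 'x \<times> 'u) \<Rightarrow> ('x \<times> 'u) measure" where
  "step_kernel \<pi> x m n \<eta> =
     next_state x n \<eta> \<bind> (\<lambda>x'. distr (step_version \<pi> x m n (\<eta>, x')) borel (Pair x'))"

primrec prefix_law :: "('x, 'u) policy \<Rightarrow> 'x \<Rightarrow> nat \<Rightarrow> (nat \<Rightarrow> 'x \<times> 'u) measure" where
  "prefix_law \<pi> x 0 = return (prefix_space 0) (\<lambda>_. undefined)"
| "prefix_law \<pi> x (Suc n) = prefix_law \<pi> x n \<bind>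
     (\<lambda>\<eta>. distr (step_kernel \<pi> x (prefix_law \<pi> x n) n \<eta>) (prefix_space (Suc n)) (fun_upd \<eta> n))"

lemma measurable_prefix_component: "k < n \<Longrightarrow> (\<lambda>\<eta>. \<eta> k) \<in> prefix_space n \<rightarrow>\<^sub>M borel"
  by (rule measurable_component_singleton) simp

lemma next_state_measurable: "next_state x n \<in> prefix_space n \<rightarrow>\<^sub>M prob_algebra borel"
proof (cases "n = 0")
  case True
  then show ?thesis
    unfolding next_state_def[abs_def] by (simp add: space_prob_algebra prob_space_return)
next
  case False
  then have "(\<lambda>\<eta>. T (\<eta> (n - 1))) \<in> prefix_space n \<rightarrow>\<^sub>M prob_algebra borel"
    by (intro measurable_compose[OF measurable_prefix_component T]) auto
  then show ?thesis
    using False unfolding next_state_def[abs_def] by simp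
qed

lemma hist_space_prefix: "hist_space n = prefix_space n \<Otimes>\<^sub>M borel"
  by (simp add: hist_space_def atLeast0LessThan)

lemma measurable_fun_upd_prefix:
  "(\<lambda>z. (fst z)(n := snd z)) \<in> prefix_space n \<Otimes>\<^sub>M borel \<rightarrow>\<^sub>M prefix_space (Suc n)"
  by (rule measurable_fun_upd[where J = "{0..<n}"]) (auto intro: measurable_fst measurable_snd)

context
  fixes \<pi> :: "('x, 'u) policy" and x :: 'x
  assumes \<pi>: "\<pi> \<in> policies K"
begin

private abbreviation m :: "nat \<Rightarrow> (nat \<Rightarrow> 'x \<times> 'u) measure" where
  "m n \<equiv> prefix_law \<pi> x n"

private abbreviation \<rho> :: "nat \<Rightarrow> ('x, 'u) hist \<Rightarrow> 'u measure" where
  "\<rho> n \<equiv> step_version \<pi> x (m n) n"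

private abbreviation q :: "nat \<Rightarrow> (nat \<Rightarrow> 'x \<times> 'u) \<Rightarrow> ('x \<times> 'u) measure" where
  "q n \<equiv> step_kernel \<pi> x (m n) n"

lemma next_state_prefix_law:
  assumes "sets (m n) = sets (prefix_space n)"
  shows "next_state x n \<in> m n \<rightarrow>\<^sub>M prob_algebra borel"
  using next_state_measurable by (simp only: measurable_cong_sets[OF assms refl])

lemma
  assumes m: "prob_space (m n)" "sets (m n) = sets (prefix_space n)"
  shows \<rho>_measurable: "\<rho> n \<in> hist_space n \<rightarrow>\<^sub>M prob_algebra borel"
    and \<rho>_AE: "AE h in semidirect (m n) borel (next_state x n). \<pi> n h = \<rho> n h"
    and q_measurable: "q n \<in> prefix_space n \<rightarrow>\<^sub>M prob_algebra borel"
    and fun_upd_measurable: "(\<lambda>\<eta>. distr (q n \<eta>) (prefix_space (Suc n)) (fun_upd \<eta> n)) \<in> prefix_space n \<rightarrow>\<^sub>M prob_algebra (prefix_space (Suc n))"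
proof -
  let ?G = "semidirect (m n) borel (next_state x n)"
  have nx: "next_state x n \<in> m n \<rightarrow>\<^sub>M prob_algebra borel"
    by (rule next_state_prefix_law[OF m(2)])
  have G: "prob_space ?G" "sets ?G = sets (hist_space n)"
    using prob_space_semidirect[OF m(1) nx] sets_semidirect[OF m(1) nx] m(2)
    by (simp_all add: hist_space_prefix cong: sets_pair_measure_cong)
  have \<pi>n: "\<pi> n \<in> univ_completion (hist_space n) \<rightarrow>\<^sub>M prob_algebra borel"
    using \<pi> by (auto simp: policies_def)
  show "AE h in ?G. \<pi> n h = \<rho> n h"
    unfolding step_version_def by (rule kernel_version(2)[OF \<pi>n G])
  have "\<rho> n \<in> ?G \<rightarrow>\<^sub>M prob_algebra borel"
    unfolding step_version_def by (rule kernel_version(1)[OF \<pi>n G])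
  then show \<rho>: "\<rho> n \<in> hist_space n \<rightarrow>\<^sub>M prob_algebra borel"
    by (simp only: measurable_cong_sets[OF G(2) refl])
  have "(\<lambda>z. distr (\<rho> n z) borel (Pair (snd z))) \<in> prefix_space n \<Otimes>\<^sub>M borel \<rightarrow>\<^sub>M prob_algebra (borel :: ('x \<times> 'u) measure)"
  proof (rule measurable_distr_prob_space2)
    show "\<rho> n \<in> prefix_space n \<Otimes>\<^sub>M borel \<rightarrow>\<^sub>M prob_algebra borel"
      using \<rho> by (simp add: hist_space_prefix)
    have "(\<lambda>w. (snd (fst w), snd w)) \<in> (prefix_space n \<Otimes>\<^sub>M borel) \<Otimes>\<^sub>M borel \<rightarrow>\<^sub>M (borel :: ('x \<times> 'u) measure)"
      by (intro borel_measurable_Pair measurable_compose[OF measurable_fst measurable_snd] measurable_snd)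
    then show "(\<lambda>(z, u). (snd z, u)) \<in> (prefix_space n \<Otimes>\<^sub>M borel) \<Otimes>\<^sub>M borel \<rightarrow>\<^sub>M (borel :: ('x \<times> 'u) measure)"
      by (simp add: case_prod_beta')
  qed
  then have "(\<lambda>(\<eta>, x'). distr (\<rho> n (\<eta>, x')) borel (Pair x')) \<in> prefix_space n \<Otimes>\<^sub>M borel \<rightarrow>\<^sub>M prob_algebra (borel :: ('x \<times> 'u) measure)"
    by (simp add: case_prod_beta')
  from measurable_bind_prob_space2[OF next_state_measurable this]
  show q: "q n \<in> prefix_space n \<rightarrow>\<^sub>M prob_algebra borel"
    unfolding step_kernel_def[abs_def] .
  show "(\<lambda>\<eta>. distr (q n \<eta>) (prefix_space (Suc n)) (fun_upd \<eta> n)) \<in> prefix_space n \<rightarrow>\<^sub>M prob_algebra (prefix_space (Suc n))"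
    by (rule measurable_distr_prob_space2[OF q]) (use measurable_fun_upd_prefix in \<open>simp add: case_prod_beta'\<close>)
qed

lemma prefix_law: "prob_space (m n)" "sets (m n) = sets (prefix_space n)"
proof (induction n)
  case 0
  case 1 show ?case
    by (auto intro!: prob_space_return simp: space_PiM)
  case 2 show ?case
    by simp
next
  case (Suc n)
  have k: "(\<lambda>\<eta>. distr (q n \<eta>) (prefix_space (Suc n)) (fun_upd \<eta> n)) \<in> m n \<rightarrow>\<^sub>M prob_algebra (prefix_space (Suc n))"
    using fun_upd_measurable[OF Suc] by (simp only: measurable_cong_sets[OF Suc(2) refl])
  have mn: "m n \<in> space (prob_algebra (m n))"
    using Suc(1) by (simp add: space_prob_algebra)
  case 1 show ?case
    using prob_space_bind'[OF mn k] by simp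
  case 2 show ?case
    using sets_bind'[OF mn k] by simp
qed

lemma nn_integral_q:
  assumes \<eta>: "\<eta> \<in> space (prefix_space n)" and f: "f \<in> borel_measurable borel"
  shows "(\<integral>\<^sup>+a. f a \<partial>q n \<eta>) = (\<integral>\<^sup>+x'. \<integral>\<^sup>+u. f (x', u) \<partial>\<rho> n (\<eta>, x') \<partial>next_state x n \<eta>)"
proof -
  have \<rho>: "\<rho> n \<in> prefix_space n \<Otimes>\<^sub>M borel \<rightarrow>\<^sub>M prob_algebra borel"
    using \<rho>_measurable[OF prefix_law] by (simp add: hist_space_prefix)
  have P\<eta>: "Pair \<eta> \<in> borel \<rightarrow>\<^sub>M prefix_space n \<Otimes>\<^sub>M borel"
    using \<eta> by (rule measurable_Pair1')
  have k: "(\<lambda>x'. distr (\<rho> n (\<eta>, x')) borel (Pair x')) \<in> borel \<rightarrow>\<^sub>M prob_algebra (borel :: ('x \<times> 'u) measure)"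
  proof (rule measurable_distr_prob_space2[OF measurable_compose[OF P\<eta> \<rho>]])
    show "(\<lambda>(x, y). (x, y)) \<in> borel \<Otimes>\<^sub>M borel \<rightarrow>\<^sub>M (borel :: ('x \<times> 'u) measure)"
      by (simp add: borel_prod)
  qed
  have ns: "sets (next_state x n \<eta>) = sets borel"
    using measurable_space[OF next_state_measurable \<eta>] by (simp add: space_prob_algebra)
  have "(\<integral>\<^sup>+a. f a \<partial>q n \<eta>) = (\<integral>\<^sup>+x'. \<integral>\<^sup>+a. f a \<partial>distr (\<rho> n (\<eta>, x')) borel (Pair x') \<partial>next_state x n \<eta>)"
    unfolding step_kernel_def
  proof (rule nn_integral_bind[OF f])
    show "(\<lambda>x'. distr (\<rho> n (\<eta>, x')) borel (Pair x')) \<in> next_state x n \<eta> \<rightarrow>\<^sub>M subprob_algebra borel"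
      using measurable_prob_algebraD[OF k] by (simp only: measurable_cong_sets[OF ns refl])
  qed
  also have "\<dots> = (\<integral>\<^sup>+x'. \<integral>\<^sup>+u. f (x', u) \<partial>\<rho> n (\<eta>, x') \<partial>next_state x n \<eta>)"
  proof (rule nn_integral_cong)
    fix x' :: 'x
    have "(\<eta>, x') \<in> space (prefix_space n \<Otimes>\<^sub>M borel)"
      using \<eta> by (simp add: space_pair_measure)
    from measurable_space[OF \<rho> this] have s: "sets (\<rho> n (\<eta>, x')) = sets borel"
      by (simp add: space_prob_algebra)
    have "Pair x' \<in> borel_measurable (borel :: 'u measure)"
      by (intro borel_measurable_continuous_onI continuous_intros)
    then have "Pair x' \<in> \<rho> n (\<eta>, x') \<rightarrow>\<^sub>M borel"
      by (simp only: measurable_cong_sets[OF s refl])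
    then show "(\<integral>\<^sup>+a. f a \<partial>distr (\<rho> n (\<eta>, x')) borel (Pair x')) = (\<integral>\<^sup>+u. f (x', u) \<partial>\<rho> n (\<eta>, x'))"
      using f by (intro nn_integral_distr) simp_all
  qed
  finally show ?thesis .
qed

lemma nn_integral_prefix_law_Suc:
  assumes f: "f \<in> borel_measurable (prefix_space (Suc n))"
  shows "(\<integral>\<^sup>+\<eta>. f \<eta> \<partial>m (Suc n)) =
    (\<integral>\<^sup>+\<eta>. \<integral>\<^sup>+x'. \<integral>\<^sup>+u. f (\<eta>(n := (x', u))) \<partial>\<rho> n (\<eta>, x') \<partial>next_state x n \<eta> \<partial>m n)"
proof -
  have k: "(\<lambda>\<eta>. distr (q n \<eta>) (prefix_space (Suc n)) (fun_upd \<eta> n)) \<in> m n \<rightarrow>\<^sub>M prob_algebra (prefix_space (Suc n))"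
    using fun_upd_measurable[OF prefix_law] by (simp only: measurable_cong_sets[OF prefix_law(2) refl])
  have "(\<integral>\<^sup>+\<eta>. f \<eta> \<partial>m (Suc n)) = (\<integral>\<^sup>+\<eta>. \<integral>\<^sup>+\<zeta>. f \<zeta> \<partial>distr (q n \<eta>) (prefix_space (Suc n)) (fun_upd \<eta> n) \<partial>m n)"
    unfolding prefix_law.simps by (rule nn_integral_bind[OF f measurable_prob_algebraD[OF k]])
  also have "\<dots> = (\<integral>\<^sup>+\<eta>. \<integral>\<^sup>+x'. \<integral>\<^sup>+u. f (\<eta>(n := (x', u))) \<partial>\<rho> n (\<eta>, x') \<partial>next_state x n \<eta> \<partial>m n)"
  proof (rule nn_integral_cong)
    fix \<eta> assume "\<eta> \<in> space (m n)"
    then have \<eta>: "\<eta> \<in> space (prefix_space n)"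
      using sets_eq_imp_space_eq[OF prefix_law(2)] by simp
    have s: "sets (q n \<eta>) = sets borel"
      using measurable_space[OF q_measurable[OF prefix_law] \<eta>] by (simp add: space_prob_algebra)
    have upd: "fun_upd \<eta> n \<in> borel \<rightarrow>\<^sub>M prefix_space (Suc n)"
      using measurable_compose[OF measurable_Pair1'[OF \<eta>] measurable_fun_upd_prefix] by simp
    then have upd': "fun_upd \<eta> n \<in> q n \<eta> \<rightarrow>\<^sub>M prefix_space (Suc n)"
      by (simp only: measurable_cong_sets[OF s refl])
    have "(\<integral>\<^sup>+\<zeta>. f \<zeta> \<partial>distr (q n \<eta>) (prefix_space (Suc n)) (fun_upd \<eta> n)) = (\<integral>\<^sup>+a. f (fun_upd \<eta> n a) \<partial>q n \<eta>)"
      using f by (intro nn_integral_distr[OF upd']) simp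
    also have "\<dots> = (\<integral>\<^sup>+x'. \<integral>\<^sup>+u. f (\<eta>(n := (x', u))) \<partial>\<rho> n (\<eta>, x') \<partial>next_state x n \<eta>)"
      by (rule nn_integral_q[OF \<eta> measurable_compose[OF upd f]])
    finally show "(\<integral>\<^sup>+\<zeta>. f \<zeta> \<partial>distr (q n \<eta>) (prefix_space (Suc n)) (fun_upd \<eta> n)) = \<dots>" .
  qed
  finally show ?thesis .
qed

lemma ex_prefix_limit:
  "\<exists>P. prob_space P \<and> sets P = sets borel \<and> (\<forall>n. distr P (prefix_space n) (\<lambda>\<omega>. restrict \<omega> {0..<n}) = m n)"
proof -
  have 1: "q i \<in> prefix_space i \<rightarrow>\<^sub>M subprob_algebra borel" for i
    by (rule measurable_prob_algebraD[OF q_measurable[OF prefix_law]])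
  have 2: "prob_space (q i \<eta>)" if "\<eta> \<in> space (prefix_space i)" for i \<eta>
    using measurable_space[OF q_measurable[OF prefix_law] that] by (simp add: space_prob_algebra)
  interpret IT: Ionescu_Tulcea q "\<lambda>_. borel"
    by (rule Ionescu_Tulcea.intro[OF 1 2])
  \<comment> \<open>\<open>prefix_law\<close> has the shape of the iterated kernels of the
    Ionescu-Tulcea construction, although the kernels \<open>q n\<close> were defined from
    it.\<close>
  have C: "IT.C 0 n (\<lambda>_. undefined) = m n" for n
    by (induction n) (simp_all add: IT.eP_def[abs_def])
  have law: "distr IT.PF.lim (prefix_space n) (\<lambda>\<omega>. restrict \<omega> {0..<n}) = m n" for n
  proof -
    have "distr IT.PF.lim (prefix_space n) (\<lambda>\<omega>. restrict \<omega> {0..<n}) = IT.CI {0..<n}"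
      by (rule IT.distr_lim) simp
    also have "\<dots> = IT.C 0 n (\<lambda>_. undefined)"
    proof (rule measure_eqI)
      show "sets (IT.CI {0..<n}) = sets (IT.C 0 n (\<lambda>_. undefined))"
        unfolding C by (simp add: IT.CI_def prefix_law(2))
      fix X assume "X \<in> sets (IT.CI {0..<n})"
      then have X: "X \<in> sets (prefix_space n)"
        by (simp add: IT.CI_def)
      then show "emeasure (IT.CI {0..<n}) X = emeasure (IT.C 0 n (\<lambda>_. undefined)) X"
        using sets.sets_into_space[OF X] by (subst IT.emeasure_CI[of _ n]) (simp_all add: prod_emb_id space_PiM)
    qed
    finally show ?thesis
      unfolding C .
  qed
  have s: "sets IT.PF.lim = sets borel"
    by (simp add: sets_PiM_equal_borel)
  \<comment> \<open>The total mass of the limit is read off from the law of the empty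
    prefix.\<close>
  have "prob_space IT.PF.lim"
  proof (rule prob_space_distrD)
    show rm: "(\<lambda>\<omega>. restrict \<omega> {0..<0}) \<in> IT.PF.lim \<rightarrow>\<^sub>M prefix_space 0"
      unfolding measurable_cong_sets[OF s refl] by (intro measurable_restrict measurable_product_coordinates)
    show "prob_space (distr IT.PF.lim (prefix_space 0) (\<lambda>\<omega>. restrict \<omega> {0..<0}))"
      unfolding law by (rule prefix_law)
  qed
  with s law show ?thesis
    by blast
qed

theorem ex_path_measure: "\<exists>P. is_path_measure T \<pi> x P"
proof -
  obtain P where P: "prob_space P" "sets P = sets borel"
    and law: "\<And>n. distr P (prefix_space n) (\<lambda>\<omega>. restrict \<omega> {0..<n}) = m n"
    using ex_prefix_limit by auto
  have sp: "space P = UNIV"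
    using sets_eq_imp_space_eq[OF P(2)] by simp
  have rm: "(\<lambda>\<omega>. restrict \<omega> {0..<n}) \<in> P \<rightarrow>\<^sub>M prefix_space n" for n
    unfolding measurable_cong_sets[OF P(2) refl] by (intro measurable_restrict measurable_product_coordinates)
  have hm: "hist_of n \<in> P \<rightarrow>\<^sub>M hist_space n" for n
    using measurable_hist_of by (simp only: measurable_cong_sets[OF P(2) refl])
  have int: "(\<integral>\<^sup>+\<omega>. f (restrict \<omega> {0..<n}) \<partial>P) = (\<integral>\<^sup>+\<eta>. f \<eta> \<partial>m n)"
    if "f \<in> borel_measurable (prefix_space n)" for f n
    unfolding law[symmetric] using that by (intro nn_integral_distr[OF rm, symmetric]) simp
  have nx: "next_state x n \<in> m n \<rightarrow>\<^sub>M prob_algebra borel" for n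
    by (rule next_state_prefix_law[OF prefix_law(2)])
  \<comment> \<open>The candidate for the law of the history at time \<open>n\<close>: a prefix of
    \<open>n\<close> pairs followed by the next state.\<close>
  let ?G = "\<lambda>n. semidirect (m n) borel (next_state x n)"
  have sG: "sets (?G n) = sets (hist_space n)" for n
    using sets_semidirect[OF prefix_law(1) nx, of n] prefix_law(2)[of n]
    by (simp add: hist_space_prefix cong: sets_pair_measure_cong)
  have sG': "sets (m n \<Otimes>\<^sub>M borel) = sets (hist_space n :: ('x, 'u) hist measure)" for n
    using prefix_law(2)[of n] by (simp add: hist_space_prefix cong: sets_pair_measure_cong)
  have restr: "restrict (\<eta>(n := a)) {0..<n} = \<eta>" if "\<eta> \<in> space (m n)" for \<eta> n a
    using that sets_eq_imp_space_eq[OF prefix_law(2)] by (auto simp: space_PiM PiE_iff extensional_def fun_eq_iff)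
  have last: "(\<lambda>\<zeta>. (restrict \<zeta> {0..<n}, fst (\<zeta> n))) \<in> prefix_space (Suc n) \<rightarrow>\<^sub>M hist_space n" for n
    unfolding hist_space_prefix
    by (intro measurable_Pair measurable_restrict measurable_compose[OF measurable_prefix_component measurable_fst_borel]
        measurable_prefix_component) auto
  have lastu: "(\<lambda>\<zeta>. snd (\<zeta> n)) \<in> prefix_space (Suc n) \<rightarrow>\<^sub>M (borel :: 'u measure)" for n
    by (intro measurable_compose[OF measurable_prefix_component measurable_snd_borel]) auto
  have hist: "hist_of n \<omega> = (restrict (restrict \<omega> {0..<Suc n}) {0..<n}, fst (restrict \<omega> {0..<Suc n} n))" for n and \<omega> :: "('x, 'u) path"
    by (auto simp: hist_of_def restrict_def fun_eq_iff)
  \<comment> \<open>The construction controls the versions \<open>\<rho> n\<close>. Taking all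
    actions for \<open>B\<close> identifies the history law with \<open>?G n\<close>, and under that
    law \<open>\<rho> n\<close> may be exchanged for \<open>\<pi> n\<close>.\<close>
  have joint: "(\<integral>\<^sup>+\<omega>. indicator A (hist_of n \<omega>) * indicator B (snd (\<omega> n)) \<partial>P) =
      (\<integral>\<^sup>+h. indicator A h * emeasure (\<rho> n h) B \<partial>?G n)"
    if A: "A \<in> sets (hist_space n)" and B: "B \<in> sets borel" for n A B
  proof -
    let ?f = "\<lambda>\<zeta>. indicator A (restrict \<zeta> {0..<n}, fst (\<zeta> n)) * indicator B (snd (\<zeta> n)) :: ennreal"
    have f: "?f \<in> borel_measurable (prefix_space (Suc n))"
      by (intro borel_measurable_times_ennreal measurable_compose[OF last] measurable_compose[OF lastu]
          borel_measurable_indicator A B)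
    have "(\<integral>\<^sup>+\<omega>. indicator A (hist_of n \<omega>) * indicator B (snd (\<omega> n)) \<partial>P) = (\<integral>\<^sup>+\<omega>. ?f (restrict \<omega> {0..<Suc n}) \<partial>P)"
      unfolding hist by simp
    also have "\<dots> = (\<integral>\<^sup>+\<eta>. ?f \<eta> \<partial>m (Suc n))"
      by (rule int[OF f])
    also have "\<dots> = (\<integral>\<^sup>+\<eta>. \<integral>\<^sup>+x'. \<integral>\<^sup>+u. ?f (\<eta>(n := (x', u))) \<partial>\<rho> n (\<eta>, x') \<partial>next_state x n \<eta> \<partial>m n)"
      by (rule nn_integral_prefix_law_Suc[OF f])
    also have "\<dots> = (\<integral>\<^sup>+\<eta>. \<integral>\<^sup>+x'. indicator A (\<eta>, x') * emeasure (\<rho> n (\<eta>, x')) B \<partial>next_state x n \<eta> \<partial>m n)"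
    proof (intro nn_integral_cong)
      fix \<eta> x' assume \<eta>: "\<eta> \<in> space (m n)"
      then have "(\<eta>, x') \<in> space (hist_space n)"
        using sets_eq_imp_space_eq[OF prefix_law(2)] by (simp add: hist_space_prefix space_pair_measure)
      from measurable_space[OF \<rho>_measurable[OF prefix_law] this] have "sets (\<rho> n (\<eta>, x')) = sets borel"
        by (simp add: space_prob_algebra)
      then show "(\<integral>\<^sup>+u. ?f (\<eta>(n := (x', u))) \<partial>\<rho> n (\<eta>, x')) = indicator A (\<eta>, x') * emeasure (\<rho> n (\<eta>, x')) B"
        using B by (simp add: restr[OF \<eta>] nn_integral_cmult)
    qed
    also have "\<dots> = (\<integral>\<^sup>+h. indicator A h * emeasure (\<rho> n h) B \<partial>?G n)"
    proof (rule nn_integral_semidirect[OF prefix_law(1) nx, symmetric])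
      have "(\<lambda>h. indicator A h * emeasure (\<rho> n h) B) \<in> borel_measurable (hist_space n)"
        by (intro borel_measurable_times_ennreal borel_measurable_indicator A
            measurable_emeasure_kernel[OF measurable_prob_algebraD[OF \<rho>_measurable[OF prefix_law]] B])
      then show "(\<lambda>h. indicator A h * emeasure (\<rho> n h) B) \<in> borel_measurable (m n \<Otimes>\<^sub>M borel)"
        by (simp only: measurable_cong_sets[OF sG' refl])
    qed
    finally show ?thesis .
  qed
  have hist_law: "distr P (hist_space n) (hist_of n) = ?G n" for n
  proof (rule measure_eqI)
    fix A assume "A \<in> sets (distr P (hist_space n) (hist_of n))"
    then have A: "A \<in> sets (hist_space n)"
      by simp
    have "emeasure (distr P (hist_space n) (hist_of n)) A = (\<integral>\<^sup>+h. indicator A h \<partial>distr P (hist_space n) (hist_of n))"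
      using A by simp
    also have "\<dots> = (\<integral>\<^sup>+\<omega>. indicator A (hist_of n \<omega>) * indicator UNIV (snd (\<omega> n)) \<partial>P)"
      using A by (subst nn_integral_distr[OF hm]) simp_all
    also have "\<dots> = (\<integral>\<^sup>+h. indicator A h * emeasure (\<rho> n h) UNIV \<partial>?G n)"
      by (rule joint[OF A]) simp
    also have "\<dots> = (\<integral>\<^sup>+h. indicator A h \<partial>?G n)"
    proof (rule nn_integral_cong)
      fix h assume "h \<in> space (?G n)"
      then have "h \<in> space (hist_space n)"
        using sets_eq_imp_space_eq[OF sG] by simp
      from in_space_prob_algebra[OF measurable_space[OF \<rho>_measurable[OF prefix_law] this]]
      show "indicator A h * emeasure (\<rho> n h) UNIV = indicator A h"
        by simp
    qed
    also have "\<dots> = emeasure (?G n) A"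
      using A sG by simp
    finally show "emeasure (distr P (hist_space n) (hist_of n)) A = emeasure (?G n) A" .
  qed (simp add: sG)
  have "is_path_measure T \<pi> x P"
  proof (rule is_path_measureI[OF P])
    have X: "{y. y \<noteq> x} \<in> sets borel"
    proof -
      have "{y \<in> space borel. y \<noteq> x} \<in> sets borel"
        by measurable
      then show ?thesis by simp
    qed
    have "AE h in ?G 0. snd h = x"
    proof (rule AE_semidirectI[OF prefix_law(1) nx])
      show "Measurable.pred (m 0 \<Otimes>\<^sub>M borel) (\<lambda>h. snd h = x)"
        by (rule measurable_eq_souslin) simp_all
      have "AE y in return borel x. y = x"
        by (subst AE_return) (simp_all, measurable)
      moreover have "next_state x 0 \<eta> = return borel x" for \<eta>
        by (simp add: next_state_def)
      ultimately show "AE \<eta> in m 0. AE y in next_state x 0 \<eta>. snd (\<eta>, y) = x"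
        by (simp only: snd_conv AE_I2)
    qed
    then have "AE h in distr P (hist_space 0) (hist_of 0). snd h = x"
      by (simp only: hist_law)
    from AE_distrD[OF hm this] show "AE \<omega> in P. fst (\<omega> 0) = x"
      by (simp add: hist_of_def)
  next
    fix n and A :: "('x, 'u) hist set" and B :: "'u set"
    assume A: "A \<in> sets (hist_space n)" and B: "B \<in> sets borel"
    have Bm: "(\<lambda>\<omega>. snd (\<omega> n)) -` B \<inter> space P \<in> sets P"
    proof (rule measurable_sets[OF _ B])
      show "(\<lambda>\<omega>. snd (\<omega> n)) \<in> P \<rightarrow>\<^sub>M borel"
        using measurable_compose[OF measurable_product_coordinates measurable_snd_borel]
        by (simp only: measurable_cong_sets[OF P(2) refl])
    qed
    have Am: "hist_of n -` A \<inter> space P \<in> sets P"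
      by (rule measurable_sets[OF hm A])
    have "emeasure P {\<omega>. hist_of n \<omega> \<in> A \<and> snd (\<omega> n) \<in> B} =
        (\<integral>\<^sup>+\<omega>. indicator {\<omega>. hist_of n \<omega> \<in> A \<and> snd (\<omega> n) \<in> B} \<omega> \<partial>P)"
      using sets.Int[OF Am Bm] by (intro nn_integral_indicator[symmetric]) (simp add: sp vimage_def Int_def)
    also have "\<dots> = (\<integral>\<^sup>+\<omega>. indicator A (hist_of n \<omega>) * indicator B (snd (\<omega> n)) \<partial>P)"
      by (intro nn_integral_cong) (auto split: split_indicator)
    also have "\<dots> = (\<integral>\<^sup>+h. indicator A h * emeasure (\<rho> n h) B \<partial>?G n)"
      by (rule joint[OF A B])
    also have "\<dots> = (\<integral>\<^sup>+\<omega>. indicator A (hist_of n \<omega>) * emeasure (\<rho> n (hist_of n \<omega>)) B \<partial>P)"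
      unfolding hist_law[symmetric]
    proof (rule nn_integral_distr[OF hm])
      have "(\<lambda>h. indicator A h * emeasure (\<rho> n h) B) \<in> borel_measurable (hist_space n)"
        by (intro borel_measurable_times_ennreal borel_measurable_indicator A
            measurable_emeasure_kernel[OF measurable_prob_algebraD[OF \<rho>_measurable[OF prefix_law]] B])
      then show "(\<lambda>h. indicator A h * emeasure (\<rho> n h) B) \<in> borel_measurable (distr P (hist_space n) (hist_of n))"
        by simp
    qed
    also have "\<dots> = (\<integral>\<^sup>+\<omega>\<in>{\<omega>. hist_of n \<omega> \<in> A}. emeasure (\<pi> n (hist_of n \<omega>)) B \<partial>P)"
    proof (rule nn_integral_cong_AE)
      have "AE h in distr P (hist_space n) (hist_of n). \<pi> n h = \<rho> n h"
        unfolding hist_law by (rule \<rho>_AE[OF prefix_law])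
      from AE_distrD[OF hm this]
      show "AE \<omega> in P. indicator A (hist_of n \<omega>) * emeasure (\<rho> n (hist_of n \<omega>)) B =
          emeasure (\<pi> n (hist_of n \<omega>)) B * indicator {\<omega>. hist_of n \<omega> \<in> A} \<omega>"
        by eventually_elim (auto split: split_indicator)
    qed
    finally show "emeasure P {\<omega>. hist_of n \<omega> \<in> A \<and> snd (\<omega> n) \<in> B} = \<dots>" .
  next
    fix n and C :: "(('x, 'u) hist \<times> 'u) set" and B :: "'x set"
    assume C: "C \<in> sets (hist_space n \<Otimes>\<^sub>M borel)" and B: "B \<in> sets borel"
    let ?A = "(\<lambda>\<zeta>. ((restrict \<zeta> {0..<n}, fst (\<zeta> n)), snd (\<zeta> n))) -` C \<inter> space (prefix_space (Suc n))"
    have A: "?A \<in> sets (prefix_space (Suc n))"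
      by (intro measurable_sets[OF _ C] measurable_Pair last lastu)
    have AC: "action_history n \<omega> \<in> C \<longleftrightarrow> restrict \<omega> {0..<Suc n} \<in> ?A" for \<omega> :: "('x, 'u) path"
      using measurable_space[OF rm, of \<omega> "Suc n"] by (simp add: action_history_def hist sp)
    have Tm: "(\<lambda>\<zeta>. emeasure (T (\<zeta> n)) B) \<in> borel_measurable (prefix_space (Suc n))"
      by (intro measurable_compose[OF measurable_prefix_component measurable_emeasure_kernel[OF measurable_prob_algebraD[OF T] B]]) simp
    let ?D = "{h \<in> space (hist_space (Suc n)). fst h \<in> ?A \<and> snd h \<in> B}"
    have D: "?D \<in> sets (hist_space (Suc n))"
    proof -
      have "?D = ?A \<times> B"
        by (auto simp: hist_space_prefix space_pair_measure)
      then show ?thesis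
        using A B by (simp add: hist_space_prefix)
    qed
    have "{\<omega>. action_history n \<omega> \<in> C \<and> fst (\<omega> (Suc n)) \<in> B} = hist_of (Suc n) -` ?D \<inter> space P"
      using measurable_space[OF hm, of _ "Suc n"] by (auto simp: AC sp hist_of_def atLeast0LessThan)
    then have "emeasure P {\<omega>. action_history n \<omega> \<in> C \<and> fst (\<omega> (Suc n)) \<in> B} = emeasure (?G (Suc n)) ?D"
      unfolding hist_law[symmetric] using emeasure_distr[OF hm D] by simp
    also have "?D = ?A \<times> B"
      by (auto simp: hist_space_prefix space_pair_measure)
    also have "emeasure (?G (Suc n)) (?A \<times> B) = (\<integral>\<^sup>+\<eta>\<in>?A. emeasure (next_state x (Suc n) \<eta>) B \<partial>m (Suc n))"
      by (rule emeasure_semidirect[OF prefix_law(1) nx _ B]) (simp only: A prefix_law(2))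
    also have "\<dots> = (\<integral>\<^sup>+\<eta>\<in>?A. emeasure (T (\<eta> n)) B \<partial>m (Suc n))"
      by (simp add: next_state_def)
    also have "\<dots> = (\<integral>\<^sup>+\<omega>. emeasure (T (restrict \<omega> {0..<Suc n} n)) B * indicator ?A (restrict \<omega> {0..<Suc n}) \<partial>P)"
      by (intro int[symmetric] borel_measurable_times_ennreal Tm borel_measurable_indicator A)
    also have "\<dots> = (\<integral>\<^sup>+\<omega>\<in>{\<omega>. action_history n \<omega> \<in> C}. emeasure (T (\<omega> n)) B \<partial>P)"
      unfolding AC by (intro nn_integral_cong) (auto split: split_indicator)
    finally show "emeasure P {\<omega>. action_history n \<omega> \<in> C \<and> fst (\<omega> (Suc n)) \<in> B} = \<dots>" .
  qed
  then show ?thesis ..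
qed

end

lemma policies_path_measures:
  "(\<lambda>\<pi>. path_measure T \<pi> x) ` policies K = {P. strategic P \<and> (AE \<omega> in P. fst (\<omega> 0) = x)}"
proof safe
  fix \<pi> assume \<pi>: "\<pi> \<in> policies K"
  obtain P where P: "is_path_measure T \<pi> x P"
    using ex_path_measure[OF \<pi>] by blast
  have eq: "path_measure T \<pi> x = P"
    by (rule path_measure_eqI[OF \<pi> P])
  show "strategic (path_measure T \<pi> x)" "AE \<omega> in path_measure T \<pi> x. fst (\<omega> 0) = x"
    unfolding eq by (rule strategic_path_measure[OF \<pi> P], rule is_path_measureD(3)[OF P])
next
  fix P assume P: "strategic P" "AE \<omega> in P. fst (\<omega> 0) = x"
  obtain \<pi> where \<pi>: "\<pi> \<in> policies K" "is_path_measure T \<pi> x P"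
    using strategic_imp_path_measure[OF P] by blast
  then show "P \<in> (\<lambda>\<pi>. path_measure T \<pi> x) ` policies K"
    using path_measure_eqI[OF \<pi>] by blast
qed

end

section \<open>Operations on strategic measures\<close>

definition shift :: "(nat \<Rightarrow> 'a) \<Rightarrow> nat \<Rightarrow> 'a" where
  "shift \<omega> = (\<lambda>i. \<omega> (Suc i))"

lemma measurable_shift [measurable]:
  "shift \<in> borel_measurable (borel :: (nat \<Rightarrow> 'a::second_countable_topology) measure)"
  unfolding shift_def by (intro measurable_coordinatewise_then_product measurable_product_coordinates)

lemma measurable_case_nat_path [measurable]:
  "case_nat a \<in> borel_measurable (borel :: (nat \<Rightarrow> 'a::second_countable_topology) measure)"
proof (rule measurable_coordinatewise_then_product)
  fix i show "(\<lambda>\<omega>. case_nat a \<omega> i) \<in> borel_measurable borel"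
    by (cases i) (auto intro: measurable_product_coordinates)
qed

lemma shift_freeze: "shift (freeze (Suc n) \<omega>) = freeze n (shift \<omega>)"
  by (auto simp: shift_def freeze_def fun_eq_iff)

lemma freeze_case_nat: "freeze (Suc n) (case_nat a \<omega>) = case_nat a (freeze n \<omega>)"
  by (auto simp: freeze_def fun_eq_iff split: nat.split)

lemma measurable_state [measurable]:
  "(\<lambda>\<omega> :: nat \<Rightarrow> 'a::second_countable_topology \<times> 'b::second_countable_topology. fst (\<omega> n)) \<in> borel_measurable borel"
  by (rule measurable_compose[OF measurable_product_coordinates measurable_fst_borel])

text \<open>Transport to an image law requires a measurable predicate, which a Borel null set
  covering the complement of \<open>A\<close> provides.\<close>

lemma AE_distr_analytic:
  fixes A :: "'b::souslin_space set"
  assumes P: "prob_space P" and f: "f \<in> P \<rightarrow>\<^sub>M M" and g: "g \<in> M \<rightarrow>\<^sub>M borel" and A: "analytic A"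
    and ae: "AE \<omega> in P. g (f \<omega>) \<in> A"
  shows "AE y in distr P M f. g y \<in> A"
proof -
  obtain Z where Z: "Z \<in> sets borel" "- A \<subseteq> Z" "AE \<omega> in P. g (f \<omega>) \<notin> Z"
    using AE_analytic_null_cover[OF P measurable_compose[OF f g] A ae] .
  have "g -` (- Z) \<inter> space M \<in> sets M"
    using Z(1) by (intro measurable_sets[OF g]) simp
  then have "{y \<in> space M. g y \<notin> Z} \<in> sets M"
    by (simp add: vimage_def Int_def conj_commute)
  then have "AE y in distr P M f. g y \<notin> Z"
    using Z(3) by (subst AE_distr_iff[OF f])
  then show ?thesis
    by eventually_elim (use Z(2) in auto)
qed

lemma finite_measure_AE_eqI:
  fixes f g :: "'a \<Rightarrow> ennreal"
  assumes "finite_measure M" "f \<in> borel_measurable M" "g \<in> borel_measurable M"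
    and "\<And>A. A \<in> sets M \<Longrightarrow> (\<integral>\<^sup>+x. f x * indicator A x \<partial>M) = (\<integral>\<^sup>+x. g x * indicator A x \<partial>M)"
  shows "AE x in M. f x = g x"
  using assms by (intro finite_measure.density_unique_finite_measure) auto

context controlled_process
begin

definition strategies :: "'x \<Rightarrow> ('x, 'u) path measure set" where
  "strategies x = {P. strategic P \<and> (AE \<omega> in P. fst (\<omega> 0) = x)}"

lemma strategies_strategic: "P \<in> strategies x \<Longrightarrow> strategic P"
  by (simp add: strategies_def)

lemma measurable_strategic:
  "strategic P \<Longrightarrow> f \<in> borel \<rightarrow>\<^sub>M M \<Longrightarrow> f \<in> P \<rightarrow>\<^sub>M M"
  by (simp only: measurable_cong_sets[OF strategicD(2) refl])

lemma space_strategic: "strategic P \<Longrightarrow> space P = UNIV"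
  using sets_eq_imp_space_eq[OF strategicD(2)] by simp

lemma transition_integrand_measurable:
  assumes "D \<in> sets borel"
  shows "(\<lambda>\<omega>. emeasure (T (\<omega> n)) {x. (freeze n \<omega>, x) \<in> D}) \<in> borel_measurable borel"
  unfolding emeasure_transition_kernel[OF assms, symmetric]
  by (rule measurable_emeasure_kernel[OF measurable_prob_algebraD[OF transition_kernel_measurable] assms])

lemma transition_set_measurable:
  assumes "D \<in> sets borel"
  shows "{\<omega> :: ('x, 'u) path. (freeze n \<omega>, fst (\<omega> m)) \<in> D} \<in> sets borel"
  using measurable_sets[OF freeze_state_measurable assms, of n m] by (simp add: vimage_def)

section \<open>Shifting, mixing, prepending and disintegrating strategic measures\<close>

text \<open>The past of the shifted path up to \<open>n\<close> is a function of the original past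
  up to \<open>Suc n\<close>, so each test set is pulled back to one for \<open>P\<close> at the
  next time.\<close>

lemma strategic_shift:
  assumes P: "strategic P"
  shows "strategic (distr P borel shift)"
proof (rule strategicI)
  note D = strategicD[OF P]
  have sm: "shift \<in> P \<rightarrow>\<^sub>M borel"
    by (rule measurable_strategic[OF P measurable_shift])
  show "prob_space (distr P borel shift)"
    by (rule prob_space.prob_space_distr[OF D(1) sm])
  show "sets (distr P borel shift) = sets borel"
    by simp
  show "AE \<omega> in distr P borel shift. \<omega> n \<in> K" for n
  proof (rule AE_distr_analytic[OF D(1) sm measurable_product_coordinates analytic_K])
    show "AE \<omega> in P. shift \<omega> n \<in> K"
      using D(3)[of "Suc n"] by (simp add: shift_def)
  qed
  fix n i
  let ?D = "borel_gen i :: (('x, 'u) path \<times> 'x) set"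
  let ?D' = "(\<lambda>z. (shift (fst z), snd z)) -` ?D \<inter> space borel"
  have D': "?D' \<in> sets borel"
    by (rule measurable_sets[OF _ sets_borel_gen])
      (intro borel_measurable_Pair measurable_compose[OF measurable_fst_borel measurable_shift] measurable_snd_borel)
  have "emeasure (distr P borel shift) {\<omega>. (freeze n \<omega>, fst (\<omega> (Suc n))) \<in> ?D} =
      emeasure P {\<omega>. (freeze (Suc n) \<omega>, fst (\<omega> (Suc (Suc n)))) \<in> ?D'}"
    using transition_set_measurable[OF sets_borel_gen, of n "Suc n" i]
    by (simp add: emeasure_distr[OF sm] space_strategic[OF P] vimage_def shift_freeze) (simp add: shift_def)
  also have "\<dots> = (\<integral>\<^sup>+\<omega>. emeasure (T (\<omega> (Suc n))) {x. (freeze (Suc n) \<omega>, x) \<in> ?D'} \<partial>P)"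
    by (rule D(4)[OF D'])
  also have "\<dots> = (\<integral>\<^sup>+\<omega>. emeasure (T (shift \<omega> n)) {x. (freeze n (shift \<omega>), x) \<in> ?D} \<partial>P)"
    by (simp add: shift_freeze) (simp add: shift_def)
  also have "\<dots> = (\<integral>\<^sup>+\<omega>. emeasure (T (\<omega> n)) {x. (freeze n \<omega>, x) \<in> ?D} \<partial>distr P borel shift)"
    using transition_integrand_measurable[OF sets_borel_gen] by (intro nn_integral_distr[OF sm, symmetric]) simp
  finally show "emeasure (distr P borel shift) {\<omega>. (freeze n \<omega>, fst (\<omega> (Suc n))) \<in> ?D} = \<dots>" .
qed

text \<open>The clauses of \<open>strategic\<close> are null statements and identities linear in the
  law, so they survive integration over \<open>y\<close>. As \<open>\<kappa> y\<close> starts at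
  \<open>y\<close>, the mixture starts with law \<open>\<nu>\<close>.\<close>

lemma
  assumes \<nu>: "prob_space \<nu>" "sets \<nu> = sets borel" and \<kappa>: "\<kappa> \<in> (borel :: 'x measure) \<rightarrow>\<^sub>M prob_algebra borel"
    and ae: "AE y in \<nu>. \<kappa> y \<in> strategies y"
  shows strategic_mixture: "strategic (\<nu> \<bind> \<kappa>)"
    and emeasure_mixture: "A \<in> sets borel \<Longrightarrow> emeasure (\<nu> \<bind> \<kappa>) A = (\<integral>\<^sup>+y. emeasure (\<kappa> y) A \<partial>\<nu>)"
    and state_law_mixture: "B \<in> sets borel \<Longrightarrow> emeasure (\<nu> \<bind> \<kappa>) {\<omega>. fst (\<omega> 0) \<in> B} = emeasure \<nu> B"
proof -
  have \<kappa>': "\<kappa> \<in> \<nu> \<rightarrow>\<^sub>M prob_algebra borel"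
    using \<kappa> by (simp only: measurable_cong_sets[OF \<nu>(2) refl])
  have \<nu>': "\<nu> \<in> space (prob_algebra \<nu>)"
    using \<nu>(1) by (simp add: space_prob_algebra)
  have em: "emeasure (\<nu> \<bind> \<kappa>) A = (\<integral>\<^sup>+y. emeasure (\<kappa> y) A \<partial>\<nu>)" if "A \<in> sets borel" for A
    by (rule emeasure_bind_prob_algebra[OF \<nu>' \<kappa>' that])
  then show "A \<in> sets borel \<Longrightarrow> emeasure (\<nu> \<bind> \<kappa>) A = (\<integral>\<^sup>+y. emeasure (\<kappa> y) A \<partial>\<nu>)" .
  have int: "(\<integral>\<^sup>+\<omega>. f \<omega> \<partial>(\<nu> \<bind> \<kappa>)) = (\<integral>\<^sup>+y. \<integral>\<^sup>+\<omega>. f \<omega> \<partial>\<kappa> y \<partial>\<nu>)" if "f \<in> borel_measurable borel" for f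
    by (rule nn_integral_bind[OF that measurable_prob_algebraD[OF \<kappa>']])
  have Q: "prob_space (\<nu> \<bind> \<kappa>)" "sets (\<nu> \<bind> \<kappa>) = sets borel"
    by (rule prob_space_bind'[OF \<nu>' \<kappa>'], rule sets_bind'[OF \<nu>' \<kappa>'])
  show "emeasure (\<nu> \<bind> \<kappa>) {\<omega>. fst (\<omega> 0) \<in> B} = emeasure \<nu> B" if B: "B \<in> sets borel"
  proof -
    have "{\<omega> :: ('x, 'u) path. fst (\<omega> 0) \<in> B} \<in> sets borel"
      using measurable_sets[OF measurable_state B, of 0] by (simp add: vimage_def)
    then have "emeasure (\<nu> \<bind> \<kappa>) {\<omega>. fst (\<omega> 0) \<in> B} = (\<integral>\<^sup>+y. emeasure (\<kappa> y) {\<omega>. fst (\<omega> 0) \<in> B} \<partial>\<nu>)"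
      by (rule em)
    also have "\<dots> = (\<integral>\<^sup>+y. indicator B y \<partial>\<nu>)"
    proof (rule nn_integral_cong_AE)
      show "AE y in \<nu>. emeasure (\<kappa> y) {\<omega>. fst (\<omega> 0) \<in> B} = indicator B y"
        using ae
      proof eventually_elim
        case (elim y)
        then have s: "strategic (\<kappa> y)" and y: "AE \<omega> in \<kappa> y. fst (\<omega> 0) = y"
          by (auto simp: strategies_def)
        interpret prob_space "\<kappa> y"
          by (rule strategicD[OF s])
        have sets: "{\<omega>. fst (\<omega> 0) \<in> B} \<in> events"
          using \<open>{\<omega> :: ('x, 'u) path. fst (\<omega> 0) \<in> B} \<in> sets borel\<close> strategicD(2)[OF s] by simp
        have "emeasure (\<kappa> y) {\<omega>. fst (\<omega> 0) \<in> B} = emeasure (\<kappa> y) (if y \<in> B then space (\<kappa> y) else {})"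
          using y sets sets.top[of "\<kappa> y"] by (intro emeasure_eq_AE) (auto elim!: eventually_mono simp: space_strategic[OF s])
        then show ?case
          by (simp add: emeasure_space_1)
      qed
    qed
    also have "\<dots> = emeasure \<nu> B"
      using B \<nu>(2) by simp
    finally show ?thesis .
  qed
  show "strategic (\<nu> \<bind> \<kappa>)"
  proof (rule strategicI[OF Q])
    fix n
    have cm: "(\<lambda>\<omega>. \<omega> n) \<in> (\<nu> \<bind> \<kappa>) \<rightarrow>\<^sub>M borel"
      using measurable_product_coordinates by (simp only: measurable_cong_sets[OF Q(2) refl])
    show "AE \<omega> in \<nu> \<bind> \<kappa>. \<omega> n \<in> K"
    proof (subst AE_analytic_iff[OF Q(1) cm analytic_K], intro ballI impI)
      fix S :: "('x \<times> 'u) set" assume S: "S \<in> sets borel" "S \<inter> K = {}"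
      have Sn: "{\<omega> :: ('x, 'u) path. \<omega> n \<in> S} \<in> sets borel"
        using measurable_sets[OF measurable_product_coordinates S(1)] by (simp add: vimage_def)
      have "emeasure (\<nu> \<bind> \<kappa>) {\<omega>. \<omega> n \<in> S} = (\<integral>\<^sup>+y. emeasure (\<kappa> y) {\<omega>. \<omega> n \<in> S} \<partial>\<nu>)"
        by (rule em[OF Sn])
      also have "\<dots> = (\<integral>\<^sup>+y. 0 \<partial>\<nu>)"
      proof (rule nn_integral_cong_AE)
        show "AE y in \<nu>. emeasure (\<kappa> y) {\<omega>. \<omega> n \<in> S} = 0"
          using ae
        proof eventually_elim
          case (elim y)
          then have s: "strategic (\<kappa> y)"
            by (rule strategies_strategic)
          have "AE \<omega> in \<kappa> y. \<omega> \<notin> {\<omega>. \<omega> n \<in> S}"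
            using strategicD(3)[OF s, of n] S(2) by (auto elim!: eventually_mono)
          then have "{\<omega>. \<omega> n \<in> S} \<in> null_sets (\<kappa> y)"
            using Sn strategicD(2)[OF s] by (intro AE_iff_null_sets[THEN iffD2]) simp_all
          then show ?case
            by (simp add: null_sets_def)
        qed
      qed
      finally have "{\<omega>. \<omega> n \<in> S} \<in> null_sets (\<nu> \<bind> \<kappa>)"
        using Sn Q(2) by (simp add: null_sets_def)
      from AE_not_in[OF this] show "AE \<omega> in \<nu> \<bind> \<kappa>. \<omega> n \<notin> S"
        by simp
    qed
    fix i
    let ?D = "borel_gen i :: (('x, 'u) path \<times> 'x) set"
    have "emeasure (\<nu> \<bind> \<kappa>) {\<omega>. (freeze n \<omega>, fst (\<omega> (Suc n))) \<in> ?D} =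
        (\<integral>\<^sup>+y. emeasure (\<kappa> y) {\<omega>. (freeze n \<omega>, fst (\<omega> (Suc n))) \<in> ?D} \<partial>\<nu>)"
      by (rule em[OF transition_set_measurable[OF sets_borel_gen]])
    also have "\<dots> = (\<integral>\<^sup>+y. \<integral>\<^sup>+\<omega>. emeasure (T (\<omega> n)) {x. (freeze n \<omega>, x) \<in> ?D} \<partial>\<kappa> y \<partial>\<nu>)"
    proof (rule nn_integral_cong_AE)
      show "AE y in \<nu>. emeasure (\<kappa> y) {\<omega>. (freeze n \<omega>, fst (\<omega> (Suc n))) \<in> ?D} =
          (\<integral>\<^sup>+\<omega>. emeasure (T (\<omega> n)) {x. (freeze n \<omega>, x) \<in> ?D} \<partial>\<kappa> y)"
        using ae by eventually_elim (rule strategicD(4)[OF strategies_strategic sets_borel_gen])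
    qed
    also have "\<dots> = (\<integral>\<^sup>+\<omega>. emeasure (T (\<omega> n)) {x. (freeze n \<omega>, x) \<in> ?D} \<partial>(\<nu> \<bind> \<kappa>))"
      by (rule int[OF transition_integrand_measurable[OF sets_borel_gen], symmetric])
    finally show "emeasure (\<nu> \<bind> \<kappa>) {\<omega>. (freeze n \<omega>, fst (\<omega> (Suc n))) \<in> ?D} = \<dots>" .
  qed
qed

text \<open>The transition identity at time zero is the hypothesis on the initial state of
  \<open>Q\<close>; at later times it is the identity of \<open>Q\<close> one step earlier.\<close>

lemma strategic_prepend:
  assumes Q: "strategic Q" and K: "(x, u) \<in> K"
    and law: "\<And>B. B \<in> sets borel \<Longrightarrow> emeasure Q {\<omega>. fst (\<omega> 0) \<in> B} = emeasure (T (x, u)) B"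
  shows "distr Q borel (case_nat (x, u)) \<in> strategies x"
proof -
  note D = strategicD[OF Q]
  let ?c = "case_nat (x, u) :: ('x, 'u) path \<Rightarrow> ('x, 'u) path"
  let ?P = "distr Q borel ?c"
  have cm: "?c \<in> Q \<rightarrow>\<^sub>M borel"
    by (rule measurable_strategic[OF Q measurable_case_nat_path])
  have P1: "prob_space ?P"
    by (rule prob_space.prob_space_distr[OF D(1) cm])
  have "strategic ?P"
  proof (rule strategicI[OF P1])
    show "sets ?P = sets borel"
      by simp
    show "AE \<omega> in ?P. \<omega> n \<in> K" for n
    proof (rule AE_distr_analytic[OF D(1) cm measurable_product_coordinates analytic_K])
      show "AE \<omega> in Q. case_nat (x, u) \<omega> n \<in> K"
        using K D(3) by (cases n) auto
    qed
    fix n i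
    let ?D = "borel_gen i :: (('x, 'u) path \<times> 'x) set"
    have lhs: "emeasure ?P {\<omega>. (freeze n \<omega>, fst (\<omega> (Suc n))) \<in> ?D} = emeasure Q {\<omega>. (freeze n (?c \<omega>), fst (\<omega> n)) \<in> ?D}"
      using transition_set_measurable[OF sets_borel_gen, of n "Suc n" i]
      by (simp add: emeasure_distr[OF cm] space_strategic[OF Q] vimage_def)
    have rhs: "(\<integral>\<^sup>+\<omega>. emeasure (T (\<omega> n)) {x. (freeze n \<omega>, x) \<in> ?D} \<partial>?P) =
        (\<integral>\<^sup>+\<omega>. emeasure (T (?c \<omega> n)) {x. (freeze n (?c \<omega>), x) \<in> ?D} \<partial>Q)"
      using transition_integrand_measurable[OF sets_borel_gen] by (intro nn_integral_distr[OF cm]) simp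
    show "emeasure ?P {\<omega>. (freeze n \<omega>, fst (\<omega> (Suc n))) \<in> ?D} =
        (\<integral>\<^sup>+\<omega>. emeasure (T (\<omega> n)) {x. (freeze n \<omega>, x) \<in> ?D} \<partial>?P)"
    proof (cases n)
      case 0
      have fr: "freeze 0 (?c \<omega>) = (\<lambda>_. (x, u))" for \<omega>
        by (simp add: freeze_def)
      have "Pair (\<lambda>_. (x, u)) -` ?D \<inter> space borel \<in> sets borel"
        by (rule measurable_sets[OF borel_measurable_continuous_onI sets_borel_gen]) (intro continuous_intros)
      then have "{y. (\<lambda>_. (x, u), y) \<in> ?D} \<in> sets borel"
        by (simp add: vimage_def)
      from law[OF this] show ?thesis
        unfolding lhs rhs using prob_space.emeasure_space_1[OF D(1)] by (simp add: 0 fr)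
    next
      case (Suc k)
      let ?D' = "(\<lambda>z. (?c (fst z), snd z)) -` ?D \<inter> space borel"
      have D': "?D' \<in> sets borel"
        by (rule measurable_sets[OF _ sets_borel_gen])
          (intro borel_measurable_Pair measurable_compose[OF measurable_fst_borel measurable_case_nat_path] measurable_snd_borel)
      show ?thesis
        unfolding lhs rhs using D(4)[OF D', of k] by (simp add: Suc freeze_case_nat)
    qed
  qed
  moreover have "AE \<omega> in ?P. fst (\<omega> 0) = x"
    by (subst AE_distr_iff[OF cm]) (simp_all, measurable)
  ultimately show ?thesis
    by (simp add: strategies_def)
qed

text \<open>Conditioning on the initial state. Each of the countably many defining conditions,
  integrated over a Borel set of initial states, is again a condition on \<open>Q\<close>; hence it
  holds for almost every initial state, and the exceptional sets are united.\<close>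

lemma strategic_disintegration:
  assumes Q: "strategic Q"
  obtains \<kappa> where "\<kappa> \<in> borel \<rightarrow>\<^sub>M prob_algebra borel"
    and "AE y in distr Q borel (\<lambda>\<omega>. fst (\<omega> 0)). \<kappa> y \<in> strategies y"
    and "\<And>A. A \<in> sets borel \<Longrightarrow> emeasure Q A = (\<integral>\<^sup>+y. emeasure (\<kappa> y) A \<partial>distr Q borel (\<lambda>\<omega>. fst (\<omega> 0)))"
proof -
  note D = strategicD[OF Q]
  have m0: "(\<lambda>\<omega>. fst (\<omega> 0)) \<in> Q \<rightarrow>\<^sub>M borel"
    by (rule measurable_strategic[OF Q measurable_state])
  have idm: "(\<lambda>\<omega>. \<omega>) \<in> Q \<rightarrow>\<^sub>M borel"
    by (rule measurable_strategic[OF Q]) simp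
  have pm: "(\<lambda>\<omega>. (fst (\<omega> 0), \<omega>)) \<in> Q \<rightarrow>\<^sub>M borel \<Otimes>\<^sub>M borel"
    by (rule measurable_Pair[OF m0 idm])
  define R where "R = distr Q (borel \<Otimes>\<^sub>M borel) (\<lambda>\<omega>. (fst (\<omega> 0), \<omega>))"
  have R: "prob_space R" "sets R = sets (borel \<Otimes>\<^sub>M borel)"
    unfolding R_def by (rule prob_space.prob_space_distr[OF D(1) pm], simp)
  let ?\<nu> = "distr Q borel (\<lambda>\<omega>. fst (\<omega> 0))"
  have \<nu>: "prob_space ?\<nu>"
    by (rule prob_space.prob_space_distr[OF D(1) m0])
  have "distr R borel fst = ?\<nu>"
    unfolding R_def using distr_distr[OF measurable_fst pm] by (simp add: o_def)
  then obtain \<kappa> where \<kappa>: "\<kappa> \<in> borel \<rightarrow>\<^sub>M prob_algebra borel" and R\<kappa>: "R = semidirect ?\<nu> borel \<kappa>"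
    using disintegration[OF R] by metis
  have \<kappa>': "\<kappa> \<in> ?\<nu> \<rightarrow>\<^sub>M prob_algebra borel"
    using \<kappa> by simp
  have \<kappa>p: "prob_space (\<kappa> y)" "sets (\<kappa> y) = sets borel" for y
    using measurable_space[OF \<kappa>, of y] by (auto simp: space_prob_algebra)
  have int: "(\<integral>\<^sup>+\<omega>. f (fst (\<omega> 0), \<omega>) \<partial>Q) = (\<integral>\<^sup>+y. \<integral>\<^sup>+\<omega>. f (y, \<omega>) \<partial>\<kappa> y \<partial>?\<nu>)"
    if f: "f \<in> borel_measurable (borel \<Otimes>\<^sub>M borel)" for f
  proof -
    have "(\<integral>\<^sup>+\<omega>. f (fst (\<omega> 0), \<omega>) \<partial>Q) = (\<integral>\<^sup>+z. f z \<partial>R)"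
      unfolding R_def using f by (intro nn_integral_distr[OF pm, symmetric]) simp
    also have "\<dots> = (\<integral>\<^sup>+y. \<integral>\<^sup>+\<omega>. f (y, \<omega>) \<partial>\<kappa> y \<partial>?\<nu>)"
      unfolding R\<kappa> using f by (intro nn_integral_semidirect[OF \<nu> \<kappa>']) (simp cong: measurable_cong_sets sets_pair_measure_cong)
    finally show ?thesis .
  qed
  have ae0: "AE y in ?\<nu>. AE \<omega> in \<kappa> y. fst (\<omega> 0) = y"
  proof -
    have "AE z in R. fst (snd z 0) = fst z"
      unfolding R_def
    proof (subst AE_distr_iff[OF pm])
      have "Measurable.pred (borel \<Otimes>\<^sub>M borel) (\<lambda>z :: 'x \<times> ('x, 'u) path. fst (snd z 0) = fst z)"
        by (intro measurable_eq_souslin measurable_compose[OF measurable_snd measurable_state] measurable_fst)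
      then show "{z \<in> space (borel \<Otimes>\<^sub>M borel). fst ((snd z :: ('x, 'u) path) 0) = fst z} \<in> sets (borel \<Otimes>\<^sub>M borel)"
        by (simp add: pred_def)
    qed simp
    then have "AE z in semidirect ?\<nu> borel \<kappa>. fst (snd z 0) = fst z"
      by (simp only: R\<kappa>[symmetric])
    from AE_semidirect[OF \<nu> \<kappa>' this] show ?thesis
      by simp
  qed
  have aeK: "AE y in ?\<nu>. AE \<omega> in \<kappa> y. \<omega> n \<in> K" for n
  proof -
    have "AE z in R. snd z n \<in> K"
      unfolding R_def
      by (rule AE_distr_analytic[OF D(1) pm measurable_compose[OF measurable_snd measurable_product_coordinates] analytic_K])
        (use D(3) in simp)
    then have "AE z in semidirect ?\<nu> borel \<kappa>. snd z n \<in> K"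
      by (simp only: R\<kappa>[symmetric])
    from AE_semidirect[OF \<nu> \<kappa>' this] show ?thesis
      by simp
  qed
  have aeT: "AE y in ?\<nu>. emeasure (\<kappa> y) {\<omega>. (freeze n \<omega>, fst (\<omega> (Suc n))) \<in> borel_gen i} =
      (\<integral>\<^sup>+\<omega>. emeasure (T (\<omega> n)) {x. (freeze n \<omega>, x) \<in> borel_gen i} \<partial>\<kappa> y)" for n i
  proof (rule finite_measure_AE_eqI)
    let ?D = "borel_gen i :: (('x, 'u) path \<times> 'x) set"
    let ?E = "{\<omega>. (freeze n \<omega>, fst (\<omega> (Suc n))) \<in> ?D}"
    let ?t = "\<lambda>\<omega>. emeasure (T (\<omega> n)) {x. (freeze n \<omega>, x) \<in> ?D}"
    have E: "?E \<in> sets borel"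
      by (rule transition_set_measurable[OF sets_borel_gen])
    have t: "?t \<in> borel_measurable borel"
      by (rule transition_integrand_measurable[OF sets_borel_gen])
    show "finite_measure ?\<nu>"
      using \<nu> by (rule prob_space.finite_measure)
    show "(\<lambda>y. emeasure (\<kappa> y) ?E) \<in> borel_measurable ?\<nu>"
      by (rule measurable_emeasure_kernel[OF measurable_prob_algebraD[OF \<kappa>'] E])
    show "(\<lambda>y. \<integral>\<^sup>+\<omega>. ?t \<omega> \<partial>\<kappa> y) \<in> borel_measurable ?\<nu>"
      by (rule measurable_compose[OF measurable_prob_algebraD[OF \<kappa>'] nn_integral_measurable_subprob_algebra[OF t]])
    fix C assume "C \<in> sets ?\<nu>"
    then have C: "C \<in> sets borel"
      by simp
    \<comment> \<open>Freezing keeps coordinate zero, so the restriction to initial states in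
      \<open>C\<close> can be absorbed into the test set.\<close>
    let ?D' = "?D \<inter> ((\<lambda>z. fst (fst z 0)) -` C \<inter> space borel)"
    have D': "?D' \<in> sets borel"
      by (intro sets.Int sets_borel_gen measurable_sets[OF measurable_compose[OF measurable_fst_borel measurable_state] C])
    have fr0: "freeze n \<omega> 0 = \<omega> 0" for \<omega> :: "('x, 'u) path"
      by (simp add: freeze_def)
    have "(\<integral>\<^sup>+y. emeasure (\<kappa> y) ?E * indicator C y \<partial>?\<nu>) = (\<integral>\<^sup>+y. \<integral>\<^sup>+\<omega>. indicator C y * indicator ?E \<omega> \<partial>\<kappa> y \<partial>?\<nu>)"
    proof (rule nn_integral_cong)
      fix y
      have "(\<integral>\<^sup>+\<omega>. indicator C y * indicator ?E \<omega> \<partial>\<kappa> y) = indicator C y * emeasure (\<kappa> y) ?E"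
        using E \<kappa>p(2) by (intro nn_integral_cmult_indicator) simp
      then show "emeasure (\<kappa> y) ?E * indicator C y = (\<integral>\<^sup>+\<omega>. indicator C y * indicator ?E \<omega> \<partial>\<kappa> y)"
        by (simp only: mult.commute)
    qed
    also have "\<dots> = (\<integral>\<^sup>+\<omega>. indicator C (fst (\<omega> 0)) * indicator ?E \<omega> \<partial>Q)"
    proof (rule int[symmetric, of "\<lambda>z. indicator C (fst z) * indicator ?E (snd z)", simplified])
      show "(\<lambda>z. indicator C (fst z) * indicator ?E (snd z) :: ennreal) \<in> borel_measurable (borel \<Otimes>\<^sub>M borel)"
        by (intro borel_measurable_times_ennreal measurable_compose[OF measurable_fst] measurable_compose[OF measurable_snd]
            borel_measurable_indicator C E)
    qed
    also have "\<dots> = (\<integral>\<^sup>+\<omega>. indicator {\<omega>. (freeze n \<omega>, fst (\<omega> (Suc n))) \<in> ?D'} \<omega> \<partial>Q)"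
      by (intro nn_integral_cong) (auto simp: fr0 split: split_indicator)
    also have "\<dots> = emeasure Q {\<omega>. (freeze n \<omega>, fst (\<omega> (Suc n))) \<in> ?D'}"
      using transition_set_measurable[OF D', of n "Suc n"] D(2) by (intro nn_integral_indicator) simp
    also have "\<dots> = (\<integral>\<^sup>+\<omega>. emeasure (T (\<omega> n)) {x. (freeze n \<omega>, x) \<in> ?D'} \<partial>Q)"
      by (rule D(4)[OF D'])
    also have "\<dots> = (\<integral>\<^sup>+\<omega>. indicator C (fst (\<omega> 0)) * ?t \<omega> \<partial>Q)"
      by (intro nn_integral_cong) (auto simp: fr0 split: split_indicator)
    also have "\<dots> = (\<integral>\<^sup>+y. \<integral>\<^sup>+\<omega>. indicator C y * ?t \<omega> \<partial>\<kappa> y \<partial>?\<nu>)"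
    proof (rule int[of "\<lambda>z. indicator C (fst z) * ?t (snd z)", simplified])
      show "(\<lambda>z. indicator C (fst z) * ?t (snd z)) \<in> borel_measurable (borel \<Otimes>\<^sub>M borel)"
        by (intro borel_measurable_times_ennreal measurable_compose[OF measurable_fst] measurable_compose[OF measurable_snd t]
            borel_measurable_indicator C)
    qed
    also have "\<dots> = (\<integral>\<^sup>+y. (\<integral>\<^sup>+\<omega>. ?t \<omega> \<partial>\<kappa> y) * indicator C y \<partial>?\<nu>)"
    proof (rule nn_integral_cong)
      fix y
      have "?t \<in> borel_measurable (\<kappa> y)"
        using t by (simp only: measurable_cong_sets[OF \<kappa>p(2) refl])
      then show "(\<integral>\<^sup>+\<omega>. indicator C y * ?t \<omega> \<partial>\<kappa> y) = (\<integral>\<^sup>+\<omega>. ?t \<omega> \<partial>\<kappa> y) * indicator C y"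
        by (simp add: nn_integral_cmult mult.commute)
    qed
    finally show "(\<integral>\<^sup>+y. emeasure (\<kappa> y) ?E * indicator C y \<partial>?\<nu>) = \<dots>" .
  qed
  have "AE y in ?\<nu>. \<forall>n. AE \<omega> in \<kappa> y. \<omega> n \<in> K"
    using aeK by (simp add: AE_all_countable)
  moreover have "AE y in ?\<nu>. \<forall>n i. emeasure (\<kappa> y) {\<omega>. (freeze n \<omega>, fst (\<omega> (Suc n))) \<in> borel_gen i} =
      (\<integral>\<^sup>+\<omega>. emeasure (T (\<omega> n)) {x. (freeze n \<omega>, x) \<in> borel_gen i} \<partial>\<kappa> y)"
    using aeT by (simp add: AE_all_countable)
  ultimately have "AE y in ?\<nu>. \<kappa> y \<in> strategies y"
    using ae0
  proof eventually_elim
    case (elim y)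
    then have "strategic (\<kappa> y)"
      by (intro strategicI \<kappa>p) auto
    with elim show ?case
      by (simp add: strategies_def)
  qed
  moreover have "emeasure Q A = (\<integral>\<^sup>+y. emeasure (\<kappa> y) A \<partial>?\<nu>)" if A: "A \<in> sets borel" for A
  proof -
    have "emeasure Q A = (\<integral>\<^sup>+\<omega>. indicator A \<omega> \<partial>Q)"
      using A D(2) by simp
    also have "\<dots> = (\<integral>\<^sup>+y. \<integral>\<^sup>+\<omega>. indicator A \<omega> \<partial>\<kappa> y \<partial>?\<nu>)"
      by (rule int[of "\<lambda>z. indicator A (snd z)", simplified])
        (intro measurable_compose[OF measurable_snd] borel_measurable_indicator A)
    finally show ?thesis
      using A \<kappa>p(2) by simp
  qed
  ultimately show ?thesis
    using \<kappa> that by blast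
qed

section \<open>Optimal values\<close>

text \<open>Each \<open>D k\<close> is uniformized separately, and the least admissible
  \<open>k\<close> is universally measurable. If the \<open>D k\<close> collect choices of
  decreasing quality, taking the least index is almost optimal, because failure at the index before
  bounds the optimum.\<close>

lemma uniformization_least:
  fixes D :: "nat \<Rightarrow> ('x \<times> 'b::souslin_space) set"
  assumes D: "\<And>k. analytic (D k)" and ex: "\<And>x. \<exists>k. x \<in> fst ` D k"
  obtains s where "s \<in> univ_completion borel \<rightarrow>\<^sub>M borel" "\<And>x. (x, s x) \<in> D (LEAST k. x \<in> fst ` D k)"
proof -
  have "\<exists>s. s \<in> univ_completion borel \<rightarrow>\<^sub>M borel \<and> (\<forall>x\<in>fst ` D k. (x, s x) \<in> D k)" for k
  proof (cases "D k = {}")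
    case True
    then show ?thesis
      by (intro exI[of _ "\<lambda>_. undefined"]) simp
  next
    case False
    then obtain d :: "(nat \<Rightarrow> nat) \<Rightarrow> 'x \<times> 'b" where d: "continuous_on UNIV d" "range d = D k"
      using D[of k] by (auto simp: analytic_def)
    have "continuous_on UNIV (\<lambda>y. fst (d y))"
      using d(1) by (rule continuous_on_fst)
    then obtain s where s: "s \<in> univ_completion borel \<rightarrow>\<^sub>M borel"
      "\<And>a. a \<in> range (\<lambda>y. fst (d y)) \<Longrightarrow> fst (d (s a)) = a"
      by (metis Jankov_von_Neumann)
    have "(\<lambda>x. snd (d (s x))) \<in> univ_completion borel \<rightarrow>\<^sub>M borel"
      by (intro measurable_compose[OF s(1)] measurable_compose[OF borel_measurable_continuous_onI[OF d(1)]] measurable_snd_borel)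
    moreover have "(x, snd (d (s x))) \<in> D k" if x: "x \<in> fst ` D k" for x
    proof -
      obtain b where "(x, b) \<in> range d"
        using x d(2) by auto
      then have "x \<in> range (\<lambda>y. fst (d y))"
        by (metis fst_conv imageE rangeI)
      then have "fst (d (s x)) = x"
        by (rule s(2))
      moreover have "d (s x) \<in> D k"
        using d(2) by auto
      ultimately show ?thesis
        by (metis prod.collapse)
    qed
    ultimately show ?thesis
      by blast
  qed
  then obtain s where s: "\<And>k. s k \<in> univ_completion borel \<rightarrow>\<^sub>M borel" "\<And>k x. x \<in> fst ` D k \<Longrightarrow> (x, s k x) \<in> D k"
    by metis
  have "Measurable.pred (univ_completion borel) (\<lambda>x. x \<in> fst ` D k)" for k
    using analytic_univ_completion[OF analytic_image[OF D measurable_fst_borel, of k]] by (simp add: pred_def)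
  then have least: "(\<lambda>x. LEAST k. x \<in> fst ` D k) \<in> univ_completion borel \<rightarrow>\<^sub>M count_space UNIV"
    by (rule measurable_Least)
  show ?thesis
  proof
    show "(\<lambda>x. s (LEAST k. x \<in> fst ` D k) x) \<in> univ_completion borel \<rightarrow>\<^sub>M borel"
      by (rule measurable_compose_countable[OF s(1) least])
    show "(x, s (LEAST k. x \<in> fst ` D k) x) \<in> D (LEAST k. x \<in> fst ` D k)" for x
      using ex[of x] by (intro s(2)) (rule LeastI_ex)
  qed
qed

text \<open>The constraint by \<open>K\<close> contributes an analytic condition on the code. The
  transition identities and the initial state are compared on a countable generator and are Borel in
  state and code.\<close>

lemma analytic_strategic_codes:
  assumes c: "c \<in> (borel :: (nat \<Rightarrow> nat) measure) \<rightarrow>\<^sub>M prob_algebra borel"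
  shows "analytic {(x, y). c y \<in> strategies x}"
proof -
  have cp: "prob_space (c y)" "sets (c y) = sets borel" for y
    using measurable_space[OF c, of y] by (auto simp: space_prob_algebra)
  have cs: "c \<in> borel \<rightarrow>\<^sub>M subprob_algebra borel"
    by (rule measurable_prob_algebraD[OF c])
  let ?t = "\<lambda>n i \<omega>. emeasure (T (\<omega> n)) {x. (freeze n \<omega>, x) \<in> borel_gen i}"
  let ?E = "\<lambda>n i. {\<omega> :: ('x, 'u) path. (freeze n \<omega>, fst (\<omega> (Suc n))) \<in> borel_gen i}"
  let ?X = "\<lambda>i. {\<omega> :: ('x, 'u) path. fst (\<omega> 0) \<in> borel_gen i}"
  have X: "?X i \<in> sets borel" for i
    using measurable_sets[OF measurable_state sets_borel_gen, of 0 i] by (simp add: vimage_def)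
  \<comment> \<open>Probability one is expressed by countably many strict lower bounds, the form in
    which the measure of an analytic set gives analytic conditions.\<close>
  have K_iff: "(AE \<omega> in c y. \<omega> n \<in> K) \<longleftrightarrow> (\<forall>k. 1 - 1 / Suc k < measure (completion (distr (c y) borel (\<lambda>\<omega>. \<omega> n))) K)" for y n
  proof -
    have cm: "(\<lambda>\<omega>. \<omega> n) \<in> c y \<rightarrow>\<^sub>M borel"
      using measurable_product_coordinates by (simp only: measurable_cong_sets[OF cp(2) refl])
    let ?d = "distr (c y) borel (\<lambda>\<omega>. \<omega> n)"
    have d: "prob_space ?d"
      by (rule prob_space.prob_space_distr[OF cp(1) cm])
    interpret C: prob_space "completion ?d"
      by (rule prob_space.prob_space_completion[OF d])
    have KC: "K \<in> sets (completion ?d)"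
      by (rule analytic_sets_completion[OF d _ analytic_K]) simp
    have "(AE \<omega> in c y. \<omega> n \<in> K) \<longleftrightarrow> (AE z in ?d. z \<in> K)"
      using AE_distr_analytic[OF cp(1) cm measurable_ident_sets[OF refl] analytic_K] AE_distrD[OF cm, of "\<lambda>z. z \<in> K"] by blast
    also have "\<dots> \<longleftrightarrow> C.prob K = 1"
      using C.AE_in_set_eq_1[OF KC] by (simp add: AE_completion_iff)
    also have "\<dots> \<longleftrightarrow> (\<forall>k. 1 - 1 / Suc k < C.prob K)"
    proof
      assume *: "\<forall>k. 1 - 1 / Suc k < C.prob K"
      show "C.prob K = 1"
      proof (rule ccontr)
        assume "C.prob K \<noteq> 1"
        then have "0 < 1 - C.prob K"
          using C.prob_le_1[of K] by linarith
        then obtain k where "1 / Suc k < 1 - C.prob K"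
          using nat_approx_posE by blast
        with * show False
          by (smt (verit))
      qed
    qed simp
    finally show ?thesis .
  qed
  have "analytic {y. \<forall>n. AE \<omega> in c y. \<omega> n \<in> K}"
  proof -
    have "analytic (\<Inter>n. \<Inter>k. {y. 1 - 1 / Suc k < measure (completion (distr (c y) borel (\<lambda>\<omega>. \<omega> n))) K})"
      by (intro analytic_INT_countable analytic_measure_gt analytic_K
          measurable_compose[OF c measurable_distr_prob_space[OF measurable_product_coordinates]])
    also have "(\<Inter>n. \<Inter>k. {y. 1 - 1 / Suc k < measure (completion (distr (c y) borel (\<lambda>\<omega>. \<omega> n))) K}) =
        {y. \<forall>n. AE \<omega> in c y. \<omega> n \<in> K}"
      unfolding K_iff by auto
    finally show ?thesis .
  qed
  then have "analytic (snd -` {y. \<forall>n. AE \<omega> in c y. \<omega> n \<in> K} :: ('x \<times> (nat \<Rightarrow> nat)) set)"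
    by (rule analytic_vimage) (rule measurable_snd_borel)
  moreover have "analytic {z :: 'x \<times> (nat \<Rightarrow> nat). (\<forall>n i. emeasure (c (snd z)) (?E n i) = (\<integral>\<^sup>+\<omega>. ?t n i \<omega> \<partial>c (snd z))) \<and>
      (\<forall>i. emeasure (c (snd z)) (?X i) = indicator (borel_gen i) (fst z))}" (is "analytic ?B")
  proof (rule borel_imp_analytic)
    have [measurable]: "(\<lambda>y. emeasure (c y) (?E n i)) \<in> borel_measurable borel" for n i
      by (rule measurable_emeasure_kernel[OF cs transition_set_measurable[OF sets_borel_gen]])
    have [measurable]: "(\<lambda>y. \<integral>\<^sup>+\<omega>. ?t n i \<omega> \<partial>c y) \<in> borel_measurable borel" for n i
      by (rule measurable_compose[OF cs nn_integral_measurable_subprob_algebra[OF transition_integrand_measurable[OF sets_borel_gen]]])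
    have [measurable]: "(\<lambda>y. emeasure (c y) (?X i)) \<in> borel_measurable borel" for i
      by (rule measurable_emeasure_kernel[OF cs X])
    have "{z \<in> space borel. (\<forall>n i. emeasure (c (snd z)) (?E n i) = (\<integral>\<^sup>+\<omega>. ?t n i \<omega> \<partial>c (snd z))) \<and>
        (\<forall>i. emeasure (c (snd z)) (?X i) = indicator (borel_gen i) (fst z))} \<in> sets (borel :: ('x \<times> (nat \<Rightarrow> nat)) measure)"
      by measurable
    then show "?B \<in> sets borel"
      by simp
  qed
  ultimately have "analytic (snd -` {y. \<forall>n. AE \<omega> in c y. \<omega> n \<in> K} \<inter> ?B)"
    by (rule analytic_Int)
  also have "snd -` {y. \<forall>n. AE \<omega> in c y. \<omega> n \<in> K} \<inter> ?B = {(x, y). c y \<in> strategies x}"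
  proof -
    have "c y \<in> strategies x \<longleftrightarrow> (\<forall>n. AE \<omega> in c y. \<omega> n \<in> K) \<and>
        (\<forall>n i. emeasure (c y) (?E n i) = (\<integral>\<^sup>+\<omega>. ?t n i \<omega> \<partial>c y)) \<and>
        (\<forall>i. emeasure (c y) (?X i) = indicator (borel_gen i) x)" for x y
    proof -
      have m0: "(\<lambda>\<omega>. fst (\<omega> 0)) \<in> c y \<rightarrow>\<^sub>M borel"
        using measurable_state by (simp only: measurable_cong_sets[OF cp(2) refl])
      have sp: "space (c y) = UNIV"
        using sets_eq_imp_space_eq[OF cp(2)] by simp
      have pd: "prob_space (distr (c y) borel (\<lambda>\<omega>. fst (\<omega> 0)))"
        by (rule prob_space.prob_space_distr[OF cp(1) m0])
      have emd: "emeasure (distr (c y) borel (\<lambda>\<omega>. fst (\<omega> 0))) (borel_gen i) = emeasure (c y) (?X i)" for i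
        by (simp add: emeasure_distr[OF m0] sp vimage_def)
      have "(AE \<omega> in c y. fst (\<omega> 0) = x) \<longleftrightarrow> distr (c y) borel (\<lambda>\<omega>. fst (\<omega> 0)) = return borel x"
      proof
        assume "AE \<omega> in c y. fst (\<omega> 0) = x"
        then have "distr (c y) borel (\<lambda>\<omega>. fst (\<omega> 0)) = distr (c y) borel (\<lambda>_. x)"
          using m0 by (intro distr_cong_AE) simp_all
        then show "distr (c y) borel (\<lambda>\<omega>. fst (\<omega> 0)) = return borel x"
          using prob_space.distr_const[OF cp(1), of x borel] by simp
      next
        assume "distr (c y) borel (\<lambda>\<omega>. fst (\<omega> 0)) = return borel x"
        moreover have "AE z in return borel x. z = x"
          by (subst AE_return) (simp_all, measurable)
        ultimately have "AE z in distr (c y) borel (\<lambda>\<omega>. fst (\<omega> 0)). z = x"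
          by (simp only:)
        from AE_distrD[OF m0 this] show "AE \<omega> in c y. fst (\<omega> 0) = x" .
      qed
      also have "\<dots> \<longleftrightarrow> (\<forall>i. emeasure (c y) (?X i) = indicator (borel_gen i) x)"
      proof
        assume eq: "\<forall>i. emeasure (c y) (?X i) = indicator (borel_gen i) x"
        show "distr (c y) borel (\<lambda>\<omega>. fst (\<omega> 0)) = return borel x"
          using pd eq by (intro measure_eqI_borel_gen) (simp_all add: emd prob_space.finite_measure)
      next
        assume eq: "distr (c y) borel (\<lambda>\<omega>. fst (\<omega> 0)) = return borel x"
        show "\<forall>i. emeasure (c y) (?X i) = indicator (borel_gen i) x"
          unfolding emd[symmetric] eq by simp
      qed
      finally have x: "(AE \<omega> in c y. fst (\<omega> 0) = x) \<longleftrightarrow> (\<forall>i. emeasure (c y) (?X i) = indicator (borel_gen i) x)" .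
      have s: "strategic (c y) \<longleftrightarrow> (\<forall>n. AE \<omega> in c y. \<omega> n \<in> K) \<and>
          (\<forall>n i. emeasure (c y) (?E n i) = (\<integral>\<^sup>+\<omega>. ?t n i \<omega> \<partial>c y))"
      proof
        assume "strategic (c y)"
        then show "(\<forall>n. AE \<omega> in c y. \<omega> n \<in> K) \<and> (\<forall>n i. emeasure (c y) (?E n i) = (\<integral>\<^sup>+\<omega>. ?t n i \<omega> \<partial>c y))"
          using strategicD(3) strategicD(4)[OF _ sets_borel_gen] by simp
      qed (intro strategicI cp, simp_all)
      show ?thesis
        unfolding strategies_def mem_Collect_eq s x by (simp only: conj_assoc)
    qed
    then show ?thesis
      by (auto simp: case_prod_beta')
  qed
  finally show ?thesis .
qed

section \<open>Optimal values as extrema over strategic measures\<close>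

lemma deterministic_policy:
  assumes g: "\<And>n. g n \<in> univ_completion borel \<rightarrow>\<^sub>M borel" "\<And>n x. (x, g n x) \<in> K"
  shows "(\<lambda>n h. return borel (g n (snd h))) \<in> policies K"
  unfolding policies_def
proof (intro CollectI allI conjI ballI)
  fix n and h :: "('x, 'u) hist"
  have "(\<lambda>h :: ('x, 'u) hist. g n (snd h)) \<in> univ_completion (hist_space n) \<rightarrow>\<^sub>M borel"
    by (rule univ_completion_compose[OF g(1)]) (simp add: hist_space_def)
  then show "(\<lambda>h. return borel (g n (snd h))) \<in> univ_completion (hist_space n :: ('x, 'u) hist measure) \<rightarrow>\<^sub>M prob_algebra borel"
    by (rule measurable_compose[OF _ measurable_return_prob_space])
  let ?r = "return borel (g n (snd h))"
  interpret C: prob_space "completion ?r"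
    by (intro prob_space.prob_space_completion prob_space_return) simp
  have "AE u in ?r. u = g n (snd h)"
    by (subst AE_return) (simp_all, measurable)
  then have ae: "AE u in ?r. u \<in> K `` {snd h}"
    by eventually_elim (use g(2) in auto)
  then have "Measurable.pred (completion ?r) (\<lambda>u. u \<notin> K `` {snd h})"
    by (intro sets_completion_AE) simp
  then have "Measurable.pred (completion ?r) (\<lambda>u. \<not> u \<notin> K `` {snd h})"
    by (rule pred_intros_logic)
  then have "K `` {snd h} \<in> sets (completion ?r)"
    by (simp add: pred_def Image_singleton)
  then have "C.prob (K `` {snd h}) = 1"
    using AE_completion[OF ae] by (simp only: C.AE_in_set_eq_1)
  then show "emeasure (completion ?r) (K `` {snd h}) = 1"
    by (simp add: C.emeasure_eq_measure del: emeasure_completion)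
qed

lemma strategies_nonempty: "strategies x \<noteq> {}"
proof -
  obtain s where "s \<in> univ_completion borel \<rightarrow>\<^sub>M borel" "\<And>x. (x, s x) \<in> K"
    using ex_selector by blast
  then have "policies K \<noteq> {}"
    using deterministic_policy[of "\<lambda>_. s"] by auto
  then show ?thesis
    using policies_path_measures[of x] by (auto simp: strategies_def)
qed

lemma M_sup_strategies: "M_sup K T A x = (SUP P\<in>strategies x. measure P A)"
  unfolding M_sup_def strategies_def policies_path_measures[symmetric] by (simp add: image_image)

lemma M_inf_strategies: "M_inf K T A x = (INF P\<in>strategies x. measure P A)"
  unfolding M_inf_def strategies_def policies_path_measures[symmetric] by (simp add: image_image)

lemma strategies_prob_space: "P \<in> strategies x \<Longrightarrow> prob_space P"
  by (rule strategicD(1)[OF strategies_strategic])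

lemma measure_le_M_sup: "P \<in> strategies x \<Longrightarrow> measure P A \<le> M_sup K T A x"
  unfolding M_sup_strategies
  by (intro cSUP_upper bdd_aboveI2[of _ _ 1] prob_space.prob_le_1 strategies_prob_space)

lemma M_sup_le: "(\<And>P. P \<in> strategies x \<Longrightarrow> measure P A \<le> b) \<Longrightarrow> M_sup K T A x \<le> b"
  unfolding M_sup_strategies by (intro cSUP_least strategies_nonempty)

lemma less_M_sup_iff: "c < M_sup K T A x \<longleftrightarrow> (\<exists>P\<in>strategies x. c < measure P A)"
  unfolding M_sup_strategies
  by (intro less_cSUP_iff strategies_nonempty bdd_aboveI2[of _ _ 1] prob_space.prob_le_1 strategies_prob_space)

lemma M_sup_bounds: "0 \<le> M_sup K T A x" "M_sup K T A x \<le> 1"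
proof -
  obtain P where P: "P \<in> strategies x"
    using strategies_nonempty by blast
  show "0 \<le> M_sup K T A x"
    using measure_le_M_sup[OF P, of A] measure_nonneg[of P A] by linarith
  show "M_sup K T A x \<le> 1"
    by (intro M_sup_le prob_space.prob_le_1 strategies_prob_space)
qed

lemma M_inf_eq_M_sup:
  assumes A: "A \<in> sets borel"
  shows "M_inf K T A x = 1 - M_sup K T (- A) x"
proof -
  have compl: "measure P (- A) = 1 - measure P A" if "P \<in> strategies x" for P
  proof -
    note s = strategies_strategic[OF that]
    show ?thesis
      using prob_space.prob_compl[OF strategicD(1)[OF s], of A] A strategicD(2)[OF s]
      by (simp add: space_strategic[OF s] Compl_eq_Diff_UNIV)
  qed
  have "bdd_below ((\<lambda>P. measure P A) ` strategies x)"
    by (intro bdd_belowI2[of _ 0]) simp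
  then show ?thesis
  proof (intro antisym)
    assume bdd: "bdd_below ((\<lambda>P. measure P A) ` strategies x)"
    have "M_sup K T (- A) x \<le> 1 - M_inf K T A x"
    proof (rule M_sup_le)
      fix P assume P: "P \<in> strategies x"
      then have "M_inf K T A x \<le> measure P A"
        unfolding M_inf_strategies using bdd by (intro cINF_lower)
      then show "measure P (- A) \<le> 1 - M_inf K T A x"
        using compl[OF P] by simp
    qed
    then show "M_inf K T A x \<le> 1 - M_sup K T (- A) x"
      by simp
    show "1 - M_sup K T (- A) x \<le> M_inf K T A x"
      unfolding M_inf_strategies
    proof (intro cINF_greatest strategies_nonempty)
      fix P assume P: "P \<in> strategies x"
      show "1 - M_sup K T (- A) x \<le> measure P A"
        using measure_le_M_sup[OF P, of "- A"] compl[OF P] by simp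
    qed
  qed
qed

lemma M_sup_upper_semianalytic:
  assumes A: "A \<in> sets borel"
  shows "upper_semianalytic (M_sup K T A)"
  unfolding upper_semianalytic_def
proof
  fix q
  obtain c :: "(nat \<Rightarrow> nat) \<Rightarrow> ('x, 'u) path measure" where c: "c \<in> borel \<rightarrow>\<^sub>M prob_algebra borel"
    and surj: "\<And>p. prob_space p \<Longrightarrow> sets p = sets borel \<Longrightarrow> p \<in> range c"
    using ex_prob_coding by blast
  have "analytic {z :: 'x \<times> (nat \<Rightarrow> nat). q < measure (c (snd z)) A}"
  proof (rule borel_imp_analytic)
    have "(\<lambda>z :: 'x \<times> (nat \<Rightarrow> nat). measure (c (snd z)) A) \<in> borel_measurable borel"
      by (rule measurable_compose[OF measurable_compose[OF measurable_snd_borel c] measurable_measure_prob_algebra[OF A]])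
    then have "{z \<in> space borel. q < measure (c (snd z)) A} \<in> sets (borel :: ('x \<times> (nat \<Rightarrow> nat)) measure)"
      by measurable
    then show "{z :: 'x \<times> (nat \<Rightarrow> nat). q < measure (c (snd z)) A} \<in> sets borel"
      by simp
  qed
  then have "analytic (fst ` ({(x, y). c y \<in> strategies x} \<inter> {z. q < measure (c (snd z)) A}))"
    by (intro analytic_image analytic_Int analytic_strategic_codes[OF c] measurable_fst_borel)
  also have "fst ` ({(x, y). c y \<in> strategies x} \<inter> {z. q < measure (c (snd z)) A}) = {x. q < M_sup K T A x}"
  proof (intro equalityI subsetI)
    fix x assume "x \<in> {x. q < M_sup K T A x}"
    then obtain P where P: "P \<in> strategies x" "q < measure P A"
      by (auto simp: less_M_sup_iff)
    obtain y where "P = c y"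
      using surj[OF strategicD(1,2)[OF strategies_strategic[OF P(1)]]] by auto
    then show "x \<in> fst ` ({(x, y). c y \<in> strategies x} \<inter> {z. q < measure (c (snd z)) A})"
      using P by (intro image_eqI[of _ _ "(x, y)"]) auto
  qed (auto simp: less_M_sup_iff)
  finally show "analytic {x. q < M_sup K T A x}" .
qed

lemma ex_optimal_kernel:
  assumes A: "A \<in> sets borel" and p: "prob_space p" "sets p = sets borel" and e: "0 < e"
  obtains \<kappa> where "\<kappa> \<in> borel \<rightarrow>\<^sub>M prob_algebra borel"
    "AE y in p. \<kappa> y \<in> strategies y \<and> M_sup K T A y - e \<le> measure (\<kappa> y) A"
proof -
  obtain c :: "(nat \<Rightarrow> nat) \<Rightarrow> ('x, 'u) path measure" where c: "c \<in> borel \<rightarrow>\<^sub>M prob_algebra borel"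
    and surj: "\<And>p. prob_space p \<Longrightarrow> sets p = sets borel \<Longrightarrow> p \<in> range c"
    using ex_prob_coding by blast
  obtain N :: nat where N: "1 < real N * e"
    using reals_Archimedean3[OF e] by blast
  \<comment> \<open>The values are cut into slices of height \<open>e\<close> from
    \<open>real N * e\<close>, which exceeds one, down to below zero. The least \<open>k\<close>
    guarantees more than \<open>(real N - real k - 1) * e\<close>, while the optimum is at most
    \<open>(real N - real k) * e\<close>.\<close>
  define D where "D k = {(x, y). c y \<in> strategies x} \<inter> {z. (real N - real k - 1) * e < measure (c (snd z)) A}" for k
  have "analytic (D k)" for k
  proof -
    have "(\<lambda>z :: 'x \<times> (nat \<Rightarrow> nat). measure (c (snd z)) A) \<in> borel_measurable borel"
      by (rule measurable_compose[OF measurable_compose[OF measurable_snd_borel c] measurable_measure_prob_algebra[OF A]])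
    then have "{z \<in> space borel. (real N - real k - 1) * e < measure (c (snd z)) A} \<in> sets (borel :: ('x \<times> (nat \<Rightarrow> nat)) measure)"
      by measurable
    then show ?thesis
      unfolding D_def by (intro analytic_Int analytic_strategic_codes[OF c] borel_imp_analytic) simp
  qed
  moreover have in_D: "x \<in> fst ` D k \<longleftrightarrow> (real N - real k - 1) * e < M_sup K T A x" for x k
  proof
    assume "(real N - real k - 1) * e < M_sup K T A x"
    then obtain P where P: "P \<in> strategies x" "(real N - real k - 1) * e < measure P A"
      by (auto simp: less_M_sup_iff)
    obtain y where "P = c y"
      using surj[OF strategicD(1,2)[OF strategies_strategic[OF P(1)]]] by auto
    then show "x \<in> fst ` D k"
      using P by (intro image_eqI[of _ _ "(x, y)"]) (auto simp: D_def)
  qed (auto simp: D_def less_M_sup_iff)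
  moreover have "\<exists>k. x \<in> fst ` D k" for x
  proof
    have "- e < M_sup K T A x"
      using e M_sup_bounds(1)[of A x] by linarith
    then show "x \<in> fst ` D N"
      by (simp add: in_D)
  qed
  ultimately obtain s where s: "s \<in> univ_completion borel \<rightarrow>\<^sub>M borel" "\<And>x. (x, s x) \<in> D (LEAST k. x \<in> fst ` D k)"
    using uniformization_least[of D] by blast
  have opt: "c (s x) \<in> strategies x \<and> M_sup K T A x - e \<le> measure (c (s x)) A" for x
  proof -
    define k where "k = (LEAST k. x \<in> fst ` D k)"
    have D: "c (s x) \<in> strategies x" "(real N - real k - 1) * e < measure (c (s x)) A"
      using s(2)[of x] by (auto simp: D_def k_def)
    have "M_sup K T A x \<le> (real N - real k) * e"
    proof (cases k)
      case 0
      then show ?thesis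
        using M_sup_bounds(2)[of A x] N by simp
    next
      case (Suc j)
      then have "x \<notin> fst ` D j"
        using not_less_Least[of j "\<lambda>k. x \<in> fst ` D k"] by (simp add: k_def)
      then have "M_sup K T A x \<le> (real N - real j - 1) * e"
        unfolding in_D by simp
      also have "real N - real j - 1 = real N - real k"
        using Suc by simp
      finally show ?thesis .
    qed
    then show ?thesis
      using D by (simp add: algebra_simps)
  qed
  \<comment> \<open>The selection is universally measurable; the kernel becomes Borel at the price
    of holding only almost surely with respect to \<open>p\<close>.\<close>
  obtain s' where s': "s' \<in> borel_measurable p" "AE x in p. s x = s' x"
    using completion_ex_borel_version[OF univ_completionD[OF s(1) p]] .
  show ?thesis
  proof (rule that)
    have "s' \<in> borel_measurable borel"
      using s'(1) by (simp only: measurable_cong_sets[OF p(2) refl])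
    then show "(\<lambda>y. c (s' y)) \<in> borel \<rightarrow>\<^sub>M prob_algebra borel"
      by (rule measurable_compose[OF _ c])
    show "AE y in p. c (s' y) \<in> strategies y \<and> M_sup K T A y - e \<le> measure (c (s' y)) A"
      using s'(2)
    proof eventually_elim
      case (elim y)
      then show ?case
        using opt[of y] by simp
    qed
  qed
qed

section \<open>The dynamic programming recursion\<close>

lemma T_ctrl_integrable:
  fixes f :: "'x \<Rightarrow> real"
  assumes f: "f \<in> univ_completion borel \<rightarrow>\<^sub>M borel" and B: "\<And>y. \<bar>f y\<bar> \<le> B"
  shows "integrable (completion (T z)) f"
  by (rule integrable_completion_bounded[OF prob_space_T sets_T f B])

lemma T_ctrl_mono:
  fixes f g :: "'x \<Rightarrow> real"
  assumes "f \<in> univ_completion borel \<rightarrow>\<^sub>M borel" "\<And>y. \<bar>f y\<bar> \<le> B"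
    and "g \<in> univ_completion borel \<rightarrow>\<^sub>M borel" "\<And>y. \<bar>g y\<bar> \<le> B'"
    and "\<And>y. f y \<le> g y"
  shows "T_ctrl T u f x \<le> T_ctrl T u g x"
  unfolding T_ctrl_def using assms by (intro integral_mono T_ctrl_integrable) auto

lemma T_ctrl_const [simp]: "T_ctrl T u (\<lambda>_. c) x = c"
proof -
  interpret prob_space "completion (T (x, u))"
    by (rule prob_space.prob_space_completion[OF prob_space_T])
  show ?thesis
    using prob_space by (simp add: T_ctrl_def)
qed

lemma T_ctrl_bound:
  fixes f :: "'x \<Rightarrow> real"
  assumes f: "f \<in> univ_completion borel \<rightarrow>\<^sub>M borel" and B: "\<And>y. \<bar>f y\<bar> \<le> B"
  shows "\<bar>T_ctrl T u f x\<bar> \<le> B"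
proof -
  have c: "(\<lambda>_. c) \<in> univ_completion borel \<rightarrow>\<^sub>M borel" for c :: real
    by simp
  have le: "f y \<le> B" "- B \<le> f y" for y
    using B[of y] by auto
  have "T_ctrl T u f x \<le> T_ctrl T u (\<lambda>_. B) x"
    by (rule T_ctrl_mono[OF f B c order_refl le(1)])
  moreover have "T_ctrl T u (\<lambda>_. - B) x \<le> T_ctrl T u f x"
    by (rule T_ctrl_mono[OF c order_refl f B le(2)])
  ultimately show ?thesis
    by simp
qed

lemma T_ctrl_one_minus:
  fixes f :: "'x \<Rightarrow> real"
  assumes f: "f \<in> univ_completion borel \<rightarrow>\<^sub>M borel" and B: "\<And>y. \<bar>f y\<bar> \<le> B"
  shows "T_ctrl T u (\<lambda>y. 1 - f y) x = 1 - T_ctrl T u f x"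
proof -
  interpret prob_space "completion (T (x, u))"
    by (rule prob_space.prob_space_completion[OF prob_space_T])
  show ?thesis
    using prob_space T_ctrl_integrable[OF f B, of "(x, u)"] by (simp add: T_ctrl_def)
qed

lemma K_section_nonempty: "K `` {x} \<noteq> {}"
  using cdt_MP by (simp add: cdt_MP_def)

lemma T_ctrl_bdd:
  fixes f :: "'x \<Rightarrow> real"
  assumes f: "f \<in> univ_completion borel \<rightarrow>\<^sub>M borel" and B: "\<And>y. \<bar>f y\<bar> \<le> B"
  shows "bdd_above ((\<lambda>u. T_ctrl T u f x) ` K `` {x})" "bdd_below ((\<lambda>u. T_ctrl T u f x) ` K `` {x})"
  using T_ctrl_bound[OF f B] by (auto intro!: bdd_aboveI2[of _ _ B] bdd_belowI2[of _ "- B"] simp: abs_le_iff minus_le_iff)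

lemma T_sup_mono:
  fixes f g :: "'x \<Rightarrow> real"
  assumes f: "f \<in> univ_completion borel \<rightarrow>\<^sub>M borel" "\<And>y. \<bar>f y\<bar> \<le> B"
    and g: "g \<in> univ_completion borel \<rightarrow>\<^sub>M borel" "\<And>y. \<bar>g y\<bar> \<le> B'"
    and le: "\<And>y. f y \<le> g y"
  shows "T_sup K T f x \<le> T_sup K T g x"
  unfolding T_sup_def
  by (intro cSUP_mono K_section_nonempty T_ctrl_bdd(1)[OF g]) (auto intro: T_ctrl_mono[OF f g le])

lemma T_sup_nonneg:
  fixes f :: "'x \<Rightarrow> real"
  assumes f: "f \<in> univ_completion borel \<rightarrow>\<^sub>M borel" "\<And>y. \<bar>f y\<bar> \<le> B" and "\<And>y. 0 \<le> f y"
  shows "0 \<le> T_sup K T f x"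
proof -
  obtain u where "u \<in> K `` {x}"
    using K_section_nonempty by blast
  then have "T_ctrl T u f x \<le> T_sup K T f x"
    unfolding T_sup_def by (intro cSUP_upper T_ctrl_bdd(1)[OF f])
  moreover have "0 \<le> T_ctrl T u f x"
    unfolding T_ctrl_def using assms(3) by (intro Bochner_Integration.integral_nonneg)
  ultimately show ?thesis
    by linarith
qed

text \<open>Written with \<open>1 - f\<close> so that, for an infimum value \<open>f\<close>, the
  right side contains the supremum value of the complementary event.\<close>

lemma T_inf_eq_T_sup:
  fixes f :: "'x \<Rightarrow> real"
  assumes f: "f \<in> univ_completion borel \<rightarrow>\<^sub>M borel" and B: "\<And>y. \<bar>f y\<bar> \<le> B"
  shows "T_inf K T f x = 1 - T_sup K T (\<lambda>y. 1 - f y) x"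
proof (rule antisym)
  have "\<bar>1 - f y\<bar> \<le> 1 + B" for y
    using B[of y] by linarith
  moreover have "(\<lambda>y. 1 - f y) \<in> univ_completion borel \<rightarrow>\<^sub>M borel"
    using f by simp
  ultimately have g: "(\<lambda>y. 1 - f y) \<in> univ_completion borel \<rightarrow>\<^sub>M borel" "\<And>y. \<bar>1 - f y\<bar> \<le> 1 + B"
    by blast+
  have "T_sup K T (\<lambda>y. 1 - f y) x \<le> 1 - T_inf K T f x"
    unfolding T_sup_def
  proof (intro cSUP_least K_section_nonempty)
    fix u assume "u \<in> K `` {x}"
    then have "T_inf K T f x \<le> T_ctrl T u f x"
      unfolding T_inf_def by (intro cINF_lower T_ctrl_bdd(2)[OF f B])
    then show "T_ctrl T u (\<lambda>y. 1 - f y) x \<le> 1 - T_inf K T f x"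
      by (simp add: T_ctrl_one_minus[OF f B])
  qed
  then show "T_inf K T f x \<le> 1 - T_sup K T (\<lambda>y. 1 - f y) x"
    by simp
  show "1 - T_sup K T (\<lambda>y. 1 - f y) x \<le> T_inf K T f x"
    unfolding T_inf_def
  proof (intro cINF_greatest K_section_nonempty)
    fix u assume "u \<in> K `` {x}"
    then have "T_ctrl T u (\<lambda>y. 1 - f y) x \<le> T_sup K T (\<lambda>y. 1 - f y) x"
      unfolding T_sup_def by (intro cSUP_upper T_ctrl_bdd(1)[OF g])
    then show "1 - T_sup K T (\<lambda>y. 1 - f y) x \<le> T_ctrl T u f x"
      by (simp add: T_ctrl_one_minus[OF f B])
  qed
qed

lemma strategic_nn_integral:
  assumes P: "strategic P" and C: "C \<in> sets borel" and f: "f \<in> borel_measurable borel"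
  shows "(\<integral>\<^sup>+\<omega>. indicator C (freeze n \<omega>) * f (fst (\<omega> (Suc n))) \<partial>P) =
    (\<integral>\<^sup>+\<omega>. indicator C (freeze n \<omega>) * (\<integral>\<^sup>+y. f y \<partial>T (\<omega> n)) \<partial>P)"
proof -
  note D = strategicD[OF P]
  have pm: "(\<lambda>\<omega>. (freeze n \<omega>, fst (\<omega> (Suc n)))) \<in> P \<rightarrow>\<^sub>M borel"
    by (rule measurable_strategic[OF P freeze_state_measurable])
  have km: "transition_kernel n \<in> P \<rightarrow>\<^sub>M subprob_algebra borel"
    by (rule measurable_strategic[OF P measurable_prob_algebraD[OF transition_kernel_measurable]])
  let ?g = "\<lambda>z :: ('x, 'u) path \<times> 'x. indicator C (fst z) * f (snd z) :: ennreal"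
  have g: "?g \<in> borel_measurable borel"
    by (intro borel_measurable_times_ennreal measurable_compose[OF measurable_fst_borel] measurable_compose[OF measurable_snd_borel]
        borel_measurable_indicator C f)
  have "(\<integral>\<^sup>+\<omega>. ?g (freeze n \<omega>, fst (\<omega> (Suc n))) \<partial>P) = (\<integral>\<^sup>+z. ?g z \<partial>transition_law n P)"
    unfolding transition_law_def using g by (intro nn_integral_distr[OF pm, symmetric]) simp
  also have "\<dots> = (\<integral>\<^sup>+z. ?g z \<partial>(P \<bind> transition_kernel n))"
    using P by (simp add: strategic_def)
  also have "\<dots> = (\<integral>\<^sup>+\<omega>. \<integral>\<^sup>+z. ?g z \<partial>transition_kernel n \<omega> \<partial>P)"
    by (rule nn_integral_bind[OF g km])
  also have "\<dots> = (\<integral>\<^sup>+\<omega>. indicator C (freeze n \<omega>) * (\<integral>\<^sup>+y. f y \<partial>T (\<omega> n)) \<partial>P)"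
  proof (rule nn_integral_cong)
    fix \<omega> :: "('x, 'u) path"
    have "Pair (freeze n \<omega>) \<in> borel_measurable borel"
      by (intro borel_measurable_continuous_onI continuous_intros)
    then have "Pair (freeze n \<omega>) \<in> T (\<omega> n) \<rightarrow>\<^sub>M borel"
      by (simp only: measurable_cong_sets[OF sets_T refl])
    then have "(\<integral>\<^sup>+z. ?g z \<partial>transition_kernel n \<omega>) = (\<integral>\<^sup>+y. ?g (freeze n \<omega>, y) \<partial>T (\<omega> n))"
      unfolding transition_kernel_def using g by (intro nn_integral_distr) simp_all
    also have "\<dots> = indicator C (freeze n \<omega>) * (\<integral>\<^sup>+y. f y \<partial>T (\<omega> n))"
    proof -
      have "f \<in> borel_measurable (T (\<omega> n))"
        using f by (simp only: measurable_cong_sets[OF sets_T refl])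
      then show ?thesis
        by (simp add: nn_integral_cmult)
    qed
    finally show "(\<integral>\<^sup>+z. ?g z \<partial>transition_kernel n \<omega>) = \<dots>" .
  qed
  finally show ?thesis
    by simp
qed

text \<open>A Borel version with respect to the law of the next state serves both purposes. A null
  set of that law is null for \<open>T (\<omega> n)\<close> for almost every
  \<open>\<omega>\<close>, so the one-step integrals of \<open>f\<close> and \<open>f'\<close> also
  agree.\<close>

lemma ex_state_version:
  assumes P: "strategic P" and f: "f \<in> univ_completion borel \<rightarrow>\<^sub>M borel" "\<And>y. 0 \<le> f y" "\<And>y. f y \<le> B"
  obtains f' :: "'x \<Rightarrow> real" where "f' \<in> borel_measurable borel" "\<And>y. 0 \<le> f' y" "\<And>y. f' y \<le> B"
    and "AE \<omega> in P. f (fst (\<omega> (Suc n))) = f' (fst (\<omega> (Suc n)))"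
    and "AE \<omega> in P. (\<integral>\<^sup>+y. ennreal (f' y) \<partial>T (\<omega> n)) = ennreal (T_ctrl T (snd (\<omega> n)) f (fst (\<omega> n)))"
proof -
  note D = strategicD[OF P]
  have sm: "(\<lambda>\<omega>. fst (\<omega> (Suc n))) \<in> P \<rightarrow>\<^sub>M borel"
    by (rule measurable_strategic[OF P measurable_state])
  let ?\<nu> = "distr P borel (\<lambda>\<omega>. fst (\<omega> (Suc n)))"
  have \<nu>: "prob_space ?\<nu>"
    by (rule prob_space.prob_space_distr[OF D(1) sm])
  obtain g where g: "g \<in> borel_measurable ?\<nu>" "AE y in ?\<nu>. f y = g y"
    using completion_ex_borel_measurable_real[OF univ_completionD[OF f(1) \<nu>]] by auto
  \<comment> \<open>Clamping restores the bounds of \<open>f\<close> at every point and changes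
    nothing where \<open>g\<close> agrees with \<open>f\<close>.\<close>
  define f' where "f' y = min B (max 0 (g y))" for y
  have f'm: "f' \<in> borel_measurable borel"
    using g(1) unfolding f'_def by simp
  have f'b: "0 \<le> f' y" "f' y \<le> B" for y
    using f(2,3)[of y] by (auto simp: f'_def)
  have ae: "AE y in ?\<nu>. f y = f' y"
    using g(2)
  proof eventually_elim
    case (elim y)
    then show ?case
      using f(2,3)[of y] by (simp add: f'_def)
  qed
  then obtain Z where Z: "{y \<in> space ?\<nu>. f y \<noteq> f' y} \<subseteq> Z" "Z \<in> null_sets ?\<nu>"
    by (auto elim!: AE_E simp: null_sets_def)
  then have Zb: "Z \<in> sets borel"
    by auto
  have "0 = emeasure ?\<nu> Z"
    using Z(2) by (simp add: null_sets_def)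
  also have "\<dots> = (\<integral>\<^sup>+y. indicator Z y \<partial>?\<nu>)"
    using Zb by simp
  also have "\<dots> = (\<integral>\<^sup>+\<omega>. indicator UNIV (freeze n \<omega>) * indicator Z (fst (\<omega> (Suc n))) \<partial>P)"
    using Zb by (subst nn_integral_distr[OF sm]) simp_all
  also have "\<dots> = (\<integral>\<^sup>+\<omega>. indicator UNIV (freeze n \<omega>) * (\<integral>\<^sup>+y. indicator Z y \<partial>T (\<omega> n)) \<partial>P)"
    by (rule strategic_nn_integral[OF P]) (use Zb in auto)
  also have "\<dots> = (\<integral>\<^sup>+\<omega>. emeasure (T (\<omega> n)) Z \<partial>P)"
    using Zb by (simp add: sets_T)
  finally have "(\<integral>\<^sup>+\<omega>. emeasure (T (\<omega> n)) Z \<partial>P) = 0"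
    by simp
  moreover have "(\<lambda>\<omega>. emeasure (T (\<omega> n)) Z) \<in> borel_measurable P"
    by (rule measurable_strategic[OF P measurable_emeasure_kernel[OF measurable_prob_algebraD[OF T_coordinate] Zb]])
  ultimately have "AE \<omega> in P. emeasure (T (\<omega> n)) Z = 0"
    by (simp add: nn_integral_0_iff_AE)
  then have ctrl: "AE \<omega> in P. (\<integral>\<^sup>+y. ennreal (f' y) \<partial>T (\<omega> n)) = ennreal (T_ctrl T (snd (\<omega> n)) f (fst (\<omega> n)))"
  proof eventually_elim
    case (elim \<omega>)
    then have "Z \<in> null_sets (T (\<omega> n))"
      using Zb by (simp add: null_sets_def sets_T)
    from AE_not_in[OF this] have ae: "AE y in T (\<omega> n). f' y = f y"
    proof eventually_elim
      case (elim y)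
      then have "\<not> f y \<noteq> f' y"
        using Z(1) by auto
      then show ?case
        by simp
    qed
    interpret prob_space "T (\<omega> n)"
      by (rule prob_space_T)
    have m: "f' \<in> borel_measurable (T (\<omega> n))"
      using f'm by (simp only: measurable_cong_sets[OF sets_T refl])
    have "(\<integral>\<^sup>+y. ennreal (f' y) \<partial>T (\<omega> n)) = ennreal (LINT y|T (\<omega> n). f' y)"
      using f'b m by (intro nn_integral_eq_integral integrable_const_bound[of _ B]) auto
    also have "(LINT y|T (\<omega> n). f' y) = (LINT y|completion (T (\<omega> n)). f' y)"
      by (rule integral_completion[OF m, symmetric])
    also have "\<dots> = (LINT y|completion (T (\<omega> n)). f y)"
      using AE_completion[OF ae] measurable_completion[OF m] univ_completionD[OF f(1) prob_space_T sets_T]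
      by (intro integral_cong_AE)
    finally show ?case
      by (simp add: T_ctrl_def)
  qed
  show ?thesis
    by (rule that[OF f'm f'b AE_distrD[OF sm ae] ctrl])
qed

lemma M_sup_measurable: "A \<in> sets borel \<Longrightarrow> M_sup K T A \<in> univ_completion borel \<rightarrow>\<^sub>M borel"
  by (intro upper_semianalytic_measurable M_sup_upper_semianalytic)

lemma M_sup_abs: "\<bar>M_sup K T A x\<bar> \<le> 1"
  using M_sup_bounds[of A x] by simp

text \<open>
  The upper bound comes from disintegrating the law of the shifted path at \<open>x\<^sub>1\<close>, the lower bound from
  mixing almost optimal strategic measures.
\<close>

lemma M_sup_shift:
  assumes A: "A \<in> sets borel"
  shows "M_sup K T (shift -` A) x = T_sup K T (M_sup K T A) x"
proof (rule antisym)
  note V = M_sup_measurable[OF A] M_sup_abs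
  show "M_sup K T (shift -` A) x \<le> T_sup K T (M_sup K T A) x"
  proof (rule M_sup_le)
    fix P assume P': "P \<in> strategies x"
    then have P: "strategic P" and x: "AE \<omega> in P. fst (\<omega> 0) = x"
      by (auto simp: strategies_def)
    interpret prob_space P
      by (rule strategicD[OF P])
    have sm: "shift \<in> P \<rightarrow>\<^sub>M borel"
      by (rule measurable_strategic[OF P measurable_shift])
    obtain \<kappa> where \<kappa>: "\<kappa> \<in> borel \<rightarrow>\<^sub>M prob_algebra borel"
      "AE y in distr (distr P borel shift) borel (\<lambda>\<omega>. fst (\<omega> 0)). \<kappa> y \<in> strategies y"
      "\<And>A. A \<in> sets borel \<Longrightarrow> emeasure (distr P borel shift) A =
        (\<integral>\<^sup>+y. emeasure (\<kappa> y) A \<partial>distr (distr P borel shift) borel (\<lambda>\<omega>. fst (\<omega> 0)))"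
      by (rule strategic_disintegration[OF strategic_shift[OF P]]) blast
    let ?\<nu> = "distr P borel (\<lambda>\<omega>. fst (\<omega> (Suc 0)))"
    have s1: "(\<lambda>\<omega>. fst (\<omega> (Suc 0))) \<in> P \<rightarrow>\<^sub>M borel"
      by (rule measurable_strategic[OF P measurable_state])
    have \<nu>: "distr (distr P borel shift) borel (\<lambda>\<omega>. fst (\<omega> 0)) = ?\<nu>"
      using distr_distr[OF measurable_state sm, of 0] by (simp add: o_def shift_def)
    obtain f' where f': "f' \<in> borel_measurable borel" "\<And>y. 0 \<le> f' y" "\<And>y. f' y \<le> 1"
      "AE \<omega> in P. M_sup K T A (fst (\<omega> (Suc 0))) = f' (fst (\<omega> (Suc 0)))"
      "AE \<omega> in P. (\<integral>\<^sup>+y. ennreal (f' y) \<partial>T (\<omega> 0)) = ennreal (T_ctrl T (snd (\<omega> 0)) (M_sup K T A) (fst (\<omega> 0)))"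
      by (rule ex_state_version[OF P M_sup_measurable[OF A] M_sup_bounds, where n = 0]) blast
    have "emeasure P (shift -` A) = emeasure (distr P borel shift) A"
      using emeasure_distr[OF sm A] by (simp add: space_strategic[OF P])
    also have "\<dots> = (\<integral>\<^sup>+y. emeasure (\<kappa> y) A \<partial>?\<nu>)"
      using \<kappa>(3)[OF A] by (simp add: \<nu>)
    also have "\<dots> = (\<integral>\<^sup>+\<omega>. emeasure (\<kappa> (fst (\<omega> (Suc 0)))) A \<partial>P)"
      using measurable_emeasure_kernel[OF measurable_prob_algebraD[OF \<kappa>(1)] A]
      by (intro nn_integral_distr[OF s1]) simp
    \<comment> \<open>Almost every conditional law is itself a strategy from the state reached, so
      its value is at most the optimal one there. The factor with \<open>UNIV\<close> only matches
      the form of \<open>strategic_nn_integral\<close>.\<close>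
    also have "\<dots> \<le> (\<integral>\<^sup>+\<omega>. indicator UNIV (freeze 0 \<omega>) * ennreal (f' (fst (\<omega> (Suc 0)))) \<partial>P)"
    proof (rule nn_integral_mono_AE)
      have "AE \<omega> in P. \<kappa> (fst (\<omega> (Suc 0))) \<in> strategies (fst (\<omega> (Suc 0)))"
        using AE_distrD[OF s1 \<kappa>(2)[unfolded \<nu>]] .
      then show "AE \<omega> in P. emeasure (\<kappa> (fst (\<omega> (Suc 0)))) A \<le> indicator UNIV (freeze 0 \<omega>) * ennreal (f' (fst (\<omega> (Suc 0))))"
        using f'(4)
      proof eventually_elim
        case (elim \<omega>)
        interpret \<kappa>: prob_space "\<kappa> (fst (\<omega> (Suc 0)))"
          by (rule strategies_prob_space[OF elim(1)])
        show ?case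
          using measure_le_M_sup[OF elim(1), of A] elim(2) by (simp add: \<kappa>.emeasure_eq_measure ennreal_leI)
      qed
    qed
    also have "\<dots> = (\<integral>\<^sup>+\<omega>. indicator UNIV (freeze 0 \<omega>) * (\<integral>\<^sup>+y. ennreal (f' y) \<partial>T (\<omega> 0)) \<partial>P)"
      using f'(1) by (intro strategic_nn_integral[OF P]) simp_all
    also have "\<dots> \<le> (\<integral>\<^sup>+\<omega>. ennreal (T_sup K T (M_sup K T A) x) \<partial>P)"
    proof (rule nn_integral_mono_AE)
      show "AE \<omega> in P. indicator UNIV (freeze 0 \<omega>) * (\<integral>\<^sup>+y. ennreal (f' y) \<partial>T (\<omega> 0)) \<le> ennreal (T_sup K T (M_sup K T A) x)"
        using f'(5) x strategicD(3)[OF P, of 0]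
      proof eventually_elim
        case (elim \<omega>)
        then have "snd (\<omega> 0) \<in> K `` {x}"
          by (metis Image_singleton_iff prod.collapse)
        then have "T_ctrl T (snd (\<omega> 0)) (M_sup K T A) x \<le> T_sup K T (M_sup K T A) x"
          unfolding T_sup_def by (intro cSUP_upper T_ctrl_bdd(1)[OF V])
        then show ?case
          using elim by (simp add: ennreal_leI)
      qed
    qed
    also have "\<dots> = ennreal (T_sup K T (M_sup K T A) x)"
      by (simp add: emeasure_space_1)
    finally show "measure P (shift -` A) \<le> T_sup K T (M_sup K T A) x"
      using T_sup_nonneg[OF V M_sup_bounds(1)] by (simp add: emeasure_eq_measure)
  qed
  show "T_sup K T (M_sup K T A) x \<le> M_sup K T (shift -` A) x"
    unfolding T_sup_def
  proof (intro cSUP_least K_section_nonempty)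
    fix u assume u: "u \<in> K `` {x}"
    then have xu: "(x, u) \<in> K"
      by simp
    show "T_ctrl T u (M_sup K T A) x \<le> M_sup K T (shift -` A) x"
    proof (rule field_le_epsilon)
      fix e :: real assume e: "0 < e"
      note T1 = prob_space_T[of "(x, u)"] sets_T[of "(x, u)"]
      obtain \<kappa> where \<kappa>: "\<kappa> \<in> borel \<rightarrow>\<^sub>M prob_algebra borel"
        "AE y in T (x, u). \<kappa> y \<in> strategies y \<and> M_sup K T A y - e \<le> measure (\<kappa> y) A"
        using ex_optimal_kernel[OF A T1 e] by blast
      have ae: "AE y in T (x, u). \<kappa> y \<in> strategies y"
        using \<kappa>(2) by eventually_elim simp
      \<comment> \<open>The law of the continuation when \<open>u\<close> is played at
        \<open>x\<close> and an almost optimal law is followed from the state reached.\<close>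
      let ?Q = "T (x, u) \<bind> \<kappa>"
      have Q: "strategic ?Q"
        by (rule strategic_mixture[OF T1 \<kappa>(1) ae])
      interpret Q: prob_space ?Q
        by (rule strategicD[OF Q])
      let ?P = "distr ?Q borel (case_nat (x, u))"
      have P: "?P \<in> strategies x"
        by (rule strategic_prepend[OF Q xu state_law_mixture[OF T1 \<kappa>(1) ae]])
      have cm: "case_nat (x, u) \<in> ?Q \<rightarrow>\<^sub>M borel"
        by (rule measurable_strategic[OF Q measurable_case_nat_path])
      have "shift -` A \<inter> space borel \<in> sets borel"
        by (rule measurable_sets[OF measurable_shift A])
      then have "measure ?P (shift -` A) = measure ?Q A"
        using measure_distr[OF cm, of "shift -` A"] by (simp add: space_strategic[OF Q] vimage_def shift_def)
      moreover have "measure ?Q A = (LINT y|T (x, u). measure (\<kappa> y) A)"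
      proof -
        have \<kappa>p: "prob_space (\<kappa> y)" for y
          using measurable_space[OF \<kappa>(1), of y] by (simp add: space_prob_algebra)
        have km: "(\<lambda>y. measure (\<kappa> y) A) \<in> borel_measurable (T (x, u))"
          using measurable_compose[OF \<kappa>(1) measurable_measure_prob_algebra[OF A]]
          by (simp only: measurable_cong_sets[OF sets_T refl])
        interpret T: prob_space "T (x, u)"
          by (rule prob_space_T)
        have "emeasure ?Q A = (\<integral>\<^sup>+y. emeasure (\<kappa> y) A \<partial>T (x, u))"
          by (rule emeasure_mixture[OF T1 \<kappa>(1) ae A])
        also have "\<dots> = (\<integral>\<^sup>+y. ennreal (measure (\<kappa> y) A) \<partial>T (x, u))"
          using finite_measure.emeasure_eq_measure[OF prob_space.finite_measure[OF \<kappa>p]] by simp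
        also have "\<dots> = ennreal (LINT y|T (x, u). measure (\<kappa> y) A)"
          using km prob_space.prob_le_1[OF \<kappa>p] by (intro nn_integral_eq_integral T.integrable_const_bound[of _ 1]) auto
        finally show ?thesis
          by (simp add: Q.emeasure_eq_measure)
      qed
      moreover have "T_ctrl T u (M_sup K T A) x - e \<le> (LINT y|T (x, u). measure (\<kappa> y) A)"
      proof -
        interpret C: prob_space "completion (T (x, u))"
          by (rule prob_space.prob_space_completion[OF prob_space_T])
        have \<kappa>p: "prob_space (\<kappa> y)" for y
          using measurable_space[OF \<kappa>(1), of y] by (simp add: space_prob_algebra)
        have km: "(\<lambda>y. measure (\<kappa> y) A) \<in> borel_measurable (T (x, u))"
          using measurable_compose[OF \<kappa>(1) measurable_measure_prob_algebra[OF A]]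
          by (simp only: measurable_cong_sets[OF sets_T refl])
        have int: "integrable (completion (T (x, u))) (M_sup K T A)"
          by (rule T_ctrl_integrable[OF V])
        have "T_ctrl T u (M_sup K T A) x - e = (LINT y|completion (T (x, u)). M_sup K T A y - e)"
          unfolding T_ctrl_def using int C.prob_space by (subst Bochner_Integration.integral_diff) auto
        also have "\<dots> \<le> (LINT y|completion (T (x, u)). measure (\<kappa> y) A)"
        proof (rule integral_mono_AE)
          show "integrable (completion (T (x, u))) (\<lambda>y. M_sup K T A y - e)"
            using int by simp
          show "integrable (completion (T (x, u))) (\<lambda>y. measure (\<kappa> y) A)"
            using measurable_completion[OF km] prob_space.prob_le_1[OF \<kappa>p]
            by (intro C.integrable_const_bound[of _ 1]) auto
          show "AE y in completion (T (x, u)). M_sup K T A y - e \<le> measure (\<kappa> y) A"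
            using AE_completion[OF \<kappa>(2)] by eventually_elim simp
        qed
        also have "\<dots> = (LINT y|T (x, u). measure (\<kappa> y) A)"
          by (rule integral_completion[OF km])
        finally show ?thesis .
      qed
      ultimately show "T_ctrl T u (M_sup K T A) x \<le> M_sup K T (shift -` A) x + e"
        using measure_le_M_sup[OF P, of "shift -` A"] by linarith
    qed
  qed
qed

lemma M_inf_eq_one_minus: "A \<in> sets borel \<Longrightarrow> M_inf K T A = (\<lambda>x. 1 - M_sup K T (- A) x)"
  using M_inf_eq_M_sup by blast

lemma M_inf_shift:
  assumes A: "A \<in> sets borel"
  shows "M_inf K T (shift -` A) x = T_inf K T (M_inf K T A) x"
proof -
  have A': "- A \<in> sets borel"
    using A by simp
  have sA: "shift -` A \<in> sets (borel :: ('x, 'u) path measure)"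
    using measurable_sets[OF measurable_shift A] by simp
  have m: "(\<lambda>x. 1 - M_sup K T (- A) x) \<in> univ_completion borel \<rightarrow>\<^sub>M borel"
    using M_sup_measurable[OF A'] by simp
  have b: "\<bar>1 - M_sup K T (- A) x\<bar> \<le> 1" for x
    using M_sup_bounds[of "- A" x] by simp
  have "M_inf K T (shift -` A) x = 1 - M_sup K T (shift -` (- A)) x"
    using M_inf_eq_M_sup[OF sA] by (simp add: vimage_Compl)
  also have "\<dots> = 1 - T_sup K T (M_sup K T (- A)) x"
    by (simp add: M_sup_shift[OF A'])
  also have "\<dots> = T_inf K T (M_inf K T A) x"
    unfolding M_inf_eq_one_minus[OF A] T_inf_eq_T_sup[OF m b] by simp
  finally show ?thesis .
qed

section \<open>Semi-analyticity of the optimal values\<close>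

lemma bA_upper_iff: "f \<in> bA_upper \<longleftrightarrow> bounded (range f) \<and> upper_semianalytic f"
proof -
  have "range (\<lambda>x. - f x) = uminus ` range f"
    by auto
  then have "bounded (range (\<lambda>x. - f x)) \<longleftrightarrow> bounded (range f)"
    by (simp only: bounded_uminus)
  moreover have "lower_semianalytic (\<lambda>x. - f x) \<longleftrightarrow> upper_semianalytic f"
    unfolding lower_semianalytic_def upper_semianalytic_def
    by (metis (no_types, lifting) Collect_cong minus_less_iff minus_minus)
  ultimately show ?thesis
    by (simp add: bA_upper_def bA_lower_def)
qed

lemma bA_lower_iff: "f \<in> bA_lower \<longleftrightarrow> (\<lambda>x. - f x) \<in> bA_upper"
  by (simp add: bA_upper_def)

lemma M_sup_bA_upper: "A \<in> sets borel \<Longrightarrow> M_sup K T A \<in> bA_upper"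
  unfolding bA_upper_iff using M_sup_upper_semianalytic M_sup_abs by (auto simp: bounded_iff)

lemma M_inf_bA_lower:
  assumes A: "A \<in> sets borel"
  shows "M_inf K T A \<in> bA_lower"
proof -
  have "- A \<in> sets borel"
    using A by simp
  from upper_semianalytic_affine[OF M_sup_upper_semianalytic[OF this], of 1 "- 1"]
  have "upper_semianalytic (\<lambda>x. - M_inf K T A x)"
    unfolding M_inf_eq_one_minus[OF A] by simp
  moreover have "\<bar>- M_inf K T A x\<bar> \<le> 1" for x
    unfolding M_inf_eq_one_minus[OF A] using M_sup_bounds[of "- A" x] by simp
  ultimately show ?thesis
    unfolding bA_lower_iff bA_upper_iff by (auto simp: bounded_iff)
qed

end

section \<open>Reachability\<close>

lemma reach_event_measurable:
  fixes S G :: "'a::second_countable_topology set"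
  assumes [measurable]: "S \<in> sets borel" "G \<in> sets borel"
  shows "reach_event S n G \<in> sets (borel :: (nat \<Rightarrow> 'a \<times> 'b::second_countable_topology) measure)"
proof -
  have "Measurable.pred borel (\<lambda>\<omega> :: nat \<Rightarrow> 'a \<times> 'b. \<exists>i. enat i \<le> n \<and> fst (\<omega> i) \<in> G \<and> (\<forall>j. j < i \<longrightarrow> fst (\<omega> j) \<in> S))"
    by measurable
  then show ?thesis
    by (simp add: pred_def reach_event_def)
qed

lemma reach_event_0: "reach_event S 0 G = {\<omega>. fst (\<omega> 0) \<in> G}"
  by (auto simp: reach_event_def zero_enat_def)

text \<open>The case of infinity is included because \<open>\<infinity> + 1 = \<infinity>\<close>.
  The fixpoint equations for the unbounded horizon thus come from the same one-step decomposition,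
  without a limit.\<close>

lemma reach_event_Suc:
  "reach_event S (n + 1) G = {\<omega>. fst (\<omega> 0) \<in> G} \<union> ({\<omega>. fst (\<omega> 0) \<in> S} \<inter> shift -` reach_event S n G)"
proof -
  have le: "enat (Suc k) \<le> n + 1 \<longleftrightarrow> enat k \<le> n" for k
    by (cases n) (auto simp: one_enat_def)
  have ex: "(\<exists>i. Q i) \<longleftrightarrow> Q 0 \<or> (\<exists>k. Q (Suc k))" for Q :: "nat \<Rightarrow> bool"
    by (metis not0_implies_Suc)
  show ?thesis
    unfolding reach_event_def
    by (subst ex) (auto simp: All_less_Suc2 le shift_def zero_enat_def[symmetric])
qed

lemma reach_event_infinity: "reach_event S \<infinity> G = (\<Union>n. reach_event S (enat n) G)"
  by (auto simp: reach_event_def)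

context controlled_process
begin

context
  fixes S G :: "'x set"
  assumes S [measurable]: "S \<in> sets borel" and G [measurable]: "G \<in> sets borel" and disjoint: "S \<inter> G = {}"
begin

lemma measure_reach_event_0:
  assumes P: "P \<in> strategies x"
  shows "measure P (reach_event S 0 G) = indicator G x"
proof -
  interpret prob_space P
    by (rule strategies_prob_space[OF P])
  note sP = strategicD(2)[OF strategies_strategic[OF P]]
  have "measure P (reach_event S 0 G) = measure P (if x \<in> G then space P else {})"
  proof (rule finite_measure_eq_AE)
    have "AE \<omega> in P. fst (\<omega> 0) = x"
      using P by (simp add: strategies_def)
    then show "AE \<omega> in P. \<omega> \<in> reach_event S 0 G \<longleftrightarrow> \<omega> \<in> (if x \<in> G then space P else {})"
      by eventually_elim (simp add: reach_event_0 space_strategic[OF strategies_strategic[OF P]])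
  qed (use reach_event_measurable[OF S G] sP in auto)
  then show ?thesis
    by (simp add: prob_space)
qed

text \<open>Almost surely the initial state is \<open>x\<close>, so the event collapses to the whole
  space, to the shifted event, or to the empty set. Disjointness of \<open>S\<close> and
  \<open>G\<close> keeps the two summands from overlapping.\<close>

lemma measure_reach_event_Suc:
  assumes P: "P \<in> strategies x"
  shows "measure P (reach_event S (n + 1) G) = indicator G x + indicator S x * measure P (shift -` reach_event S n G)"
proof -
  interpret prob_space P
    by (rule strategies_prob_space[OF P])
  note sP = strategicD(2)[OF strategies_strategic[OF P]]
  have sm: "shift -` reach_event S n G \<in> sets P"
    using measurable_sets[OF measurable_shift reach_event_measurable[OF S G]] by (simp add: sP)
  let ?A = "if x \<in> G then space P else if x \<in> S then shift -` reach_event S n G else {}"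
  have "measure P (reach_event S (n + 1) G) = measure P ?A"
  proof (rule finite_measure_eq_AE)
    have "AE \<omega> in P. fst (\<omega> 0) = x"
      using P by (simp add: strategies_def)
    then show "AE \<omega> in P. \<omega> \<in> reach_event S (n + 1) G \<longleftrightarrow> \<omega> \<in> ?A"
      unfolding reach_event_Suc by eventually_elim (simp add: space_strategic[OF strategies_strategic[OF P]])
  qed (use reach_event_measurable[OF S G] sP sm in auto)
  then show ?thesis
    using disjoint by (auto simp: prob_space split: split_indicator)
qed

lemma M_reach_event_0:
  shows "M_sup K T (reach_event S 0 G) = indicator G" "M_inf K T (reach_event S 0 G) = indicator G"
proof -
  show "M_sup K T (reach_event S 0 G) = indicator G"
  proof
    fix x show "M_sup K T (reach_event S 0 G) x = indicator G x"
      unfolding M_sup_strategies using strategies_nonempty by (simp add: measure_reach_event_0 cong: SUP_cong)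
  qed
  show "M_inf K T (reach_event S 0 G) = indicator G"
  proof
    fix x show "M_inf K T (reach_event S 0 G) x = indicator G x"
      unfolding M_inf_strategies using strategies_nonempty by (simp add: measure_reach_event_0 cong: INF_cong)
  qed
qed

lemma M_sup_reach_event_Suc:
  "M_sup K T (reach_event S (n + 1) G) = R_sup K T S G (M_sup K T (reach_event S n G))"
proof
  fix x
  let ?A = "reach_event S n G :: ('x, 'u) path set"
  have "M_sup K T (reach_event S (n + 1) G) x =
      (SUP P\<in>strategies x. indicator G x + indicator S x * measure P (shift -` ?A))"
    unfolding M_sup_strategies by (intro SUP_cong refl measure_reach_event_Suc)
  also have "\<dots> = indicator G x + indicator S x * M_sup K T (shift -` ?A) x"
    using disjoint strategies_nonempty by (cases "x \<in> S") (auto simp: M_sup_strategies indicator_def)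
  finally show "M_sup K T (reach_event S (n + 1) G) x = R_sup K T S G (M_sup K T ?A) x"
    by (simp add: R_sup_def M_sup_shift[OF reach_event_measurable[OF S G]])
qed

lemma M_inf_reach_event_Suc:
  "M_inf K T (reach_event S (n + 1) G) = R_inf K T S G (M_inf K T (reach_event S n G))"
proof
  fix x
  let ?A = "reach_event S n G :: ('x, 'u) path set"
  have "M_inf K T (reach_event S (n + 1) G) x =
      (INF P\<in>strategies x. indicator G x + indicator S x * measure P (shift -` ?A))"
    unfolding M_inf_strategies by (intro INF_cong refl measure_reach_event_Suc)
  also have "\<dots> = indicator G x + indicator S x * M_inf K T (shift -` ?A) x"
    using disjoint strategies_nonempty by (cases "x \<in> S") (auto simp: M_inf_strategies indicator_def)
  finally show "M_inf K T (reach_event S (n + 1) G) x = R_inf K T S G (M_inf K T ?A) x"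
    by (simp add: R_inf_def M_inf_shift[OF reach_event_measurable[OF S G]])
qed

lemma measure_reach_event_infinity_le:
  assumes P: "P \<in> strategies x" and le: "\<And>n. measure P (reach_event S (enat n) G) \<le> c"
  shows "measure P (reach_event S \<infinity> G) \<le> c"
proof -
  interpret prob_space P
    by (rule strategies_prob_space[OF P])
  have "reach_event S (enat n) G \<in> sets P" for n
    using reach_event_measurable[OF S G] by (simp add: strategicD(2)[OF strategies_strategic[OF P]])
  moreover have "incseq (\<lambda>n. reach_event S (enat n) G :: ('x, 'u) path set)"
    by (auto simp: incseq_def reach_event_def) (meson dual_order.trans)
  ultimately have "(\<lambda>n. measure P (reach_event S (enat n) G)) \<longlonglongrightarrow> measure P (\<Union>n. reach_event S (enat n) G)"
    by (intro finite_Lim_measure_incseq) auto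
  then show ?thesis
    unfolding reach_event_infinity by (rule LIMSEQ_le_const2) (use le in blast)
qed

lemma M_sup_reach_event_least:
  assumes f: "f \<in> bA_upper" "\<And>x. 0 \<le> f x" and R: "\<And>x. R_sup K T S G f x \<le> f x"
  shows "M_sup K T (reach_event S \<infinity> G) x \<le> f x"
proof -
  have fm: "f \<in> univ_completion borel \<rightarrow>\<^sub>M borel"
    using f(1) upper_semianalytic_measurable unfolding bA_upper_iff by blast
  obtain B where B: "\<bar>f y\<bar> \<le> B" for y
    using f(1) unfolding bA_upper_iff bounded_iff by auto
  have step: "M_sup K T (reach_event S (enat n) G) x \<le> f x" for n x
  proof (induction n arbitrary: x)
    case 0
    have "(indicator G x :: real) \<le> R_sup K T S G f x"
      using T_sup_nonneg[OF fm B f(2), of x] by (simp add: R_sup_def)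
    then show ?case
      using R[of x] by (simp add: M_reach_event_0 zero_enat_def[symmetric])
  next
    case (Suc n)
    let ?M = "M_sup K T (reach_event S (enat n) G)"
    have "T_sup K T ?M x \<le> T_sup K T f x"
      by (rule T_sup_mono[OF M_sup_measurable[OF reach_event_measurable[OF S G]] M_sup_abs fm B Suc.IH])
    then have "R_sup K T S G ?M x \<le> R_sup K T S G f x"
      by (simp add: R_sup_def indicator_def)
    moreover have "enat (Suc n) = enat n + 1"
      by (simp add: one_enat_def)
    ultimately show ?case
      using R[of x] by (simp add: M_sup_reach_event_Suc)
  qed
  \<comment> \<open>The limit over horizons is taken under each law separately, and the bound by
    \<open>f\<close> does not depend on the horizon; the supremum comes last.\<close>
  show ?thesis
  proof (rule M_sup_le)
    fix P assume P: "P \<in> strategies x"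
    show "measure P (reach_event S \<infinity> G) \<le> f x"
      by (rule measure_reach_event_infinity_le[OF P order_trans[OF measure_le_M_sup[OF P] step]])
  qed
qed

end

section \<open>Almost minimal deterministic policies\<close>

lemma M_inf_le_measure: "P \<in> strategies x \<Longrightarrow> M_inf K T A x \<le> measure P A"
  unfolding M_inf_strategies by (rule cINF_lower) (auto intro!: bdd_belowI2[of _ 0])

lemma ex_near_minimal_selector:
  assumes f: "f \<in> bA_lower" "\<And>y. 0 \<le> f y" and e: "0 < (e :: real)"
  shows "\<exists>g. g \<in> univ_completion borel \<rightarrow>\<^sub>M borel \<and> (\<forall>x. (x, g x) \<in> K) \<and>
    (\<forall>x. T_ctrl T (g x) f x \<le> T_inf K T f x + e)"
proof -
  have sf: "upper_semianalytic (\<lambda>x. - f x)"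
    using f(1) unfolding bA_lower_iff bA_upper_iff by simp
  obtain B where B: "\<bar>- f y\<bar> \<le> B" for y
    using f(1) unfolding bA_lower_iff bA_upper_iff bounded_iff by auto
  have "upper_semianalytic (\<lambda>z. LINT y|completion (T z). - f y)"
    by (rule upper_semianalytic_integral[OF T sf B])
  then have "analytic {z. - (real k * e) < (LINT y|completion (T z). - f y)}" for k
    unfolding upper_semianalytic_def by blast
  then have "analytic (K \<inter> {z. - (real k * e) < (LINT y|completion (T z). - f y)})" for k
    by (intro analytic_Int analytic_K)
  \<comment> \<open>Slices of height \<open>e\<close> counted upwards from zero: \<open>D k\<close>
    holds the admissible pairs whose one-step integral of \<open>f\<close> is below
    \<open>real k * e\<close>. Superlevel sets of the integral of \<open>- f\<close> are analytic
    because \<open>f\<close> is lower semi-analytic.\<close>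
  moreover define D where "D k = K \<inter> {z. - (real k * e) < (LINT y|completion (T z). - f y)}" for k
  ultimately have D: "analytic (D k)" for k
    by simp
  have in_D: "(x, u) \<in> D k \<longleftrightarrow> (x, u) \<in> K \<and> T_ctrl T u f x < real k * e" for x u k
    by (auto simp: D_def T_ctrl_def)
  have ex: "\<exists>k. x \<in> fst ` D k" for x
  proof -
    obtain u where u: "(x, u) \<in> K"
      using K_section_nonempty[of x] by auto
    obtain k :: nat where "T_ctrl T u f x < real k * e"
      using reals_Archimedean3[OF e] by blast
    then have "(x, u) \<in> D k"
      using u by (simp add: in_D)
    then show ?thesis
      by force
  qed
  obtain g where g: "g \<in> univ_completion borel \<rightarrow>\<^sub>M borel" "\<And>x. (x, g x) \<in> D (LEAST k. x \<in> fst ` D k)"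
    using uniformization_least[OF D ex] by blast
  have "T_ctrl T (g x) f x \<le> T_inf K T f x + e" for x
  proof -
    define k where "k = (LEAST k. x \<in> fst ` D k)"
    have gk: "(x, g x) \<in> D k"
      using g(2)[of x] by (simp add: k_def)
    have "0 \<le> T_ctrl T (g x) f x"
      unfolding T_ctrl_def using f(2) by (intro Bochner_Integration.integral_nonneg)
    \<comment> \<open>The index zero is impossible because the integral of \<open>f\<close> is
      non-negative. Absence from the slice before bounds the infimum below by
      \<open>real j * e\<close>.\<close>
    then obtain j where j: "k = Suc j"
      using gk by (cases k) (auto simp: in_D)
    then have nj: "x \<notin> fst ` D j"
      using not_less_Least[of j "\<lambda>k. x \<in> fst ` D k"] by (simp add: k_def)
    have "real j * e \<le> T_inf K T f x"
      unfolding T_inf_def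
    proof (intro cINF_greatest K_section_nonempty)
      fix u assume "u \<in> K `` {x}"
      moreover have "(x, u) \<notin> D j"
        using nj by force
      ultimately show "real j * e \<le> T_ctrl T u f x"
        by (simp add: in_D)
    qed
    moreover have "T_ctrl T (g x) f x < real k * e"
      using gk by (simp add: in_D)
    ultimately show ?thesis
      by (simp add: j algebra_simps)
  qed
  then show ?thesis
    using g by (intro exI[of _ g]) (auto simp: in_D)
qed

text \<open>The graph of \<open>g n\<close> is not Borel in general. A Borel version
  \<open>g'\<close> for the law of the current state gives the same joint law of history and action,
  and that law is carried by the measurable graph of \<open>g'\<close>.\<close>

lemma deterministic_policy_action:
  assumes g: "g n \<in> univ_completion borel \<rightarrow>\<^sub>M borel"
    and P: "is_path_measure T (\<lambda>n h. return borel (g n (snd h))) x P"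
  shows "AE \<omega> in P. snd (\<omega> n) = g n (fst (\<omega> n))"
proof -
  note D = is_path_measureD[OF P]
  have hm: "hist_of n \<in> P \<rightarrow>\<^sub>M hist_space n"
    using measurable_hist_of by (simp only: measurable_cong_sets[OF D(2) refl])
  have am: "action_history n \<in> P \<rightarrow>\<^sub>M hist_space n \<Otimes>\<^sub>M borel"
    using measurable_action_history by (simp only: measurable_cong_sets[OF D(2) refl])
  let ?H = "distr P (hist_space n) (hist_of n)"
  have H: "prob_space ?H"
    by (rule prob_space.prob_space_distr[OF D(1) hm])
  have sm: "snd \<in> ?H \<rightarrow>\<^sub>M borel"
    by (simp add: hist_space_def)
  let ?\<nu> = "distr ?H borel snd"
  have \<nu>: "prob_space ?\<nu>"
    by (rule prob_space.prob_space_distr[OF H sm])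
  obtain g' where g': "g' \<in> borel_measurable ?\<nu>" "AE y in ?\<nu>. g n y = g' y"
    using completion_ex_borel_version[OF univ_completionD[OF g \<nu> sets_distr]] .
  then have g'm: "g' \<in> borel_measurable borel"
    by simp
  have eq: "AE h in ?H. g n (snd h) = g' (snd h)"
    by (rule AE_distrD[OF sm g'(2)])
  have sg: "(\<lambda>h :: ('x, 'u) hist. g' (snd h)) \<in> hist_space n \<rightarrow>\<^sub>M borel"
    unfolding hist_space_def by (rule measurable_compose[OF measurable_snd g'm])
  then have \<kappa>: "(\<lambda>h :: ('x, 'u) hist. return borel (g' (snd h))) \<in> hist_space n \<rightarrow>\<^sub>M prob_algebra borel"
    by (rule measurable_compose[OF _ measurable_return_prob_space])
  have "AE h in ?H. return borel (g n (snd h)) = return borel (g' (snd h))"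
    using eq by eventually_elim simp
  note law = hist_law_semidirect[OF P \<kappa> this]
  have "AE z in semidirect ?H borel (\<lambda>h. return borel (g' (snd h))). snd z = g' (snd (fst z))"
  proof (rule AE_semidirectI[OF H])
    show "(\<lambda>h. return borel (g' (snd h))) \<in> ?H \<rightarrow>\<^sub>M prob_algebra borel"
      using \<kappa> by simp
    have "(\<lambda>z :: ('x, 'u) hist \<times> 'u. g' (snd (fst z))) \<in> hist_space n \<Otimes>\<^sub>M borel \<rightarrow>\<^sub>M borel"
      by (rule measurable_compose[OF measurable_fst sg])
    then have "Measurable.pred (hist_space n \<Otimes>\<^sub>M borel) (\<lambda>z :: ('x, 'u) hist \<times> 'u. snd z = g' (snd (fst z)))"
      by (rule measurable_eq_souslin[OF measurable_snd])
    then show "Measurable.pred (?H \<Otimes>\<^sub>M borel) (\<lambda>z :: ('x, 'u) hist \<times> 'u. snd z = g' (snd (fst z)))"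
      by (simp cong: measurable_cong_sets sets_pair_measure_cong)
    show "AE h in ?H. AE u in return borel (g' (snd h)). snd (h, u) = g' (snd (fst (h, u)))"
      by (rule AE_I2, subst AE_return) (simp_all, measurable)
  qed
  then have "AE z in distr P (hist_space n \<Otimes>\<^sub>M borel) (action_history n). snd z = g' (snd (fst z))"
    unfolding law .
  from AE_distrD[OF am this] AE_distrD[OF hm eq] show ?thesis
    by eventually_elim (simp add: action_history_def hist_of_def)
qed

text \<open>The controlled quantity is the probability of success before time \<open>n\<close> plus
  the expectation of \<open>f\<close> at time \<open>n\<close> on the paths still in
  \<open>S\<close>. It starts at \<open>f x\<close> and grows by at most \<open>\<epsilon> n\<close>
  in the step from \<open>n\<close>.\<close>

lemma reach_event_near_minimal_bound:
  fixes S G :: "'x set" and f :: "'x \<Rightarrow> real" and \<epsilon> :: "nat \<Rightarrow> real"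
  assumes S: "S \<in> sets borel" and G: "G \<in> sets borel" and disjoint: "S \<inter> G = {}"
    and f: "f \<in> bA_lower" "\<And>y. 0 \<le> f y" and R: "\<And>y. R_inf K T S G f y \<le> f y"
    and \<epsilon>: "\<And>n. 0 \<le> \<epsilon> n"
    and g: "\<And>n y. T_ctrl T (g n y) f y \<le> T_inf K T f y + \<epsilon> n"
    and P: "P \<in> strategies x" and act: "\<And>n. AE \<omega> in P. snd (\<omega> n) = g n (fst (\<omega> n))"
  shows "measure P (reach_event S (enat n) G) \<le> f x + (\<Sum>k\<le>n. \<epsilon> k)"
proof -
  interpret prob_space P
    by (rule strategies_prob_space[OF P])
  note SP = strategies_strategic[OF P]
  note sP = strategicD(2)[OF SP]
  have x: "AE \<omega> in P. fst (\<omega> 0) = x"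
    using P by (simp add: strategies_def)
  have "(\<lambda>y. - f y) \<in> univ_completion borel \<rightarrow>\<^sub>M borel"
    using f(1) unfolding bA_lower_iff bA_upper_iff by (intro upper_semianalytic_measurable) simp
  then have "(\<lambda>y. - (- f y)) \<in> univ_completion borel \<rightarrow>\<^sub>M borel"
    by (rule borel_measurable_uminus)
  then have fm: "f \<in> univ_completion borel \<rightarrow>\<^sub>M borel"
    by simp
  obtain B where B: "\<bar>- f y\<bar> \<le> B" for y
    using f(1) unfolding bA_lower_iff bA_upper_iff bounded_iff by auto
  have fB: "f y \<le> B" for y
    using B[of y] by simp
  \<comment> \<open>Both events look at times strictly below \<open>n\<close> only, so
    \<open>alive (Suc n)\<close> is decided by the path frozen at \<open>n\<close>, as the
    transition identity requires.\<close>
  define alive :: "nat \<Rightarrow> ('x, 'u) path set" where "alive n = {\<omega>. \<forall>j<n. fst (\<omega> j) \<in> S}" for n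
  define reached :: "nat \<Rightarrow> ('x, 'u) path set" where
    "reached n = {\<omega>. \<exists>i<n. fst (\<omega> i) \<in> G \<and> (\<forall>j<i. fst (\<omega> j) \<in> S)}" for n
  have stm: "{\<omega> :: ('x, 'u) path. fst (\<omega> n) \<in> A} \<in> sets borel" if "A \<in> sets borel" for A n
    using measurable_sets[OF measurable_state that, of n] by (simp add: vimage_def)
  have alive_Suc: "alive (Suc n) = alive n \<inter> {\<omega>. fst (\<omega> n) \<in> S}" for n
    by (auto simp: alive_def less_Suc_eq)
  have am: "alive n \<in> sets borel" for n
    by (induction n) (auto simp: alive_Suc intro!: sets.Int stm S, simp add: alive_def)
  have reached_Suc: "reached (Suc n) = reached n \<union> (alive n \<inter> {\<omega>. fst (\<omega> n) \<in> G})" for n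
    by (auto simp: reached_def alive_def less_Suc_eq)
  have rm: "reached n \<in> sets borel" for n
    by (induction n) (auto simp: reached_Suc intro!: sets.Int sets.Un am stm G, simp add: reached_def)
  have alive_freeze: "freeze n \<omega> \<in> alive (Suc n) \<longleftrightarrow> \<omega> \<in> alive (Suc n)" for n \<omega>
    by (auto simp: alive_def freeze_def min_def)
  have "\<exists>f'. f' \<in> borel_measurable borel \<and> (AE \<omega> in P. f (fst (\<omega> (Suc n))) = f' (fst (\<omega> (Suc n)))) \<and>
      (AE \<omega> in P. (\<integral>\<^sup>+y. ennreal (f' y) \<partial>T (\<omega> n)) = ennreal (T_ctrl T (snd (\<omega> n)) f (fst (\<omega> n))))" for n
    by (rule ex_state_version[OF SP fm f(2) fB, where n = n]) blast
  then obtain v where "\<forall>n. v n \<in> borel_measurable borel \<and> (AE \<omega> in P. f (fst (\<omega> (Suc n))) = v n (fst (\<omega> (Suc n)))) \<and>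
      (AE \<omega> in P. (\<integral>\<^sup>+y. ennreal (v n y) \<partial>T (\<omega> n)) = ennreal (T_ctrl T (snd (\<omega> n)) f (fst (\<omega> n))))"
    by (elim choice[OF allI, THEN exE])
  then have v: "v n \<in> borel_measurable borel" "AE \<omega> in P. f (fst (\<omega> (Suc n))) = v n (fst (\<omega> (Suc n)))"
    "AE \<omega> in P. (\<integral>\<^sup>+y. ennreal (v n y) \<partial>T (\<omega> n)) = ennreal (T_ctrl T (snd (\<omega> n)) f (fst (\<omega> n)))" for n
    by blast+
  \<comment> \<open>Borel versions of \<open>f\<close> along the path: for time zero the constant
    \<open>f x\<close>, for a later time the version chosen for the law of that state.\<close>
  define w where "w n = (case n of 0 \<Rightarrow> \<lambda>_. f x | Suc m \<Rightarrow> v m)" for n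
  have wm: "w n \<in> borel_measurable borel" for n
    by (cases n) (auto simp: w_def v(1))
  have weq: "AE \<omega> in P. f (fst (\<omega> n)) = w n (fst (\<omega> n))" for n
  proof (cases n)
    case 0
    then show ?thesis
      using x by (auto simp: w_def)
  next
    case (Suc m)
    then show ?thesis
      using v(2)[of m] by (simp add: w_def)
  qed
  have wPm: "(\<lambda>\<omega>. ennreal (w n (fst (\<omega> n)))) \<in> borel_measurable P" for n
    by (intro measurable_strategic[OF SP] measurable_compose[OF _ measurable_ennreal] measurable_compose[OF measurable_state wm])
  have bound: "emeasure P (reached n) + (\<integral>\<^sup>+\<omega>. indicator (alive n) \<omega> * ennreal (w n (fst (\<omega> n))) \<partial>P)
      \<le> ennreal (f x + (\<Sum>k<n. \<epsilon> k))" for n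
  proof (induction n)
    case 0
    have "(\<integral>\<^sup>+\<omega>. indicator (alive 0) \<omega> * ennreal (w 0 (fst (\<omega> 0))) \<partial>P) = (\<integral>\<^sup>+\<omega>. ennreal (f x) \<partial>P)"
      by (intro nn_integral_cong) (simp add: alive_def w_def)
    then show ?case
      by (simp add: reached_def emeasure_space_1)
  next
    case (Suc n)
    let ?A = "alive n \<inter> {\<omega>. fst (\<omega> n) \<in> G}"
    have Am: "?A \<in> sets P"
      using am stm[OF G] by (simp add: sP)
    let ?h = "\<lambda>\<omega>. \<integral>\<^sup>+y. ennreal (w (Suc n) y) \<partial>T (\<omega> n)"
    have "?h \<in> borel_measurable borel"
      by (rule measurable_compose[OF measurable_prob_algebraD[OF T_coordinate] nn_integral_measurable_subprob_algebra])
        (rule measurable_compose[OF wm measurable_ennreal])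
    then have hm: "(\<lambda>\<omega>. indicator (alive (Suc n)) \<omega> * ?h \<omega>) \<in> borel_measurable P"
      using am by (intro measurable_strategic[OF SP] borel_measurable_times_ennreal borel_measurable_indicator)
    have "(\<integral>\<^sup>+\<omega>. indicator (alive (Suc n)) \<omega> * ennreal (w (Suc n) (fst (\<omega> (Suc n)))) \<partial>P) =
        (\<integral>\<^sup>+\<omega>. indicator (alive (Suc n)) (freeze n \<omega>) * ennreal (w (Suc n) (fst (\<omega> (Suc n)))) \<partial>P)"
      by (intro nn_integral_cong) (simp add: indicator_def alive_freeze)
    also have "\<dots> = (\<integral>\<^sup>+\<omega>. indicator (alive (Suc n)) (freeze n \<omega>) * ?h \<omega> \<partial>P)"
      by (intro strategic_nn_integral[OF SP am] measurable_compose[OF wm measurable_ennreal])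
    also have "\<dots> = (\<integral>\<^sup>+\<omega>. indicator (alive (Suc n)) \<omega> * ?h \<omega> \<partial>P)"
      by (intro nn_integral_cong) (simp add: indicator_def alive_freeze)
    finally have next_step: "(\<integral>\<^sup>+\<omega>. indicator (alive (Suc n)) \<omega> * ennreal (w (Suc n) (fst (\<omega> (Suc n)))) \<partial>P) = \<dots>" .
    have "emeasure P (reached (Suc n)) \<le> emeasure P (reached n) + emeasure P ?A"
      unfolding reached_Suc using rm Am by (intro emeasure_subadditive) (simp_all add: sP)
    then have "emeasure P (reached (Suc n)) + (\<integral>\<^sup>+\<omega>. indicator (alive (Suc n)) \<omega> * ennreal (w (Suc n) (fst (\<omega> (Suc n)))) \<partial>P)
        \<le> emeasure P (reached n) + (emeasure P ?A + (\<integral>\<^sup>+\<omega>. indicator (alive (Suc n)) \<omega> * ?h \<omega> \<partial>P))"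
      unfolding next_step by (simp add: add.assoc[symmetric] add_right_mono)
    also have "emeasure P ?A + (\<integral>\<^sup>+\<omega>. indicator (alive (Suc n)) \<omega> * ?h \<omega> \<partial>P) =
        (\<integral>\<^sup>+\<omega>. indicator ?A \<omega> + indicator (alive (Suc n)) \<omega> * ?h \<omega> \<partial>P)"
      using Am hm by (subst nn_integral_add) simp_all
    also have "\<dots> \<le> (\<integral>\<^sup>+\<omega>. indicator (alive n) \<omega> * ennreal (w n (fst (\<omega> n))) + ennreal (\<epsilon> n) \<partial>P)"
    proof (rule nn_integral_mono_AE)
      show "AE \<omega> in P. indicator ?A \<omega> + indicator (alive (Suc n)) \<omega> * ?h \<omega>
          \<le> indicator (alive n) \<omega> * ennreal (w n (fst (\<omega> n))) + ennreal (\<epsilon> n)"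
        using v(3)[of n] weq[of n] act[of n]
      proof eventually_elim
        case (elim \<omega>)
        let ?y = "fst (\<omega> n)"
        have h: "?h \<omega> = ennreal (T_ctrl T (g n ?y) f ?y)"
          using elim by (simp add: w_def)
        have Ry: "indicator G ?y + indicator S ?y * T_inf K T f ?y \<le> f ?y"
          using R[of ?y] by (simp add: R_inf_def)
        \<comment> \<open>On \<open>G\<close> the success counts one, which \<open>f\<close>
          dominates since \<open>f \<ge> R_inf f\<close>. On \<open>S\<close> the action is within
          \<open>\<epsilon> n\<close> of the infimum, itself at most \<open>f\<close>. Elsewhere the
          path contributes nothing to the left side.\<close>
        consider "?y \<in> G" "?y \<notin> S" | "?y \<in> S" "?y \<notin> G" | "?y \<notin> G" "?y \<notin> S"
          using disjoint by blast
        then show ?case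
        proof cases
          case 1
          then have "1 \<le> f ?y"
            using Ry by simp
          then have "1 \<le> ennreal (w n ?y)"
            unfolding elim(2)[symmetric] by simp
          then have "1 \<le> ennreal (w n ?y) + ennreal (\<epsilon> n)"
            by (rule add_increasing2[rotated]) simp
          then show ?thesis
            using 1 by (simp add: alive_Suc indicator_def)
        next
          case 2
          then have "T_ctrl T (g n ?y) f ?y \<le> f ?y + \<epsilon> n"
            using Ry g[of n ?y] by simp
          then have "ennreal (T_ctrl T (g n ?y) f ?y) \<le> ennreal (w n ?y) + ennreal (\<epsilon> n)"
            unfolding elim(2)[symmetric] by (simp add: f(2) \<epsilon> ennreal_plus[symmetric] ennreal_leI del: ennreal_plus)
          then show ?thesis
            using 2 h by (simp add: alive_Suc indicator_def)
        next
          case 3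
          then show ?thesis
            by (simp add: alive_Suc indicator_def)
        qed
      qed
    qed
    also have "\<dots> = (\<integral>\<^sup>+\<omega>. indicator (alive n) \<omega> * ennreal (w n (fst (\<omega> n))) \<partial>P) + ennreal (\<epsilon> n)"
    proof (subst nn_integral_add)
      have "alive n \<in> sets P"
        using am by (simp add: sP)
      then show "(\<lambda>\<omega>. indicator (alive n) \<omega> * ennreal (w n (fst (\<omega> n)))) \<in> borel_measurable P"
        by (intro borel_measurable_times_ennreal wPm borel_measurable_indicator)
    qed (simp_all add: emeasure_space_1)
    finally have "emeasure P (reached (Suc n)) + (\<integral>\<^sup>+\<omega>. indicator (alive (Suc n)) \<omega> * ennreal (w (Suc n) (fst (\<omega> (Suc n)))) \<partial>P)
        \<le> emeasure P (reached n) + ((\<integral>\<^sup>+\<omega>. indicator (alive n) \<omega> * ennreal (w n (fst (\<omega> n))) \<partial>P) + ennreal (\<epsilon> n))"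
      by (simp add: add_left_mono)
    also have "\<dots> \<le> ennreal (f x + (\<Sum>k<n. \<epsilon> k)) + ennreal (\<epsilon> n)"
      unfolding add.assoc[symmetric] by (rule add_right_mono[OF Suc.IH])
    also have "\<dots> = ennreal (f x + (\<Sum>k<Suc n. \<epsilon> k))"
      using f(2)[of x] \<epsilon> by (subst ennreal_plus[symmetric]) (auto intro!: add_nonneg_nonneg sum_nonneg simp: add.assoc)
    finally show ?case .
  qed
  \<comment> \<open>A horizon of \<open>n\<close> allows success at time \<open>n\<close> itself,
    whence the successor.\<close>
  have "reach_event S (enat n) G = reached (Suc n)"
    by (auto simp: reach_event_def reached_def less_Suc_eq_le)
  then have "ennreal (measure P (reach_event S (enat n) G)) \<le> ennreal (f x + (\<Sum>k<Suc n. \<epsilon> k))"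
    using bound[of "Suc n"] by (simp add: emeasure_eq_measure[symmetric] del: sum.lessThan_Suc) (meson add_increasing2 dual_order.trans order_refl zero_le)
  then show ?thesis
    using f(2)[of x] \<epsilon> by (subst (asm) ennreal_le_iff) (auto intro!: add_nonneg_nonneg sum_nonneg simp: lessThan_Suc_atMost simp del: sum.lessThan_Suc)
qed

lemma M_inf_reach_event_least:
  fixes S G :: "'x set"
  assumes S: "S \<in> sets borel" and G: "G \<in> sets borel" and disjoint: "S \<inter> G = {}"
    and f: "f \<in> bA_lower" "\<And>y. 0 \<le> f y" and R: "\<And>y. R_inf K T S G f y \<le> f y"
  shows "M_inf K T (reach_event S \<infinity> G) x \<le> f x"
proof (rule field_le_epsilon)
  fix e :: real assume e: "0 < e"
  define \<epsilon> where "\<epsilon> n = e * (1 / 2) ^ Suc n" for n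
  have \<epsilon>: "0 < \<epsilon> n" for n
    using e by (simp add: \<epsilon>_def)
  have sums: "(\<lambda>n. \<epsilon> n) sums (e * 1)"
    unfolding \<epsilon>_def by (intro sums_mult power_half_series)
  have sum: "(\<Sum>k\<le>n. \<epsilon> k) \<le> e" for n
    using sum_le_suminf[OF sums_summable[OF sums], of "{..n}"] less_imp_le[OF \<epsilon>] sums_unique[OF sums] by simp
  have "\<forall>n. \<exists>g. g \<in> univ_completion borel \<rightarrow>\<^sub>M borel \<and> (\<forall>x. (x, g x) \<in> K) \<and>
      (\<forall>x. T_ctrl T (g x) f x \<le> T_inf K T f x + \<epsilon> n)"
    by (intro allI ex_near_minimal_selector f \<epsilon>)
  then obtain g where g: "\<forall>n. g n \<in> univ_completion borel \<rightarrow>\<^sub>M borel \<and> (\<forall>x. (x, g n x) \<in> K) \<and>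
      (\<forall>x. T_ctrl T (g n x) f x \<le> T_inf K T f x + \<epsilon> n)"
    by (elim choice[THEN exE])
  then have \<pi>: "(\<lambda>n h. return borel (g n (snd h))) \<in> policies K"
    by (intro deterministic_policy) auto
  obtain P where P: "is_path_measure T (\<lambda>n h. return borel (g n (snd h))) x P"
    using ex_path_measure[OF \<pi>] by blast
  have Px: "P \<in> strategies x"
    using strategic_path_measure[OF \<pi> P] is_path_measureD(3)[OF P] by (simp add: strategies_def)
  have act: "AE \<omega> in P. snd (\<omega> n) = g n (fst (\<omega> n))" for n
    using g by (intro deterministic_policy_action[OF _ P]) blast
  have g': "T_ctrl T (g n y) f y \<le> T_inf K T f y + \<epsilon> n" for n y
    using g by blast
  have "measure P (reach_event S (enat n) G) \<le> f x + e" for n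
    using reach_event_near_minimal_bound[OF S G disjoint f R less_imp_le[OF \<epsilon>] g' Px act, of n] sum[of n]
    by linarith
  then have "measure P (reach_event S \<infinity> G) \<le> f x + e"
    by (rule measure_reach_event_infinity_le[OF S G disjoint Px])
  then show "M_inf K T (reach_event S \<infinity> G) x \<le> f x + e"
    using M_inf_le_measure[OF Px, of "reach_event S \<infinity> G"] by linarith
qed

end

text \<open>The memberships in \<open>bA_upper\<close> and \<open>bA_lower\<close> record that
  \<open>R_sup\<close> and \<open>R_inf\<close> are applied within the function classes for which
  these operators are introduced.\<close>

theorem theorem3:
  fixes K :: "('x::borel_space \<times> 'u::borel_space) set"
    and T :: "'x \<times> 'u \<Rightarrow> 'x measure"
    and S G :: "'x set"
  assumes "cdt_MP K T"
    and "S \<in> sets borel" and "G \<in> sets borel" and "S \<inter> G = {}"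
  shows "M_sup K T (reach_event S 0 G) = indicator G \<and>
     M_inf K T (reach_event S 0 G) = indicator G \<and>
     (\<forall>n::enat.
        M_sup K T (reach_event S n G) \<in> bA_upper \<and>
        M_sup K T (reach_event S (n + 1) G) = R_sup K T S G (M_sup K T (reach_event S n G)) \<and>
        M_inf K T (reach_event S n G) \<in> bA_lower \<and>
        M_inf K T (reach_event S (n + 1) G) = R_inf K T S G (M_inf K T (reach_event S n G))) \<and>
     (\<forall>f\<in>bA_upper. (\<forall>x. 0 \<le> f x) \<longrightarrow> (\<forall>x. R_sup K T S G f x \<le> f x) \<longrightarrow>
        (\<forall>x. M_sup K T (reach_event S \<infinity> G) x \<le> f x)) \<and>
     (\<forall>f\<in>bA_lower. (\<forall>x. 0 \<le> f x) \<longrightarrow> (\<forall>x. R_inf K T S G f x \<le> f x) \<longrightarrow>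
        (\<forall>x. M_inf K T (reach_event S \<infinity> G) x \<le> f x))"
proof -
  interpret controlled_process K T
    by standard (rule assms(1))
  note SG = assms(2-4)
  note meas = reach_event_measurable[OF SG(1,2)]
  show ?thesis
    using M_sup_bA_upper[OF meas] M_inf_bA_lower[OF meas]
    by (auto simp: M_reach_event_0[OF SG] M_sup_reach_event_Suc[OF SG] M_inf_reach_event_Suc[OF SG]
        intro: M_sup_reach_event_least[OF SG] M_inf_reach_event_least[OF SG])
qed

end
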